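(* Suppose that the control model $\mathfrak{M}(\eta,\Delta)$ is absorbing and satisfies Condition (S). The following statements are equivalent: (a) $\mathfrak{M}(\eta,\Delta)$ is uniformly absorbing. (b) The set $\mathcal{O}_\eta$ is relatively compact in $\mathcal{M}^+(\mathbf{X}\times\mathbf{A})$ for the $ws$-topology. (c) The set $\mathcal{O}_\eta$ is compact for the $ws$-topology.
   Context: For a measurable space $\mathbf{\Omega}$, $\mathcal{M}^+(\mathbf{\Omega})$ is the set of finite nonnegative measures and $\mathcal{P}(\mathbf{\Omega})$ the set of probability measures on it. Control model. $(\mathbf{X},\mathfrak{X})$ is a measurable space (state space); $\mathbf{A}$ is a Borel space (action space) with Borel $\sigma$-algebra $\mathfrak{B}(\mathbf{A})$; for each $x\in\mathbf{X}$, $\mathbf{A}(x)\subseteq\mathbf{A}$ is a nonempty measurable set of available actions; $\mathbf{K}=\{(x,a):a\in\mathbf{A}(x)\}$ is assumed to be in $\mathfrak{X}\otimes\mathfrak{B}(\mathbf{A})$ and to contain the graph of a measurable function $f:\mathbf{X}\to\mathbf{A}$ with $f(x)\in\mathbf{A}(x)$ for all $x$; $Q$ is a stochastic kernel on $\mathbf{X}$ given $\mathbf{X}\times\mathbf{A}$; $\eta\in\mathcal{P}(\mathbf{X})$ is an initial distribution; $\Delta\in\mathfrak{X}$ is a given set. This model is denoted $\mathfrak{M}(\eta,\Delta)$. Policies. Let $\mathbf{H}_0=\mathbf{X}$, $\mathbf{H}_n=\mathbf{H}_{n-1}\times\mathbf{A}\times\mathbf{X}$. A policy $\pi=\{\pi_n\}_{n\ge0}\in\mathbf{\Pi}$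 is a sequence of stochastic kernels $\pi_n$ on $\mathbf{A}$ given $\mathbf{H}_n$ with $\pi_n(\mathbf{A}(x_n)|h_n)=1$ for all $h_n=(x_0,a_0,\ldots,x_n)\in\mathbf{H}_n$. $\mathbf{M}$ is the set of stochastic kernels $\sigma$ on $\mathbf{A}$ given $\mathbf{X}$ with $\sigma(\mathbf{A}(x)|x)=1$ for all $x$; each $\sigma\in\mathbf{M}$ is identified with the stationary randomized policy $\pi_n(\cdot|h_n)=\sigma(\cdot|x_n)$. For an initial distribution $\lambda\in\mathcal{P}(\mathbf{X})$ and $\pi\in\mathbf{\Pi}$, $\mathbb{P}_{\lambda,\pi}$ (expectation $\mathbb{E}_{\lambda,\pi}$) is the unique probability measure on $(\mathbf{X}\times\mathbf{A})^\infty$ under which the coordinate processes satisfy $X_0\sim\lambda$, $\mathbb{P}_{\lambda,\pi}(A_n\in\cdot\mid X_0,A_0,\ldots,X_n)=\pi_n(\cdot\mid X_0,A_0,\ldots,X_n)$ and $\mathbb{P}_{\lambda,\pi}(X_{n+1}\in\cdot\mid X_0,A_0,\ldots,X_n,A_n)=Q(\cdot\mid X_n,A_n)$ almost surely. Let $T_\Delta=\min\{n\ge0:X_n\in\Delta\}$ ($=\infty$ if there is no such $n$). The model $\mathfrak{M}(\lambda,\Delta)$ is absorbing if (a) $Q(\Delta|x,a)=1$ for all $(x,a)\in\Delta\times\mathbf{A}$, and (b) $\mathbb{E}_{\lambda,\pi}[T_\Delta]<\infty$ for every $\pi\in\mathbf{\Pi}$. It is uniformly absorbing if, additionally, (c)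 $\lim_{n\to\infty}\sup_{\pi\in\mathbf{M}}\sum_{t=n}^\infty\mathbb{P}_{\lambda,\pi}\{T_\Delta>t\}=0$. Occupation measures. $\mu_{\lambda,\pi}(\Gamma)=\mathbb{E}_{\lambda,\pi}\big[\sum_{t=0}^\infty \mathbf{1}_{\{T_\Delta>t\}}\mathbf{1}_{\{(X_t,A_t)\in\Gamma\}}\big]$ for $\Gamma\in\mathfrak{X}\otimes\mathfrak{B}(\mathbf{A})$; $\mathcal{O}_\lambda=\{\mu_{\lambda,\pi}:\pi\in\mathbf{\Pi}\}$. Condition (S): (S1) $\mathbf{A}$ is compact and the correspondence $x\mapsto\mathbf{A}(x)$ is weakly measurable (i.e. $\{x:\mathbf{A}(x)\cap G\ne\emptyset\}\in\mathfrak{X}$ for every open $G\subseteq\mathbf{A}$) with nonempty compact values; (S2) for every $x\in\mathbf{X}$ and $\Gamma\in\mathfrak{X}$, the mapping $a\mapsto Q(\Gamma|x,a)$ is continuous on $\mathbf{A}(x)$. $ws$-topology. The $ws$-topology on finite (signed) measures on $\mathbf{X}\times\mathbf{A}$ is the coarsest topology making $\mu\mapsto\int f\,d\mu$ continuous for every bounded Carathéodory function $f:\mathbf{X}\times\mathbf{A}\to\mathbb{R}$, i.e. $f$ bounded, $f(\cdot,a)$ measurable for each $a$ and $f(x,\cdot)$ continuous for each $x$. *)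

theory Defs
  imports "HOL-Probability.Probability"
begin

text \<open>
  A measurable space is given by a \<open>measure\<close> of which only \<open>space\<close> and \<open>sets\<close> matter.
  A Borel space is a Borel subset of a Polish space, with the subspace topology and
  the trace of the Borel sigma-algebra.
\<close>

section \<open>The ws-topology on finite nonnegative measures\<close>

abbreviation actM :: "'a::polish_space set \<Rightarrow> 'a measure" where
  "actM A \<equiv> restrict_space borel A"

definition bounded_caratheodory ::
  "'x measure \<Rightarrow> 'a::polish_space set \<Rightarrow> ('x \<times> 'a \<Rightarrow> real) \<Rightarrow> bool" where
  "bounded_caratheodory X A f \<longleftrightarrow>
     bounded (f ` (space X \<times> A)) \<and>
     (\<forall>a\<in>A. (\<lambda>x. f (x, a)) \<in> borel_measurable X) \<and>
     (\<forall>x\<in>space X. continuous_on A (\<lambda>a. f (x, a)))"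

definition finite_measures :: "'b measure \<Rightarrow> 'b measure set" where
  "finite_measures M = {\<mu>. finite_measure \<mu> \<and> sets \<mu> = sets M}"

text \<open>
  This is the trace on nonnegative measures of the ws-topology on finite signed measures.
\<close>

definition ws_topology ::
  "'x measure \<Rightarrow> 'a::polish_space set \<Rightarrow> ('x \<times> 'a) measure topology" where
  "ws_topology X A = topology_generated_by
     {{\<mu> \<in> finite_measures (X \<Otimes>\<^sub>M actM A). (\<integral>z. f z \<partial>\<mu>) \<in> U} | f U.
        bounded_caratheodory X A f \<and> open U}"

lemma topspace_ws_topology: "topspace (ws_topology X A) = finite_measures (X \<Otimes>\<^sub>M actM A)"
proof -
  have "bounded_caratheodory X A (\<lambda>_. 0)"
    by (auto simp: bounded_caratheodory_def intro!: boundedI[where B=0])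
  then have "finite_measures (X \<Otimes>\<^sub>M actM A) \<in>
     {{\<mu> \<in> finite_measures (X \<Otimes>\<^sub>M actM A). (\<integral>z. f z \<partial>\<mu>) \<in> U} | f U.
        bounded_caratheodory X A f \<and> open U}"
    by (intro CollectI exI[of _ "\<lambda>_. 0"] exI[of _ UNIV]) auto
  then show ?thesis
    unfolding ws_topology_def topology_generated_by_topspace by blast
qed

definition relatively_compact_in :: "'b topology \<Rightarrow> 'b set \<Rightarrow> bool" where
  "relatively_compact_in T S \<longleftrightarrow> S \<subseteq> topspace T \<and> compactin T (T closure_of S)"


section \<open>Control models\<close>

text \<open>
  \<open>As x\<close> is the set of actions available in state \<open>x\<close>, and \<open>Q (x, a)\<close> is the distribution of
  the next state. The initial distribution \<open>\<nu>\<close> is an argument of the notions that depend on it.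
\<close>

locale control_model =
  fixes X :: "'x measure"
    and A :: "'a::polish_space set"
    and As :: "'x \<Rightarrow> 'a set"
    and Q :: "'x \<times> 'a \<Rightarrow> 'x measure"
    and \<Delta> :: "'x set"
  assumes A_borel: "A \<in> sets borel"
    and As_measurable: "\<And>x. x \<in> space X \<Longrightarrow> As x \<in> sets (actM A)"
    and As_nonempty: "\<And>x. x \<in> space X \<Longrightarrow> As x \<noteq> {}"
    and K_measurable: "(SIGMA x:space X. As x) \<in> sets (X \<Otimes>\<^sub>M actM A)"
    and selector: "\<exists>f \<in> X \<rightarrow>\<^sub>M actM A. \<forall>x\<in>space X. f x \<in> As x"
    and Q_kernel: "Q \<in> X \<Otimes>\<^sub>M actM A \<rightarrow>\<^sub>M prob_algebra X"
    and Delta_measurable: "\<Delta> \<in> sets X"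
begin

text \<open>
  A history \<open>(x\<^sub>0, a\<^sub>0, \<dots>, x\<^sub>n)\<close> is encoded as the pair of the sequence
  \<open>(x\<^sub>0, a\<^sub>0), \<dots>, (x\<^sub>n\<^sub>-\<^sub>1, a\<^sub>n\<^sub>-\<^sub>1)\<close> and the current state \<open>x\<^sub>n\<close>.
\<close>

definition histM :: "nat \<Rightarrow> ((nat \<Rightarrow> 'x \<times> 'a) \<times> 'x) measure" where
  "histM n = (\<Pi>\<^sub>M i\<in>{0..<n}. X \<Otimes>\<^sub>M actM A) \<Otimes>\<^sub>M X"

definition policies :: "(nat \<Rightarrow> (nat \<Rightarrow> 'x \<times> 'a) \<times> 'x \<Rightarrow> 'a measure) set" where
  "policies = {\<pi>. \<forall>n. \<pi> n \<in> histM n \<rightarrow>\<^sub>M prob_algebra (actM A) \<and>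
     (\<forall>h\<in>space (histM n). emeasure (\<pi> n h) (As (snd h)) = 1)}"

definition markov_kernels :: "('x \<Rightarrow> 'a measure) set" where
  "markov_kernels = {\<sigma>. \<sigma> \<in> X \<rightarrow>\<^sub>M prob_algebra (actM A) \<and>
     (\<forall>x\<in>space X. emeasure (\<sigma> x) (As x) = 1)}"

definition stationary ::
  "('x \<Rightarrow> 'a measure) \<Rightarrow> nat \<Rightarrow> (nat \<Rightarrow> 'x \<times> 'a) \<times> 'x \<Rightarrow> 'a measure" where
  "stationary \<sigma> n h = \<sigma> (snd h)"

text \<open>Trajectories are elements of \<open>(X \<times> A)\<^sup>\<infinity>\<close>.\<close>

definition trajM :: "(nat \<Rightarrow> 'x \<times> 'a) measure" where
  "trajM = (\<Pi>\<^sub>M i\<in>UNIV. X \<Otimes>\<^sub>M actM A)"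

definition state :: "nat \<Rightarrow> (nat \<Rightarrow> 'x \<times> 'a) \<Rightarrow> 'x" where
  "state n \<omega> = fst (\<omega> n)"

definition action :: "nat \<Rightarrow> (nat \<Rightarrow> 'x \<times> 'a) \<Rightarrow> 'a" where
  "action n \<omega> = snd (\<omega> n)"

definition hist :: "nat \<Rightarrow> (nat \<Rightarrow> 'x \<times> 'a) \<Rightarrow> (nat \<Rightarrow> 'x \<times> 'a) \<times> 'x" where
  "hist n \<omega> = (restrict \<omega> {0..<n}, state n \<omega>)"

definition hist_algebra :: "nat \<Rightarrow> (nat \<Rightarrow> 'x \<times> 'a) measure" where
  "hist_algebra n = vimage_algebra (space trajM) (hist n) (histM n)"

definition hist_action_algebra :: "nat \<Rightarrow> (nat \<Rightarrow> 'x \<times> 'a) measure" where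
  "hist_action_algebra n =
     vimage_algebra (space trajM) (\<lambda>\<omega>. (hist n \<omega>, action n \<omega>)) (histM n \<Otimes>\<^sub>M actM A)"

definition is_law ::
  "'x measure \<Rightarrow> (nat \<Rightarrow> (nat \<Rightarrow> 'x \<times> 'a) \<times> 'x \<Rightarrow> 'a measure) \<Rightarrow>
     (nat \<Rightarrow> 'x \<times> 'a) measure \<Rightarrow> bool" where
  "is_law \<nu> \<pi> P \<longleftrightarrow>
     prob_space P \<and> sets P = sets trajM \<and>
     distr P X (state 0) = \<nu> \<and>
     (\<forall>n. \<forall>B\<in>sets (actM A). AE \<omega> in P.
        real_cond_exp P (hist_algebra n) (indicator {\<omega>\<in>space P. action n \<omega> \<in> B}) \<omega>
          = measure (\<pi> n (hist n \<omega>)) B) \<and>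
     (\<forall>n. \<forall>\<Gamma>\<in>sets X. AE \<omega> in P.
        real_cond_exp P (hist_action_algebra n)
            (indicator {\<omega>\<in>space P. state (Suc n) \<omega> \<in> \<Gamma>}) \<omega>
          = measure (Q (state n \<omega>, action n \<omega>)) \<Gamma>)"

definition law ::
  "'x measure \<Rightarrow> (nat \<Rightarrow> (nat \<Rightarrow> 'x \<times> 'a) \<times> 'x \<Rightarrow> 'a measure) \<Rightarrow>
     (nat \<Rightarrow> 'x \<times> 'a) measure" where
  "law \<nu> \<pi> = (THE P. is_law \<nu> \<pi> P)"

definition hitting_time :: "(nat \<Rightarrow> 'x \<times> 'a) \<Rightarrow> enat" where
  "hitting_time \<omega> = (INF n\<in>{n. state n \<omega> \<in> \<Delta>}. enat n)"

definition absorbing :: "'x measure \<Rightarrow> bool" where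
  "absorbing \<nu> \<longleftrightarrow>
     (\<forall>x\<in>\<Delta>. \<forall>a\<in>A. emeasure (Q (x, a)) \<Delta> = 1) \<and>
     (\<forall>\<pi>\<in>policies. (\<integral>\<^sup>+\<omega>. ennreal_of_enat (hitting_time \<omega>) \<partial>law \<nu> \<pi>) < \<infinity>)"

definition uniformly_absorbing :: "'x measure \<Rightarrow> bool" where
  "uniformly_absorbing \<nu> \<longleftrightarrow> absorbing \<nu> \<and>
     (\<lambda>n. SUP \<sigma>\<in>markov_kernels. \<Sum>t.
        emeasure (law \<nu> (stationary \<sigma>))
          {\<omega>\<in>space (law \<nu> (stationary \<sigma>)). hitting_time \<omega> > enat (n + t)}) \<longlonglongrightarrow> 0"

definition occupation_measure ::
  "'x measure \<Rightarrow> (nat \<Rightarrow> (nat \<Rightarrow> 'x \<times> 'a) \<times> 'x \<Rightarrow> 'a measure) \<Rightarrow> ('x \<times> 'a) measure" where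
  "occupation_measure \<nu> \<pi> =
     measure_of (space (X \<Otimes>\<^sub>M actM A)) (sets (X \<Otimes>\<^sub>M actM A))
       (\<lambda>\<Gamma>. \<integral>\<^sup>+\<omega>. (\<Sum>t. indicator {\<omega>. hitting_time \<omega> > enat t} \<omega>
                       * indicator \<Gamma> (state t \<omega>, action t \<omega>)) \<partial>law \<nu> \<pi>)"

definition occupation_measures :: "'x measure \<Rightarrow> ('x \<times> 'a) measure set" where
  "occupation_measures \<nu> = occupation_measure \<nu> ` policies"

definition condition_S :: bool where
  "condition_S \<longleftrightarrow>
     compact A \<and>
     (\<forall>G. openin (top_of_set A) G \<longrightarrow> {x\<in>space X. As x \<inter> G \<noteq> {}} \<in> sets X) \<and>
     (\<forall>x\<in>space X. As x \<noteq> {} \<and> compact (As x)) \<and>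
     (\<forall>x\<in>space X. \<forall>\<Gamma>\<in>sets X. continuous_on (As x) (\<lambda>a. measure (Q (x, a)) \<Gamma>))"

end

end

theory Submission
  imports Defs
begin

text \<open>
  Absorption turns occupation measures into solutions \<open>\<mu>\<close> of the linear balance equation
  \<open>\<mu> (G \<times> A) = \<eta> (G - \<Delta>) + (\<integral>z. Q z (G - \<Delta>)
  \<partial>\<mu>)\<close>. The theorem then rests on two questions about measures on \<open>X \<times>
  A\<close>: which solutions are occupation measures, and which sets of solutions are compact.

  A solution that is finite, is carried by the graph of \<open>As\<close>, and whose marginal vanishes on
  every set that one reference policy almost surely avoids is an occupation measure
  (\<open>balance_occupation\<close>). Indeed, disintegrate it into its marginal and a kernel
  \<open>\<sigma>\<close>, and iterate the equation under \<open>\<sigma>\<close>. The remainder after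
  \<open>n\<close> steps is the integral of the probability of surviving \<open>n\<close> further steps
  under \<open>\<sigma>\<close>. It vanishes because the policy that follows the reference policy up to time
  \<open>t\<close> and \<open>\<sigma>\<close> afterwards has a finite mean absorption time. By the same
  argument a solution without source is zero (\<open>invariant_zero\<close>). The domination costs nothing:
  the reference policy chooses at random from a countable dense family of measurable selectors, so by the
  setwise continuity of \<open>Q\<close> it reaches every set that any policy reaches
  (\<open>state_law_ac\<close>).

  All these conditions are closed in the ws-topology (\<open>closedin_flux_between\<close>). Indicators of
  null sets of states are Caratheodory functions. A function such as \<open>Q z G\<close>, continuous in the
  action on \<open>As x\<close> only, is on the graph of \<open>As\<close> an increasing limit of
  Caratheodory functions, and so is its negative; hence its integral is continuous on the measures carried
  by the graph. So the set of occupation measures is closed, and for it relative compactness and compactness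
  agree.

  Compactness itself comes from one criterion (\<open>ws_compact_superset\<close>): measures whose marginals
  lie below a set function that tends to zero along decreasing sequences of sets with empty intersection
  form a subset of a compact set. The state space carries no topology, so tightness is not at hand. Instead,
  actions are coded by infinite binary sequences, and a measure is recorded by its values on products of a
  measurable set with a cell of actions of equal initial code. By Tychonoff the consistent tables of such
  values form a compact space, and a consistent table is turned back into a measure by tossing, in each
  state, coins for the successive code digits. This map is continuous. Applied to the table of a given
  measure it also yields its disintegration.

  If the model is uniformly absorbing, the occupation measures can be cut at a common time with a uniformly
  small error, and the state laws at finitely many times are uniformly small on late sets of a decreasing
  sequence, by Dini's theorem on the compact sets \<open>As x\<close> applied to the iterates of the
  operator that maximises over actions; so the criterion applies
  (\<open>uniformly_absorbing_compact\<close>). Conversely, if the set of occupation measures is compact,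
  then Dini's theorem on that set gives the hypothesis of the criterion, and the tails of occupation
  measures stay in a compact set too. If the tails did not vanish uniformly, they would accumulate at a
  nonzero solution without source (\<open>compact_uniformly_absorbing\<close>).

  The law of a policy is given by a definite description, so its existence, by the theorem of
  Ionescu-Tulcea, and its uniqueness come before everything that concerns policies.
\<close>

section \<open>Binary coding of a compact action space\<close>

text \<open>A point of \<open>A\<close> is coded by the infinite sequence of its memberships in a countable base of open sets.
  Finite initial segments of the code cut \<open>A\<close> into finitely many measurable cells.\<close>

locale compact_coding =
  fixes A :: "'a::polish_space set" and U :: "nat \<Rightarrow> 'a set"
  assumes A_compact: "compact A" and A_nonempty: "A \<noteq> {}"
    and U_open: "\<And>n. open (U n)"
    and U_basis: "\<And>a V. open V \<Longrightarrow> a \<in> V \<Longrightarrow> \<exists>n. a \<in> U n \<and> U n \<subseteq> V"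
begin

definition code :: "nat \<Rightarrow> 'a \<Rightarrow> bool list" where
  "code n a = map (\<lambda>j. a \<in> U j) [0..<n]"

definition cell :: "bool list \<Rightarrow> 'a set" where
  "cell c = {a \<in> A. code (length c) a = c}"

definition rep :: "bool list \<Rightarrow> 'a" where
  "rep c = (SOME a. a \<in> (if cell c = {} then A else cell c))"

lemma length_code [simp]: "length (code n a) = n"
  by (simp add: code_def)

lemma code_Suc: "code (Suc n) a = code n a @ [a \<in> U n]"
  by (simp add: code_def)

lemma code_0 [simp]: "code 0 a = []"
  by (simp add: code_def)

lemma take_code: "n \<le> m \<Longrightarrow> take n (code m a) = code n a"
  by (simp add: code_def take_map)

lemma cell_subset: "cell c \<subseteq> A"
  by (auto simp: cell_def)

lemma cell_code: "a \<in> A \<Longrightarrow> a \<in> cell (code n a)"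
  by (simp add: cell_def)

lemma cell_mono: "cell c \<subseteq> cell (take n c)"
proof (cases "n \<le> length c")
  case True
  show ?thesis using take_code[OF True, symmetric] by (auto simp: cell_def min_absorb2[OF True])
qed simp

lemma rep_in_cell: "cell c \<noteq> {} \<Longrightarrow> rep c \<in> cell c"
  unfolding rep_def by (simp add: some_in_eq)

lemma rep_in: "rep c \<in> A"
proof (cases "cell c = {}")
  case True
  then show ?thesis unfolding rep_def using A_nonempty by (simp add: some_in_eq)
qed (use rep_in_cell cell_subset in blast)

lemma space_actM [simp]: "space (actM A) = A"
  by (simp add: space_restrict_space)

lemma sets_A: "A \<in> sets borel"
  using A_compact by (simp add: borel_compact)

lemma U_measurable [measurable]: "Measurable.pred (actM A) (\<lambda>a. a \<in> U n)"
  using U_open[of n] by (intro measurable_restrict_space1) (auto simp: pred_def)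

lemma code_measurable [measurable]: "code n \<in> actM A \<rightarrow>\<^sub>M count_space UNIV"
proof (induction n)
  case (Suc n)
  have "(\<lambda>a. (\<lambda>(c, b). c @ [b]) (code n a, a \<in> U n)) \<in> actM A \<rightarrow>\<^sub>M count_space UNIV"
    using Suc U_measurable[of n] by measurable
  then show ?case by (simp add: code_Suc[abs_def])
qed (simp add: code_def)

lemma cell_measurable [measurable]: "cell c \<in> sets (actM A)"
proof -
  have "cell c = {a \<in> space (actM A). code (length c) a = c}" by (simp add: cell_def)
  also have "\<dots> \<in> sets (actM A)" by measurable
  finally show ?thesis .
qed

text \<open>By compactness finitely many base sets of small diameter cover \<open>A\<close>.  A code that is long enough to
  record membership in all of them confines a point to one of them.\<close>

lemma code_fine:
  assumes "e > 0"
  obtains N where "\<And>n a b. n \<ge> N \<Longrightarrow> a \<in> A \<Longrightarrow> b \<in> A \<Longrightarrow> code n a = code n b \<Longrightarrow> dist a b < e"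
proof -
  define I where "I = {k. \<forall>y\<in>U k. \<forall>z\<in>U k. dist y z < e}"
  have "A \<subseteq> (\<Union>k\<in>I. U k)"
  proof
    fix a assume "a \<in> A"
    obtain n where n: "a \<in> U n" "U n \<subseteq> ball a (e/2)"
      using U_basis[of "ball a (e/2)" a] assms by auto
    have "n \<in> I" unfolding I_def
    proof safe
      fix y z assume "y \<in> U n" "z \<in> U n"
      then have "dist a y < e/2" "dist a z < e/2" using n by auto
      then show "dist y z < e" using dist_triangle3[of y z a] by linarith
    qed
    then show "a \<in> (\<Union>k\<in>I. U k)" using n by auto
  qed
  then obtain I' where I': "I' \<subseteq> I" "finite I'" "A \<subseteq> (\<Union>k\<in>I'. U k)"
    using A_compact U_open by (metis compactE_image)
  show ?thesis
  proof (rule that[of "Suc (Max (insert 0 I'))"])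
    fix n a b assume n: "n \<ge> Suc (Max (insert 0 I'))" and ab: "a \<in> A" "b \<in> A" "code n a = code n b"
    obtain k where k: "k \<in> I'" "a \<in> U k" using I' ab by auto
    have "k \<le> Max (insert 0 I')" using k I' by auto
    then have "k < n" using n by auto
    then have "code n a ! k = code n b ! k" "code n a ! k = (a \<in> U k)" "code n b ! k = (b \<in> U k)"
      using ab by (auto simp: code_def)
    then show "dist a b < e" using k I' unfolding I_def by auto
  qed
qed

text \<open>Consistency of a sequence of words is required only through the cells being nonempty, so that
  the limit point need not lie in the cells themselves, which are not closed.\<close>

definition follows :: "(nat \<Rightarrow> bool list) \<Rightarrow> 'a \<Rightarrow> bool" where
  "follows w a \<longleftrightarrow> (\<forall>n. length (w n) = n) \<and> (\<forall>n m. n \<le> m \<longrightarrow> take n (w m) = w n) \<and>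
     (\<forall>n. cell (w n) \<noteq> {}) \<and> (\<lambda>n. rep (w n)) \<longlonglongrightarrow> a"

lemma code_rep: "cell c \<noteq> {} \<Longrightarrow> code (length c) (rep c) = c"
  using rep_in_cell[of c] by (simp add: cell_def)

lemma code_rep_take: "cell c \<noteq> {} \<Longrightarrow> n \<le> length c \<Longrightarrow> code n (rep c) = take n c"
  using code_rep[of c] take_code[of n "length c" "rep c"] by simp

lemma follows_code: "a \<in> A \<Longrightarrow> follows (\<lambda>n. code n a) a"
  unfolding follows_def
proof (intro conjI allI impI)
  assume a: "a \<in> A"
  show "length (code n a) = n" for n by simp
  show "take n (code m a) = code n a" if "n \<le> m" for n m using that by (rule take_code)
  show ne: "cell (code n a) \<noteq> {}" for n using cell_code[OF a] by auto
  show "(\<lambda>n. rep (code n a)) \<longlonglongrightarrow> a"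
  proof (rule metric_LIMSEQ_I)
    fix r :: real assume "0 < r"
    then obtain N where N: "\<And>n a b. n \<ge> N \<Longrightarrow> a \<in> A \<Longrightarrow> b \<in> A \<Longrightarrow> code n a = code n b \<Longrightarrow> dist a b < r"
      using code_fine by blast
    show "\<exists>no. \<forall>n\<ge>no. dist (rep (code n a)) a < r"
      using N a rep_in code_rep[OF ne] by (metis length_code)
  qed
qed

lemma follows_convergent:
  assumes len: "\<And>n. length (w n) = n" and tk: "\<And>n m. n \<le> m \<Longrightarrow> take n (w m) = w n"
    and ne: "\<And>n. cell (w n) \<noteq> {}"
  shows "follows w (lim (\<lambda>n. rep (w n)))" "lim (\<lambda>n. rep (w n)) \<in> A"
proof -
  have C: "Cauchy (\<lambda>n. rep (w n))"
  proof (rule metric_CauchyI)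
    fix e :: real assume "0 < e"
    then obtain N where N: "\<And>n a b. n \<ge> N \<Longrightarrow> a \<in> A \<Longrightarrow> b \<in> A \<Longrightarrow> code n a = code n b \<Longrightarrow> dist a b < e"
      using code_fine by blast
    have "code N (rep (w n)) = w N" if "n \<ge> N" for n
      using code_rep_take[OF ne, of N n] len tk[OF that] that by simp
    then show "\<exists>M. \<forall>m\<ge>M. \<forall>n\<ge>M. dist (rep (w m)) (rep (w n)) < e"
      using N rep_in by (metis order_refl)
  qed
  then have "convergent (\<lambda>n. rep (w n))" by (rule Cauchy_convergent)
  then have L: "(\<lambda>n. rep (w n)) \<longlonglongrightarrow> lim (\<lambda>n. rep (w n))" by (simp add: convergent_LIMSEQ_iff)
  then show "follows w (lim (\<lambda>n. rep (w n)))"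
    unfolding follows_def using assms by blast
  show "lim (\<lambda>n. rep (w n)) \<in> A"
    by (rule closed_sequentially[OF compact_imp_closed[OF A_compact] _ L]) (rule rep_in)
qed

lemma followsD:
  assumes "follows w a"
  shows "length (w n) = n" "n \<le> m \<Longrightarrow> take n (w m) = w n" "cell (w n) \<noteq> {}" "(\<lambda>n. rep (w n)) \<longlonglongrightarrow> a"
  using assms unfolding follows_def by blast+

lemma follows_in: "follows w a \<Longrightarrow> a \<in> A"
  by (rule closed_sequentially[OF compact_imp_closed[OF A_compact] _ followsD(4)]) (rule rep_in)

lemma measurable_word:
  assumes w: "w \<in> Z \<rightarrow>\<^sub>M count_space (UNIV::bool list set)" and \<xi>: "\<xi> \<in> Z \<rightarrow>\<^sub>M X"
    and h: "\<And>c. h c \<in> X \<rightarrow>\<^sub>M N"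
  shows "(\<lambda>z. h (w z) (\<xi> z)) \<in> Z \<rightarrow>\<^sub>M N"
  by (rule measurable_compose_countable[OF measurable_compose[OF \<xi> h] w])

text \<open>Replacing the action by the representative of its cell gives a function of the state and of countably
  many words; as the cells shrink these functions converge by continuity in the action.\<close>

lemma caratheodory_measurable:
  assumes f: "bounded_caratheodory X A f"
  shows "f \<in> borel_measurable (X \<Otimes>\<^sub>M actM A)"
proof (rule borel_measurable_LIMSEQ_metric)
  fix n
  show "(\<lambda>z. f (fst z, rep (code n (snd z)))) \<in> borel_measurable (X \<Otimes>\<^sub>M actM A)"
    by (rule measurable_word[where h="\<lambda>c x. f (x, rep c)", OF measurable_compose[OF measurable_snd code_measurable] measurable_fst])
      (use f rep_in in \<open>simp add: bounded_caratheodory_def\<close>)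
next
  fix z assume z: "z \<in> space (X \<Otimes>\<^sub>M actM A)"
  then have "fst z \<in> space X" and a: "snd z \<in> A" by (auto simp: space_pair_measure)
  then have c: "continuous_on A (\<lambda>a. f (fst z, a))" using f by (auto simp: bounded_caratheodory_def)
  have "(\<lambda>n. rep (code n (snd z))) \<longlonglongrightarrow> snd z"
    by (rule followsD(4)[OF follows_code[OF a]])
  then have "(\<lambda>n. f (fst z, rep (code n (snd z)))) \<longlonglongrightarrow> f (fst z, snd z)"
    by (rule continuous_on_tendsto_compose[OF c _ a]) (simp add: rep_in)
  then show "(\<lambda>n. f (fst z, rep (code n (snd z)))) \<longlonglongrightarrow> f z" by simp
qed

text \<open>At state \<open>x\<close> this bounds the error of stopping the code after \<open>n\<close> bits.  Representatives of longer
  words stand for the points of their cells, so only countably many points are compared and the bound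
  is measurable in \<open>x\<close>.\<close>

definition osc :: "('x \<times> 'a \<Rightarrow> real) \<Rightarrow> nat \<Rightarrow> 'x \<Rightarrow> real" where
  "osc f n x = (SUP c\<in>{c. n \<le> length c \<and> cell c \<noteq> {}}. \<bar>f (x, rep c) - f (x, rep (take n c))\<bar>)"

lemma long_cell_ex: "{c. n \<le> length c \<and> cell c \<noteq> {}} \<noteq> {}"
  using A_nonempty cell_code by (force intro: exI[of _ "code n _"])

lemma caratheodory_bound:
  assumes f: "bounded_caratheodory X A f"
  obtains B where "B \<ge> 0" "\<And>x a. x \<in> space X \<Longrightarrow> a \<in> A \<Longrightarrow> \<bar>f (x, a)\<bar> \<le> B"
proof -
  from f obtain B where "\<forall>y\<in>f ` (space X \<times> A). norm y \<le> B"
    unfolding bounded_caratheodory_def bounded_iff by auto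
  then show ?thesis by (intro that[of "max 0 B"]) (auto simp: le_max_iff_disj)
qed

context
  fixes X :: "'x measure" and f :: "'x \<times> 'a \<Rightarrow> real"
  assumes f: "bounded_caratheodory X A f"
begin

lemma osc_bdd:
  assumes x: "x \<in> space X"
  shows "bdd_above ((\<lambda>c. \<bar>f (x, rep c) - f (x, rep (take n c))\<bar>) ` {c. n \<le> length c \<and> cell c \<noteq> {}})"
proof -
  obtain B where B: "\<And>x a. x \<in> space X \<Longrightarrow> a \<in> A \<Longrightarrow> \<bar>f (x, a)\<bar> \<le> B"
    using caratheodory_bound[OF f] by blast
  have "\<bar>f (x, rep c) - f (x, rep c')\<bar> \<le> 2 * B" for c c'
    using B[OF x rep_in, of c] B[OF x rep_in, of c'] by linarith
  then show ?thesis by (auto intro!: bdd_aboveI)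
qed

lemma osc_nonneg: "x \<in> space X \<Longrightarrow> 0 \<le> osc f n x"
proof -
  assume x: "x \<in> space X"
  obtain c where c: "n \<le> length c" "cell c \<noteq> {}" using long_cell_ex[of n] by blast
  have "0 \<le> \<bar>f (x, rep c) - f (x, rep (take n c))\<bar>" by simp
  also have "\<dots> \<le> osc f n x" unfolding osc_def
    by (rule cSUP_upper[OF _ osc_bdd[OF x]]) (use c in auto)
  finally show ?thesis .
qed

lemma osc_le:
  assumes B: "\<And>x a. x \<in> space X \<Longrightarrow> a \<in> A \<Longrightarrow> \<bar>f (x, a)\<bar> \<le> B" and x: "x \<in> space X"
  shows "osc f n x \<le> 2 * B"
  unfolding osc_def
proof (rule cSUP_least[OF long_cell_ex])
  fix c
  show "\<bar>f (x, rep c) - f (x, rep (take n c))\<bar> \<le> 2 * B"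
    using B[OF x rep_in, of c] B[OF x rep_in, of "take n c"] by linarith
qed

lemma osc_measurable [measurable]: "osc f n \<in> borel_measurable X"
  unfolding osc_def[abs_def]
proof (rule borel_measurable_cSUP)
  show "(\<lambda>x. \<bar>f (x, rep c) - f (x, rep (take n c))\<bar>) \<in> borel_measurable X" for c
  proof -
    have [measurable]: "(\<lambda>x. f (x, rep c)) \<in> borel_measurable X" for c
      using f rep_in by (auto simp: bounded_caratheodory_def)
    show ?thesis by measurable
  qed
qed (simp_all add: osc_bdd)

text \<open>On the compact set \<open>A\<close> continuity in the action is uniform, and long words have small cells.\<close>

lemma osc_tendsto:
  assumes x: "x \<in> space X"
  shows "(\<lambda>n. osc f n x) \<longlonglongrightarrow> 0"
proof (rule LIMSEQ_I)
  fix r :: real assume r: "0 < r"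
  have "uniformly_continuous_on A (\<lambda>a. f (x, a))"
    using f x A_compact by (intro compact_uniformly_continuous) (auto simp: bounded_caratheodory_def)
  then obtain d where d: "d > 0" "\<And>a b. a \<in> A \<Longrightarrow> b \<in> A \<Longrightarrow> dist b a < d \<Longrightarrow> dist (f (x, b)) (f (x, a)) < r / 2"
    unfolding uniformly_continuous_on_def using r by (metis half_gt_zero)
  obtain N where N: "\<And>n a b. n \<ge> N \<Longrightarrow> a \<in> A \<Longrightarrow> b \<in> A \<Longrightarrow> code n a = code n b \<Longrightarrow> dist a b < d"
    using code_fine[OF d(1)] by blast
  have "norm (osc f n x - 0) < r" if n: "n \<ge> N" for n
  proof -
    have "osc f n x \<le> r / 2" unfolding osc_def
    proof (rule cSUP_least[OF long_cell_ex])
      fix c assume "c \<in> {c. n \<le> length c \<and> cell c \<noteq> {}}"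
      then have c: "n \<le> length c" "cell c \<noteq> {}" by auto
      have c2: "cell (take n c) \<noteq> {}" using cell_mono c by blast
      have "code n (rep c) = code n (rep (take n c))"
        using code_rep_take[OF c(2,1)] code_rep[OF c2] c by (simp add: min_absorb2)
      then have "dist (rep c) (rep (take n c)) < d" using N[OF n rep_in rep_in] by blast
      then have "dist (f (x, rep c)) (f (x, rep (take n c))) < r / 2" using d(2) rep_in by blast
      then show "\<bar>f (x, rep c) - f (x, rep (take n c))\<bar> \<le> r / 2" by (simp add: dist_real_def)
    qed
    then show ?thesis using osc_nonneg[OF x, of n] r by simp
  qed
  then show "\<exists>no. \<forall>n\<ge>no. norm (osc f n x - 0) < r" by blast
qed

lemma osc_follows:
  assumes x: "x \<in> space X" and w: "follows w a"
  shows "\<bar>f (x, a) - f (x, rep (w n))\<bar> \<le> osc f n x"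
proof (rule LIMSEQ_le_const2)
  have "continuous_on A (\<lambda>a. f (x, a))" using f x by (auto simp: bounded_caratheodory_def)
  then have "(\<lambda>k. f (x, rep (w k))) \<longlonglongrightarrow> f (x, a)"
    by (rule continuous_on_tendsto_compose[OF _ followsD(4)[OF w] follows_in[OF w]]) (simp add: rep_in)
  then show "(\<lambda>k. \<bar>f (x, rep (w k)) - f (x, rep (w n))\<bar>) \<longlonglongrightarrow> \<bar>f (x, a) - f (x, rep (w n))\<bar>"
    by (intro tendsto_intros)
  have "\<bar>f (x, rep (w k)) - f (x, rep (w n))\<bar> \<le> osc f n x" if k: "k \<ge> n" for k
  proof -
    have "\<bar>f (x, rep (w k)) - f (x, rep (take n (w k)))\<bar> \<le> osc f n x" unfolding osc_def
      by (rule cSUP_upper[OF _ osc_bdd[OF x]]) (use followsD[OF w] k in simp)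
    then show ?thesis using followsD(2)[OF w k] by simp
  qed
  then show "\<exists>N. \<forall>k\<ge>N. \<bar>f (x, rep (w k)) - f (x, rep (w n))\<bar> \<le> osc f n x" by blast
qed

end

end

section \<open>Random codes along a tree of measures\<close>

definition coin :: "real measure" where
  "coin = uniform_measure lborel {0..1}"

definition coins :: "(nat \<Rightarrow> real) measure" where
  "coins = (\<Pi>\<^sub>M i\<in>UNIV. coin)"

lemma sets_coin [measurable_cong, simp]: "sets coin = sets borel"
  by (simp add: coin_def)

lemma space_coin [simp]: "space coin = UNIV"
  by (simp add: coin_def)

lemma prob_space_coin: "prob_space coin"
  unfolding coin_def by (rule prob_space_uniform_measure) auto

lemma prob_space_coins: "prob_space coins"
  unfolding coins_def by (intro prob_space_PiM prob_space_coin)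

lemma measurable_coins [measurable]: "(\<lambda>u. u n) \<in> borel_measurable coins"
proof -
  have "(\<lambda>u. u n) \<in> coins \<rightarrow>\<^sub>M coin" unfolding coins_def by measurable
  then show ?thesis by (simp cong: measurable_cong_sets)
qed

lemma space_coins [simp]: "space coins = UNIV"
  by (simp add: coins_def space_PiM)

lemma coin_less:
  assumes "0 \<le> q" "q \<le> 1"
  shows "emeasure coin {v. v < q} = ennreal q" "emeasure coin {v. \<not> v < q} = ennreal (1 - q)"
proof -
  have "{0..1} \<inter> {v. v < q} = {0..<q}" "{0..1} \<inter> {v. \<not> v < q} = {q..1}" using assms by auto
  then show "emeasure coin {v. v < q} = ennreal q" "emeasure coin {v. \<not> v < q} = ennreal (1 - q)"
    using assms by (auto simp: coin_def emeasure_uniform_measure divide_ennreal_def)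
qed

text \<open>A random infinite code is produced bit by bit: given the word drawn so far, the next bit is
  drawn from a fresh uniform variable with the prescribed conditional probability.\<close>

primrec word :: "(bool list \<Rightarrow> 'x \<Rightarrow> real) \<Rightarrow> nat \<Rightarrow> 'x \<Rightarrow> (nat \<Rightarrow> real) \<Rightarrow> bool list" where
  "word p 0 x u = []"
| "word p (Suc n) x u = word p n x u @ [u n < p (word p n x u) x]"

lemma length_word [simp]: "length (word p n x u) = n"
  by (induction n) auto

lemma take_word: "n \<le> m \<Longrightarrow> take n (word p m x u) = word p n x u"
proof (induction m)
  case (Suc m)
  then show ?case by (cases "n = Suc m") auto
qed simp

lemma word_measurable:
  assumes p: "\<And>c. p c \<in> borel_measurable X"
  shows "(\<lambda>z. word p n (fst z) (snd z)) \<in> X \<Otimes>\<^sub>M coins \<rightarrow>\<^sub>M count_space UNIV"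
proof (induction n)
  case (Suc n)
  have "(\<lambda>z. c @ [snd z n < p c (fst z)]) \<in> X \<Otimes>\<^sub>M coins \<rightarrow>\<^sub>M count_space UNIV" for c
  proof -
    have [measurable]: "p c \<in> borel_measurable X" by (rule p)
    show ?thesis by measurable
  qed
  then show ?case
    using measurable_compose_countable[of "\<lambda>c z. c @ [snd z n < p c (fst z)]", OF _ Suc] by simp
qed simp

lemma word_eq_iff: "word p (length c) x u = c \<longleftrightarrow> (\<forall>j<length c. (u j < p (take j c) x) = c ! j)"
proof (induction c rule: rev_induct)
  case (snoc b c)
  have "word p (length (c @ [b])) x u = c @ [b] \<longleftrightarrow>
      word p (length c) x u = c \<and> (u (length c) < p c x) = b" by auto
  also have "\<dots> \<longleftrightarrow> (\<forall>j<length c. (u j < p (take j c) x) = c ! j) \<and> (u (length c) < p c x) = b"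
    using snoc by simp
  also have "\<dots> \<longleftrightarrow> (\<forall>j<length (c @ [b]). (u j < p (take j (c @ [b])) x) = (c @ [b]) ! j)"
    by (auto simp: less_Suc_eq nth_append)
  finally show ?case .
qed simp

text \<open>For a fixed target word every comparison involves one uniform variable and a constant, so the event
  is a product cylinder.\<close>

lemma emeasure_word:
  assumes p: "\<And>j. j < length c \<Longrightarrow> 0 \<le> p (take j c) x \<and> p (take j c) x \<le> 1"
  shows "emeasure coins {u. word p (length c) x u = c} =
    ennreal (\<Prod>j<length c. if c ! j then p (take j c) x else 1 - p (take j c) x)"
proof -
  let ?E = "\<lambda>j. {v. (v < p (take j c) x) = c ! j}"
  have E: "?E j \<in> sets coin" for j by (cases "c ! j") auto
  have "{u. word p (length c) x u = c} = prod_emb UNIV (\<lambda>_. coin) {..<length c} (\<Pi>\<^sub>E j\<in>{..<length c}. ?E j)"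
    unfolding word_eq_iff by (rule set_eqI) (simp add: prod_emb_iff PiE_iff Ball_def)
  then have "emeasure coins {u. word p (length c) x u = c} = (\<Prod>j<length c. emeasure coin (?E j))"
    unfolding coins_def using E by (simp add: emeasure_PiM_emb prob_space_coin)
  also have "\<dots> = (\<Prod>j<length c. ennreal (if c ! j then p (take j c) x else 1 - p (take j c) x))"
  proof (rule prod.cong[OF refl])
    fix j assume "j \<in> {..<length c}"
    then show "emeasure coin (?E j) = ennreal (if c ! j then p (take j c) x else 1 - p (take j c) x)"
      using p[of j] coin_less[of "p (take j c) x"] by (cases "c ! j") auto
  qed
  also have "\<dots> = ennreal (\<Prod>j<length c. if c ! j then p (take j c) x else 1 - p (take j c) x)"
    using p by (intro prod_ennreal) auto
  finally show ?thesis .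
qed

text \<open>A family of measures indexed by the words, in which every measure splits into those of the two
  extensions of its word: what a measure on states and actions leaves on the cells.\<close>

locale measure_tree =
  fixes X :: "'x measure" and \<nu> :: "bool list \<Rightarrow> 'x measure"
  assumes sets_tree: "\<And>c. sets (\<nu> c) = sets X"
    and finite_tree: "\<And>c. finite_measure (\<nu> c)"
    and split_tree: "\<And>c \<Gamma>. \<Gamma> \<in> sets X \<Longrightarrow> emeasure (\<nu> c) \<Gamma> = emeasure (\<nu> (c @ [True])) \<Gamma> + emeasure (\<nu> (c @ [False])) \<Gamma>"
begin

lemma sets_tree' [measurable_cong]: "sets (\<nu> c) = sets X" by (rule sets_tree)

lemma space_tree: "space (\<nu> c) = space X" using sets_eq_imp_space_eq[OF sets_tree] .

lemma tree_snoc_le: "\<Gamma> \<in> sets X \<Longrightarrow> emeasure (\<nu> (c @ [b])) \<Gamma> \<le> emeasure (\<nu> c) \<Gamma>"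
  using split_tree[of \<Gamma> c] by (cases b) simp_all

lemma tree_le_root: "\<Gamma> \<in> sets X \<Longrightarrow> emeasure (\<nu> c) \<Gamma> \<le> emeasure (\<nu> []) \<Gamma>"
  by (induction c rule: rev_induct) (auto intro: order_trans[OF tree_snoc_le])

lemma tree_ac: "absolutely_continuous (\<nu> []) (\<nu> c)"
  unfolding absolutely_continuous_def
proof
  fix \<Gamma> assume "\<Gamma> \<in> null_sets (\<nu> [])"
  then show "\<Gamma> \<in> null_sets (\<nu> c)"
    using tree_le_root[of \<Gamma> c] by (simp add: null_sets_def sets_tree)
qed

definition dens :: "bool list \<Rightarrow> 'x \<Rightarrow> real" where
  "dens c x = enn2real (RN_deriv (\<nu> []) (\<nu> c) x)"

lemma dens_measurable [measurable]: "dens c \<in> borel_measurable X"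
proof -
  have "dens c \<in> borel_measurable (\<nu> [])" unfolding dens_def by measurable
  then show ?thesis by (simp cong: measurable_cong_sets add: sets_tree)
qed

lemma dens_nonneg: "0 \<le> dens c x"
  by (simp add: dens_def)

lemma emeasure_dens:
  assumes "\<Gamma> \<in> sets X"
  shows "emeasure (\<nu> c) \<Gamma> = (\<integral>\<^sup>+x\<in>\<Gamma>. ennreal (dens c x) \<partial>\<nu> [])"
proof -
  interpret finite_measure "\<nu> []" by (rule finite_tree)
  interpret c: finite_measure "\<nu> c" by (rule finite_tree)
  have "AE x in \<nu> []. RN_deriv (\<nu> []) (\<nu> c) x \<noteq> \<infinity>"
    by (rule RN_deriv_finite[OF c.sigma_finite_measure_axioms tree_ac]) (simp add: sets_tree)
  then have ae: "AE x in \<nu> []. ennreal (dens c x) = RN_deriv (\<nu> []) (\<nu> c) x"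
    by eventually_elim (simp add: dens_def less_top)
  have "emeasure (\<nu> c) \<Gamma> = emeasure (density (\<nu> []) (RN_deriv (\<nu> []) (\<nu> c))) \<Gamma>"
    by (simp add: density_RN_deriv[OF tree_ac] sets_tree)
  also have "\<dots> = (\<integral>\<^sup>+x\<in>\<Gamma>. RN_deriv (\<nu> []) (\<nu> c) x \<partial>\<nu> [])"
    using assms by (simp add: emeasure_density sets_tree)
  also have "\<dots> = (\<integral>\<^sup>+x\<in>\<Gamma>. ennreal (dens c x) \<partial>\<nu> [])"
    by (rule nn_integral_cong_AE[OF AE_mp[OF ae AE_I2]]) simp
  finally show ?thesis .
qed

lemma dens_split: "AE x in \<nu> []. \<forall>c. dens c x = dens (c @ [True]) x + dens (c @ [False]) x"
proof (subst AE_all_countable, rule allI)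
  fix c
  interpret finite_measure "\<nu> []" by (rule finite_tree)
  have "AE x in \<nu> []. ennreal (dens c x) = ennreal (dens (c @ [True]) x) + ennreal (dens (c @ [False]) x)"
  proof (rule density_unique_finite_measure)
    fix \<Gamma> assume "\<Gamma> \<in> sets (\<nu> [])"
    then have \<Gamma>[measurable]: "\<Gamma> \<in> sets X" by (simp add: sets_tree)
    have "(\<integral>\<^sup>+x. (ennreal (dens (c @ [True]) x) + ennreal (dens (c @ [False]) x)) * indicator \<Gamma> x \<partial>\<nu> [])
       = emeasure (\<nu> (c @ [True])) \<Gamma> + emeasure (\<nu> (c @ [False])) \<Gamma>"
      by (simp add: emeasure_dens[OF \<Gamma>] distrib_right nn_integral_add)
    then show "(\<integral>\<^sup>+x. ennreal (dens c x) * indicator \<Gamma> x \<partial>\<nu> []) =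
        (\<integral>\<^sup>+x. (ennreal (dens (c @ [True]) x) + ennreal (dens (c @ [False]) x)) * indicator \<Gamma> x \<partial>\<nu> [])"
      by (simp add: emeasure_dens[OF \<Gamma>, symmetric] split_tree[OF \<Gamma>, of c])
  qed auto
  then show "AE x in \<nu> []. dens c x = dens (c @ [True]) x + dens (c @ [False]) x"
    by eventually_elim (simp add: dens_nonneg flip: ennreal_plus)
qed

lemma dens_root: "AE x in \<nu> []. dens [] x = 1"
proof -
  interpret finite_measure "\<nu> []" by (rule finite_tree)
  have "AE x in \<nu> []. ennreal (dens [] x) = 1"
  proof (rule density_unique_finite_measure)
    fix \<Gamma> assume "\<Gamma> \<in> sets (\<nu> [])"
    then have \<Gamma>[measurable]: "\<Gamma> \<in> sets X" by (simp add: sets_tree)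
    then show "(\<integral>\<^sup>+x. ennreal (dens [] x) * indicator \<Gamma> x \<partial>\<nu> []) = (\<integral>\<^sup>+x. 1 * indicator \<Gamma> x \<partial>\<nu> [])"
      by (simp add: emeasure_dens[OF \<Gamma>, symmetric])
  qed auto
  then show ?thesis by eventually_elim simp
qed

text \<open>Where the density of the parent vanishes so do those of the children, almost everywhere; the value
  \<open>0 / 0 = 0\<close> is then harmless.\<close>

definition split_prob :: "bool list \<Rightarrow> 'x \<Rightarrow> real" where
  "split_prob c x = dens (c @ [True]) x / dens c x"

lemma split_prob_measurable [measurable]: "split_prob c \<in> borel_measurable X"
  unfolding split_prob_def by measurable

lemma word_prob: "AE x in \<nu> []. \<forall>c. emeasure coins {u. word split_prob (length c) x u = c} = ennreal (dens c x)"
  using dens_split dens_root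
proof eventually_elim
  case (elim x)
  have split: "dens c x = dens (c @ [True]) x + dens (c @ [False]) x" for c using elim by blast
  have p: "0 \<le> split_prob c x \<and> split_prob c x \<le> 1" for c
    using split[of c] dens_nonneg[of "c @ [True]" x] dens_nonneg[of "c @ [False]" x]
    by (auto simp: split_prob_def divide_le_eq_1)
  have "(\<Prod>j<length c. if c ! j then split_prob (take j c) x else 1 - split_prob (take j c) x) = dens c x" for c
  proof (induction c rule: rev_induct)
    case Nil
    show ?case using elim(2) by simp
  next
    case (snoc b c)
    have "(\<Prod>j<length (c @ [b]). if (c @ [b]) ! j then split_prob (take j (c @ [b])) x else 1 - split_prob (take j (c @ [b])) x)
      = dens c x * (if b then split_prob c x else 1 - split_prob c x)"
    proof -
      have "(\<Prod>j<length c. if (c @ [b]) ! j then split_prob (take j (c @ [b])) x else 1 - split_prob (take j (c @ [b])) x) = dens c x"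
        unfolding snoc[symmetric] by (intro prod.cong) (auto simp: nth_append)
      then show ?thesis by simp
    qed
    also have "\<dots> = dens (c @ [b]) x"
    proof (cases "dens c x = 0")
      case True
      then have "dens (c @ [b]) x = 0"
        using split[of c] dens_nonneg[of "c @ [True]" x] dens_nonneg[of "c @ [False]" x] by (cases b) auto
      then show ?thesis using True by simp
    next
      case False
      then show ?thesis using split[of c] by (cases b) (auto simp: split_prob_def field_simps)
    qed
    finally show ?case .
  qed
  then show ?case using emeasure_word[of _ split_prob x] p by simp
qed

text \<open>The product of the conditional probabilities along a word telescopes to the density of its measure,
  so drawing a code at a random state reproduces the whole tree.\<close>

lemma emeasure_word_tree:
  assumes \<Gamma>: "\<Gamma> \<in> sets X"
  shows "emeasure (\<nu> [] \<Otimes>\<^sub>M coins) {z \<in> space (\<nu> [] \<Otimes>\<^sub>M coins). fst z \<in> \<Gamma> \<and> word split_prob (length c) (fst z) (snd z) = c}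
    = emeasure (\<nu> c) \<Gamma>"
proof -
  interpret prob_space coins by (rule prob_space_coins)
  have [measurable]: "(\<lambda>z. word split_prob (length c) (fst z) (snd z)) \<in> \<nu> [] \<Otimes>\<^sub>M coins \<rightarrow>\<^sub>M count_space UNIV"
    by (rule word_measurable) simp
  have [measurable]: "\<Gamma> \<in> sets (\<nu> [])" using \<Gamma> by (simp add: sets_tree)
  let ?S = "{z \<in> space (\<nu> [] \<Otimes>\<^sub>M coins). fst z \<in> \<Gamma> \<and> word split_prob (length c) (fst z) (snd z) = c}"
  have "emeasure (\<nu> [] \<Otimes>\<^sub>M coins) ?S = (\<integral>\<^sup>+x. emeasure coins (Pair x -` ?S) \<partial>\<nu> [])"
    by (rule emeasure_pair_measure_alt) measurable
  also have "\<dots> = (\<integral>\<^sup>+x\<in>\<Gamma>. ennreal (dens c x) \<partial>\<nu> [])"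
  proof (rule nn_integral_cong_AE)
    show "AE x in \<nu> []. emeasure coins (Pair x -` ?S) = ennreal (dens c x) * indicator \<Gamma> x"
      using word_prob AE_space
    proof eventually_elim
      case (elim x)
      then have "Pair x -` ?S = (if x \<in> \<Gamma> then {u. word split_prob (length c) x u = c} else {})"
        by (auto simp: space_pair_measure)
      then show ?case using elim by simp
    qed
  qed
  finally show ?thesis by (simp add: emeasure_dens[OF \<Gamma>])
qed

end

text \<open>Words of empty cells carry no mass, hence almost every random code follows nonempty cells and determines
  a point of \<open>A\<close>.\<close>

locale coded_tree = compact_coding A U + measure_tree X \<nu>
  for A :: "'a::polish_space set" and U and X :: "'x measure" and \<nu> +
  assumes null_empty: "\<And>c. cell c = {} \<Longrightarrow> emeasure (\<nu> c) (space X) = 0"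
begin

definition good :: "'x \<Rightarrow> (nat \<Rightarrow> real) \<Rightarrow> bool" where
  "good x u \<longleftrightarrow> (\<forall>n. cell (word split_prob n x u) \<noteq> {})"

definition sel :: "'x \<Rightarrow> (nat \<Rightarrow> real) \<Rightarrow> 'a" where
  "sel x u = (if good x u then lim (\<lambda>n. rep (word split_prob n x u)) else rep [])"

lemma word_tree_measurable [measurable]:
  "(\<lambda>z. word split_prob n (fst z) (snd z)) \<in> X \<Otimes>\<^sub>M coins \<rightarrow>\<^sub>M count_space UNIV"
  by (rule word_measurable) measurable

lemma sel_follows: "good x u \<Longrightarrow> follows (\<lambda>n. word split_prob n x u) (sel x u)"
  using follows_convergent(1)[of "\<lambda>n. word split_prob n x u"] by (simp add: sel_def good_def take_word)

lemma sel_in: "sel x u \<in> A"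
  using follows_in[OF sel_follows, of x u] by (cases "good x u") (auto simp: sel_def rep_in)

lemma sel_measurable: "(\<lambda>z. sel (fst z) (snd z)) \<in> X \<Otimes>\<^sub>M coins \<rightarrow>\<^sub>M actM A"
proof (rule measurable_restrict_space2)
  have [measurable]: "Measurable.pred (X \<Otimes>\<^sub>M coins) (\<lambda>z. cell (word split_prob n (fst z) (snd z)) = {})" for n
    by (rule measurable_compose[OF word_tree_measurable]) simp
  show "(\<lambda>z. sel (fst z) (snd z)) \<in> borel_measurable (X \<Otimes>\<^sub>M coins)"
  proof (rule borel_measurable_LIMSEQ_metric)
    fix n
    have [measurable]: "(\<lambda>z. rep (word split_prob n (fst z) (snd z))) \<in> borel_measurable (X \<Otimes>\<^sub>M coins)"
      by (rule measurable_compose[OF word_tree_measurable]) simp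
    show "(\<lambda>z. if good (fst z) (snd z) then rep (word split_prob n (fst z) (snd z)) else rep []) \<in> borel_measurable (X \<Otimes>\<^sub>M coins)"
      unfolding good_def by measurable
  next
    fix z
    show "(\<lambda>n. if good (fst z) (snd z) then rep (word split_prob n (fst z) (snd z)) else rep []) \<longlonglongrightarrow> sel (fst z) (snd z)"
      using followsD(4)[OF sel_follows, of "fst z" "snd z"] by (auto simp: sel_def)
  qed
qed (use sel_in in auto)

lemma AE_good: "AE z in \<nu> [] \<Otimes>\<^sub>M coins. good (fst z) (snd z)"
  unfolding good_def
proof (subst AE_all_countable, rule allI)
  fix n
  let ?w = "\<lambda>z. word split_prob n (fst z) (snd z)"
  have "AE z in \<nu> [] \<Otimes>\<^sub>M coins. \<forall>c\<in>{c. length c = n \<and> cell c = {}}. ?w z \<noteq> c"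
  proof (subst AE_ball_countable)
    show "\<forall>c\<in>{c. length c = n \<and> cell c = {}}. AE z in \<nu> [] \<Otimes>\<^sub>M coins. ?w z \<noteq> c"
    proof
      fix c assume "c \<in> {c. length c = n \<and> cell c = {}}"
      then have c: "length c = n" "cell c = {}" by auto
      have "?w \<in> \<nu> [] \<Otimes>\<^sub>M coins \<rightarrow>\<^sub>M count_space UNIV" by (rule word_measurable) simp
      note [measurable] = this
      have "emeasure (\<nu> [] \<Otimes>\<^sub>M coins) {z \<in> space (\<nu> [] \<Otimes>\<^sub>M coins). ?w z = c} = 0"
        using emeasure_word_tree[OF sets.top, of c] null_empty[OF c(2)] c(1)
        by (simp add: space_pair_measure space_tree mem_Times_iff cong: conj_cong)
      then show "AE z in \<nu> [] \<Otimes>\<^sub>M coins. ?w z \<noteq> c"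
        by (subst AE_iff_measurable[OF _ refl]) auto
    qed
  qed auto
  then show "AE z in \<nu> [] \<Otimes>\<^sub>M coins. cell (?w z) \<noteq> {}" by eventually_elim (metis (mono_tags) mem_Collect_eq length_word)
qed

end

section \<open>Caratheodory integrals and the code\<close>

lemma measure_eqI_rect:
  assumes M: "sets M = sets (X \<Otimes>\<^sub>M Y)" and N: "sets N = sets (X \<Otimes>\<^sub>M Y)" and fin: "finite_measure M"
    and eq: "\<And>\<Gamma> B. \<Gamma> \<in> sets X \<Longrightarrow> B \<in> sets Y \<Longrightarrow> emeasure M (\<Gamma> \<times> B) = emeasure N (\<Gamma> \<times> B)"
  shows "M = N"
proof (rule measure_eqI_generator_eq[OF Int_stable_pair_measure_generator[of X Y]])
  show "{a \<times> b | a b. a \<in> sets X \<and> b \<in> sets Y} \<subseteq> Pow (space X \<times> space Y)"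
    using sets.sets_into_space[of _ X] sets.sets_into_space[of _ Y] by blast
  show "sets M = sigma_sets (space X \<times> space Y) {a \<times> b | a b. a \<in> sets X \<and> b \<in> sets Y}"
    "sets N = sigma_sets (space X \<times> space Y) {a \<times> b | a b. a \<in> sets X \<and> b \<in> sets Y}"
    using M N by (simp_all add: sets_pair_measure)
  show "range (\<lambda>_::nat. space X \<times> space Y) \<subseteq> {a \<times> b | a b. a \<in> sets X \<and> b \<in> sets Y}" by auto
  show "emeasure M (space X \<times> space Y) \<noteq> \<infinity>" using finite_measure.emeasure_finite[OF fin] by simp
qed (use eq in auto)

lemma indicator_caratheodory:
  fixes g :: "'a::polish_space \<Rightarrow> real"
  assumes \<Gamma>: "\<Gamma> \<in> sets X" and g: "continuous_on A g" and b: "\<And>a. a \<in> A \<Longrightarrow> \<bar>g a\<bar> \<le> B"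
  shows "bounded_caratheodory X A (\<lambda>z. indicator \<Gamma> (fst z) * g (snd z))"
  unfolding bounded_caratheodory_def
proof (intro conjI ballI)
  show "bounded ((\<lambda>z. indicator \<Gamma> (fst z) * g (snd z)) ` (space X \<times> A))"
    by (rule boundedI[where B="\<bar>B\<bar>"]) (use b in \<open>force simp: indicator_def\<close>)
  fix a
  show "(\<lambda>x. indicator \<Gamma> (fst (x, a)) * g (snd (x, a))) \<in> borel_measurable X" using \<Gamma> by simp
next
  fix x
  show "continuous_on A (\<lambda>a. indicator \<Gamma> (fst (x, a)) * g (snd (x, a)))"
    using g by (auto intro!: continuous_intros)
qed

text \<open>Rectangles with a closed side generate the product sigma-algebra, and the indicator of such a
  rectangle is a decreasing limit of Caratheodory functions built from the distance to the closed side.\<close>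

lemma caratheodory_determines:
  fixes A :: "'a::polish_space set"
  assumes M: "M \<in> finite_measures (X \<Otimes>\<^sub>M actM A)" and N: "N \<in> finite_measures (X \<Otimes>\<^sub>M actM A)"
    and A: "A \<in> sets borel"
    and eq: "\<And>f. bounded_caratheodory X A f \<Longrightarrow> (\<integral>z. f z \<partial>M) = (\<integral>z. f z \<partial>N)"
  shows "M = N"
proof -
  have rect: "measure M (\<Gamma> \<times> (C \<inter> A)) = measure N (\<Gamma> \<times> (C \<inter> A))" if \<Gamma>: "\<Gamma> \<in> sets X" and C: "closed C" for \<Gamma> C
  proof (cases "C = {}")
    case False
    define g where "g n a = max 0 (1 - real n * infdist a C)" for n and a :: 'a
    have lim: "(\<lambda>n. \<integral>z. indicator \<Gamma> (fst z) * g n (snd z) \<partial>L) \<longlonglongrightarrow> measure L (\<Gamma> \<times> (C \<inter> A))"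
      if L: "L \<in> finite_measures (X \<Otimes>\<^sub>M actM A)" for L
    proof -
      interpret finite_measure L using L by (simp add: finite_measures_def)
      have sL [measurable_cong]: "sets L = sets (X \<Otimes>\<^sub>M actM A)" using L by (simp add: finite_measures_def)
      have spL: "space L = space X \<times> A"
        using sets_eq_imp_space_eq[OF sL] by (simp add: space_pair_measure space_restrict_space)
      have CA: "C \<inter> A \<in> sets (actM A)" using C A by (auto simp: sets_restrict_space)
      then have R: "\<Gamma> \<times> (C \<inter> A) \<in> sets L" using \<Gamma> by (simp add: sL)
      have "(\<lambda>n. \<integral>z. indicator \<Gamma> (fst z) * g n (snd z) \<partial>L) \<longlonglongrightarrow> (\<integral>z. indicator (\<Gamma> \<times> (C \<inter> A)) z \<partial>L)"
      proof (rule integral_dominated_convergence[where w="\<lambda>_. 1"])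
        have [measurable]: "(\<lambda>a. infdist a C) \<in> borel_measurable (actM A)"
          by (intro measurable_restrict_space1 borel_measurable_continuous_onI continuous_on_infdist continuous_on_id)
        have [measurable]: "g n \<in> borel_measurable (actM A)" for n unfolding g_def by measurable
        show "(\<lambda>z. indicator \<Gamma> (fst z) * g n (snd z)) \<in> borel_measurable L" for n
          using \<Gamma> by measurable
        show "(\<lambda>z. indicator (\<Gamma> \<times> (C \<inter> A)) z :: real) \<in> borel_measurable L" using R by simp
        show "AE z in L. norm (indicator \<Gamma> (fst z) * g n (snd z)) \<le> 1" for n
          by (rule AE_I2) (auto simp: g_def indicator_def infdist_nonneg)
        show "AE z in L. (\<lambda>n. indicator \<Gamma> (fst z) * g n (snd z)) \<longlonglongrightarrow> indicator (\<Gamma> \<times> (C \<inter> A)) z"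
        proof (rule AE_I2)
          fix z assume z: "z \<in> space L"
          have "(\<lambda>n. g n (snd z)) \<longlonglongrightarrow> indicator C (snd z)"
          proof (cases "snd z \<in> C")
            case True
            then show ?thesis by (simp add: g_def)
          next
            case F: False
            then have "infdist (snd z) C > 0"
              using in_closed_iff_infdist_zero[OF C False] infdist_nonneg by (metis less_eq_real_def)
            then obtain k where k: "real k * infdist (snd z) C > 1" using reals_Archimedean3 by blast
            have "g n (snd z) = 0" if "n \<ge> k" for n
            proof -
              have "real k * infdist (snd z) C \<le> real n * infdist (snd z) C"
                using that by (intro mult_right_mono) (auto simp: infdist_nonneg)
              then show ?thesis using k by (simp add: g_def)
            qed
            then have "eventually (\<lambda>n. g n (snd z) = 0) sequentially" by (auto simp: eventually_sequentially)
            then show ?thesis using F by (simp add: tendsto_eventually)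
          qed
          then have "(\<lambda>n. indicator \<Gamma> (fst z) * g n (snd z)) \<longlonglongrightarrow> indicator \<Gamma> (fst z) * indicator C (snd z)"
            by (intro tendsto_intros)
          moreover have "indicator \<Gamma> (fst z) * indicator C (snd z) = (indicator (\<Gamma> \<times> (C \<inter> A)) z :: real)"
            using z by (auto simp: spL indicator_def)
          ultimately show "(\<lambda>n. indicator \<Gamma> (fst z) * g n (snd z)) \<longlonglongrightarrow> indicator (\<Gamma> \<times> (C \<inter> A)) z" by simp
        qed
      qed simp
      then show ?thesis using R by simp
    qed
    have "bounded_caratheodory X A (\<lambda>z. indicator \<Gamma> (fst z) * g n (snd z))" for n
      by (rule indicator_caratheodory[OF \<Gamma>, where B=1])
        (auto simp: g_def infdist_nonneg intro!: continuous_intros)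
    then show ?thesis using LIMSEQ_unique[OF lim[OF M]] lim[OF N] eq by simp
  qed simp
  have FM: "finite_measure M" "finite_measure N" and
    S [simp]: "sets M = sets (X \<Otimes>\<^sub>M actM A)" "sets N = sets (X \<Otimes>\<^sub>M actM A)"
    using M N by (auto simp: finite_measures_def)
  note [measurable_cong] = S
  show ?thesis
  proof (rule measure_eqI_rect[OF S FM(1)])
    fix \<Gamma> B assume \<Gamma>: "\<Gamma> \<in> sets X" and B: "B \<in> sets (actM A)"
    let ?R = "\<lambda>L. distr (restrict_space L (\<Gamma> \<times> A)) borel snd"
    have GA: "\<Gamma> \<times> A \<in> sets (X \<Otimes>\<^sub>M actM A)"
      using \<Gamma> sets.top[of "actM A"] by (auto simp: space_restrict_space)
    have snd: "snd \<in> (X \<Otimes>\<^sub>M actM A) \<rightarrow>\<^sub>M borel"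
      by (rule measurable_compose[OF measurable_snd]) (intro measurable_restrict_space1 measurable_ident_sets refl)
    have R: "emeasure (?R L) C = emeasure L (\<Gamma> \<times> (C \<inter> A))"
      if "sets L = sets (X \<Otimes>\<^sub>M actM A)" "C \<in> sets borel" for L C
    proof -
      have "snd \<in> restrict_space L (\<Gamma> \<times> A) \<rightarrow>\<^sub>M borel"
        using snd that(1) by (intro measurable_restrict_space1) (simp cong: measurable_cong_sets)
      moreover have sp: "space L = space X \<times> A"
        using sets_eq_imp_space_eq[OF that(1)] by (simp add: space_pair_measure space_restrict_space)
      ultimately have "emeasure (?R L) C = emeasure (restrict_space L (\<Gamma> \<times> A)) (snd -` C \<inter> (\<Gamma> \<times> A))"
        using that sets.sets_into_space[OF \<Gamma>] by (subst emeasure_distr) (auto simp: space_restrict_space Int_absorb2 Sigma_mono intro!: arg_cong2[where f=emeasure])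
      also have "\<dots> = emeasure L (snd -` C \<inter> (\<Gamma> \<times> A))"
        using sets.Int_space_eq2[of "\<Gamma> \<times> A" L] GA that(1) by (intro emeasure_restrict_space) auto
      also have "snd -` C \<inter> (\<Gamma> \<times> A) = \<Gamma> \<times> (C \<inter> A)" by auto
      finally show ?thesis .
    qed
    have "?R M = ?R N"
    proof (rule measure_eqI_generator_eq[where E="Collect closed" and \<Omega>=UNIV and A="\<lambda>_. UNIV"])
      show "Int_stable (Collect closed :: 'a set set)" by (auto simp: Int_stable_def)
      show "emeasure (?R M) C = emeasure (?R N) C" if "C \<in> Collect closed" for C
        using that rect[OF \<Gamma>, of C] by (simp add: R finite_measure.emeasure_eq_measure[OF FM(1)] finite_measure.emeasure_eq_measure[OF FM(2)])
      show "emeasure (?R M) UNIV \<noteq> \<infinity>"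
        by (subst R) (use finite_measure.emeasure_finite[OF FM(1)] in auto)
      show "sets (?R M) = sigma_sets UNIV (Collect closed)" "sets (?R N) = sigma_sets UNIV (Collect closed)"
        by (auto simp: borel_eq_closed)
    qed auto
    moreover have "B \<in> sets borel" "B \<inter> A = B" using B A by (auto simp: sets_restrict_space)
    ultimately show "emeasure M (\<Gamma> \<times> B) = emeasure N (\<Gamma> \<times> B)"
      using R[of M B] R[of N B] by simp
  qed
qed

context coded_tree
begin

lemma integral_word:
  assumes \<xi>: "\<xi> \<in> \<kappa> \<rightarrow>\<^sub>M X" and w: "w \<in> \<kappa> \<rightarrow>\<^sub>M count_space UNIV"
    and eq: "\<And>\<Gamma>. \<Gamma> \<in> sets X \<Longrightarrow> emeasure \<kappa> {z \<in> space \<kappa>. \<xi> z \<in> \<Gamma> \<and> w z = c} = emeasure (\<nu> c) \<Gamma>"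
    and h: "h \<in> borel_measurable X"
  shows "(\<integral>z. indicator {z. w z = c} z * h (\<xi> z) \<partial>\<kappa>) = (\<integral>x. h x \<partial>\<nu> c :: real)"
proof -
  note [measurable] = \<xi> w h
  let ?S = "{z. w z = c}"
  have S [measurable]: "(\<lambda>z. indicator ?S z :: real) \<in> borel_measurable \<kappa>"
    unfolding indicator_def by measurable
  have S' [measurable]: "(\<lambda>z. ennreal (indicator ?S z)) \<in> borel_measurable \<kappa>" by measurable
  have "\<nu> c = distr (density \<kappa> (\<lambda>z. ennreal (indicator ?S z))) X \<xi>"
  proof (rule measure_eqI)
    fix \<Gamma> assume "\<Gamma> \<in> sets (\<nu> c)"
    then have \<Gamma>[measurable]: "\<Gamma> \<in> sets X" by (simp add: sets_tree)
    have "emeasure (distr (density \<kappa> (\<lambda>z. ennreal (indicator ?S z))) X \<xi>) \<Gamma>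
      = (\<integral>\<^sup>+z. ennreal (indicator ?S z) * indicator (\<xi> -` \<Gamma> \<inter> space \<kappa>) z \<partial>\<kappa>)"
      by (simp add: emeasure_distr emeasure_density)
    also have "\<dots> = (\<integral>\<^sup>+z. indicator {z \<in> space \<kappa>. \<xi> z \<in> \<Gamma> \<and> w z = c} z \<partial>\<kappa>)"
      by (intro nn_integral_cong) (auto simp: indicator_def)
    also have "\<dots> = emeasure \<kappa> {z \<in> space \<kappa>. \<xi> z \<in> \<Gamma> \<and> w z = c}"
      by (rule nn_integral_indicator) measurable
    finally show "emeasure (\<nu> c) \<Gamma> = emeasure (distr (density \<kappa> (\<lambda>z. ennreal (indicator ?S z))) X \<xi>) \<Gamma>"
      by (simp add: eq[OF \<Gamma>])
  qed (simp add: sets_tree)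
  then have "(\<integral>x. h x \<partial>\<nu> c) = (\<integral>z. h (\<xi> z) \<partial>density \<kappa> (\<lambda>z. ennreal (indicator ?S z)))"
    by (simp add: integral_distr)
  also have "\<dots> = (\<integral>z. indicator ?S z *\<^sub>R h (\<xi> z) \<partial>\<kappa>)"
    by (rule integral_density) auto
  finally show ?thesis by simp
qed

text \<open>The estimate depends on the tree of measures only, so it applies both to a measure and to
  the measure resampled from its tree: the integrals of a Caratheodory function agree in the limit.\<close>

lemma integral_approx:
  assumes fin: "finite_measure \<kappa>" and \<xi>: "\<xi> \<in> \<kappa> \<rightarrow>\<^sub>M X" and w: "\<And>n. w n \<in> \<kappa> \<rightarrow>\<^sub>M count_space UNIV"
    and y: "y \<in> \<kappa> \<rightarrow>\<^sub>M actM A"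
    and eq: "\<And>c \<Gamma>. \<Gamma> \<in> sets X \<Longrightarrow> emeasure \<kappa> {z \<in> space \<kappa>. \<xi> z \<in> \<Gamma> \<and> w (length c) z = c} = emeasure (\<nu> c) \<Gamma>"
    and follow: "AE z in \<kappa>. follows (\<lambda>n. w n z) (y z)"
    and f: "bounded_caratheodory X A f"
  shows "\<bar>(\<integral>z. f (\<xi> z, y z) \<partial>\<kappa>) - (\<Sum>c | length c = n. \<integral>x. f (x, rep c) \<partial>\<nu> c)\<bar> \<le> (\<integral>x. osc f n x \<partial>\<nu> [])"
proof -
  interpret finite_measure \<kappa> by (rule fin)
  note [measurable] = \<xi> w y caratheodory_measurable[OF f]
  have fr [measurable]: "(\<lambda>x. f (x, rep c)) \<in> borel_measurable X" for c
    using f rep_in by (simp add: bounded_caratheodory_def)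
  obtain B where B: "\<And>x a. x \<in> space X \<Longrightarrow> a \<in> A \<Longrightarrow> \<bar>f (x, a)\<bar> \<le> B"
    using caratheodory_bound[OF f] by blast
  have \<xi>_sp: "\<xi> z \<in> space X" if "z \<in> space \<kappa>" for z using \<xi> that by (rule measurable_space)
  have y_sp: "y z \<in> A" if "z \<in> space \<kappa>" for z using measurable_space[OF y that] by simp
  have [measurable]: "(\<lambda>z. f (\<xi> z, y z)) \<in> borel_measurable \<kappa>" by measurable
  have frw [measurable]: "(\<lambda>z. f (\<xi> z, rep (w n z))) \<in> borel_measurable \<kappa>"
    by (rule measurable_word[where h="\<lambda>c x. f (x, rep c)", OF w \<xi> fr])
  have osc_m [measurable]: "osc f n \<in> borel_measurable X" by (rule osc_measurable[OF f])
  have i1: "integrable \<kappa> (\<lambda>z. f (\<xi> z, y z))"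
    by (rule integrable_const_bound[where B=B]) (auto intro!: AE_I2 B \<xi>_sp y_sp)
  have i2: "integrable \<kappa> (\<lambda>z. f (\<xi> z, rep (w n z)))"
    by (rule integrable_const_bound[where B=B]) (auto intro!: AE_I2 B \<xi>_sp rep_in)
  have i3: "integrable \<kappa> (\<lambda>z. osc f n (\<xi> z))"
    by (rule integrable_const_bound[where B="2 * B"])
      (auto intro!: AE_I2 osc_le[OF f B] simp: abs_of_nonneg[OF osc_nonneg[OF f]] \<xi>_sp)
  have fin_words: "finite {c::bool list. length c = n}"
    using finite_lists_length_eq[of "UNIV::bool set" n] by simp
  have len: "AE z in \<kappa>. length (w n z) = n" for n
    using follow by eventually_elim (rule followsD(1))
  have "(\<integral>z. f (\<xi> z, rep (w n z)) \<partial>\<kappa>) =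
      (\<integral>z. (\<Sum>c | length c = n. indicator {z. w n z = c} z * f (\<xi> z, rep c)) \<partial>\<kappa>)"
  proof (rule integral_cong_AE)
    show "AE z in \<kappa>. f (\<xi> z, rep (w n z)) = (\<Sum>c | length c = n. indicator {z. w n z = c} z * f (\<xi> z, rep c))"
      using len[of n]
    proof eventually_elim
      case (elim z)
      have "(\<Sum>c | length c = n. indicator {z. w n z = c} z * f (\<xi> z, rep c))
          = (\<Sum>c | length c = n. if w n z = c then f (\<xi> z, rep c) else 0)"
        by (intro sum.cong) (auto simp: indicator_def)
      then show ?case using elim fin_words by simp
    qed
  qed (auto simp: indicator_def intro!: borel_measurable_sum)
  also have "\<dots> = (\<Sum>c | length c = n. \<integral>z. indicator {z. w n z = c} z * f (\<xi> z, rep c) \<partial>\<kappa>)"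
  proof (rule Bochner_Integration.integral_sum)
    fix c
    show "integrable \<kappa> (\<lambda>z. indicator {z. w n z = c} z * f (\<xi> z, rep c))"
    proof (rule integrable_const_bound[where B=B])
      show "AE z in \<kappa>. norm (indicator {z. w n z = c} z * f (\<xi> z, rep c)) \<le> B"
      proof (rule AE_I2)
        fix z assume "z \<in> space \<kappa>"
        then have "\<bar>f (\<xi> z, rep c)\<bar> \<le> B" by (intro B \<xi>_sp rep_in)
        then show "norm (indicator {z. w n z = c} z * f (\<xi> z, rep c)) \<le> B" by (auto simp: indicator_def)
      qed
      show "(\<lambda>z. indicator {z. w n z = c} z * f (\<xi> z, rep c)) \<in> borel_measurable \<kappa>"
        unfolding indicator_def by measurable
    qed
  qed
  also have "\<dots> = (\<Sum>c | length c = n. \<integral>x. f (x, rep c) \<partial>\<nu> c)"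
    by (intro sum.cong refl integral_word[OF \<xi> w]) (use eq in auto)
  finally have E: "(\<integral>z. f (\<xi> z, rep (w n z)) \<partial>\<kappa>) = (\<Sum>c | length c = n. \<integral>x. f (x, rep c) \<partial>\<nu> c)" .
  have "\<bar>(\<integral>z. f (\<xi> z, y z) \<partial>\<kappa>) - (\<integral>z. f (\<xi> z, rep (w n z)) \<partial>\<kappa>)\<bar>
      = \<bar>\<integral>z. f (\<xi> z, y z) - f (\<xi> z, rep (w n z)) \<partial>\<kappa>\<bar>"
    using i1 i2 by simp
  also have "\<dots> \<le> (\<integral>z. \<bar>f (\<xi> z, y z) - f (\<xi> z, rep (w n z))\<bar> \<partial>\<kappa>)"
    by (rule integral_abs_bound)
  also have "\<dots> \<le> (\<integral>z. osc f n (\<xi> z) \<partial>\<kappa>)"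
  proof (rule integral_mono_AE)
    show "AE z in \<kappa>. \<bar>f (\<xi> z, y z) - f (\<xi> z, rep (w n z))\<bar> \<le> osc f n (\<xi> z)"
      using follow AE_space
    proof eventually_elim
      case (elim z)
      show ?case by (rule osc_follows[OF f \<xi>_sp[OF elim(2)] elim(1)])
    qed
  qed (use i1 i2 i3 in auto)
  also have "\<dots> = (\<integral>z. indicator {z. w 0 z = []} z * osc f n (\<xi> z) \<partial>\<kappa>)"
  proof (rule integral_cong_AE)
    show "AE z in \<kappa>. osc f n (\<xi> z) = indicator {z. w 0 z = []} z * osc f n (\<xi> z)"
      using len[of 0] by eventually_elim (simp add: indicator_def)
    show "(\<lambda>z. indicator {z. w 0 z = []} z * osc f n (\<xi> z)) \<in> borel_measurable \<kappa>"
      unfolding indicator_def by measurable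
  qed measurable
  also have "\<dots> = (\<integral>x. osc f n x \<partial>\<nu> [])"
    by (rule integral_word[OF \<xi> w]) (use eq[of _ "[]"] in auto)
  finally show ?thesis by (simp add: E)
qed

definition sampled :: "('x \<times> 'a) measure" where
  "sampled = distr (\<nu> [] \<Otimes>\<^sub>M coins) (X \<Otimes>\<^sub>M actM A) (\<lambda>z. (fst z, sel (fst z) (snd z)))"

lemma sel_measurable' [measurable]: "(\<lambda>z. sel (fst z) (snd z)) \<in> \<nu> [] \<Otimes>\<^sub>M coins \<rightarrow>\<^sub>M actM A"
  using sel_measurable by (simp cong: measurable_cong_sets add: sets_pair_measure_cong[OF sets_tree refl])

lemma finite_coins: "finite_measure (\<nu> [] \<Otimes>\<^sub>M coins)"
proof -
  interpret C: prob_space coins by (rule prob_space_coins)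
  interpret N: finite_measure "\<nu> []" by (rule finite_tree)
  show ?thesis
  proof (rule finite_measureI)
    have "emeasure (\<nu> [] \<Otimes>\<^sub>M coins) (space (\<nu> [] \<Otimes>\<^sub>M coins)) = emeasure (\<nu> []) (space (\<nu> [])) * emeasure coins (space coins)"
      unfolding space_pair_measure by (rule C.emeasure_pair_measure_Times) (rule sets.top)+
    then show "emeasure (\<nu> [] \<Otimes>\<^sub>M coins) (space (\<nu> [] \<Otimes>\<^sub>M coins)) \<noteq> \<infinity>"
      using N.emeasure_finite C.emeasure_space_1 by (simp add: ennreal_mult_eq_top_iff del: space_coins)
  qed
qed

lemma sampled_finite: "sampled \<in> finite_measures (X \<Otimes>\<^sub>M actM A)"
  unfolding finite_measures_def sampled_def
  by (auto intro!: finite_measure.finite_measure_distr[OF finite_coins])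

lemma sampled_approx:
  assumes f: "bounded_caratheodory X A f"
  shows "\<bar>(\<integral>z. f z \<partial>sampled) - (\<Sum>c | length c = n. \<integral>x. f (x, rep c) \<partial>\<nu> c)\<bar> \<le> (\<integral>x. osc f n x \<partial>\<nu> [])"
proof -
  note [measurable] = caratheodory_measurable[OF f]
  have [measurable]: "fst \<in> \<nu> [] \<Otimes>\<^sub>M coins \<rightarrow>\<^sub>M X" by measurable
  have "(\<integral>z. f z \<partial>sampled) = (\<integral>z. f (fst z, sel (fst z) (snd z)) \<partial>(\<nu> [] \<Otimes>\<^sub>M coins))"
    unfolding sampled_def by (rule integral_distr) measurable
  also have "\<bar>\<dots> - (\<Sum>c | length c = n. \<integral>x. f (x, rep c) \<partial>\<nu> c)\<bar> \<le> (\<integral>x. osc f n x \<partial>\<nu> [])"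
  proof (rule integral_approx[OF finite_coins _ _ sel_measurable' _ _ f])
    show "(\<lambda>z. word split_prob n (fst z) (snd z)) \<in> \<nu> [] \<Otimes>\<^sub>M coins \<rightarrow>\<^sub>M count_space UNIV" for n
      by (rule word_measurable) simp
    show "AE z in \<nu> [] \<Otimes>\<^sub>M coins. follows (\<lambda>n. word split_prob n (fst z) (snd z)) (sel (fst z) (snd z))"
      using AE_good by eventually_elim (rule sel_follows)
  qed (use emeasure_word_tree in auto)
  finally show ?thesis .
qed

lemma emeasure_sampled:
  assumes \<Gamma>: "\<Gamma> \<in> sets X" and B: "B \<in> sets (actM A)"
  shows "emeasure sampled (\<Gamma> \<times> B) = (\<integral>\<^sup>+x\<in>\<Gamma>. emeasure (distr coins (actM A) (sel x)) B \<partial>\<nu> [])"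
proof -
  interpret prob_space coins by (rule prob_space_coins)
  note [measurable] = \<Gamma> B
  let ?S = "(\<lambda>z. (fst z, sel (fst z) (snd z))) -` (\<Gamma> \<times> B) \<inter> space (\<nu> [] \<Otimes>\<^sub>M coins)"
  have "emeasure sampled (\<Gamma> \<times> B) = emeasure (\<nu> [] \<Otimes>\<^sub>M coins) ?S"
    unfolding sampled_def by (rule emeasure_distr) measurable
  also have "\<dots> = (\<integral>\<^sup>+x. emeasure coins (Pair x -` ?S) \<partial>\<nu> [])"
    by (rule emeasure_pair_measure_alt) measurable
  also have "\<dots> = (\<integral>\<^sup>+x\<in>\<Gamma>. emeasure (distr coins (actM A) (sel x)) B \<partial>\<nu> [])"
  proof (rule nn_integral_cong)
    fix x assume x: "x \<in> space (\<nu> [])"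
    then have x': "x \<in> space X" by (simp add: space_tree)
    have "sel x \<in> coins \<rightarrow>\<^sub>M actM A"
      using measurable_compose[OF measurable_Pair1'[OF x'] sel_measurable] by simp
    then have "emeasure (distr coins (actM A) (sel x)) B = emeasure coins (sel x -` B)"
      by (simp add: emeasure_distr)
    moreover have "Pair x -` ?S = (if x \<in> \<Gamma> then sel x -` B else {})"
      using x by (auto simp: space_pair_measure)
    ultimately show "emeasure coins (Pair x -` ?S) = emeasure (distr coins (actM A) (sel x)) B * indicator \<Gamma> x"
      by auto
  qed
  finally show ?thesis .
qed

lemma sampled_kernel: "(\<lambda>x. distr coins (actM A) (sel x)) \<in> X \<rightarrow>\<^sub>M prob_algebra (actM A)"
proof (rule measurable_prob_algebraI)
  interpret prob_space coins by (rule prob_space_coins)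
  show "prob_space (distr coins (actM A) (sel x))" if x: "x \<in> space X" for x
    by (rule prob_space_distr) (use measurable_compose[OF measurable_Pair1'[OF x] sel_measurable] in simp)
  show "(\<lambda>x. distr coins (actM A) (sel x)) \<in> X \<rightarrow>\<^sub>M subprob_algebra (actM A)"
  proof (rule measurable_distr2)
    show "(\<lambda>(x, y). sel x y) \<in> X \<Otimes>\<^sub>M coins \<rightarrow>\<^sub>M actM A"
      using sel_measurable by (simp add: case_prod_beta')
    have "coins \<in> space (subprob_algebra coins)"
      by (simp add: space_subprob_algebra prob_space_imp_subprob_space[OF prob_space_coins])
    then show "(\<lambda>x. coins) \<in> X \<rightarrow>\<^sub>M subprob_algebra coins" by simp
  qed
qed

end

section \<open>Compactness in the ws-topology and disintegration\<close>

lemma continuous_map_uniform_approx: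
  fixes f :: "'b \<Rightarrow> real"
  assumes "\<And>e. e > 0 \<Longrightarrow> \<exists>g. continuous_map T euclideanreal g \<and> (\<forall>x\<in>topspace T. \<bar>g x - f x\<bar> \<le> e)"
  shows "continuous_map T euclideanreal f"
proof -
  have "\<exists>g. continuous_map T euclideanreal g \<and> (\<forall>x\<in>topspace T. \<bar>g x - f x\<bar> \<le> 1 / real (Suc n))" for n
    using assms[of "1 / real (Suc n)"] by simp
  then obtain g where g: "\<And>n. continuous_map T euclideanreal (g n)"
    "\<And>n x. x \<in> topspace T \<Longrightarrow> \<bar>g n x - f x\<bar> \<le> 1 / real (Suc n)" by metis
  have "continuous_map T Met_TC.mtopology f"
  proof (rule Met_TC.continuous_map_uniform_limit_alt[where f=g and F=sequentially])
    fix e :: real assume "0 < e"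
    then obtain N where N: "1 / real (Suc N) < e" using nat_approx_posE by blast
    have "\<forall>x\<in>topspace T. dist (g n x) (f x) < e" if n: "n \<ge> N" for n
    proof
      fix x assume "x \<in> topspace T"
      then have "\<bar>g n x - f x\<bar> \<le> 1 / real (Suc n)" by (rule g)
      also have "\<dots> \<le> 1 / real (Suc N)" using n by (simp add: frac_le)
      finally show "dist (g n x) (f x) < e" using N by (simp add: dist_real_def)
    qed
    then show "\<forall>\<^sub>F n in sequentially. \<forall>x\<in>topspace T. dist (g n x) (f x) < e"
      by (auto simp: eventually_sequentially)
  qed (use g(1) in auto)
  then show ?thesis by simp
qed

text \<open>For a set function that dominates a family of measures this is uniform countable additivity.\<close>

definition vanishing :: "'x measure \<Rightarrow> ('x set \<Rightarrow> real) \<Rightarrow> bool" where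
  "vanishing X \<beta> \<longleftrightarrow> (\<forall>\<Gamma>::nat \<Rightarrow> 'x set. range \<Gamma> \<subseteq> sets X \<and> decseq \<Gamma> \<and> (\<Inter>n. \<Gamma> n) = {} \<longrightarrow> (\<lambda>n. \<beta> (\<Gamma> n)) \<longlonglongrightarrow> 0)"

lemma vanishing_measure:
  assumes "finite_measure \<nu>" "sets \<nu> = sets X"
  shows "vanishing X (measure \<nu>)"
  unfolding vanishing_def
proof (intro allI impI)
  fix \<Gamma> :: "nat \<Rightarrow> 'a set" assume "range \<Gamma> \<subseteq> sets X \<and> decseq \<Gamma> \<and> (\<Inter>n. \<Gamma> n) = {}"
  then show "(\<lambda>n. measure \<nu> (\<Gamma> n)) \<longlonglongrightarrow> 0"
    using finite_measure.finite_Lim_measure_decseq[OF assms(1), of \<Gamma>] assms(2) by simp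
qed

definition dominated :: "'x measure \<Rightarrow> ('x set \<Rightarrow> real) \<Rightarrow> 'x measure \<Rightarrow> bool" where
  "dominated X \<beta> \<nu> \<longleftrightarrow> finite_measure \<nu> \<and> sets \<nu> = sets X \<and> (\<forall>\<Gamma>\<in>sets X. measure \<nu> \<Gamma> \<le> \<beta> \<Gamma>)"

text \<open>Up to a small constant the functions are supported, from some index on, by sets that decrease to the
  empty set.\<close>

lemma vanishing_integral:
  assumes van: "vanishing X \<beta>" and m: "\<And>n. \<omega> n \<in> borel_measurable X"
    and nn: "\<And>n x. x \<in> space X \<Longrightarrow> 0 \<le> \<omega> n x" and B: "\<And>n x. x \<in> space X \<Longrightarrow> \<omega> n x \<le> B"
    and lim: "\<And>x. x \<in> space X \<Longrightarrow> (\<lambda>n. \<omega> n x) \<longlonglongrightarrow> 0" and e: "0 < (e::real)"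
  obtains N where "\<And>n \<nu>. n \<ge> N \<Longrightarrow> dominated X \<beta> \<nu> \<Longrightarrow> (\<integral>x. \<omega> n x \<partial>\<nu>) \<le> e"
proof -
  define b where "b = max 0 (\<beta> (space X))"
  define d where "d = e / (2 * (b + 1))"
  define C where "C = max 0 B"
  have d: "d > 0" "d * b \<le> e / 2" using e by (auto simp: d_def b_def field_simps)
  define \<Gamma> where "\<Gamma> k = {x \<in> space X. \<exists>n\<ge>k. \<omega> n x > d}" for k :: nat
  have \<Gamma>_sets [measurable]: "\<Gamma> k \<in> sets X" for k
  proof -
    note [measurable] = m
    show ?thesis unfolding \<Gamma>_def by measurable
  qed
  have "(\<Inter>k. \<Gamma> k) = {}"
  proof (rule ccontr)
    assume "(\<Inter>k. \<Gamma> k) \<noteq> {}"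
    then obtain x where x: "\<And>k. x \<in> \<Gamma> k" by blast
    then have xs: "x \<in> space X" by (auto simp: \<Gamma>_def)
    have "\<forall>\<^sub>F n in sequentially. \<omega> n x < d" using order_tendstoD(2)[OF lim[OF xs] d(1)] .
    then obtain k where "\<forall>n\<ge>k. \<omega> n x < d" by (auto simp: eventually_sequentially)
    then show False using x[of k] by (auto simp: \<Gamma>_def dest: less_asym)
  qed
  moreover have "decseq \<Gamma>" unfolding decseq_def \<Gamma>_def by (auto intro: order_trans)
  ultimately have "(\<lambda>k. \<beta> (\<Gamma> k)) \<longlonglongrightarrow> 0" using van \<Gamma>_sets unfolding vanishing_def by blast
  moreover have "0 < e / (2 * (C + 1))" using e by (auto simp: C_def)
  ultimately have "\<forall>\<^sub>F k in sequentially. \<beta> (\<Gamma> k) < e / (2 * (C + 1))" by (rule order_tendstoD(2))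
  then obtain N where N: "\<beta> (\<Gamma> N) < e / (2 * (C + 1))" by (auto simp: eventually_sequentially)
  show ?thesis
  proof (rule that[of N])
    fix n \<nu> assume n: "n \<ge> N" and "dominated X \<beta> \<nu>"
    then have fin: "finite_measure \<nu>" and s [measurable_cong]: "sets \<nu> = sets X"
      and le: "\<And>\<Gamma>. \<Gamma> \<in> sets X \<Longrightarrow> measure \<nu> \<Gamma> \<le> \<beta> \<Gamma>" by (auto simp: dominated_def)
    interpret finite_measure \<nu> by (rule fin)
    have sp: "space \<nu> = space X" using sets_eq_imp_space_eq[OF s] .
    note [measurable] = m
    have G: "\<Gamma> N \<in> sets \<nu>" by (simp add: s)
    have iI: "integrable \<nu> (\<lambda>x. C * indicator (\<Gamma> N) x)"
      by (intro integrable_mult_right integrable_real_indicator[OF G]) (simp add: emeasure_eq_measure)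
    have pt: "\<omega> n x \<le> d + C * indicator (\<Gamma> N) x" if x: "x \<in> space X" for x
    proof (cases "x \<in> \<Gamma> N")
      case True
      then show ?thesis using B[OF x, of n] d by (simp add: C_def)
    next
      case False
      then have "\<omega> n x \<le> d" using x n by (auto simp: \<Gamma>_def not_less)
      then show ?thesis using False by simp
    qed
    have "(\<integral>x. \<omega> n x \<partial>\<nu>) \<le> (\<integral>x. d + C * indicator (\<Gamma> N) x \<partial>\<nu>)"
    proof (rule integral_mono_AE)
      show "integrable \<nu> (\<omega> n)"
        by (rule integrable_const_bound[where B=B]) (auto intro!: AE_I2 simp: sp nn B)
      show "AE x in \<nu>. \<omega> n x \<le> d + C * indicator (\<Gamma> N) x" by (rule AE_I2) (simp add: pt sp)
    qed (rule Bochner_Integration.integrable_add[OF integrable_const iI])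
    also have "\<dots> = d * measure \<nu> (space X) + C * measure \<nu> (\<Gamma> N)"
      using G by (subst Bochner_Integration.integral_add[OF integrable_const iI]) (simp add: sp mult.commute)
    also have "\<dots> \<le> d * b + C * \<beta> (\<Gamma> N)"
      using d le[OF sets.top] le[OF \<Gamma>_sets[of N]] by (intro add_mono mult_left_mono) (auto simp: b_def C_def)
    also have "\<dots> \<le> e / 2 + C * (e / (2 * (C + 1)))"
      using d N by (intro add_mono mult_left_mono) (auto simp: C_def)
    also have "\<dots> \<le> e / 2 + e / 2"
      using e by (intro add_left_mono) (auto simp: C_def field_simps)
    finally show "(\<integral>x. \<omega> n x \<partial>\<nu>) \<le> e" by simp
  qed
qed

lemma closedin_Collect_all:
  "(\<And>i. i \<in> I \<Longrightarrow> closedin T {x \<in> topspace T. P i x}) \<Longrightarrow> closedin T {x \<in> topspace T. \<forall>i\<in>I. P i x}"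
proof (cases "I = {}")
  case False
  assume "\<And>i. i \<in> I \<Longrightarrow> closedin T {x \<in> topspace T. P i x}"
  then have "closedin T (\<Inter>i\<in>I. {x \<in> topspace T. P i x})" using False by (intro closedin_Inter) auto
  also have "(\<Inter>i\<in>I. {x \<in> topspace T. P i x}) = {x \<in> topspace T. \<forall>i\<in>I. P i x}" using False by auto
  finally show ?thesis .
qed simp

lemma closedin_Collect_imp:
  "(Q \<Longrightarrow> closedin T {x \<in> topspace T. P x}) \<Longrightarrow> closedin T {x \<in> topspace T. Q \<longrightarrow> P x}"
  by (cases Q) auto

lemma closedin_Collect_conj:
  "closedin T {x \<in> topspace T. P x} \<Longrightarrow> closedin T {x \<in> topspace T. Q x} \<Longrightarrow> closedin T {x \<in> topspace T. P x \<and> Q x}"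
  using closedin_Int[of T "{x \<in> topspace T. P x}" "{x \<in> topspace T. Q x}"]
  by (simp add: Collect_conj_eq[symmetric] conj_ac cong: conj_cong)

lemma closedin_Collect_real:
  assumes "continuous_map T euclideanreal g"
  shows "closedin T {x \<in> topspace T. g x \<le> r}" "closedin T {x \<in> topspace T. g x = r}" "closedin T {x \<in> topspace T. r \<le> g x}"
  using closedin_continuous_map_preimage[OF assms, of "{..r}"] closedin_continuous_map_preimage[OF assms, of "{r}"]
    closedin_continuous_map_preimage[OF assms, of "{r..}"] by auto

locale compact_ws = compact_coding A U for A :: "'a::polish_space set" and U +
  fixes X :: "'x measure" and \<beta> :: "'x set \<Rightarrow> real"
  assumes van: "vanishing X \<beta>"
begin

definition masses :: "('x set \<times> bool list \<Rightarrow> real) topology" where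
  "masses = product_topology (\<lambda>_. top_of_set {0..max 0 (\<beta> (space X))}) (sets X \<times> UNIV)"

lemma compact_masses: "compact_space masses"
  unfolding masses_def by (rule compact_space_product_topology[THEN iffD2]) (auto simp: compact_space_subtopology)

text \<open>Tables of values on the products of measurable sets with cells.  Each condition constrains finitely many
  entries of the table, so it is closed in the product topology; countable additivity is not of this kind
  and comes from the bound \<open>\<beta>\<close>.\<close>

definition admissible :: "('x set \<times> bool list \<Rightarrow> real) set" where
  "admissible = {m \<in> topspace masses.
     (\<forall>\<Gamma>\<in>sets X. m (\<Gamma>, []) \<le> \<beta> \<Gamma>) \<and>
     (\<forall>\<Gamma>\<in>sets X. \<forall>\<Gamma>'\<in>sets X. \<forall>c. \<Gamma> \<inter> \<Gamma>' = {} \<longrightarrow> m (\<Gamma> \<union> \<Gamma>', c) - m (\<Gamma>, c) - m (\<Gamma>', c) = 0) \<and>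
     (\<forall>\<Gamma>\<in>sets X. \<forall>c. m (\<Gamma>, c) - m (\<Gamma>, c @ [True]) - m (\<Gamma>, c @ [False]) = 0) \<and>
     (\<forall>c. cell c = {} \<longrightarrow> m (space X, c) = 0)}"

lemma masses_coord: "\<Gamma> \<in> sets X \<Longrightarrow> continuous_map masses euclideanreal (\<lambda>m. m (\<Gamma>, c))"
  unfolding masses_def
  using continuous_map_product_projection[of "(\<Gamma>, c)" "sets X \<times> UNIV" "\<lambda>_. top_of_set {0..max 0 (\<beta> (space X))}"]
  by (auto simp: continuous_map_in_subtopology)

lemma closedin_admissible: "closedin masses admissible"
proof -
  have "closedin masses {m \<in> topspace masses. (\<forall>\<Gamma>\<in>sets X. m (\<Gamma>, []) \<le> \<beta> \<Gamma>)}"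
    by (intro closedin_Collect_all closedin_Collect_real masses_coord)
  moreover have "closedin masses {m \<in> topspace masses. (\<forall>\<Gamma>\<in>sets X. \<forall>\<Gamma>'\<in>sets X. \<forall>c\<in>UNIV. \<Gamma> \<inter> \<Gamma>' = {} \<longrightarrow> m (\<Gamma> \<union> \<Gamma>', c) - m (\<Gamma>, c) - m (\<Gamma>', c) = 0)}"
    by (intro closedin_Collect_all closedin_Collect_imp closedin_Collect_real continuous_map_diff masses_coord) auto
  moreover have "closedin masses {m \<in> topspace masses. (\<forall>\<Gamma>\<in>sets X. \<forall>c\<in>UNIV. m (\<Gamma>, c) - m (\<Gamma>, c @ [True]) - m (\<Gamma>, c @ [False]) = 0)}"
    by (intro closedin_Collect_all closedin_Collect_imp closedin_Collect_real continuous_map_diff masses_coord) auto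
  moreover have "closedin masses {m \<in> topspace masses. (\<forall>c\<in>UNIV. cell c = {} \<longrightarrow> m (space X, c) = 0)}"
    by (intro closedin_Collect_all closedin_Collect_imp closedin_Collect_real continuous_map_diff masses_coord) auto
  ultimately show ?thesis
    unfolding admissible_def by (intro closedin_Collect_conj) simp_all
qed

definition tree :: "('x set \<times> bool list \<Rightarrow> real) \<Rightarrow> bool list \<Rightarrow> 'x measure" where
  "tree m c = measure_of (space X) (sets X) (\<lambda>\<Gamma>. ennreal (m (\<Gamma>, c)))"

lemma sets_tree_of: "sets (tree m c) = sets X"
  unfolding tree_def by simp

lemma space_tree_of: "space (tree m c) = space X"
  unfolding tree_def by simp

context
  fixes m assumes m: "m \<in> admissible"
begin

lemma mass_nonneg: "\<Gamma> \<in> sets X \<Longrightarrow> 0 \<le> m (\<Gamma>, c)"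
  using m by (auto simp: admissible_def masses_def PiE_iff)

lemma mass_Un:
  assumes "\<Gamma> \<in> sets X" "\<Gamma>' \<in> sets X" "\<Gamma> \<inter> \<Gamma>' = {}"
  shows "m (\<Gamma> \<union> \<Gamma>', c) = m (\<Gamma>, c) + m (\<Gamma>', c)"
proof -
  have "m (\<Gamma> \<union> \<Gamma>', c) - m (\<Gamma>, c) - m (\<Gamma>', c) = 0"
    using m assms unfolding admissible_def by blast
  then show ?thesis by linarith
qed

lemma mass_split:
  assumes "\<Gamma> \<in> sets X"
  shows "m (\<Gamma>, c) = m (\<Gamma>, c @ [True]) + m (\<Gamma>, c @ [False])"
proof -
  have "m (\<Gamma>, c) - m (\<Gamma>, c @ [True]) - m (\<Gamma>, c @ [False]) = 0"
    using m assms unfolding admissible_def by blast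
  then show ?thesis by linarith
qed

lemma mass_le: "\<Gamma> \<in> sets X \<Longrightarrow> m (\<Gamma>, c) \<le> \<beta> \<Gamma>"
proof (induction c rule: rev_induct)
  case Nil
  then show ?case using m by (auto simp: admissible_def)
next
  case (snoc b c)
  have "m (\<Gamma>, c @ [b]) \<le> m (\<Gamma>, c)"
    using mass_split[OF snoc.prems, of c] mass_nonneg[OF snoc.prems] by (cases b) auto
  then show ?case using snoc by linarith
qed

text \<open>An entry bounded by \<open>\<beta>\<close> is continuous at the empty set, so additivity improves to countable additivity.\<close>

lemma emeasure_tree: "\<Gamma> \<in> sets X \<Longrightarrow> emeasure (tree m c) \<Gamma> = ennreal (m (\<Gamma>, c))"
  unfolding tree_def
proof (rule emeasure_measure_of_sigma[OF sets.sigma_algebra_axioms])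
  have e0: "m ({}, c) = 0" using mass_Un[of "{}" "{}" c] by simp
  then show pos: "positive (sets X) (\<lambda>\<Gamma>. ennreal (m (\<Gamma>, c)))" by (simp add: positive_def)
  show "countably_additive (sets X) (\<lambda>\<Gamma>. ennreal (m (\<Gamma>, c)))"
  proof (rule sets.empty_continuous_imp_countably_additive[OF pos])
    show "additive (sets X) (\<lambda>\<Gamma>. ennreal (m (\<Gamma>, c)))"
      by (auto simp: additive_def mass_Un mass_nonneg)
    fix \<Gamma> :: "nat \<Rightarrow> 'x set" assume G: "range \<Gamma> \<subseteq> sets X" "decseq \<Gamma>" "(\<Inter>i. \<Gamma> i) = {}"
    then have "(\<lambda>i. \<beta> (\<Gamma> i)) \<longlonglongrightarrow> 0" using van by (auto simp: vanishing_def)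
    then have "(\<lambda>i. m (\<Gamma> i, c)) \<longlonglongrightarrow> 0"
      by (rule tendsto_sandwich[OF _ _ tendsto_const, rotated 2])
        (use G in \<open>auto intro!: always_eventually mass_nonneg mass_le\<close>)
    then show "(\<lambda>i. ennreal (m (\<Gamma> i, c))) \<longlonglongrightarrow> 0"
      using tendsto_ennrealI by fastforce
  qed auto
qed

lemma measure_tree_of: "\<Gamma> \<in> sets X \<Longrightarrow> measure (tree m c) \<Gamma> = m (\<Gamma>, c)"
  by (simp add: measure_def emeasure_tree mass_nonneg)

lemma finite_tree_of: "finite_measure (tree m c)"
  by (rule finite_measureI) (simp add: space_tree_of emeasure_tree)

lemma coded_tree_of: "coded_tree A U X (tree m)"
proof (intro coded_tree.intro measure_tree.intro coded_tree_axioms.intro compact_coding_axioms)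
  show "emeasure (tree m c) \<Gamma> = emeasure (tree m (c @ [True])) \<Gamma> + emeasure (tree m (c @ [False])) \<Gamma>"
    if "\<Gamma> \<in> sets X" for c \<Gamma>
    using that mass_split[OF that, of c] by (simp add: emeasure_tree mass_nonneg)
  show "emeasure (tree m c) (space X) = 0" if "cell c = {}" for c
    using m that by (simp add: emeasure_tree admissible_def)
  show "sets (tree m c) = sets X" "finite_measure (tree m c)" for c
    by (rule sets_tree_of finite_tree_of)+
qed

lemma dominated_tree: "dominated X \<beta> (tree m c)"
  by (simp add: dominated_def finite_tree_of sets_tree_of measure_tree_of mass_le)

end

text \<open>A step function is integrated against the table by a finite sum of its entries, and bounded functions are
  uniform limits of step functions.\<close>

lemma continuous_tree_integral:
  assumes h: "h \<in> borel_measurable X" and B: "\<And>x. x \<in> space X \<Longrightarrow> \<bar>h x\<bar> \<le> B"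
  shows "continuous_map (subtopology masses admissible) euclideanreal (\<lambda>m. \<integral>x. h x \<partial>tree m c)"
proof (rule continuous_map_uniform_approx)
  fix e :: real assume e: "e > 0"
  define b where "b = max 0 (\<beta> (space X))"
  \<comment> \<open>The mesh of the step functions; adding \<open>1\<close> avoids a division by zero.\<close>
  define d where "d = e / (b + 1)"
  have d: "d > 0" "d * b \<le> e" using e by (auto simp: d_def b_def field_simps)
  define K where "K = {\<lfloor>- B / d\<rfloor>..\<lfloor>B / d\<rfloor>}"
  define L where "L k = {x \<in> space X. \<lfloor>h x / d\<rfloor> = k}" for k :: int
  note [measurable] = h
  have L [measurable]: "L k \<in> sets X" for k unfolding L_def by measurable
  have hK: "\<lfloor>h x / d\<rfloor> \<in> K" if "x \<in> space X" for x
  proof -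
    have "- B / d \<le> h x / d" "h x / d \<le> B / d"
      using B[OF that] d by (intro divide_right_mono; linarith)+
    then show ?thesis unfolding K_def by (simp add: floor_mono)
  qed
  show "\<exists>g. continuous_map (subtopology masses admissible) euclideanreal g \<and>
      (\<forall>m\<in>topspace (subtopology masses admissible). \<bar>g m - (\<integral>x. h x \<partial>tree m c)\<bar> \<le> e)"
  proof (intro exI[of _ "\<lambda>m. \<Sum>k\<in>K. (d * of_int k) * m (L k, c)"] conjI ballI)
    show "continuous_map (subtopology masses admissible) euclideanreal (\<lambda>m. \<Sum>k\<in>K. (d * of_int k) * m (L k, c))"
      by (intro continuous_map_sum continuous_map_real_mult_left continuous_map_from_subtopology masses_coord L) (simp add: K_def)
    fix m assume "m \<in> topspace (subtopology masses admissible)"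
    then have m: "m \<in> admissible" by simp
    interpret finite_measure "tree m c" by (rule finite_tree_of[OF m])
    note [measurable_cong] = sets_tree_of
    have LS: "L k \<in> sets (tree m c)" for k by (simp add: sets_tree_of)
    have s: "d * \<lfloor>h x / d\<rfloor> = (\<Sum>k\<in>K. (d * of_int k) * indicator (L k) x)" if "x \<in> space X" for x
    proof -
      have "(\<Sum>k\<in>K. (d * of_int k) * indicator (L k) x) = (\<Sum>k\<in>K. if \<lfloor>h x / d\<rfloor> = k then d * of_int k else 0)"
        using that by (intro sum.cong) (auto simp: L_def indicator_def)
      then show ?thesis using hK[OF that] by (simp add: K_def)
    qed
    have "(\<integral>x. d * \<lfloor>h x / d\<rfloor> \<partial>tree m c) = (\<integral>x. (\<Sum>k\<in>K. (d * of_int k) * indicator (L k) x) \<partial>tree m c)"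
      by (intro Bochner_Integration.integral_cong) (auto simp: space_tree_of s)
    also have "\<dots> = (\<Sum>k\<in>K. (d * of_int k) * m (L k, c))"
    proof (subst Bochner_Integration.integral_sum)
      show "integrable (tree m c) (\<lambda>x. d * of_int k * indicator (L k) x)" for k
        by (intro integrable_mult_right integrable_real_indicator[OF LS]) (simp add: emeasure_eq_measure)
    qed (use LS in \<open>simp add: measure_tree_of[OF m]\<close>)
    finally have E: "(\<Sum>k\<in>K. (d * of_int k) * m (L k, c)) = (\<integral>x. d * \<lfloor>h x / d\<rfloor> \<partial>tree m c)" ..
    have close: "\<bar>d * \<lfloor>h x / d\<rfloor> - h x\<bar> \<le> d" for x
    proof -
      have "\<lfloor>h x / d\<rfloor> \<le> h x / d" "h x / d \<le> \<lfloor>h x / d\<rfloor> + 1" by linarith+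
      then have "d * \<lfloor>h x / d\<rfloor> \<le> d * (h x / d)" "d * (h x / d) \<le> d * (\<lfloor>h x / d\<rfloor> + 1)"
        using d by (intro mult_left_mono; simp)+
      then have "d * \<lfloor>h x / d\<rfloor> \<le> h x" "h x \<le> d * (\<lfloor>h x / d\<rfloor> + 1)"
        using d by simp_all
      then show ?thesis by (auto simp: algebra_simps abs_le_iff)
    qed
    have ih: "integrable (tree m c) h"
      by (rule integrable_const_bound[where B=B]) (auto intro!: AE_I2 B simp: space_tree_of)
    have ir: "integrable (tree m c) (\<lambda>x. d * \<lfloor>h x / d\<rfloor>)"
    proof (rule integrable_const_bound[where B="B + d"])
      have "\<bar>d * \<lfloor>h x / d\<rfloor>\<bar> \<le> B + d" if "x \<in> space X" for x
        using close[of x] B[OF that] by linarith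
      then show "AE x in tree m c. norm (d * \<lfloor>h x / d\<rfloor>) \<le> B + d" by (auto intro!: AE_I2 simp: space_tree_of)
    qed measurable
    have "\<bar>(\<integral>x. d * \<lfloor>h x / d\<rfloor> \<partial>tree m c) - (\<integral>x. h x \<partial>tree m c)\<bar> = \<bar>\<integral>x. d * \<lfloor>h x / d\<rfloor> - h x \<partial>tree m c\<bar>"
      using ih ir by simp
    also have "\<dots> \<le> (\<integral>x. \<bar>d * \<lfloor>h x / d\<rfloor> - h x\<bar> \<partial>tree m c)" by (rule integral_abs_bound)
    also have "\<dots> \<le> (\<integral>x. d \<partial>tree m c)"
      using ih ir close by (intro integral_mono) auto
    also have "\<dots> = d * m (space X, c)" by (simp add: space_tree_of measure_tree_of[OF m])
    also have "\<dots> \<le> d * b"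
      using d mass_le[OF m sets.top, of c] by (intro mult_left_mono) (auto simp: b_def)
    also have "\<dots> \<le> e" by (rule d)
    finally show "\<bar>(\<Sum>k\<in>K. (d * of_int k) * m (L k, c)) - (\<integral>x. h x \<partial>tree m c)\<bar> \<le> e" by (simp add: E)
  qed
qed

definition realize :: "('x set \<times> bool list \<Rightarrow> real) \<Rightarrow> ('x \<times> 'a) measure" where
  "realize m = coded_tree.sampled A U X (tree m)"

lemma osc_uniform:
  assumes f: "bounded_caratheodory X A f" and e: "0 < (e::real)"
  obtains N where "\<And>n \<nu>. n \<ge> N \<Longrightarrow> dominated X \<beta> \<nu> \<Longrightarrow> (\<integral>x. osc f n x \<partial>\<nu>) \<le> e"
proof -
  obtain B where B: "\<And>x a. x \<in> space X \<Longrightarrow> a \<in> A \<Longrightarrow> \<bar>f (x, a)\<bar> \<le> B"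
    using caratheodory_bound[OF f] by blast
  show ?thesis
    by (rule vanishing_integral[OF van osc_measurable[OF f] osc_nonneg[OF f] osc_le[OF f B] osc_tendsto[OF f] e]) (use that in auto)
qed

text \<open>The finite sums over the words of a given length depend continuously on the table, and the bound \<open>\<beta>\<close>
  makes their error small for all tables at once.\<close>

lemma continuous_realize_integral:
  assumes f: "bounded_caratheodory X A f"
  shows "continuous_map (subtopology masses admissible) euclideanreal (\<lambda>m. \<integral>z. f z \<partial>realize m)"
proof (rule continuous_map_uniform_approx)
  fix e :: real assume e: "e > 0"
  then obtain N where N: "\<And>n \<nu>. n \<ge> N \<Longrightarrow> dominated X \<beta> \<nu> \<Longrightarrow> (\<integral>x. osc f n x \<partial>\<nu>) \<le> e"
    using osc_uniform[OF f] by blast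
  obtain B where B: "\<And>x a. x \<in> space X \<Longrightarrow> a \<in> A \<Longrightarrow> \<bar>f (x, a)\<bar> \<le> B"
    using caratheodory_bound[OF f] by blast
  have fin_words: "finite {c::bool list. length c = N}"
    using finite_lists_length_eq[of "UNIV::bool set" N] by simp
  show "\<exists>g. continuous_map (subtopology masses admissible) euclideanreal g \<and>
      (\<forall>m\<in>topspace (subtopology masses admissible). \<bar>g m - (\<integral>z. f z \<partial>realize m)\<bar> \<le> e)"
  proof (intro exI[of _ "\<lambda>m. \<Sum>c | length c = N. \<integral>x. f (x, rep c) \<partial>tree m c"] conjI ballI)
    show "continuous_map (subtopology masses admissible) euclideanreal (\<lambda>m. \<Sum>c | length c = N. \<integral>x. f (x, rep c) \<partial>tree m c)"
      using f rep_in B by (intro continuous_map_sum continuous_tree_integral[where B=B] fin_words)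
        (auto simp: bounded_caratheodory_def)
    fix m assume "m \<in> topspace (subtopology masses admissible)"
    then have m: "m \<in> admissible" by simp
    interpret T: coded_tree A U X "tree m" by (rule coded_tree_of[OF m])
    show "\<bar>(\<Sum>c | length c = N. \<integral>x. f (x, rep c) \<partial>tree m c) - (\<integral>z. f z \<partial>realize m)\<bar> \<le> e"
      using T.sampled_approx[OF f, of N] N[OF order_refl dominated_tree[OF m, of "[]"]]
      unfolding realize_def by linarith
  qed
qed

definition dominated_measures :: "('x \<times> 'a) measure set" where
  "dominated_measures = {\<mu> \<in> finite_measures (X \<Otimes>\<^sub>M actM A). \<forall>\<Gamma>\<in>sets X. measure \<mu> (\<Gamma> \<times> A) \<le> \<beta> \<Gamma>}"

lemma continuous_realize: "continuous_map (subtopology masses admissible) (ws_topology X A) realize"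
  unfolding ws_topology_def
proof (subst continuous_on_generated_topo_iff, intro conjI allI impI)
  have fm: "realize m \<in> finite_measures (X \<Otimes>\<^sub>M actM A)" if m: "m \<in> admissible" for m
    using coded_tree.sampled_finite[OF coded_tree_of[OF m]] by (simp add: realize_def)
  fix V assume "V \<in> {{\<mu> \<in> finite_measures (X \<Otimes>\<^sub>M actM A). (\<integral>z. f z \<partial>\<mu>) \<in> U} | f U. bounded_caratheodory X A f \<and> open U}"
  then obtain f W where V: "V = {\<mu> \<in> finite_measures (X \<Otimes>\<^sub>M actM A). (\<integral>z. f z \<partial>\<mu>) \<in> W}"
    and f: "bounded_caratheodory X A f" and W: "open W" by auto
  have "realize -` V \<inter> topspace (subtopology masses admissible)
      = {m \<in> topspace (subtopology masses admissible). (\<integral>z. f z \<partial>realize m) \<in> W}"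
    using fm by (auto simp: V)
  also have "openin (subtopology masses admissible) \<dots>"
    by (rule openin_continuous_map_preimage[OF continuous_realize_integral[OF f]]) (simp add: W)
  finally show "openin (subtopology masses admissible) (realize -` V \<inter> topspace (subtopology masses admissible))" .
next
  have "realize ` topspace (subtopology masses admissible) \<subseteq> finite_measures (X \<Otimes>\<^sub>M actM A)"
    using coded_tree.sampled_finite[OF coded_tree_of] by (auto simp: realize_def)
  then show "realize ` topspace (subtopology masses admissible) \<subseteq>
      \<Union>{{\<mu> \<in> finite_measures (X \<Otimes>\<^sub>M actM A). (\<integral>z. f z \<partial>\<mu>) \<in> U} | f U. bounded_caratheodory X A f \<and> open U}"
    using topspace_ws_topology[of X A] unfolding ws_topology_def topology_generated_by_topspace by simp
qed

definition cell_mass :: "('x \<times> 'a) measure \<Rightarrow> 'x set \<times> bool list \<Rightarrow> real" where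
  "cell_mass \<mu> = (\<lambda>(\<Gamma>, c)\<in>sets X \<times> UNIV. measure \<mu> (\<Gamma> \<times> cell c))"

lemma cell_split: "cell c = cell (c @ [True]) \<union> cell (c @ [False])" "cell (c @ [True]) \<inter> cell (c @ [False]) = {}"
  by (auto simp: cell_def code_Suc)

lemma cell_Nil: "cell [] = A"
  by (auto simp: cell_def)

lemma cell_mass_admissible:
  assumes \<mu>: "\<mu> \<in> dominated_measures"
  shows "cell_mass \<mu> \<in> admissible"
proof -
  have fin: "finite_measure \<mu>" and s: "sets \<mu> = sets (X \<Otimes>\<^sub>M actM A)"
    and le: "\<And>\<Gamma>. \<Gamma> \<in> sets X \<Longrightarrow> measure \<mu> (\<Gamma> \<times> A) \<le> \<beta> \<Gamma>"
    using \<mu> by (auto simp: dominated_measures_def finite_measures_def)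
  interpret finite_measure \<mu> by (rule fin)
  have R: "\<Gamma> \<times> cell c \<in> sets \<mu>" if "\<Gamma> \<in> sets X" for \<Gamma> c using that by (simp add: s)
  have up: "measure \<mu> (\<Gamma> \<times> cell c) \<le> max 0 (\<beta> (space X))" if "\<Gamma> \<in> sets X" for \<Gamma> c
  proof -
    have "measure \<mu> (\<Gamma> \<times> cell c) \<le> measure \<mu> (space X \<times> cell [])"
      using R[of "space X" "[]"] sets.sets_into_space[OF that] cell_subset[of c] by (intro finite_measure_mono) (auto simp: cell_Nil)
    then show ?thesis using le[OF sets.top] by (simp add: cell_Nil)
  qed
  show ?thesis
    unfolding admissible_def
  proof (intro CollectI conjI ballI allI impI)
    show "cell_mass \<mu> \<in> topspace masses"
      using up by (auto simp: masses_def cell_mass_def PiE_iff)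
    show "cell_mass \<mu> (\<Gamma>, []) \<le> \<beta> \<Gamma>" if "\<Gamma> \<in> sets X" for \<Gamma>
      using le[OF that] that by (simp add: cell_mass_def cell_Nil)
    show "cell_mass \<mu> (\<Gamma> \<union> \<Gamma>', c) - cell_mass \<mu> (\<Gamma>, c) - cell_mass \<mu> (\<Gamma>', c) = 0"
      if G: "\<Gamma> \<in> sets X" "\<Gamma>' \<in> sets X" "\<Gamma> \<inter> \<Gamma>' = {}" for \<Gamma> \<Gamma>' c
    proof -
      have "measure \<mu> ((\<Gamma> \<times> cell c) \<union> (\<Gamma>' \<times> cell c)) = measure \<mu> (\<Gamma> \<times> cell c) + measure \<mu> (\<Gamma>' \<times> cell c)"
        by (rule finite_measure_Union) (use R G in auto)
      then show ?thesis using G by (simp add: cell_mass_def Sigma_Un_distrib1)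
    qed
    show "cell_mass \<mu> (\<Gamma>, c) - cell_mass \<mu> (\<Gamma>, c @ [True]) - cell_mass \<mu> (\<Gamma>, c @ [False]) = 0"
      if G: "\<Gamma> \<in> sets X" for \<Gamma> c
    proof -
      have "measure \<mu> ((\<Gamma> \<times> cell (c @ [True])) \<union> (\<Gamma> \<times> cell (c @ [False])))
          = measure \<mu> (\<Gamma> \<times> cell (c @ [True])) + measure \<mu> (\<Gamma> \<times> cell (c @ [False]))"
        by (rule finite_measure_Union) (use R G cell_split(2)[of c] in auto)
      then show ?thesis using G by (simp add: cell_mass_def cell_split(1)[of c] Sigma_Un_distrib2)
    qed
    show "cell_mass \<mu> (space X, c) = 0" if "cell c = {}" for c
      using that by (simp add: cell_mass_def)
  qed
qed

text \<open>Resampling a measure from its own table gives it back: the same finite sums approximate the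
  integrals of both, and these integrals determine a measure.\<close>

lemma realize_cell_mass:
  assumes \<mu>: "\<mu> \<in> dominated_measures"
  shows "realize (cell_mass \<mu>) = \<mu>"
proof (rule caratheodory_determines[OF _ _ sets_A])
  have m: "cell_mass \<mu> \<in> admissible" by (rule cell_mass_admissible[OF \<mu>])
  interpret T: coded_tree A U X "tree (cell_mass \<mu>)" by (rule coded_tree_of[OF m])
  show "realize (cell_mass \<mu>) \<in> finite_measures (X \<Otimes>\<^sub>M actM A)"
    unfolding realize_def by (rule T.sampled_finite)
  show "\<mu> \<in> finite_measures (X \<Otimes>\<^sub>M actM A)" using \<mu> by (simp add: dominated_measures_def)
  then have fin: "finite_measure \<mu>" and s [measurable_cong]: "sets \<mu> = sets (X \<Otimes>\<^sub>M actM A)"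
    by (auto simp: finite_measures_def)
  interpret finite_measure \<mu> by (rule fin)
  have sp: "space \<mu> = space X \<times> A" using sets_eq_imp_space_eq[OF s] by (simp add: space_pair_measure)
  fix f assume f: "bounded_caratheodory X A f"
  have "\<bar>(\<integral>z. f z \<partial>realize (cell_mass \<mu>)) - (\<integral>z. f z \<partial>\<mu>)\<bar> \<le> e" if e: "e > 0" for e :: real
  proof -
    obtain N where N: "\<And>n \<nu>. n \<ge> N \<Longrightarrow> dominated X \<beta> \<nu> \<Longrightarrow> (\<integral>x. osc f n x \<partial>\<nu>) \<le> e / 2"
      using osc_uniform[OF f, of "e / 2"] e by auto
    have "\<bar>(\<integral>z. f (fst z, snd z) \<partial>\<mu>) - (\<Sum>c | length c = N. \<integral>x. f (x, rep c) \<partial>tree (cell_mass \<mu>) c)\<bar>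
        \<le> (\<integral>x. osc f N x \<partial>tree (cell_mass \<mu>) [])"
    proof (rule T.integral_approx[OF fin _ _ _ _ _ f, where w="\<lambda>n z. code n (snd z)"])
      show "AE z in \<mu>. follows (\<lambda>n. code n (snd z)) (snd z)"
        by (rule AE_I2) (auto simp: sp intro!: follows_code)
      fix c \<Gamma> assume G: "\<Gamma> \<in> sets X"
      have "{z \<in> space \<mu>. fst z \<in> \<Gamma> \<and> code (length c) (snd z) = c} = \<Gamma> \<times> cell c"
        using sets.sets_into_space[OF G] by (auto simp: sp cell_def)
      then show "emeasure \<mu> {z \<in> space \<mu>. fst z \<in> \<Gamma> \<and> code (length c) (snd z) = c} = emeasure (tree (cell_mass \<mu>) c) \<Gamma>"
        using G by (simp add: emeasure_tree[OF m] emeasure_eq_measure) (simp add: cell_mass_def)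
    qed measurable
    then show ?thesis
      using T.sampled_approx[OF f, of N] N[OF order_refl dominated_tree[OF m, of "[]"]]
      unfolding realize_def by simp
  qed
  then show "(\<integral>z. f z \<partial>realize (cell_mass \<mu>)) = (\<integral>z. f z \<partial>\<mu>)"
    using field_le_epsilon[of "\<bar>(\<integral>z. f z \<partial>realize (cell_mass \<mu>)) - (\<integral>z. f z \<partial>\<mu>)\<bar>" 0] by auto
qed

lemma compactin_superset:
  obtains K where "compactin (ws_topology X A) K" "dominated_measures \<subseteq> K"
proof (rule that[of "realize ` admissible"])
  have "compactin masses admissible"
    by (rule closedin_compact_space[OF compact_masses closedin_admissible])
  then have "compactin (subtopology masses admissible) admissible"
    by (simp add: compactin_subtopology)
  then show "compactin (ws_topology X A) (realize ` admissible)"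
    by (rule image_compactin[OF _ continuous_realize])
  show "dominated_measures \<subseteq> realize ` admissible"
    using realize_cell_mass cell_mass_admissible by (force simp: image_iff)
qed

end

lemma compact_coding_ex:
  fixes A :: "'a::polish_space set"
  assumes "compact A" "A \<noteq> {}"
  obtains U where "compact_coding A U"
proof -
  obtain B :: "'a set set" where B: "countable B" "topological_basis B" using ex_countable_basis by blast
  have "B \<noteq> {}" using topological_basisE[OF B(2), of UNIV undefined] by auto
  then have r: "range (from_nat_into B) = B" using B(1) by (rule range_from_nat_into)
  have "compact_coding A (from_nat_into B)"
  proof
    show "open (from_nat_into B n)" for n
      using topological_basis_open[OF B(2)] r by blast
    show "\<exists>n. a \<in> from_nat_into B n \<and> from_nat_into B n \<subseteq> V" if V: "open V" "a \<in> V" for a V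
    proof -
      obtain W where "W \<in> B" "a \<in> W" "W \<subseteq> V" using topological_basisE[OF B(2) V] by blast
      then show ?thesis using r by (metis rangeE)
    qed
  qed (use assms in auto)
  then show ?thesis by (rule that)
qed

text \<open>Tychonoff makes the set of tables compact, and sampling maps it continuously onto a set of measures.\<close>

lemma ws_compact_superset:
  fixes A :: "'a::polish_space set"
  assumes "compact A" "A \<noteq> {}" and "vanishing X \<beta>"
  obtains K where "compactin (ws_topology X A) K"
    "\<And>\<mu>. \<mu> \<in> finite_measures (X \<Otimes>\<^sub>M actM A) \<Longrightarrow> (\<And>\<Gamma>. \<Gamma> \<in> sets X \<Longrightarrow> measure \<mu> (\<Gamma> \<times> A) \<le> \<beta> \<Gamma>) \<Longrightarrow> \<mu> \<in> K"
proof -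
  obtain U where "compact_coding A U" using compact_coding_ex assms by blast
  then interpret compact_ws A U X \<beta>
    using assms(3) by (intro compact_ws.intro compact_ws_axioms.intro)
  obtain K where K: "compactin (ws_topology X A) K" "dominated_measures \<subseteq> K" by (rule compactin_superset)
  show ?thesis
    by (rule that[OF K(1)]) (rule subsetD[OF K(2)], simp add: dominated_measures_def)
qed

definition kprod :: "'x measure \<Rightarrow> 'b measure \<Rightarrow> 'x measure \<Rightarrow> ('x \<Rightarrow> 'b measure) \<Rightarrow> ('x \<times> 'b) measure" where
  "kprod X Y \<nu> \<kappa> = \<nu> \<bind> (\<lambda>x. distr (\<kappa> x) (X \<Otimes>\<^sub>M Y) (Pair x))"

context
  fixes X :: "'x measure" and Y :: "'b measure" and \<nu> \<kappa>
  assumes \<nu>: "sets \<nu> = sets X" and ne: "space X \<noteq> {}" and \<kappa>: "\<kappa> \<in> X \<rightarrow>\<^sub>M prob_algebra Y"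
begin

lemma kprod_kernel: "(\<lambda>x. distr (\<kappa> x) (X \<Otimes>\<^sub>M Y) (Pair x)) \<in> \<nu> \<rightarrow>\<^sub>M prob_algebra (X \<Otimes>\<^sub>M Y)"
proof -
  have "(\<lambda>x. distr (\<kappa> x) (X \<Otimes>\<^sub>M Y) (Pair x)) \<in> X \<rightarrow>\<^sub>M prob_algebra (X \<Otimes>\<^sub>M Y)"
  proof (rule measurable_prob_algebraI)
    show "prob_space (distr (\<kappa> x) (X \<Otimes>\<^sub>M Y) (Pair x))" if x: "x \<in> space X" for x
    proof (rule prob_space.prob_space_distr)
      have k: "\<kappa> x \<in> space (prob_algebra Y)" using measurable_space[OF \<kappa> x] .
      then show "prob_space (\<kappa> x)" by (simp add: space_prob_algebra)
      show "Pair x \<in> \<kappa> x \<rightarrow>\<^sub>M X \<Otimes>\<^sub>M Y"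
        using k measurable_Pair1'[OF x, of Y] by (simp add: space_prob_algebra cong: measurable_cong_sets)
    qed
    show "(\<lambda>x. distr (\<kappa> x) (X \<Otimes>\<^sub>M Y) (Pair x)) \<in> X \<rightarrow>\<^sub>M subprob_algebra (X \<Otimes>\<^sub>M Y)"
      by (rule measurable_distr2[OF _ measurable_prob_algebraD[OF \<kappa>]]) simp
  qed
  then show ?thesis by (simp add: measurable_cong_sets[OF \<nu> refl])
qed

lemma sets_kprod [measurable_cong]: "sets (kprod X Y \<nu> \<kappa>) = sets (X \<Otimes>\<^sub>M Y)"
proof -
  have "space \<nu> \<noteq> {}" using ne sets_eq_imp_space_eq[OF \<nu>] by simp
  then show ?thesis unfolding kprod_def by (intro sets_bind) auto
qed

lemma nn_integral_kprod:
  assumes f: "f \<in> borel_measurable (X \<Otimes>\<^sub>M Y)"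
  shows "(\<integral>\<^sup>+z. f z \<partial>kprod X Y \<nu> \<kappa>) = (\<integral>\<^sup>+x. \<integral>\<^sup>+y. f (x, y) \<partial>\<kappa> x \<partial>\<nu>)"
proof -
  have "(\<integral>\<^sup>+z. f z \<partial>kprod X Y \<nu> \<kappa>) = (\<integral>\<^sup>+x. \<integral>\<^sup>+z. f z \<partial>distr (\<kappa> x) (X \<Otimes>\<^sub>M Y) (Pair x) \<partial>\<nu>)"
    unfolding kprod_def by (rule nn_integral_bind[OF f measurable_prob_algebraD[OF kprod_kernel]])
  also have "\<dots> = (\<integral>\<^sup>+x. \<integral>\<^sup>+y. f (x, y) \<partial>\<kappa> x \<partial>\<nu>)"
  proof (rule nn_integral_cong)
    fix x assume "x \<in> space \<nu>"
    then have x: "x \<in> space X" using sets_eq_imp_space_eq[OF \<nu>] by simp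
    have "\<kappa> x \<in> space (prob_algebra Y)" using measurable_space[OF \<kappa> x] .
    then have "Pair x \<in> \<kappa> x \<rightarrow>\<^sub>M X \<Otimes>\<^sub>M Y"
      using measurable_Pair1'[OF x, of Y] by (simp add: space_prob_algebra cong: measurable_cong_sets)
    then show "(\<integral>\<^sup>+z. f z \<partial>distr (\<kappa> x) (X \<Otimes>\<^sub>M Y) (Pair x)) = (\<integral>\<^sup>+y. f (x, y) \<partial>\<kappa> x)"
      using f by (intro nn_integral_distr) auto
  qed
  finally show ?thesis .
qed

lemma emeasure_kprod:
  assumes \<Gamma>: "\<Gamma> \<in> sets X" and B: "B \<in> sets Y"
  shows "emeasure (kprod X Y \<nu> \<kappa>) (\<Gamma> \<times> B) = (\<integral>\<^sup>+x\<in>\<Gamma>. emeasure (\<kappa> x) B \<partial>\<nu>)"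
proof -
  have R: "\<Gamma> \<times> B \<in> sets (X \<Otimes>\<^sub>M Y)" using \<Gamma> B by simp
  have "emeasure (kprod X Y \<nu> \<kappa>) (\<Gamma> \<times> B) = (\<integral>\<^sup>+z. indicator (\<Gamma> \<times> B) z \<partial>kprod X Y \<nu> \<kappa>)"
    using R by (simp add: sets_kprod)
  also have "\<dots> = (\<integral>\<^sup>+x. \<integral>\<^sup>+y. indicator (\<Gamma> \<times> B) (x, y) \<partial>\<kappa> x \<partial>\<nu>)"
    using R by (intro nn_integral_kprod) simp
  also have "\<dots> = (\<integral>\<^sup>+x\<in>\<Gamma>. emeasure (\<kappa> x) B \<partial>\<nu>)"
  proof (rule nn_integral_cong)
    fix x assume "x \<in> space \<nu>"
    then have "\<kappa> x \<in> space (prob_algebra Y)"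
      using measurable_space[OF \<kappa>] sets_eq_imp_space_eq[OF \<nu>] by simp
    then have "B \<in> sets (\<kappa> x)" using B by (simp add: space_prob_algebra)
    then show "(\<integral>\<^sup>+y. indicator (\<Gamma> \<times> B) (x, y) \<partial>\<kappa> x) = emeasure (\<kappa> x) B * indicator \<Gamma> x"
      by (cases "x \<in> \<Gamma>") (simp_all add: indicator_times)
  qed
  finally show ?thesis .
qed

end

text \<open>The kernel is the conditional law of the sampled action given the state.\<close>

theorem disintegration:
  fixes A :: "'a::polish_space set"
  assumes A: "compact A" "A \<noteq> {}" and ne: "space X \<noteq> {}"
    and \<mu>: "\<mu> \<in> finite_measures (X \<Otimes>\<^sub>M actM A)"
  obtains \<kappa> where "\<kappa> \<in> X \<rightarrow>\<^sub>M prob_algebra (actM A)" "\<mu> = kprod X (actM A) (distr \<mu> X fst) \<kappa>"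
proof -
  have fin: "finite_measure \<mu>" and s [measurable_cong]: "sets \<mu> = sets (X \<Otimes>\<^sub>M actM A)"
    using \<mu> by (auto simp: finite_measures_def)
  interpret finite_measure \<mu> by (rule fin)
  have fst: "fst \<in> \<mu> \<rightarrow>\<^sub>M X" by measurable
  have sp: "space \<mu> = space X \<times> A" using sets_eq_imp_space_eq[OF s] by (simp add: space_pair_measure space_restrict_space)
  have marg: "emeasure (distr \<mu> X fst) \<Gamma> = emeasure \<mu> (\<Gamma> \<times> A)" if "\<Gamma> \<in> sets X" for \<Gamma>
    using sets.sets_into_space[OF that] by (subst emeasure_distr[OF fst that]) (auto simp: sp intro!: arg_cong2[where f=emeasure])
  define \<beta> where "\<beta> = (\<lambda>\<Gamma>. measure (distr \<mu> X fst) \<Gamma>)"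
  obtain U where "compact_coding A U" using compact_coding_ex A by blast
  then interpret compact_ws A U X \<beta>
    using vanishing_measure[OF finite_measure_distr[OF fst], of X] by (simp add: compact_ws_def compact_ws_axioms_def \<beta>_def)
  have dom: "\<mu> \<in> dominated_measures"
    unfolding dominated_measures_def using \<mu> marg by (auto simp: \<beta>_def measure_def)
  have m: "cell_mass \<mu> \<in> admissible" by (rule cell_mass_admissible[OF dom])
  interpret T: coded_tree A U X "tree (cell_mass \<mu>)" by (rule coded_tree_of[OF m])
  have root: "tree (cell_mass \<mu>) [] = distr \<mu> X fst"
  proof (rule measure_eqI)
    fix \<Gamma> assume "\<Gamma> \<in> sets (tree (cell_mass \<mu>) [])"
    then have G: "\<Gamma> \<in> sets X" by (simp add: sets_tree_of)
    have "emeasure (tree (cell_mass \<mu>) []) \<Gamma> = ennreal (cell_mass \<mu> (\<Gamma>, []))" by (rule emeasure_tree[OF m G])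
    also have "\<dots> = emeasure \<mu> (\<Gamma> \<times> A)" using G by (simp add: cell_mass_def cell_Nil emeasure_eq_measure)
    finally show "emeasure (tree (cell_mass \<mu>) []) \<Gamma> = emeasure (distr \<mu> X fst) \<Gamma>" by (simp add: marg[OF G])
  qed (simp add: sets_tree_of)
  let ?\<kappa> = "\<lambda>x. distr coins (actM A) (T.sel x)"
  have k: "?\<kappa> \<in> X \<rightarrow>\<^sub>M prob_algebra (actM A)" by (rule T.sampled_kernel)
  have "T.sampled = \<mu>" using realize_cell_mass[OF dom] by (simp add: realize_def)
  moreover have "T.sampled = kprod X (actM A) (distr \<mu> X fst) ?\<kappa>"
  proof (rule measure_eqI_rect)
    show "finite_measure T.sampled" "sets T.sampled = sets (X \<Otimes>\<^sub>M actM A)"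
      using T.sampled_finite by (auto simp: finite_measures_def)
    show "sets (kprod X (actM A) (distr \<mu> X fst) ?\<kappa>) = sets (X \<Otimes>\<^sub>M actM A)"
      by (rule sets_kprod[OF _ ne k]) simp
    show "emeasure T.sampled (\<Gamma> \<times> B) = emeasure (kprod X (actM A) (distr \<mu> X fst) ?\<kappa>) (\<Gamma> \<times> B)"
      if "\<Gamma> \<in> sets X" "B \<in> sets (actM A)" for \<Gamma> B
      using T.emeasure_sampled[OF that] emeasure_kprod[OF _ ne k that, of "distr \<mu> X fst"] by (simp add: root)
  qed
  ultimately show ?thesis using that[OF k] by simp
qed

section \<open>Existence and uniqueness of the law of a policy\<close>

text \<open>Sets of the generated sub-sigma-algebra are the preimages under \<open>g\<close>, so the defining property of the
  conditional expectation can be tested on the sets of the target space.\<close>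

lemma cond_exp_indicator_iff:
  fixes k :: "'b \<Rightarrow> real"
  assumes L: "prob_space L" and g: "g \<in> L \<rightarrow>\<^sub>M N" and E: "E \<in> sets L"
    and k: "k \<in> borel_measurable N" and k01: "\<And>y. y \<in> space N \<Longrightarrow> 0 \<le> k y \<and> k y \<le> 1"
  shows "(AE \<omega> in L. real_cond_exp L (vimage_algebra (space L) g N) (indicator E) \<omega> = k (g \<omega>)) \<longleftrightarrow>
    (\<forall>S\<in>sets N. emeasure L (g -` S \<inter> E) = (\<integral>\<^sup>+\<omega>. indicator S (g \<omega>) * ennreal (k (g \<omega>)) \<partial>L))"
proof -
  interpret prob_space L by (rule L)
  let ?F = "vimage_algebra (space L) g N"
  have gsp: "g \<in> space L \<rightarrow> space N" using g by (rule measurable_space[THEN funcsetI])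
  have setsF: "sets ?F = {g -` S \<inter> space L | S. S \<in> sets N}" by (rule sets_vimage_algebra2[OF gsp])
  have sub: "subalgebra L ?F"
    unfolding subalgebra_def using setsF measurable_sets[OF g] by auto
  interpret F: finite_measure_subalgebra L ?F by standard (rule sub)
  note [measurable] = g E k
  have kF: "(\<lambda>\<omega>. k (g \<omega>)) \<in> borel_measurable ?F"
    by (rule measurable_compose[OF measurable_vimage_algebra1[OF gsp] k])
  have k01': "0 \<le> k (g \<omega>)" "k (g \<omega>) \<le> 1" if "\<omega> \<in> space L" for \<omega>
    using k01 gsp that by auto
  have iE: "integrable L (indicator E :: _ \<Rightarrow> real)" by (rule integrable_real_indicator[OF E]) (simp add: emeasure_eq_measure)
  have ik: "integrable L (\<lambda>\<omega>. k (g \<omega>))"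
    by (rule integrable_const_bound[where B=1]) (auto intro!: AE_I2 simp: k01')
  have key: "(\<integral>\<omega>\<in>g -` S \<inter> space L. indicator E \<omega> \<partial>L) = (\<integral>\<omega>\<in>g -` S \<inter> space L. k (g \<omega>) \<partial>L) \<longleftrightarrow>
      emeasure L (g -` S \<inter> E) = (\<integral>\<^sup>+\<omega>. indicator S (g \<omega>) * ennreal (k (g \<omega>)) \<partial>L)" if S: "S \<in> sets N" for S
  proof -
    note [measurable] = S
    have "g -` S \<inter> E = (g -` S \<inter> space L) \<inter> E" using sets.sets_into_space[OF E] by blast
    then have SE: "g -` S \<inter> E \<in> sets L" using sets.Int[OF measurable_sets[OF g S] E] by simp
    have "(\<integral>\<omega>\<in>g -` S \<inter> space L. indicator E \<omega> \<partial>L) = (\<integral>\<omega>. indicat_real (g -` S \<inter> E) \<omega> \<partial>L)"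
      unfolding set_lebesgue_integral_def
      by (intro Bochner_Integration.integral_cong) (auto simp: indicator_def)
    then have 1: "(\<integral>\<omega>\<in>g -` S \<inter> space L. indicator E \<omega> \<partial>L) = measure L (g -` S \<inter> E)" using SE by simp
    have "(\<integral>\<omega>\<in>g -` S \<inter> space L. k (g \<omega>) \<partial>L) = (\<integral>\<omega>. indicator S (g \<omega>) * k (g \<omega>) \<partial>L)"
      unfolding set_lebesgue_integral_def
      by (intro Bochner_Integration.integral_cong) (auto simp: indicator_def)
    moreover have "ennreal (\<integral>\<omega>. indicator S (g \<omega>) * k (g \<omega>) \<partial>L) = (\<integral>\<^sup>+\<omega>. ennreal (indicator S (g \<omega>) * k (g \<omega>)) \<partial>L)"
    proof (rule nn_integral_eq_integral[symmetric])
      show "integrable L (\<lambda>\<omega>. indicator S (g \<omega>) * k (g \<omega>))"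
        by (rule integrable_const_bound[where B=1]) (auto intro!: AE_I2 simp: k01' indicator_def)
    qed (auto intro!: AE_I2 simp: k01')
    moreover have "(\<integral>\<^sup>+\<omega>. ennreal (indicator S (g \<omega>) * k (g \<omega>)) \<partial>L) = (\<integral>\<^sup>+\<omega>. indicator S (g \<omega>) * ennreal (k (g \<omega>)) \<partial>L)"
      by (intro nn_integral_cong) (auto simp: indicator_def)
    moreover have "0 \<le> (\<integral>\<omega>. indicator S (g \<omega>) * k (g \<omega>) \<partial>L)"
      by (rule Bochner_Integration.integral_nonneg) (simp add: k01')
    ultimately show ?thesis unfolding 1 emeasure_eq_measure by (metis ennreal_inj measure_nonneg)
  qed
  show ?thesis
  proof
    assume ae: "AE \<omega> in L. real_cond_exp L ?F (indicator E) \<omega> = k (g \<omega>)"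
    show "\<forall>S\<in>sets N. emeasure L (g -` S \<inter> E) = (\<integral>\<^sup>+\<omega>. indicator S (g \<omega>) * ennreal (k (g \<omega>)) \<partial>L)"
    proof
      fix S assume S: "S \<in> sets N"
      then have T: "g -` S \<inter> space L \<in> sets ?F" using setsF by auto
      have "(\<integral>\<omega>\<in>g -` S \<inter> space L. indicator E \<omega> \<partial>L) = (\<integral>\<omega>\<in>g -` S \<inter> space L. real_cond_exp L ?F (indicator E) \<omega> \<partial>L)"
        by (rule F.real_cond_exp_intA[OF iE T])
      also have "\<dots> = (\<integral>\<omega>\<in>g -` S \<inter> space L. k (g \<omega>) \<partial>L)"
        unfolding set_lebesgue_integral_def
      proof (rule integral_cong_AE)
        show "AE \<omega> in L. indicat_real (g -` S \<inter> space L) \<omega> *\<^sub>R real_cond_exp L ?F (indicator E) \<omega>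
           = indicat_real (g -` S \<inter> space L) \<omega> *\<^sub>R k (g \<omega>)"
          using ae by eventually_elim simp
      qed (use measurable_sets[OF g S] in measurable)
      finally show "emeasure L (g -` S \<inter> E) = (\<integral>\<^sup>+\<omega>. indicator S (g \<omega>) * ennreal (k (g \<omega>)) \<partial>L)"
        using key[OF S] by simp
    qed
  next
    assume eq: "\<forall>S\<in>sets N. emeasure L (g -` S \<inter> E) = (\<integral>\<^sup>+\<omega>. indicator S (g \<omega>) * ennreal (k (g \<omega>)) \<partial>L)"
    show "AE \<omega> in L. real_cond_exp L ?F (indicator E) \<omega> = k (g \<omega>)"
    proof (rule F.real_cond_exp_charact[OF _ iE ik kF])
      fix T assume "T \<in> sets ?F"
      then obtain S where S: "S \<in> sets N" "T = g -` S \<inter> space L" using setsF by auto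
      then show "(\<integral>\<omega>\<in>T. indicator E \<omega> \<partial>L) = (\<integral>\<omega>\<in>T. k (g \<omega>) \<partial>L)" using key eq by simp
    qed
  qed
qed

context control_model
begin

abbreviation Z :: "('x \<times> 'a) measure" where "Z \<equiv> X \<Otimes>\<^sub>M actM A"

lemma space_act: "space (actM A) = A"
  by (simp add: space_restrict_space)

lemma space_trajM: "space trajM = UNIV \<rightarrow> space Z"
  by (simp add: trajM_def space_PiM PiE_UNIV_domain)

lemma coord_measurable [measurable]: "(\<lambda>\<omega>. \<omega> n) \<in> trajM \<rightarrow>\<^sub>M Z"
  unfolding trajM_def by measurable

lemma state_measurable [measurable]: "state n \<in> trajM \<rightarrow>\<^sub>M X"
  unfolding state_def by measurable

lemma action_measurable [measurable]: "action n \<in> trajM \<rightarrow>\<^sub>M actM A"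
  unfolding action_def by measurable

lemma past_measurable [measurable]: "(\<lambda>\<omega>. restrict \<omega> {0..<n}) \<in> trajM \<rightarrow>\<^sub>M (\<Pi>\<^sub>M i\<in>{0..<n}. Z)"
  unfolding trajM_def by (rule measurable_restrict_subset) simp

lemma hist_measurable [measurable]: "hist n \<in> trajM \<rightarrow>\<^sub>M histM n"
  unfolding hist_def histM_def by measurable

lemma Q_measure_measurable: "\<Gamma> \<in> sets X \<Longrightarrow> (\<lambda>z. measure (Q z) \<Gamma>) \<in> borel_measurable Z"
  by (rule measurable_compose[OF measurable_prob_algebraD[OF Q_kernel]])
    (rule measurable_measure_subprob_algebra)

lemma Q_emeasure_measurable: "\<Gamma> \<in> sets X \<Longrightarrow> (\<lambda>z. emeasure (Q z) \<Gamma>) \<in> borel_measurable Z"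
  by (rule measurable_compose[OF measurable_prob_algebraD[OF Q_kernel]])
    (rule measurable_emeasure_subprob_algebra)

lemma Q_space: "z \<in> space Z \<Longrightarrow> prob_space (Q z) \<and> sets (Q z) = sets X"
  using measurable_space[OF Q_kernel] by (simp add: space_prob_algebra)

lemma policyD:
  assumes "\<pi> \<in> policies"
  shows "\<pi> n \<in> histM n \<rightarrow>\<^sub>M prob_algebra (actM A)"
    "h \<in> space (histM n) \<Longrightarrow> emeasure (\<pi> n h) (As (snd h)) = 1"
    "h \<in> space (histM n) \<Longrightarrow> prob_space (\<pi> n h)"
    "h \<in> space (histM n) \<Longrightarrow> sets (\<pi> n h) = sets (actM A)"
proof -
  show p: "\<pi> n \<in> histM n \<rightarrow>\<^sub>M prob_algebra (actM A)"
    "h \<in> space (histM n) \<Longrightarrow> emeasure (\<pi> n h) (As (snd h)) = 1"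
    using assms by (auto simp: policies_def)
  show "h \<in> space (histM n) \<Longrightarrow> prob_space (\<pi> n h)"
    "h \<in> space (histM n) \<Longrightarrow> sets (\<pi> n h) = sets (actM A)"
    using measurable_space[OF p(1), of h] by (auto simp: space_prob_algebra)
qed

text \<open>Integrated against test sets, the two conditional-distribution clauses of a law become
  statements about joint distributions.\<close>

lemma is_law_iff:
  assumes \<pi>: "\<pi> \<in> policies"
  shows "is_law \<nu> \<pi> L \<longleftrightarrow> prob_space L \<and> sets L = sets trajM \<and> distr L X (state 0) = \<nu> \<and>
    (\<forall>n. \<forall>B\<in>sets (actM A). \<forall>S\<in>sets (histM n). emeasure L {\<omega> \<in> space L. hist n \<omega> \<in> S \<and> action n \<omega> \<in> B}
       = (\<integral>\<^sup>+\<omega>. indicator S (hist n \<omega>) * emeasure (\<pi> n (hist n \<omega>)) B \<partial>L)) \<and>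
    (\<forall>n. \<forall>\<Gamma>\<in>sets X. \<forall>S\<in>sets (histM n \<Otimes>\<^sub>M actM A).
       emeasure L {\<omega> \<in> space L. (hist n \<omega>, action n \<omega>) \<in> S \<and> state (Suc n) \<omega> \<in> \<Gamma>}
       = (\<integral>\<^sup>+\<omega>. indicator S (hist n \<omega>, action n \<omega>) * emeasure (Q (state n \<omega>, action n \<omega>)) \<Gamma> \<partial>L))"
proof (cases "prob_space L \<and> sets L = sets trajM")
  case False
  then show ?thesis by (auto simp: is_law_def)
next
  case True
  then have L: "prob_space L" and s [measurable_cong]: "sets L = sets trajM" by auto
  interpret prob_space L by (rule L)
  have sp: "space trajM = space L" using sets_eq_imp_space_eq[OF s] by simp
  have 1: "(AE \<omega> in L. real_cond_exp L (hist_algebra n) (indicator {\<omega>\<in>space L. action n \<omega> \<in> B}) \<omega>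
          = measure (\<pi> n (hist n \<omega>)) B) \<longleftrightarrow>
     (\<forall>S\<in>sets (histM n). emeasure L {\<omega> \<in> space L. hist n \<omega> \<in> S \<and> action n \<omega> \<in> B}
       = (\<integral>\<^sup>+\<omega>. indicator S (hist n \<omega>) * emeasure (\<pi> n (hist n \<omega>)) B \<partial>L))"
    if B: "B \<in> sets (actM A)" for n B
  proof -
    note [measurable] = B
    have e: "ennreal (measure (\<pi> n (hist n \<omega>)) B) = emeasure (\<pi> n (hist n \<omega>)) B" if "\<omega> \<in> space L" for \<omega>
    proof -
      have "hist n \<omega> \<in> space (histM n)" using measurable_space[OF hist_measurable] that by (simp add: sp)
      then interpret p: prob_space "\<pi> n (hist n \<omega>)" by (rule policyD(3)[OF \<pi>])
      show ?thesis by (simp add: p.emeasure_eq_measure)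
    qed
    have "(AE \<omega> in L. real_cond_exp L (hist_algebra n) (indicator {\<omega>\<in>space L. action n \<omega> \<in> B}) \<omega>
          = measure (\<pi> n (hist n \<omega>)) B) \<longleftrightarrow>
        (\<forall>S\<in>sets (histM n). emeasure L (hist n -` S \<inter> {\<omega>\<in>space L. action n \<omega> \<in> B})
       = (\<integral>\<^sup>+\<omega>. indicator S (hist n \<omega>) * ennreal (measure (\<pi> n (hist n \<omega>)) B) \<partial>L))"
      unfolding hist_algebra_def sp
    proof (rule cond_exp_indicator_iff[OF L, where k="\<lambda>h. measure (\<pi> n h) B"])
      show "(\<lambda>h. measure (\<pi> n h) B) \<in> borel_measurable (histM n)"
        by (rule measurable_compose[OF measurable_prob_algebraD[OF policyD(1)[OF \<pi>]]])
          (rule measurable_measure_subprob_algebra[OF B])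
      show "0 \<le> measure (\<pi> n h) B \<and> measure (\<pi> n h) B \<le> 1" if "h \<in> space (histM n)" for h
        using prob_space.prob_le_1[OF policyD(3)[OF \<pi> that]] by simp
    qed measurable
    also have "\<dots> \<longleftrightarrow> (\<forall>S\<in>sets (histM n). emeasure L {\<omega> \<in> space L. hist n \<omega> \<in> S \<and> action n \<omega> \<in> B}
       = (\<integral>\<^sup>+\<omega>. indicator S (hist n \<omega>) * emeasure (\<pi> n (hist n \<omega>)) B \<partial>L))"
      by (intro ball_cong refl arg_cong2[where f="(=)"] arg_cong2[where f=emeasure] nn_integral_cong) (auto simp: e)
    finally show ?thesis .
  qed
  have 2: "(AE \<omega> in L. real_cond_exp L (hist_action_algebra n) (indicator {\<omega>\<in>space L. state (Suc n) \<omega> \<in> \<Gamma>}) \<omega>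
          = measure (Q (state n \<omega>, action n \<omega>)) \<Gamma>) \<longleftrightarrow>
     (\<forall>S\<in>sets (histM n \<Otimes>\<^sub>M actM A). emeasure L {\<omega> \<in> space L. (hist n \<omega>, action n \<omega>) \<in> S \<and> state (Suc n) \<omega> \<in> \<Gamma>}
       = (\<integral>\<^sup>+\<omega>. indicator S (hist n \<omega>, action n \<omega>) * emeasure (Q (state n \<omega>, action n \<omega>)) \<Gamma> \<partial>L))"
    if \<Gamma>: "\<Gamma> \<in> sets X" for n \<Gamma>
  proof -
    note [measurable] = \<Gamma>
    have snd_hist: "snd (hist n \<omega>) = state n \<omega>" for \<omega> by (simp add: hist_def)
    have Qsp: "prob_space (Q (snd h, a))" if "(h, a) \<in> space (histM n \<Otimes>\<^sub>M actM A)" for h a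
      using Q_space[of "(snd h, a)"] that by (auto simp: space_pair_measure histM_def)
    have e: "ennreal (measure (Q (state n \<omega>, action n \<omega>)) \<Gamma>) = emeasure (Q (state n \<omega>, action n \<omega>)) \<Gamma>" if "\<omega> \<in> space L" for \<omega>
    proof -
      have "(state n \<omega>, action n \<omega>) \<in> space Z"
        using that measurable_space[OF state_measurable] measurable_space[OF action_measurable] by (simp add: space_pair_measure sp)
      then interpret p: prob_space "Q (state n \<omega>, action n \<omega>)" using Q_space by blast
      show ?thesis by (simp add: p.emeasure_eq_measure)
    qed
    have "(AE \<omega> in L. real_cond_exp L (hist_action_algebra n) (indicator {\<omega>\<in>space L. state (Suc n) \<omega> \<in> \<Gamma>}) \<omega>
          = (\<lambda>(h, a). measure (Q (snd h, a)) \<Gamma>) (hist n \<omega>, action n \<omega>)) \<longleftrightarrow>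
        (\<forall>S\<in>sets (histM n \<Otimes>\<^sub>M actM A). emeasure L ((\<lambda>\<omega>. (hist n \<omega>, action n \<omega>)) -` S \<inter> {\<omega>\<in>space L. state (Suc n) \<omega> \<in> \<Gamma>})
       = (\<integral>\<^sup>+\<omega>. indicator S (hist n \<omega>, action n \<omega>) * ennreal ((\<lambda>(h, a). measure (Q (snd h, a)) \<Gamma>) (hist n \<omega>, action n \<omega>)) \<partial>L))"
      unfolding hist_action_algebra_def sp
    proof (rule cond_exp_indicator_iff[OF L])
      have [measurable]: "(\<lambda>z. measure (Q z) \<Gamma>) \<in> borel_measurable Z" by (rule Q_measure_measurable[OF \<Gamma>])
      have "(\<lambda>p. (snd (fst p), snd p)) \<in> histM n \<Otimes>\<^sub>M actM A \<rightarrow>\<^sub>M Z" unfolding histM_def by measurable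
      from measurable_compose[OF this Q_measure_measurable[OF \<Gamma>]]
      show "(\<lambda>(h, a). measure (Q (snd h, a)) \<Gamma>) \<in> borel_measurable (histM n \<Otimes>\<^sub>M actM A)"
        by (simp add: case_prod_beta')
      show "0 \<le> (\<lambda>(h, a). measure (Q (snd h, a)) \<Gamma>) y \<and> (\<lambda>(h, a). measure (Q (snd h, a)) \<Gamma>) y \<le> 1"
        if "y \<in> space (histM n \<Otimes>\<^sub>M actM A)" for y
        using that prob_space.prob_le_1[OF Qsp] by (auto split: prod.split)
    qed measurable
    also have "\<dots> \<longleftrightarrow> (\<forall>S\<in>sets (histM n \<Otimes>\<^sub>M actM A). emeasure L {\<omega> \<in> space L. (hist n \<omega>, action n \<omega>) \<in> S \<and> state (Suc n) \<omega> \<in> \<Gamma>}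
       = (\<integral>\<^sup>+\<omega>. indicator S (hist n \<omega>, action n \<omega>) * emeasure (Q (state n \<omega>, action n \<omega>)) \<Gamma> \<partial>L))"
      by (intro ball_cong refl arg_cong2[where f="(=)"] arg_cong2[where f=emeasure] nn_integral_cong) (auto simp: e snd_hist)
    finally show ?thesis by (simp add: snd_hist)
  qed
  show ?thesis
    unfolding is_law_def using True by (simp add: 1 2)
qed

lemma is_lawD:
  assumes "\<pi> \<in> policies" "is_law \<nu> \<pi> L"
  shows "prob_space L" "sets L = sets trajM" "distr L X (state 0) = \<nu>"
    "B \<in> sets (actM A) \<Longrightarrow> S \<in> sets (histM n) \<Longrightarrow> emeasure L {\<omega> \<in> space L. hist n \<omega> \<in> S \<and> action n \<omega> \<in> B}
       = (\<integral>\<^sup>+\<omega>. indicator S (hist n \<omega>) * emeasure (\<pi> n (hist n \<omega>)) B \<partial>L)"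
    "\<Gamma> \<in> sets X \<Longrightarrow> S' \<in> sets (histM n \<Otimes>\<^sub>M actM A) \<Longrightarrow>
       emeasure L {\<omega> \<in> space L. (hist n \<omega>, action n \<omega>) \<in> S' \<and> state (Suc n) \<omega> \<in> \<Gamma>}
       = (\<integral>\<^sup>+\<omega>. indicator S' (hist n \<omega>, action n \<omega>) * emeasure (Q (state n \<omega>, action n \<omega>)) \<Gamma> \<partial>L)"
proof -
  note D = iffD1[OF is_law_iff[OF assms(1)] assms(2)]
  show "prob_space L" "sets L = sets trajM" "distr L X (state 0) = \<nu>"
    by (rule D[THEN conjunct1] D[THEN conjunct2, THEN conjunct1] D[THEN conjunct2, THEN conjunct2, THEN conjunct1])+
  show "emeasure L {\<omega> \<in> space L. hist n \<omega> \<in> S \<and> action n \<omega> \<in> B}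
       = (\<integral>\<^sup>+\<omega>. indicator S (hist n \<omega>) * emeasure (\<pi> n (hist n \<omega>)) B \<partial>L)"
    if "B \<in> sets (actM A)" "S \<in> sets (histM n)"
    by (rule D[THEN conjunct2, THEN conjunct2, THEN conjunct2, THEN conjunct1, rule_format, OF that])
  show "emeasure L {\<omega> \<in> space L. (hist n \<omega>, action n \<omega>) \<in> S' \<and> state (Suc n) \<omega> \<in> \<Gamma>}
       = (\<integral>\<^sup>+\<omega>. indicator S' (hist n \<omega>, action n \<omega>) * emeasure (Q (state n \<omega>, action n \<omega>)) \<Gamma> \<partial>L)"
    if "\<Gamma> \<in> sets X" "S' \<in> sets (histM n \<Otimes>\<^sub>M actM A)"
    by (rule D[THEN conjunct2, THEN conjunct2, THEN conjunct2, THEN conjunct2, rule_format, OF that])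
qed

end

context control_model
begin

lemma law_hist_action:
  assumes \<pi>: "\<pi> \<in> policies" and L: "is_law \<nu> \<pi> L" and ne: "space X \<noteq> {}"
  shows "distr L (histM n \<Otimes>\<^sub>M actM A) (\<lambda>\<omega>. (hist n \<omega>, action n \<omega>))
    = kprod (histM n) (actM A) (distr L (histM n) (hist n)) (\<pi> n)"
proof -
  note D = is_lawD[OF \<pi> L]
  interpret prob_space L by (rule D)
  note [measurable_cong] = D(2)
  have hne: "space (histM n) \<noteq> {}"
    using not_empty measurable_space[OF hist_measurable] sets_eq_imp_space_eq[OF D(2)] by blast
  have m [measurable]: "(\<lambda>\<omega>. (hist n \<omega>, action n \<omega>)) \<in> L \<rightarrow>\<^sub>M histM n \<Otimes>\<^sub>M actM A" by measurable
  show ?thesis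
  proof (rule measure_eqI_rect[where X="histM n" and Y="actM A"])
    show "finite_measure (distr L (histM n \<Otimes>\<^sub>M actM A) (\<lambda>\<omega>. (hist n \<omega>, action n \<omega>)))"
      by (rule finite_measure_distr[OF m])
    show "sets (kprod (histM n) (actM A) (distr L (histM n) (hist n)) (\<pi> n)) = sets (histM n \<Otimes>\<^sub>M actM A)"
      by (rule sets_kprod[OF _ hne policyD(1)[OF \<pi>]]) simp
    fix S B assume S [measurable]: "S \<in> sets (histM n)" and B [measurable]: "B \<in> sets (actM A)"
    have "emeasure (distr L (histM n \<Otimes>\<^sub>M actM A) (\<lambda>\<omega>. (hist n \<omega>, action n \<omega>))) (S \<times> B)
      = emeasure L {\<omega> \<in> space L. hist n \<omega> \<in> S \<and> action n \<omega> \<in> B}"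
      by (subst emeasure_distr[OF m]) (auto intro!: arg_cong2[where f=emeasure])
    also have "\<dots> = (\<integral>\<^sup>+\<omega>. indicator S (hist n \<omega>) * emeasure (\<pi> n (hist n \<omega>)) B \<partial>L)" by (rule D(4)[OF B S])
    also have "\<dots> = (\<integral>\<^sup>+h. indicator S h * emeasure (\<pi> n h) B \<partial>distr L (histM n) (hist n))"
    proof (rule nn_integral_distr[symmetric])
      have "(\<lambda>h. emeasure (\<pi> n h) B) \<in> borel_measurable (histM n)"
        by (rule measurable_compose[OF measurable_prob_algebraD[OF policyD(1)[OF \<pi>]]])
          (rule measurable_emeasure_subprob_algebra[OF B])
      then have "(\<lambda>h. indicator S h * emeasure (\<pi> n h) B) \<in> borel_measurable (histM n)" by measurable
      then show "(\<lambda>h. indicator S h * emeasure (\<pi> n h) B) \<in> borel_measurable (distr L (histM n) (hist n))" by simp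
    qed measurable
    also have "\<dots> = emeasure (kprod (histM n) (actM A) (distr L (histM n) (hist n)) (\<pi> n)) (S \<times> B)"
      by (subst emeasure_kprod[OF _ hne policyD(1)[OF \<pi>] S B]) (simp_all add: mult.commute)
    finally show "emeasure (distr L (histM n \<Otimes>\<^sub>M actM A) (\<lambda>\<omega>. (hist n \<omega>, action n \<omega>))) (S \<times> B)
      = emeasure (kprod (histM n) (actM A) (distr L (histM n) (hist n)) (\<pi> n)) (S \<times> B)" .
  qed simp
qed

definition extend :: "nat \<Rightarrow> ((nat \<Rightarrow> 'x \<times> 'a) \<times> 'x) \<times> 'a \<Rightarrow> nat \<Rightarrow> 'x \<times> 'a" where
  "extend n p = (fst (fst p))(n := (snd (fst p), snd p))"

lemma extend_measurable [measurable]: "extend n \<in> histM n \<Otimes>\<^sub>M actM A \<rightarrow>\<^sub>M (\<Pi>\<^sub>M i\<in>{0..<Suc n}. Z)"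
  unfolding extend_def histM_def
  by (rule measurable_fun_upd[where J="{0..<n}"]) (auto, measurable)

lemma extend_hist: "extend n (hist n \<omega>, action n \<omega>) = restrict \<omega> {0..<Suc n}"
  by (auto simp: extend_def hist_def state_def action_def restrict_def fun_eq_iff less_Suc_eq)

text \<open>The two clauses of a law determine in turn the joint law of the history and the action, and that of the
  next history; the laws of all histories determine the law of the trajectory.\<close>

lemma law_unique:
  assumes \<pi>: "\<pi> \<in> policies" and L1: "is_law \<nu> \<pi> L1" and L2: "is_law \<nu> \<pi> L2"
  shows "L1 = L2"
proof -
  note D1 = is_lawD[OF \<pi> L1] and D2 = is_lawD[OF \<pi> L2]
  interpret L1: prob_space L1 by (rule D1)
  interpret L2: prob_space L2 by (rule D2)
  have sp: "space L1 = space trajM" "space L2 = space trajM"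
    using D1(2) D2(2) sets_eq_imp_space_eq by blast+
  have ne: "space X \<noteq> {}"
    using L1.not_empty measurable_space[OF state_measurable] sp by blast
  let ?H = "\<lambda>L n. distr L (histM n) (hist n)"
  let ?HA = "\<lambda>L n. distr L (histM n \<Otimes>\<^sub>M actM A) (\<lambda>\<omega>. (hist n \<omega>, action n \<omega>))"
  have HA: "?HA L1 n = ?HA L2 n" if "?H L1 n = ?H L2 n" for n
    using law_hist_action[OF \<pi> L1 ne] law_hist_action[OF \<pi> L2 ne] that by simp
  have H: "?H L1 n = ?H L2 n" for n
  proof (induction n)
    case 0
    have e: "emeasure (?H L 0) (S \<times> \<Gamma>) = indicator S (\<lambda>_. undefined) * emeasure \<nu> \<Gamma>"
      if L: "is_law \<nu> \<pi> L" and S: "S \<in> sets (\<Pi>\<^sub>M i\<in>{0..<0}. Z)" and \<Gamma>: "\<Gamma> \<in> sets X" for L S \<Gamma>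
    proof -
      note D = is_lawD[OF \<pi> L]
      note [measurable_cong] = D(2)
      have R: "S \<times> \<Gamma> \<in> sets (histM 0)" unfolding histM_def using S \<Gamma> by (intro pair_measureI)
      have "emeasure (?H L 0) (S \<times> \<Gamma>) = emeasure L (hist 0 -` (S \<times> \<Gamma>) \<inter> space L)"
        by (rule emeasure_distr) (use R in measurable)
      also have "hist 0 -` (S \<times> \<Gamma>) \<inter> space L = (if (\<lambda>_. undefined) \<in> S then state 0 -` \<Gamma> \<inter> space L else {})"
        by (auto simp: hist_def restrict_def)
      also have "emeasure L \<dots> = indicator S (\<lambda>_. undefined) * emeasure (distr L X (state 0)) \<Gamma>"
        using \<Gamma> by (auto simp: emeasure_distr)
      finally show ?thesis by (simp add: D(3))
    qed
    show ?case
    proof (rule measure_eqI_rect[where X="\<Pi>\<^sub>M i\<in>{0..<0}. Z" and Y=X])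
      show "finite_measure (?H L1 0)" using D1(2) by (intro L1.finite_measure_distr) (simp cong: measurable_cong_sets)
    qed (use e[OF L1] e[OF L2] in \<open>simp_all add: histM_def\<close>)
  next
    case (Suc n)
    have e: "emeasure (?H L (Suc n)) (S \<times> \<Gamma>) =
        (\<integral>\<^sup>+p. indicator S (extend n p) * emeasure (Q (snd (fst p), snd p)) \<Gamma> \<partial>?HA L n)"
      if L: "is_law \<nu> \<pi> L" and S: "S \<in> sets (\<Pi>\<^sub>M i\<in>{0..<Suc n}. Z)" and \<Gamma>: "\<Gamma> \<in> sets X" for L S \<Gamma>
    proof -
      note D = is_lawD[OF \<pi> L]
      note [measurable_cong] = D(2)
      note [measurable] = S \<Gamma>
      have R: "S \<times> \<Gamma> \<in> sets (histM (Suc n))" unfolding histM_def using S \<Gamma> by (intro pair_measureI)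
      let ?S = "extend n -` S \<inter> space (histM n \<Otimes>\<^sub>M actM A)"
      have S': "?S \<in> sets (histM n \<Otimes>\<^sub>M actM A)" by (rule measurable_sets[OF extend_measurable S])
      have hs: "(hist n \<omega>, action n \<omega>) \<in> space (histM n \<Otimes>\<^sub>M actM A)" if "\<omega> \<in> space L" for \<omega>
        using that measurable_space[OF hist_measurable] measurable_space[OF action_measurable]
          sets_eq_imp_space_eq[OF D(2)] by (simp add: space_pair_measure)
      have "emeasure (?H L (Suc n)) (S \<times> \<Gamma>) = emeasure L (hist (Suc n) -` (S \<times> \<Gamma>) \<inter> space L)"
        by (rule emeasure_distr) (use R in measurable)
      also have "hist (Suc n) -` (S \<times> \<Gamma>) \<inter> space L = {\<omega> \<in> space L. (hist n \<omega>, action n \<omega>) \<in> ?S \<and> state (Suc n) \<omega> \<in> \<Gamma>}"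
        using hs by (auto simp: extend_hist hist_def[of "Suc n"])
      also have "emeasure L \<dots> = (\<integral>\<^sup>+\<omega>. indicator ?S (hist n \<omega>, action n \<omega>) * emeasure (Q (state n \<omega>, action n \<omega>)) \<Gamma> \<partial>L)"
        by (rule D(5)[OF \<Gamma> S'])
      also have "\<dots> = (\<integral>\<^sup>+\<omega>. indicator S (extend n (hist n \<omega>, action n \<omega>)) * emeasure (Q (snd (hist n \<omega>), action n \<omega>)) \<Gamma> \<partial>L)"
        using hs by (intro nn_integral_cong) (auto simp: hist_def indicator_def)
      also have "\<dots> = (\<integral>\<^sup>+p. indicator S (extend n p) * emeasure (Q (snd (fst p), snd p)) \<Gamma> \<partial>?HA L n)"
      proof (subst nn_integral_distr)
        have "(\<lambda>p. (snd (fst p), snd p)) \<in> histM n \<Otimes>\<^sub>M actM A \<rightarrow>\<^sub>M Z" unfolding histM_def by measurable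
        from measurable_compose[OF this Q_emeasure_measurable[OF \<Gamma>]]
        have [measurable]: "(\<lambda>p. emeasure (Q (snd (fst p), snd p)) \<Gamma>) \<in> borel_measurable (histM n \<Otimes>\<^sub>M actM A)" .
        have "(\<lambda>p. indicator S (extend n p) * emeasure (Q (snd (fst p), snd p)) \<Gamma>) \<in> borel_measurable (histM n \<Otimes>\<^sub>M actM A)"
          by measurable
        then show "(\<lambda>p. indicator S (extend n p) * emeasure (Q (snd (fst p), snd p)) \<Gamma>) \<in> borel_measurable (?HA L n)"
          by simp
        show "(\<lambda>\<omega>. (hist n \<omega>, action n \<omega>)) \<in> L \<rightarrow>\<^sub>M histM n \<Otimes>\<^sub>M actM A" by measurable
      qed simp
      finally show ?thesis .
    qed
    show ?case
    proof (rule measure_eqI_rect[where X="\<Pi>\<^sub>M i\<in>{0..<Suc n}. Z" and Y=X])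
      show "finite_measure (?H L1 (Suc n))" using D1(2) by (intro L1.finite_measure_distr) (simp cong: measurable_cong_sets)
      show "emeasure (?H L1 (Suc n)) (S \<times> \<Gamma>) = emeasure (?H L2 (Suc n)) (S \<times> \<Gamma>)"
        if "S \<in> sets (\<Pi>\<^sub>M i\<in>{0..<Suc n}. Z)" "\<Gamma> \<in> sets X" for S \<Gamma>
        unfolding e[OF L1 that] e[OF L2 that] HA[OF Suc] ..
    qed (simp_all add: histM_def)
  qed
  show ?thesis
  proof (rule measure_eqI_PiM_infinite[where I=UNIV and M="\<lambda>_. Z"])
    show "sets L1 = sets (\<Pi>\<^sub>M i\<in>UNIV. Z)" "sets L2 = sets (\<Pi>\<^sub>M i\<in>UNIV. Z)"
      using D1(2) D2(2) by (simp_all add: trajM_def)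
    show "finite_measure L1" by (rule L1.finite_measure_axioms)
    fix C :: "nat \<Rightarrow> ('x \<times> 'a) set" and J :: "nat set" assume J: "finite J" and C: "\<And>i. i \<in> J \<Longrightarrow> C i \<in> sets Z"
    obtain n where n: "J \<subseteq> {0..<n}" using finite_nat_bounded[OF J] by (auto simp: atLeast0LessThan)
    let ?S = "prod_emb {0..<n} (\<lambda>_. Z) J (Pi\<^sub>E J C) \<times> space X"
    have "Pi\<^sub>E J C \<in> sets (\<Pi>\<^sub>M i\<in>J. Z)" using J C by (intro sets_PiM_I_finite) auto
    then have S: "?S \<in> sets (histM n)"
      unfolding histM_def using n by (intro pair_measureI measurable_prod_emb) auto
    have "emeasure L (prod_emb UNIV (\<lambda>_. Z) J (Pi\<^sub>E J C)) = emeasure (?H L n) ?S" if "sets L = sets trajM" for L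
    proof -
      have [measurable_cong]: "sets L = sets trajM" by (rule that)
      have spL: "space L = space trajM" using sets_eq_imp_space_eq[OF that] .
      have "emeasure (?H L n) ?S = emeasure L (hist n -` ?S \<inter> space L)"
        by (rule emeasure_distr) (use S in measurable)
      also have "hist n -` ?S \<inter> space L = prod_emb UNIV (\<lambda>_. Z) J (Pi\<^sub>E J C)"
      proof -
        have r: "restrict (restrict \<omega> {0..<n}) J = restrict \<omega> J" for \<omega> :: "nat \<Rightarrow> 'x \<times> 'a"
          using n by (auto simp: restrict_def fun_eq_iff)
        have s: "state n \<omega> \<in> space X" if "\<omega> \<in> space trajM" for \<omega> using measurable_space[OF state_measurable that] .
        have nJ: "{0..<n} \<inter> J = J" using n by blast
        show ?thesis
          unfolding spL
        proof (intro set_eqI iffI)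
          fix \<omega> assume "\<omega> \<in> hist n -` ?S \<inter> space trajM"
          then show "\<omega> \<in> prod_emb UNIV (\<lambda>_. Z) J (Pi\<^sub>E J C)"
            by (auto simp: hist_def prod_emb_iff r space_trajM Pi_iff nJ)
        next
          fix \<omega> assume w: "\<omega> \<in> prod_emb UNIV (\<lambda>_. Z) J (Pi\<^sub>E J C)"
          then have "\<omega> \<in> space trajM" by (auto simp: prod_emb_iff space_trajM)
          moreover have "restrict \<omega> {0..<n} \<in> prod_emb {0..<n} (\<lambda>_. Z) J (Pi\<^sub>E J C)"
            using w by (simp add: prod_emb_iff r nJ)
          ultimately show "\<omega> \<in> hist n -` ?S \<inter> space trajM" using s by (simp add: hist_def)
        qed
      qed
      finally show ?thesis by simp
    qed
    then show "emeasure L1 (prod_emb UNIV (\<lambda>_. Z) J (Pi\<^sub>E J C)) = emeasure L2 (prod_emb UNIV (\<lambda>_. Z) J (Pi\<^sub>E J C))"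
      using D1(2) D2(2) H[of n] by simp
  qed
qed

text \<open>Existence: the pair of next state and action is drawn from a kernel of the past, so the
  Ionescu-Tulcea theorem applies.\<close>

definition next_state :: "'x measure \<Rightarrow> nat \<Rightarrow> (nat \<Rightarrow> 'x \<times> 'a) \<Rightarrow> 'x measure" where
  "next_state \<nu> n h = (case n of 0 \<Rightarrow> \<nu> | Suc m \<Rightarrow> Q (h m))"

definition transition ::
  "'x measure \<Rightarrow> (nat \<Rightarrow> (nat \<Rightarrow> 'x \<times> 'a) \<times> 'x \<Rightarrow> 'a measure) \<Rightarrow> nat \<Rightarrow> (nat \<Rightarrow> 'x \<times> 'a) \<Rightarrow> ('x \<times> 'a) measure" where
  "transition \<nu> \<pi> n h = kprod X (actM A) (next_state \<nu> n h) (\<lambda>x. \<pi> n (h, x))"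

context
  fixes \<nu> \<pi>
  assumes \<nu>: "prob_space \<nu>" "sets \<nu> = sets X" and \<pi>: "\<pi> \<in> policies"
begin

lemma X_nonempty: "space X \<noteq> {}"
  using prob_space.not_empty[OF \<nu>(1)] sets_eq_imp_space_eq[OF \<nu>(2)] by simp

lemma next_state_measurable: "next_state \<nu> n \<in> (\<Pi>\<^sub>M i\<in>{0..<n}. Z) \<rightarrow>\<^sub>M prob_algebra X"
proof (cases n)
  case 0
  have "\<nu> \<in> space (prob_algebra X)" using \<nu> by (simp add: space_prob_algebra)
  then show ?thesis unfolding 0 next_state_def by simp
next
  case (Suc m)
  have "(\<lambda>h. h m) \<in> (\<Pi>\<^sub>M i\<in>{0..<n}. Z) \<rightarrow>\<^sub>M Z" using Suc by simp
  from measurable_compose[OF this Q_kernel] show ?thesis by (simp add: next_state_def[abs_def] Suc)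
qed

lemma policy_section: "h \<in> space (\<Pi>\<^sub>M i\<in>{0..<n}. Z) \<Longrightarrow> (\<lambda>x. \<pi> n (h, x)) \<in> X \<rightarrow>\<^sub>M prob_algebra (actM A)"
  by (rule measurable_compose[OF measurable_Pair1' policyD(1)[OF \<pi>, unfolded histM_def]])

lemma next_state_space:
  assumes "h \<in> space (\<Pi>\<^sub>M i\<in>{0..<n}. Z)"
  shows "prob_space (next_state \<nu> n h)" "sets (next_state \<nu> n h) = sets X"
  using measurable_space[OF next_state_measurable assms] by (auto simp: space_prob_algebra)

lemma transition_measurable: "transition \<nu> \<pi> n \<in> (\<Pi>\<^sub>M i\<in>{0..<n}. Z) \<rightarrow>\<^sub>M prob_algebra Z"
  unfolding transition_def[abs_def] kprod_def
proof (rule measurable_bind_prob_space2[OF next_state_measurable])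
  have p: "(\<lambda>p. \<pi> n p) \<in> (\<Pi>\<^sub>M i\<in>{0..<n}. Z) \<Otimes>\<^sub>M X \<rightarrow>\<^sub>M prob_algebra (actM A)"
    using policyD(1)[OF \<pi>, of n] by (simp add: histM_def)
  have "(\<lambda>p. distr (\<pi> n p) Z (Pair (snd p))) \<in> (\<Pi>\<^sub>M i\<in>{0..<n}. Z) \<Otimes>\<^sub>M X \<rightarrow>\<^sub>M prob_algebra Z"
  proof (rule measurable_prob_algebraI)
    show "(\<lambda>p. distr (\<pi> n p) Z (Pair (snd p))) \<in> (\<Pi>\<^sub>M i\<in>{0..<n}. Z) \<Otimes>\<^sub>M X \<rightarrow>\<^sub>M subprob_algebra Z"
      by (rule measurable_distr2[OF _ measurable_prob_algebraD[OF p]]) (simp add: case_prod_beta')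
    fix q assume q: "q \<in> space ((\<Pi>\<^sub>M i\<in>{0..<n}. Z) \<Otimes>\<^sub>M X)"
    then have x: "snd q \<in> space X" by (auto simp: space_pair_measure)
    have k: "\<pi> n q \<in> space (prob_algebra (actM A))" by (rule measurable_space[OF p q])
    show "prob_space (distr (\<pi> n q) Z (Pair (snd q)))"
    proof (rule prob_space.prob_space_distr)
      show "prob_space (\<pi> n q)" using k by (simp add: space_prob_algebra)
      show "Pair (snd q) \<in> \<pi> n q \<rightarrow>\<^sub>M Z"
        using k measurable_Pair1'[OF x, of "actM A"] by (simp add: space_prob_algebra cong: measurable_cong_sets)
    qed
  qed
  then show "(\<lambda>(h, x). distr (\<pi> n (h, x)) Z (Pair x)) \<in> (\<Pi>\<^sub>M i\<in>{0..<n}. Z) \<Otimes>\<^sub>M X \<rightarrow>\<^sub>M prob_algebra Z"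
    by (simp add: case_prod_beta')
qed

interpretation IT: Ionescu_Tulcea "transition \<nu> \<pi>" "\<lambda>_. Z"
proof (rule Ionescu_Tulcea.intro)
  show "transition \<nu> \<pi> i \<in> (\<Pi>\<^sub>M i\<in>{0..<i}. Z) \<rightarrow>\<^sub>M subprob_algebra Z" for i
    by (rule measurable_prob_algebraD[OF transition_measurable])
  show "prob_space (transition \<nu> \<pi> i x)" if "x \<in> space (\<Pi>\<^sub>M i\<in>{0..<i}. Z)" for i x
    using measurable_space[OF transition_measurable that] by (simp add: space_prob_algebra)
qed

lemma nn_integral_past_next:
  assumes g: "g \<in> borel_measurable ((\<Pi>\<^sub>M i\<in>{0..<n}. Z) \<Otimes>\<^sub>M Z)"
  shows "(\<integral>\<^sup>+\<omega>. g (restrict \<omega> {0..<n}, \<omega> n) \<partial>IT.PF.lim)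
    = (\<integral>\<^sup>+\<omega>. \<integral>\<^sup>+z. g (restrict \<omega> {0..<n}, z) \<partial>transition \<nu> \<pi> n (restrict \<omega> {0..<n}) \<partial>IT.PF.lim)"
proof -
  let ?P = "\<lambda>n. \<Pi>\<^sub>M i\<in>{0..<n}. Z"
  have sl [measurable_cong]: "sets IT.PF.lim = sets (\<Pi>\<^sub>M i\<in>UNIV. Z)" by (rule IT.PF.sets_lim)
  have CI: "distr IT.PF.lim (?P m) (\<lambda>\<omega>. restrict \<omega> {0..<m}) = IT.C 0 m (\<lambda>_. undefined)" for m
  proof -
    have "distr IT.PF.lim (?P m) (\<lambda>\<omega>. restrict \<omega> {0..<m}) = IT.CI {0..<m}" by (rule IT.distr_lim) simp
    also have "\<dots> = IT.C 0 m (\<lambda>_. undefined)"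
    proof (rule measure_eqI)
      fix S assume "S \<in> sets (IT.CI {0..<m})"
      then have S: "S \<in> sets (?P m)" by (simp add: IT.CI_def)
      then show "emeasure (IT.CI {0..<m}) S = emeasure (IT.C 0 m (\<lambda>_. undefined)) S"
        by (subst IT.emeasure_CI[of _ m]) (simp_all add: prod_emb_id[OF sets.sets_into_space[OF S, unfolded space_PiM]])
    qed (simp add: IT.CI_def IT.sets_C)
    finally show ?thesis .
  qed
  have r [measurable]: "(\<lambda>\<omega>. restrict \<omega> {0..<m}) \<in> IT.PF.lim \<rightarrow>\<^sub>M ?P m" for m
    by (simp cong: measurable_cong_sets)
  let ?f = "\<lambda>h. g (restrict h {0..<n}, h n)"
  have f: "?f \<in> borel_measurable (?P (Suc n))"
    by (rule measurable_compose[OF _ g]) (auto intro!: measurable_Pair measurable_restrict_subset)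
  have e: "restrict (restrict \<omega> {0..<Suc n}) {0..<n} = restrict \<omega> {0..<n}" for \<omega> :: "nat \<Rightarrow> 'x \<times> 'a"
    by (auto simp: restrict_def fun_eq_iff)
  have "(\<integral>\<^sup>+\<omega>. g (restrict \<omega> {0..<n}, \<omega> n) \<partial>IT.PF.lim) = (\<integral>\<^sup>+\<omega>. ?f (restrict \<omega> {0..<Suc n}) \<partial>IT.PF.lim)"
    by (simp add: e)
  also have "\<dots> = (\<integral>\<^sup>+h. ?f h \<partial>IT.C 0 (Suc n) (\<lambda>_. undefined))"
    unfolding CI[symmetric] by (rule nn_integral_distr[symmetric, OF r]) (use f in simp)
  also have "\<dots> = (\<integral>\<^sup>+h. \<integral>\<^sup>+h'. ?f h' \<partial>IT.eP n h \<partial>IT.C 0 n (\<lambda>_. undefined))"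
    using f by (simp del: restrict_apply) (subst nn_integral_bind[where B="?P (Suc n)"], auto simp: IT.sets_C cong: measurable_cong_sets)
  also have "\<dots> = (\<integral>\<^sup>+h. \<integral>\<^sup>+z. g (h, z) \<partial>transition \<nu> \<pi> n h \<partial>IT.C 0 n (\<lambda>_. undefined))"
  proof (rule nn_integral_cong)
    fix h assume "h \<in> space (IT.C 0 n (\<lambda>_. undefined))"
    then have h: "h \<in> space (?P n)" by (simp add: IT.space_C)
    then have hr: "restrict (h(n := z)) {0..<n} = h" for z
      by (auto simp: space_PiM PiE_iff extensional_def restrict_def fun_eq_iff)
    have "(\<integral>\<^sup>+h'. ?f h' \<partial>IT.eP n h) = (\<integral>\<^sup>+z. ?f (h(n := z)) \<partial>transition \<nu> \<pi> n h)"
      by (rule IT.nn_integral_eP[OF h f])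
    then show "(\<integral>\<^sup>+h'. ?f h' \<partial>IT.eP n h) = (\<integral>\<^sup>+z. g (h, z) \<partial>transition \<nu> \<pi> n h)" by (simp add: hr)
  qed
  also have "\<dots> = (\<integral>\<^sup>+\<omega>. \<integral>\<^sup>+z. g (restrict \<omega> {0..<n}, z) \<partial>transition \<nu> \<pi> n (restrict \<omega> {0..<n}) \<partial>IT.PF.lim)"
    unfolding CI[symmetric]
  proof (rule nn_integral_distr[OF r])
    have "(\<lambda>h. \<integral>\<^sup>+z. g (h, z) \<partial>transition \<nu> \<pi> n h) \<in> borel_measurable (?P n)"
      by (rule nn_integral_measurable_subprob_algebra2[OF _ measurable_prob_algebraD[OF transition_measurable]])
        (use g in \<open>simp add: case_prod_beta'\<close>)
    then show "(\<lambda>h. \<integral>\<^sup>+z. g (h, z) \<partial>transition \<nu> \<pi> n h) \<in> borel_measurable (distr IT.PF.lim (?P n) (\<lambda>\<omega>. restrict \<omega> {0..<n}))"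
      by simp
  qed
  finally show ?thesis .
qed

lemma nn_integral_transition:
  assumes h: "h \<in> space (\<Pi>\<^sub>M i\<in>{0..<n}. Z)" and f: "f \<in> borel_measurable Z"
  shows "(\<integral>\<^sup>+z. f z \<partial>transition \<nu> \<pi> n h) = (\<integral>\<^sup>+x. \<integral>\<^sup>+a. f (x, a) \<partial>\<pi> n (h, x) \<partial>next_state \<nu> n h)"
  unfolding transition_def
  by (rule nn_integral_kprod[OF next_state_space(2)[OF h] X_nonempty policy_section[OF h] f])

lemma is_law_lim: "is_law \<nu> \<pi> IT.PF.lim"
proof -
  let ?L = "IT.PF.lim"
  let ?P = "\<lambda>n. \<Pi>\<^sub>M i\<in>{0..<n}. Z"
  have s [measurable_cong]: "sets ?L = sets trajM" by (simp add: trajM_def IT.PF.sets_lim)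
  have sp: "space ?L = space trajM" using sets_eq_imp_space_eq[OF s] .
  have past: "restrict \<omega> {0..<n} \<in> space (?P n)" if "\<omega> \<in> space ?L" for \<omega> n
    using that unfolding sp by (rule measurable_space[OF past_measurable])
  have P: "prob_space ?L"
  proof -
    have "prob_space (IT.CI {})" by (rule IT.PF.prob_space_P) simp_all
    then have "prob_space (distr ?L (Pi\<^sub>M {} (\<lambda>_. Z)) (\<lambda>\<omega>. restrict \<omega> {}))" by (simp add: IT.distr_lim)
    then show ?thesis
      by (rule prob_space_distrD[rotated]) (simp cong: measurable_cong_sets add: trajM_def)
  qed
  have init: "distr ?L X (state 0) = \<nu>"
  proof (rule measure_eqI)
    fix \<Gamma> assume "\<Gamma> \<in> sets (distr ?L X (state 0))"
    then have G [measurable]: "\<Gamma> \<in> sets X" by simp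
    have "emeasure (distr ?L X (state 0)) \<Gamma> = (\<integral>\<^sup>+\<omega>. indicator \<Gamma> (state 0 \<omega>) \<partial>?L)"
    proof -
      have "(\<integral>\<^sup>+\<omega>. indicator \<Gamma> (state 0 \<omega>) \<partial>?L) = (\<integral>\<^sup>+x. indicator \<Gamma> x \<partial>distr ?L X (state 0))"
        by (rule nn_integral_distr[symmetric]) simp_all
      then show ?thesis by simp
    qed
    also have "\<dots> = (\<integral>\<^sup>+\<omega>. \<integral>\<^sup>+z. indicator \<Gamma> (fst z) \<partial>transition \<nu> \<pi> 0 (restrict \<omega> {0..<0}) \<partial>?L)"
      using nn_integral_past_next[of "\<lambda>p. indicator \<Gamma> (fst (snd p))" 0] by (simp add: state_def)
    also have "\<dots> = (\<integral>\<^sup>+\<omega>. emeasure \<nu> \<Gamma> \<partial>?L)"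
    proof (rule nn_integral_cong)
      fix \<omega> assume "\<omega> \<in> space ?L"
      then have h: "restrict \<omega> {0..<0} \<in> space (?P 0)" by (rule past)
      have "(\<integral>\<^sup>+z. indicator \<Gamma> (fst z) \<partial>transition \<nu> \<pi> 0 (restrict \<omega> {0..<0}))
        = (\<integral>\<^sup>+x. \<integral>\<^sup>+a. indicator \<Gamma> x \<partial>\<pi> 0 (restrict \<omega> {0..<0}, x) \<partial>next_state \<nu> 0 (restrict \<omega> {0..<0}))"
        by (subst nn_integral_transition[OF h]) simp_all
      also have "\<dots> = (\<integral>\<^sup>+x. indicator \<Gamma> x \<partial>\<nu>)"
        unfolding next_state_def nat.case
      proof (rule nn_integral_cong)
        fix x assume "x \<in> space \<nu>"
        then have "(restrict \<omega> {0..<0}, x) \<in> space (histM 0)"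
          using h sets_eq_imp_space_eq[OF \<nu>(2)] by (simp add: histM_def space_pair_measure)
        from prob_space.emeasure_space_1[OF policyD(3)[OF \<pi> this]]
        show "(\<integral>\<^sup>+a. indicator \<Gamma> x \<partial>\<pi> 0 (restrict \<omega> {0..<0}, x)) = indicator \<Gamma> x" by simp
      qed
      also have "\<dots> = emeasure \<nu> \<Gamma>" using G \<nu>(2) by simp
      finally show "(\<integral>\<^sup>+z. indicator \<Gamma> (fst z) \<partial>transition \<nu> \<pi> 0 (restrict \<omega> {0..<0})) = emeasure \<nu> \<Gamma>" .
    qed
    also have "\<dots> = emeasure \<nu> \<Gamma>" using prob_space.emeasure_space_1[OF P] by simp
    finally show "emeasure (distr ?L X (state 0)) \<Gamma> = emeasure \<nu> \<Gamma>" .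
  qed (simp add: \<nu>)
  have act: "emeasure ?L {\<omega> \<in> space ?L. hist n \<omega> \<in> S \<and> action n \<omega> \<in> B}
       = (\<integral>\<^sup>+\<omega>. indicator S (hist n \<omega>) * emeasure (\<pi> n (hist n \<omega>)) B \<partial>?L)"
    if B [measurable]: "B \<in> sets (actM A)" and S: "S \<in> sets (histM n)" for n B S
  proof -
    have S' [measurable]: "S \<in> sets (?P n \<Otimes>\<^sub>M X)" using S by (simp add: histM_def)
    have mS [measurable]: "(\<lambda>p. indicator S (fst p, fst (snd p)) :: ennreal) \<in> borel_measurable (?P n \<Otimes>\<^sub>M Z)"
      by (rule measurable_compose[OF _ borel_measurable_indicator[OF S']]) measurable
    have mB [measurable]: "(\<lambda>p. indicator B (snd (snd p)) :: ennreal) \<in> borel_measurable (?P n \<Otimes>\<^sub>M Z)"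
      by (rule measurable_compose[OF _ borel_measurable_indicator[OF B]]) measurable
    have em: "(\<lambda>h. emeasure (\<pi> n h) B) \<in> borel_measurable (?P n \<Otimes>\<^sub>M X)"
      using measurable_compose[OF measurable_prob_algebraD[OF policyD(1)[OF \<pi>]] measurable_emeasure_subprob_algebra[OF B], of n]
      by (simp add: histM_def)
    have em' [measurable]: "(\<lambda>p. emeasure (\<pi> n (fst p, fst (snd p))) B) \<in> borel_measurable (?P n \<Otimes>\<^sub>M Z)"
      by (rule measurable_compose[OF _ em]) measurable
    have "emeasure ?L {\<omega> \<in> space ?L. hist n \<omega> \<in> S \<and> action n \<omega> \<in> B}
        = (\<integral>\<^sup>+\<omega>. indicator {\<omega> \<in> space ?L. hist n \<omega> \<in> S \<and> action n \<omega> \<in> B} \<omega> \<partial>?L)"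
    proof (rule nn_integral_indicator[symmetric])
      have H: "hist n \<in> ?L \<rightarrow>\<^sub>M histM n" and C: "action n \<in> ?L \<rightarrow>\<^sub>M actM A"
        unfolding measurable_cong_sets[OF s refl] by (rule hist_measurable action_measurable)+
      have "{\<omega> \<in> space ?L. hist n \<omega> \<in> S \<and> action n \<omega> \<in> B} = (hist n -` S \<inter> space ?L) \<inter> (action n -` B \<inter> space ?L)" by auto
      then show "{\<omega> \<in> space ?L. hist n \<omega> \<in> S \<and> action n \<omega> \<in> B} \<in> sets ?L"
        using sets.Int[OF measurable_sets[OF H S] measurable_sets[OF C B]] by simp
    qed
    also have "\<dots> = (\<integral>\<^sup>+\<omega>. (\<lambda>p. indicator S (fst p, fst (snd p)) * indicator B (snd (snd p))) (restrict \<omega> {0..<n}, \<omega> n) \<partial>?L)"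
      by (intro nn_integral_cong) (auto simp: indicator_def hist_def state_def action_def)
    also have "\<dots> = (\<integral>\<^sup>+\<omega>. \<integral>\<^sup>+z. indicator S (restrict \<omega> {0..<n}, fst z) * indicator B (snd z) \<partial>transition \<nu> \<pi> n (restrict \<omega> {0..<n}) \<partial>?L)"
      by (subst nn_integral_past_next[OF borel_measurable_times_ennreal[OF mS mB]]) simp
    also have "\<dots> = (\<integral>\<^sup>+\<omega>. \<integral>\<^sup>+z. indicator S (restrict \<omega> {0..<n}, fst z) * emeasure (\<pi> n (restrict \<omega> {0..<n}, fst z)) B \<partial>transition \<nu> \<pi> n (restrict \<omega> {0..<n}) \<partial>?L)"
    proof (rule nn_integral_cong)
      fix \<omega> assume "\<omega> \<in> space ?L"
      let ?h = "restrict \<omega> {0..<n}"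
      have h: "?h \<in> space (?P n)" by (rule past) fact
      have S2 [measurable]: "(\<lambda>z. indicator S (?h, fst z) :: ennreal) \<in> borel_measurable Z"
        by (rule measurable_compose[OF _ borel_measurable_indicator[OF S']]) (use h in measurable)
      have B2: "(\<lambda>z. indicator B (snd z) :: ennreal) \<in> borel_measurable Z"
        by (rule measurable_compose[OF _ borel_measurable_indicator[OF B]]) measurable
      have E2 [measurable]: "(\<lambda>z. emeasure (\<pi> n (?h, fst z)) B) \<in> borel_measurable Z"
        by (rule measurable_compose[OF _ em]) (use h in measurable)
      have "(\<integral>\<^sup>+z. indicator S (?h, fst z) * indicator B (snd z) \<partial>transition \<nu> \<pi> n ?h)
        = (\<integral>\<^sup>+x. \<integral>\<^sup>+a. indicator S (?h, x) * indicator B a \<partial>\<pi> n (?h, x) \<partial>next_state \<nu> n ?h)"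
        by (subst nn_integral_transition[OF h borel_measurable_times_ennreal[OF S2 B2]]) simp
      also have "\<dots> = (\<integral>\<^sup>+x. \<integral>\<^sup>+a. indicator S (?h, x) * emeasure (\<pi> n (?h, x)) B \<partial>\<pi> n (?h, x) \<partial>next_state \<nu> n ?h)"
      proof (rule nn_integral_cong)
        fix x assume "x \<in> space (next_state \<nu> n ?h)"
        then have "x \<in> space X" using sets_eq_imp_space_eq[OF next_state_space(2)[OF h]] by simp
        then have hx: "(?h, x) \<in> space (histM n)" using h by (simp add: histM_def space_pair_measure)
        have "B \<in> sets (\<pi> n (?h, x))" using policyD(4)[OF \<pi> hx] B by simp
        then show "(\<integral>\<^sup>+a. indicator S (?h, x) * indicator B a \<partial>\<pi> n (?h, x)) = (\<integral>\<^sup>+a. indicator S (?h, x) * emeasure (\<pi> n (?h, x)) B \<partial>\<pi> n (?h, x))"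
          using prob_space.emeasure_space_1[OF policyD(3)[OF \<pi> hx]] by (simp add: nn_integral_cmult)
      qed
      also have "\<dots> = (\<integral>\<^sup>+z. indicator S (?h, fst z) * emeasure (\<pi> n (?h, fst z)) B \<partial>transition \<nu> \<pi> n ?h)"
        by (subst nn_integral_transition[OF h borel_measurable_times_ennreal[OF S2 E2]]) simp
      finally show "(\<integral>\<^sup>+z. indicator S (?h, fst z) * indicator B (snd z) \<partial>transition \<nu> \<pi> n ?h)
        = (\<integral>\<^sup>+z. indicator S (?h, fst z) * emeasure (\<pi> n (?h, fst z)) B \<partial>transition \<nu> \<pi> n ?h)" .
    qed
    also have "\<dots> = (\<integral>\<^sup>+\<omega>. (\<lambda>p. indicator S (fst p, fst (snd p)) * emeasure (\<pi> n (fst p, fst (snd p))) B) (restrict \<omega> {0..<n}, \<omega> n) \<partial>?L)"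
      by (subst nn_integral_past_next[OF borel_measurable_times_ennreal[OF mS em']]) simp
    also have "\<dots> = (\<integral>\<^sup>+\<omega>. indicator S (hist n \<omega>) * emeasure (\<pi> n (hist n \<omega>)) B \<partial>?L)"
      by (simp add: hist_def state_def)
    finally show ?thesis .
  qed
  have nxt: "emeasure ?L {\<omega> \<in> space ?L. (hist n \<omega>, action n \<omega>) \<in> S \<and> state (Suc n) \<omega> \<in> \<Gamma>}
       = (\<integral>\<^sup>+\<omega>. indicator S (hist n \<omega>, action n \<omega>) * emeasure (Q (state n \<omega>, action n \<omega>)) \<Gamma> \<partial>?L)"
    if G [measurable]: "\<Gamma> \<in> sets X" and S [measurable]: "S \<in> sets (histM n \<Otimes>\<^sub>M actM A)" for n \<Gamma> S
  proof -
    have split: "(\<lambda>h. ((restrict h {0..<n}, fst (h n)), snd (h n))) \<in> ?P (Suc n) \<rightarrow>\<^sub>M histM n \<Otimes>\<^sub>M actM A"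
    proof -
      have [measurable]: "(\<lambda>h. restrict h {0..<n}) \<in> ?P (Suc n) \<rightarrow>\<^sub>M ?P n" by (rule measurable_restrict_subset) simp
      have [measurable]: "(\<lambda>h. h n) \<in> ?P (Suc n) \<rightarrow>\<^sub>M Z" by simp
      show ?thesis unfolding histM_def by measurable
    qed
    let ?g = "\<lambda>h. indicator S ((restrict h {0..<n}, fst (h n)), snd (h n)) :: ennreal"
    have g [measurable]: "?g \<in> borel_measurable (?P (Suc n))"
      by (rule measurable_compose[OF split borel_measurable_indicator[OF S]])
    have ge: "?g (restrict \<omega> {0..<Suc n}) = indicator S (hist n \<omega>, action n \<omega>)" for \<omega>
    proof -
      have "restrict (restrict \<omega> {0..<Suc n}) {0..<n} = restrict \<omega> {0..<n}" by (auto simp: restrict_def fun_eq_iff)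
      then show ?thesis by (simp add: hist_def state_def action_def)
    qed
    have "emeasure ?L {\<omega> \<in> space ?L. (hist n \<omega>, action n \<omega>) \<in> S \<and> state (Suc n) \<omega> \<in> \<Gamma>}
        = (\<integral>\<^sup>+\<omega>. indicator {\<omega> \<in> space ?L. (hist n \<omega>, action n \<omega>) \<in> S \<and> state (Suc n) \<omega> \<in> \<Gamma>} \<omega> \<partial>?L)"
      by (intro nn_integral_indicator[symmetric]) measurable
    also have "\<dots> = (\<integral>\<^sup>+\<omega>. (\<lambda>p. ?g (fst p) * indicator \<Gamma> (fst (snd p))) (restrict \<omega> {0..<Suc n}, \<omega> (Suc n)) \<partial>?L)"
      by (intro nn_integral_cong) (simp add: ge, auto simp: indicator_def state_def hist_def action_def)
    also have "\<dots> = (\<integral>\<^sup>+\<omega>. \<integral>\<^sup>+z. ?g (restrict \<omega> {0..<Suc n}) * indicator \<Gamma> (fst z) \<partial>transition \<nu> \<pi> (Suc n) (restrict \<omega> {0..<Suc n}) \<partial>?L)"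
      by (subst nn_integral_past_next) (auto intro!: borel_measurable_times_ennreal measurable_compose[OF _ g] measurable_compose[OF _ borel_measurable_indicator[OF G]])
    also have "\<dots> = (\<integral>\<^sup>+\<omega>. indicator S (hist n \<omega>, action n \<omega>) * emeasure (Q (state n \<omega>, action n \<omega>)) \<Gamma> \<partial>?L)"
    proof (rule nn_integral_cong)
      fix \<omega> assume w: "\<omega> \<in> space ?L"
      let ?h = "restrict \<omega> {0..<Suc n}"
      have h: "?h \<in> space (?P (Suc n))" by (rule past) fact
      have ns: "next_state \<nu> (Suc n) ?h = Q (state n \<omega>, action n \<omega>)"
        by (simp add: next_state_def state_def action_def)
      have "(\<integral>\<^sup>+z. ?g ?h * indicator \<Gamma> (fst z) \<partial>transition \<nu> \<pi> (Suc n) ?h)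
        = (\<integral>\<^sup>+x. \<integral>\<^sup>+a. ?g ?h * indicator \<Gamma> x \<partial>\<pi> (Suc n) (?h, x) \<partial>next_state \<nu> (Suc n) ?h)"
        by (subst nn_integral_transition[OF h]) simp_all
      also have "\<dots> = (\<integral>\<^sup>+x. ?g ?h * indicator \<Gamma> x \<partial>next_state \<nu> (Suc n) ?h)"
      proof (rule nn_integral_cong)
        fix x assume "x \<in> space (next_state \<nu> (Suc n) ?h)"
        then have "x \<in> space X" using sets_eq_imp_space_eq[OF next_state_space(2)[OF h]] by simp
        then have hx: "(?h, x) \<in> space (histM (Suc n))" using h by (simp add: histM_def space_pair_measure)
        show "(\<integral>\<^sup>+a. ?g ?h * indicator \<Gamma> x \<partial>\<pi> (Suc n) (?h, x)) = ?g ?h * indicator \<Gamma> x"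
          using prob_space.emeasure_space_1[OF policyD(3)[OF \<pi> hx]] by simp
      qed
      also have "\<dots> = ?g ?h * emeasure (next_state \<nu> (Suc n) ?h) \<Gamma>"
        using G next_state_space(2)[OF h] by (simp add: nn_integral_cmult)
      finally show "(\<integral>\<^sup>+z. ?g ?h * indicator \<Gamma> (fst z) \<partial>transition \<nu> \<pi> (Suc n) ?h)
        = indicator S (hist n \<omega>, action n \<omega>) * emeasure (Q (state n \<omega>, action n \<omega>)) \<Gamma>"
        unfolding ge ns .
    qed
    finally show ?thesis .
  qed
  show ?thesis
    unfolding is_law_iff[OF \<pi>] using P s init act nxt by blast
qed

lemma is_law_law: "is_law \<nu> \<pi> (law \<nu> \<pi>)"
  unfolding law_def by (rule theI[of _ "IT.PF.lim"]) (use is_law_lim law_unique[OF \<pi>] in blast)+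

end

end

section \<open>State laws and the balance equation of occupation measures\<close>

lemma ennreal_of_enat_eq_suminf: "ennreal_of_enat k = (\<Sum>t. indicator {t. enat t < k} t)"
proof (cases k)
  case (enat n)
  have "(\<Sum>t. indicator {t. enat t < k} t :: ennreal) = (\<Sum>t<n. indicator {t. enat t < k} t)"
    by (rule suminf_finite) (auto simp: enat indicator_def)
  also have "\<dots> = of_nat n" by (simp add: enat indicator_def)
  finally show ?thesis by (simp add: enat)
next
  case infinity
  have "(\<Sum>t::nat. 1::ennreal) = (\<integral>\<^sup>+t. 1 \<partial>count_space (UNIV::nat set))"
    by (simp only: nn_integral_count_space_nat)
  also have "\<dots> = \<top>" by simp
  finally have "(\<Sum>t::nat. 1::ennreal) = \<top>" .
  then show ?thesis by (simp add: infinity)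
qed

context control_model
begin

lemma markov_kernelD:
  assumes "\<sigma> \<in> markov_kernels"
  shows "\<sigma> \<in> X \<rightarrow>\<^sub>M prob_algebra (actM A)" "x \<in> space X \<Longrightarrow> emeasure (\<sigma> x) (As x) = 1"
    "x \<in> space X \<Longrightarrow> prob_space (\<sigma> x)" "x \<in> space X \<Longrightarrow> sets (\<sigma> x) = sets (actM A)"
proof -
  show s: "\<sigma> \<in> X \<rightarrow>\<^sub>M prob_algebra (actM A)" "x \<in> space X \<Longrightarrow> emeasure (\<sigma> x) (As x) = 1"
    using assms by (auto simp: markov_kernels_def)
  show "x \<in> space X \<Longrightarrow> prob_space (\<sigma> x)" "x \<in> space X \<Longrightarrow> sets (\<sigma> x) = sets (actM A)"
    using measurable_space[OF s(1), of x] by (auto simp: space_prob_algebra)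
qed

definition markov_policy :: "(nat \<Rightarrow> 'x \<Rightarrow> 'a measure) \<Rightarrow> nat \<Rightarrow> (nat \<Rightarrow> 'x \<times> 'a) \<times> 'x \<Rightarrow> 'a measure" where
  "markov_policy s n h = s n (snd h)"

lemma stationary_eq: "stationary \<sigma> = markov_policy (\<lambda>_. \<sigma>)"
  by (simp add: fun_eq_iff stationary_def markov_policy_def)

lemma markov_policy_in:
  assumes s: "\<And>n. s n \<in> markov_kernels"
  shows "markov_policy s \<in> policies"
  unfolding policies_def markov_policy_def[abs_def]
proof (intro CollectI allI conjI ballI)
  fix n
  show "(\<lambda>h. s n (snd h)) \<in> histM n \<rightarrow>\<^sub>M prob_algebra (actM A)"
    unfolding histM_def by (rule measurable_compose[OF measurable_snd markov_kernelD(1)[OF s]])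
  fix h assume "h \<in> space (histM n)"
  then show "emeasure (s n (snd h)) (As (snd h)) = 1"
    by (intro markov_kernelD(2)[OF s]) (auto simp: histM_def space_pair_measure)
qed

text \<open>The transition operator of a stationary policy.\<close>

definition evolve :: "('x \<Rightarrow> 'a measure) \<Rightarrow> ('x \<Rightarrow> ennreal) \<Rightarrow> 'x \<Rightarrow> ennreal" where
  "evolve \<sigma> f x = (\<integral>\<^sup>+a. \<integral>\<^sup>+y. f y \<partial>Q (x, a) \<partial>\<sigma> x)"

lemma nn_integral_Q_measurable:
  assumes "f \<in> borel_measurable X"
  shows "(\<lambda>z. \<integral>\<^sup>+y. f y \<partial>Q z) \<in> borel_measurable Z"
  by (rule measurable_compose[OF measurable_prob_algebraD[OF Q_kernel] nn_integral_measurable_subprob_algebra[OF assms]])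

lemma evolve_measurable:
  assumes \<sigma>: "\<sigma> \<in> markov_kernels" and f: "f \<in> borel_measurable X"
  shows "evolve \<sigma> f \<in> borel_measurable X"
  unfolding evolve_def[abs_def]
  by (rule nn_integral_measurable_subprob_algebra2[OF _ measurable_prob_algebraD[OF markov_kernelD(1)[OF \<sigma>]]])
    (use nn_integral_Q_measurable[OF f] in \<open>simp add: case_prod_beta'\<close>)

lemma evolve_iter_measurable:
  assumes \<sigma>: "\<sigma> \<in> markov_kernels" and f: "f \<in> borel_measurable X"
  shows "(evolve \<sigma> ^^ k) f \<in> borel_measurable X"
  by (induction k) (auto simp: f evolve_measurable[OF \<sigma>])

lemma sec_in:
  assumes \<sigma>: "\<sigma> \<in> markov_kernels" and x: "x \<in> space X"
  shows "space (\<sigma> x) = A" "a \<in> A \<Longrightarrow> (x, a) \<in> space Z"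
  using sets_eq_imp_space_eq[OF markov_kernelD(4)[OF \<sigma> x]] x by (simp_all add: space_act space_pair_measure)

lemma evolve_cong_mono:
  assumes \<sigma>: "\<sigma> \<in> markov_kernels" and x: "x \<in> space X" and le: "\<And>y. y \<in> space X \<Longrightarrow> f y \<le> g y"
  shows "evolve \<sigma> f x \<le> evolve \<sigma> g x"
  unfolding evolve_def
proof (intro nn_integral_mono)
  fix a y assume "a \<in> space (\<sigma> x)" and y: "y \<in> space (Q (x, a))"
  then have "(x, a) \<in> space Z" using sec_in[OF \<sigma> x] by simp
  then have "space (Q (x, a)) = space X" using Q_space sets_eq_imp_space_eq by blast
  then show "f y \<le> g y" using y le by simp
qed

lemma evolve_iter_mono:
  assumes \<sigma>: "\<sigma> \<in> markov_kernels" and x: "x \<in> space X" and le: "\<And>y. y \<in> space X \<Longrightarrow> f y \<le> g y"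
  shows "(evolve \<sigma> ^^ k) f x \<le> (evolve \<sigma> ^^ k) g x"
  using x
proof (induction k arbitrary: x)
  case (Suc k)
  then show ?case by (auto intro!: evolve_cong_mono[OF \<sigma>])
qed (use le in auto)

lemma evolve_le_1:
  assumes \<sigma>: "\<sigma> \<in> markov_kernels" and x: "x \<in> space X" and le: "\<And>y. y \<in> space X \<Longrightarrow> f y \<le> 1"
  shows "(evolve \<sigma> ^^ k) f x \<le> 1"
  using x
proof (induction k arbitrary: x)
  case (Suc k)
  have "evolve \<sigma> ((evolve \<sigma> ^^ k) f) x \<le> evolve \<sigma> (\<lambda>_. 1) x"
    using Suc by (intro evolve_cong_mono[OF \<sigma>]) auto
  also have "\<dots> = (\<integral>\<^sup>+a. 1 \<partial>\<sigma> x)"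
    unfolding evolve_def
  proof (rule nn_integral_cong)
    fix a assume "a \<in> space (\<sigma> x)"
    then have "(x, a) \<in> space Z" using sec_in[OF \<sigma> Suc.prems] by simp
    then have "prob_space (Q (x, a))" using Q_space by blast
    from prob_space.emeasure_space_1[OF this] show "(\<integral>\<^sup>+y. 1 \<partial>Q (x, a)) = 1" by simp
  qed
  also have "\<dots> = 1" using prob_space.emeasure_space_1[OF markov_kernelD(3)[OF \<sigma> Suc.prems]] by simp
  finally show ?case by simp
qed (use le in auto)

lemma Dc_sets [measurable]: "space X - \<Delta> \<in> sets X"
  using Delta_measurable by auto

lemma hitting_time_gt: "enat t < hitting_time \<omega> \<longleftrightarrow> (\<forall>n\<le>t. state n \<omega> \<notin> \<Delta>)"
proof
  assume h: "enat t < hitting_time \<omega>"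
  show "\<forall>n\<le>t. state n \<omega> \<notin> \<Delta>"
  proof (intro allI impI notI)
    fix n assume "n \<le> t" "state n \<omega> \<in> \<Delta>"
    then have "hitting_time \<omega> \<le> enat n" unfolding hitting_time_def by (auto intro: INF_lower)
    then show False using h \<open>n \<le> t\<close> by (metis enat_ord_simps(1) leD order_trans)
  qed
next
  assume h: "\<forall>n\<le>t. state n \<omega> \<notin> \<Delta>"
  have "enat (Suc t) \<le> hitting_time \<omega>"
    unfolding hitting_time_def
  proof (rule INF_greatest)
    fix n assume "n \<in> {n. state n \<omega> \<in> \<Delta>}"
    then have "\<not> n \<le> t" using h by auto
    then show "enat (Suc t) \<le> enat n" by simp
  qed
  then show "enat t < hitting_time \<omega>" by (metis Suc_ile_eq)
qed

end

locale initial_model = control_model X A As Q \<Delta>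
  for X :: "'x measure" and A :: "'a::polish_space set" and As Q \<Delta> +
  fixes \<eta> :: "'x measure"
  assumes prob_\<eta>: "prob_space \<eta>" and sets_\<eta>: "sets \<eta> = sets X"
begin

lemma X_ne: "space X \<noteq> {}"
  using prob_space.not_empty[OF prob_\<eta>] sets_eq_imp_space_eq[OF sets_\<eta>] by simp

definition pair_law :: "(nat \<Rightarrow> (nat \<Rightarrow> 'x \<times> 'a) \<times> 'x \<Rightarrow> 'a measure) \<Rightarrow> nat \<Rightarrow> ('x \<times> 'a) measure" where
  "pair_law \<pi> n = distr (law \<eta> \<pi>) Z (\<lambda>\<omega>. \<omega> n)"

definition state_law :: "(nat \<Rightarrow> (nat \<Rightarrow> 'x \<times> 'a) \<times> 'x \<Rightarrow> 'a measure) \<Rightarrow> nat \<Rightarrow> 'x measure" where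
  "state_law \<pi> n = distr (law \<eta> \<pi>) X (state n)"

lemma sets_pair_law [measurable_cong]: "sets (pair_law \<pi> n) = sets Z"
  by (simp add: pair_law_def)

lemma sets_state_law [measurable_cong]: "sets (state_law \<pi> n) = sets X"
  by (simp add: state_law_def)

lemma space_pair_law: "space (pair_law \<pi> n) = space Z"
  by (simp add: pair_law_def)

context
  fixes \<pi> assumes \<pi>: "\<pi> \<in> policies"
begin

lemmas lawD = is_lawD[OF \<pi> is_law_law[OF prob_\<eta> sets_\<eta> \<pi>]]

lemma sets_law [measurable_cong]: "sets (law \<eta> \<pi>) = sets trajM"
  by (rule lawD)

lemma space_law: "space (law \<eta> \<pi>) = space trajM"
  using sets_eq_imp_space_eq[OF sets_law] .

lemma coord_m [measurable]: "(\<lambda>\<omega>. \<omega> n) \<in> law \<eta> \<pi> \<rightarrow>\<^sub>M Z"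
  by measurable

lemma prob_pair_law: "prob_space (pair_law \<pi> n)"
  unfolding pair_law_def by (rule prob_space.prob_space_distr[OF lawD(1)]) measurable

lemma prob_state_law: "prob_space (state_law \<pi> n)"
  unfolding state_law_def by (rule prob_space.prob_space_distr[OF lawD(1)]) measurable

lemma state_law_0: "state_law \<pi> 0 = \<eta>"
  unfolding state_law_def by (rule lawD)

lemma pair_law_fst: "distr (pair_law \<pi> n) X fst = state_law \<pi> n"
  unfolding pair_law_def state_law_def
  by (subst distr_distr) (auto simp: comp_def state_def[abs_def])

lemma state_law_Suc: "state_law \<pi> (Suc n) = pair_law \<pi> n \<bind> Q"
proof (rule measure_eqI)
  have Qm: "Q \<in> pair_law \<pi> n \<rightarrow>\<^sub>M subprob_algebra X"
    unfolding measurable_cong_sets[OF sets_pair_law refl] by (rule measurable_prob_algebraD[OF Q_kernel])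
  have ne: "space (pair_law \<pi> n) \<noteq> {}" by (rule prob_space.not_empty[OF prob_pair_law])
  show "sets (state_law \<pi> (Suc n)) = sets (pair_law \<pi> n \<bind> Q)"
    using sets_bind[OF sets_kernel[OF Qm] ne] by (simp add: sets_state_law)
  fix \<Gamma> assume "\<Gamma> \<in> sets (state_law \<pi> (Suc n))"
  then have G [measurable]: "\<Gamma> \<in> sets X" by (simp add: sets_state_law)
  have hs: "(hist n \<omega>, action n \<omega>) \<in> space (histM n \<Otimes>\<^sub>M actM A)" if "\<omega> \<in> space (law \<eta> \<pi>)" for \<omega>
    using that measurable_space[OF hist_measurable] measurable_space[OF action_measurable]
    by (simp add: space_pair_measure space_law)
  have "emeasure (state_law \<pi> (Suc n)) \<Gamma> = emeasure (law \<eta> \<pi>) (state (Suc n) -` \<Gamma> \<inter> space (law \<eta> \<pi>))"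
    unfolding state_law_def by (rule emeasure_distr) measurable
  also have "state (Suc n) -` \<Gamma> \<inter> space (law \<eta> \<pi>) =
      {\<omega> \<in> space (law \<eta> \<pi>). (hist n \<omega>, action n \<omega>) \<in> space (histM n \<Otimes>\<^sub>M actM A) \<and> state (Suc n) \<omega> \<in> \<Gamma>}"
    using hs by auto
  also have "emeasure (law \<eta> \<pi>) \<dots> = (\<integral>\<^sup>+\<omega>. indicator (space (histM n \<Otimes>\<^sub>M actM A)) (hist n \<omega>, action n \<omega>) * emeasure (Q (state n \<omega>, action n \<omega>)) \<Gamma> \<partial>law \<eta> \<pi>)"
    by (rule lawD(5)[OF G sets.top])
  also have "\<dots> = (\<integral>\<^sup>+\<omega>. emeasure (Q (\<omega> n)) \<Gamma> \<partial>law \<eta> \<pi>)"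
    using hs by (intro nn_integral_cong) (auto simp: state_def action_def)
  also have "\<dots> = (\<integral>\<^sup>+z. emeasure (Q z) \<Gamma> \<partial>pair_law \<pi> n)"
    unfolding pair_law_def by (rule nn_integral_distr[symmetric]) (use Q_emeasure_measurable[OF G] in simp_all)
  also have "\<dots> = emeasure (pair_law \<pi> n \<bind> Q) \<Gamma>"
    by (rule emeasure_bind[OF ne Qm G, symmetric])
  finally show "emeasure (state_law \<pi> (Suc n)) \<Gamma> = emeasure (pair_law \<pi> n \<bind> Q) \<Gamma>" .
qed

lemma nn_integral_state_Suc:
  assumes f: "f \<in> borel_measurable X"
  shows "(\<integral>\<^sup>+x. f x \<partial>state_law \<pi> (Suc n)) = (\<integral>\<^sup>+z. \<integral>\<^sup>+y. f y \<partial>Q z \<partial>pair_law \<pi> n)"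
  unfolding state_law_Suc
  by (rule nn_integral_bind[OF f])
    (unfold measurable_cong_sets[OF sets_pair_law refl], rule measurable_prob_algebraD[OF Q_kernel])

lemma nn_integral_state_law:
  assumes f: "f \<in> borel_measurable X"
  shows "(\<integral>\<^sup>+x. f x \<partial>state_law \<pi> n) = (\<integral>\<^sup>+z. f (fst z) \<partial>pair_law \<pi> n)"
  unfolding pair_law_fst[symmetric] using f
  by (intro nn_integral_distr) (simp_all add: measurable_cong_sets[OF sets_pair_law refl])

lemma pair_law_K: "AE z in pair_law \<pi> n. snd z \<in> As (fst z)"
proof -
  let ?L = "law \<eta> \<pi>" and ?N = "histM n \<Otimes>\<^sub>M actM A"
  let ?H = "distr ?L (histM n) (hist n)"
  have hne: "space (histM n) \<noteq> {}"
    using prob_space.not_empty[OF lawD(1)] measurable_space[OF hist_measurable] space_law by blast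
  have proj: "(\<lambda>p. (snd (fst p), snd p)) \<in> ?N \<rightarrow>\<^sub>M Z" unfolding histM_def by measurable
  let ?K = "SIGMA x:space X. As x"
  have K: "?K \<in> sets Z" by (rule K_measurable)
  have ha: "(\<lambda>\<omega>. (hist n \<omega>, action n \<omega>)) \<in> ?L \<rightarrow>\<^sub>M ?N" by measurable
  have "distr (distr ?L ?N (\<lambda>\<omega>. (hist n \<omega>, action n \<omega>))) Z (\<lambda>p. (snd (fst p), snd p)) = pair_law \<pi> n"
    unfolding pair_law_def
    by (subst distr_distr[OF proj ha]) (simp add: comp_def hist_def state_def action_def)
  then have E: "pair_law \<pi> n = distr (kprod (histM n) (actM A) ?H (\<pi> n)) Z (\<lambda>p. (snd (fst p), snd p))"
    unfolding law_hist_action[OF \<pi> is_law_law[OF prob_\<eta> sets_\<eta> \<pi>] X_ne] ..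
  have sk: "sets (kprod (histM n) (actM A) ?H (\<pi> n)) = sets ?N"
    by (rule sets_kprod[OF _ hne policyD(1)[OF \<pi>]]) simp
  have ind: "(\<lambda>p. indicator ?K (snd (fst p), snd p) :: ennreal) \<in> borel_measurable ?N"
    by (rule measurable_compose[OF proj]) (use K in simp)
  have "emeasure (pair_law \<pi> n) ?K = (\<integral>\<^sup>+z. indicator ?K z \<partial>pair_law \<pi> n)"
    using K by (simp add: sets_pair_law)
  also have "\<dots> = (\<integral>\<^sup>+p. indicator ?K (snd (fst p), snd p) \<partial>kprod (histM n) (actM A) ?H (\<pi> n))"
    unfolding E using proj K sk by (intro nn_integral_distr) (simp_all cong: measurable_cong_sets)
  also have "\<dots> = (\<integral>\<^sup>+h. \<integral>\<^sup>+a. indicator ?K (snd h, a) \<partial>\<pi> n h \<partial>?H)"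
    by (subst nn_integral_kprod[OF _ hne policyD(1)[OF \<pi>] ind]) simp_all
  also have "\<dots> = (\<integral>\<^sup>+h. 1 \<partial>?H)"
  proof (rule nn_integral_cong)
    fix h assume "h \<in> space ?H"
    then have h: "h \<in> space (histM n)" by simp
    then have x: "snd h \<in> space X" by (auto simp: histM_def space_pair_measure)
    have "(\<integral>\<^sup>+a. indicator ?K (snd h, a) \<partial>\<pi> n h) = (\<integral>\<^sup>+a. indicator (As (snd h)) a \<partial>\<pi> n h)"
      using x by (intro nn_integral_cong) (auto simp: indicator_def)
    also have "\<dots> = emeasure (\<pi> n h) (As (snd h))"
      using As_measurable[OF x] policyD(4)[OF \<pi> h] by (intro nn_integral_indicator) simp
    finally show "(\<integral>\<^sup>+a. indicator ?K (snd h, a) \<partial>\<pi> n h) = 1" using policyD(2)[OF \<pi> h] by simp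
  qed
  also have "\<dots> = 1"
  proof -
    interpret H: prob_space ?H by (rule prob_space.prob_space_distr[OF lawD(1)]) measurable
    show ?thesis using H.emeasure_space_1 by simp
  qed
  finally have "emeasure (pair_law \<pi> n) ?K = 1" .
  then have "AE z in pair_law \<pi> n. z \<in> ?K"
    by (intro prob_space.AE_prob_1[OF prob_pair_law]) (simp add: measure_def)
  then show ?thesis by eventually_elim auto
qed

end

text \<open>When the choice of the action depends on the current state and the time alone, the rest of the history can
  be integrated out.\<close>

lemma pair_law_markov:
  assumes s: "\<And>n. s n \<in> markov_kernels"
  shows "pair_law (markov_policy s) n = kprod X (actM A) (state_law (markov_policy s) n) (s n)"
proof (rule measure_eqI_rect)
  let ?\<pi> = "markov_policy s"
  note \<pi> = markov_policy_in[OF s]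
  let ?L = "law \<eta> ?\<pi>"
  note [measurable_cong] = sets_law[OF \<pi>]
  show "sets (pair_law ?\<pi> n) = sets (X \<Otimes>\<^sub>M actM A)" by (rule sets_pair_law)
  show "finite_measure (pair_law ?\<pi> n)" using prob_pair_law[OF \<pi>] by (simp add: prob_space.finite_measure)
  show "sets (kprod X (actM A) (state_law ?\<pi> n) (s n)) = sets (X \<Otimes>\<^sub>M actM A)"
    by (rule sets_kprod[OF sets_state_law X_ne markov_kernelD(1)[OF s]])
  fix \<Gamma> B assume G [measurable]: "\<Gamma> \<in> sets X" and B [measurable]: "B \<in> sets (actM A)"
  have S: "snd -` \<Gamma> \<inter> space (histM n) \<in> sets (histM n)"
    unfolding histM_def by (rule measurable_sets[OF measurable_snd G])
  have hs: "hist n \<omega> \<in> space (histM n)" if "\<omega> \<in> space ?L" for \<omega>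
    using measurable_space[OF hist_measurable] that by (simp add: space_law[OF \<pi>])
  have em: "(\<lambda>x. emeasure (s n x) B) \<in> borel_measurable X"
    by (rule measurable_compose[OF measurable_prob_algebraD[OF markov_kernelD(1)[OF s]] measurable_emeasure_subprob_algebra[OF B]])
  have "emeasure (pair_law ?\<pi> n) (\<Gamma> \<times> B) = emeasure ?L ((\<lambda>\<omega>. \<omega> n) -` (\<Gamma> \<times> B) \<inter> space ?L)"
    unfolding pair_law_def by (rule emeasure_distr[OF coord_m[OF \<pi>]]) simp
  also have "(\<lambda>\<omega>. \<omega> n) -` (\<Gamma> \<times> B) \<inter> space ?L = {\<omega> \<in> space ?L. hist n \<omega> \<in> snd -` \<Gamma> \<inter> space (histM n) \<and> action n \<omega> \<in> B}"
    using hs by (auto simp: hist_def state_def action_def mem_Times_iff)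
  also have "emeasure ?L \<dots> = (\<integral>\<^sup>+\<omega>. indicator (snd -` \<Gamma> \<inter> space (histM n)) (hist n \<omega>) * emeasure (?\<pi> n (hist n \<omega>)) B \<partial>?L)"
    by (rule lawD(4)[OF \<pi> B S])
  also have "\<dots> = (\<integral>\<^sup>+\<omega>. emeasure (s n (state n \<omega>)) B * indicator \<Gamma> (state n \<omega>) \<partial>?L)"
    using hs by (intro nn_integral_cong) (auto simp: hist_def markov_policy_def indicator_def)
  also have "\<dots> = (\<integral>\<^sup>+x\<in>\<Gamma>. emeasure (s n x) B \<partial>state_law ?\<pi> n)"
    unfolding state_law_def by (rule nn_integral_distr[symmetric]) (use em in simp_all)
  also have "\<dots> = emeasure (kprod X (actM A) (state_law ?\<pi> n) (s n)) (\<Gamma> \<times> B)"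
    by (rule emeasure_kprod[OF sets_state_law X_ne markov_kernelD(1)[OF s] G B, symmetric])
  finally show "emeasure (pair_law ?\<pi> n) (\<Gamma> \<times> B) = emeasure (kprod X (actM A) (state_law ?\<pi> n) (s n)) (\<Gamma> \<times> B)" .
qed

lemma nn_integral_markov_Suc:
  assumes s: "\<And>n. s n \<in> markov_kernels" and f: "f \<in> borel_measurable X"
  shows "(\<integral>\<^sup>+x. f x \<partial>state_law (markov_policy s) (Suc n)) = (\<integral>\<^sup>+x. evolve (s n) f x \<partial>state_law (markov_policy s) n)"
  unfolding nn_integral_state_Suc[OF markov_policy_in[OF s] f] pair_law_markov[OF s] evolve_def
  by (rule nn_integral_kprod[OF sets_state_law X_ne markov_kernelD(1)[OF s] nn_integral_Q_measurable[OF f]])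

lemma nn_integral_markov_add:
  assumes s: "\<And>n. s n \<in> markov_kernels" and \<sigma>: "\<And>k. k \<ge> n \<Longrightarrow> s k = \<sigma>" and f: "f \<in> borel_measurable X"
  shows "(\<integral>\<^sup>+x. f x \<partial>state_law (markov_policy s) (n + k)) = (\<integral>\<^sup>+x. (evolve \<sigma> ^^ k) f x \<partial>state_law (markov_policy s) n)"
  using f
proof (induction k arbitrary: f)
  case (Suc k)
  have \<sigma>m: "\<sigma> \<in> markov_kernels" using s[of n] \<sigma>[of n] by simp
  have "(\<integral>\<^sup>+x. f x \<partial>state_law (markov_policy s) (n + Suc k)) = (\<integral>\<^sup>+x. evolve \<sigma> f x \<partial>state_law (markov_policy s) (n + k))"
    using nn_integral_markov_Suc[OF s Suc.prems, where n="n + k"] by (simp add: \<sigma>)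
  also have "\<dots> = (\<integral>\<^sup>+x. (evolve \<sigma> ^^ k) (evolve \<sigma> f) x \<partial>state_law (markov_policy s) n)"
    by (rule Suc.IH[OF evolve_measurable[OF \<sigma>m Suc.prems]])
  also have "(evolve \<sigma> ^^ k) (evolve \<sigma> f) = (evolve \<sigma> ^^ Suc k) f"
    by (simp add: funpow_swap1)
  finally show ?case .
qed simp

lemma state_law_agree:
  assumes s: "\<And>n. s n \<in> markov_kernels" and s': "\<And>n. s' n \<in> markov_kernels" and eq: "\<And>k. k < n \<Longrightarrow> s k = s' k"
  shows "state_law (markov_policy s) n = state_law (markov_policy s') n"
  using eq
proof (induction n)
  case 0
  then show ?case by (simp add: state_law_0 markov_policy_in s s')
next
  case (Suc n)
  then show ?case
    by (simp add: state_law_Suc markov_policy_in s s' pair_law_markov)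
qed

end

locale absorbing_model = initial_model X A As Q \<Delta> \<eta>
  for X :: "'x measure" and A :: "'a::polish_space set" and As Q \<Delta> and \<eta> :: "'x measure" +
  assumes absorbing: "absorbing \<eta>"
begin

lemma Q_Delta: "x \<in> \<Delta> \<Longrightarrow> a \<in> A \<Longrightarrow> emeasure (Q (x, a)) \<Delta> = 1"
  using absorbing by (auto simp: absorbing_def)

lemma Delta_sub: "\<Delta> \<subseteq> space X"
  by (rule sets.sets_into_space[OF Delta_measurable])

lemma Q_leave: "x \<in> \<Delta> \<Longrightarrow> a \<in> A \<Longrightarrow> emeasure (Q (x, a)) (space X - \<Delta>) = 0"
proof -
  assume x: "x \<in> \<Delta>" "a \<in> A"
  then have z: "(x, a) \<in> space Z" using Delta_sub by (auto simp: space_pair_measure space_act)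
  then interpret q: prob_space "Q (x, a)" using Q_space by blast
  have s: "sets (Q (x, a)) = sets X" using Q_space[OF z] by blast
  have "emeasure (Q (x, a)) (space (Q (x, a)) - \<Delta>) = emeasure (Q (x, a)) (space (Q (x, a))) - emeasure (Q (x, a)) \<Delta>"
    by (rule emeasure_compl) (use Delta_measurable s in auto)
  then show ?thesis using Q_Delta[OF x] q.emeasure_space_1 sets_eq_imp_space_eq[OF s] by simp
qed

lemma nn_integral_Q_Delta:
  assumes x: "x \<in> \<Delta>" "a \<in> A" and f: "f \<in> borel_measurable X" "\<And>y. y \<in> \<Delta> \<Longrightarrow> f y = 0"
  shows "(\<integral>\<^sup>+y. f y \<partial>Q (x, a)) = 0"
proof -
  have z: "(x, a) \<in> space Z" using x Delta_sub by (auto simp: space_pair_measure space_act)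
  have s: "sets (Q (x, a)) = sets X" using Q_space[OF z] by blast
  have "AE y in Q (x, a). y \<notin> space X - \<Delta>"
    by (rule AE_not_in) (use Q_leave[OF x] s in \<open>auto simp: null_sets_def\<close>)
  then have "AE y in Q (x, a). f y = 0"
    using AE_space by eventually_elim (use f(2) sets_eq_imp_space_eq[OF s] in auto)
  then show ?thesis using f(1) s by (subst nn_integral_0_iff_AE) (auto cong: measurable_cong_sets)
qed

lemma evolve_Delta:
  assumes \<sigma>: "\<sigma> \<in> markov_kernels" and f: "f \<in> borel_measurable X" "\<And>y. y \<in> \<Delta> \<Longrightarrow> f y = 0" and x: "x \<in> \<Delta>"
  shows "(evolve \<sigma> ^^ k) f x = 0"
  using x
proof (induction k arbitrary: x)
  case (Suc k)
  have xX: "x \<in> space X" using Suc Delta_sub by auto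
  have "(\<integral>\<^sup>+a. \<integral>\<^sup>+y. (evolve \<sigma> ^^ k) f y \<partial>Q (x, a) \<partial>\<sigma> x) = (\<integral>\<^sup>+a. 0 \<partial>\<sigma> x)"
  proof (rule nn_integral_cong)
    fix a assume "a \<in> space (\<sigma> x)"
    then have "a \<in> A" using sec_in(1)[OF \<sigma> xX] by simp
    then show "(\<integral>\<^sup>+y. (evolve \<sigma> ^^ k) f y \<partial>Q (x, a)) = 0"
      by (rule nn_integral_Q_Delta[OF Suc.prems _ evolve_iter_measurable[OF \<sigma> f(1)] Suc.IH])
  qed
  then show ?case by (simp add: evolve_def[of \<sigma> "(evolve \<sigma> ^^ k) f" x])
qed (use f in auto)

context
  fixes \<pi> assumes \<pi>: "\<pi> \<in> policies"
begin

lemma AE_absorbed: "AE \<omega> in law \<eta> \<pi>. \<forall>n. state n \<omega> \<in> \<Delta> \<longrightarrow> state (Suc n) \<omega> \<in> \<Delta>"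
proof (subst AE_all_countable, rule allI)
  fix n
  let ?L = "law \<eta> \<pi>"
  note [measurable_cong] = sets_law[OF \<pi>]
  let ?S = "(\<lambda>p. snd (fst p)) -` \<Delta> \<inter> space (histM n \<Otimes>\<^sub>M actM A)"
  have S: "?S \<in> sets (histM n \<Otimes>\<^sub>M actM A)"
    by (rule measurable_sets[OF _ Delta_measurable]) (simp add: histM_def)
  have hs: "(hist n \<omega>, action n \<omega>) \<in> space (histM n \<Otimes>\<^sub>M actM A)" "action n \<omega> \<in> A" if "\<omega> \<in> space ?L" for \<omega>
    using that measurable_space[OF hist_measurable] measurable_space[OF action_measurable]
    by (simp_all add: space_pair_measure space_law[OF \<pi>] space_act)
  let ?E = "{\<omega> \<in> space ?L. (hist n \<omega>, action n \<omega>) \<in> ?S \<and> state (Suc n) \<omega> \<in> space X - \<Delta>}"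
  have "emeasure ?L ?E = (\<integral>\<^sup>+\<omega>. indicator ?S (hist n \<omega>, action n \<omega>) * emeasure (Q (state n \<omega>, action n \<omega>)) (space X - \<Delta>) \<partial>?L)"
    by (rule lawD(5)[OF \<pi> Dc_sets S])
  also have "\<dots> = (\<integral>\<^sup>+\<omega>. 0 \<partial>?L)"
    using hs by (intro nn_integral_cong) (auto simp: indicator_def hist_def Q_leave)
  finally have 0: "emeasure ?L ?E = 0" by simp
  have sX: "state (Suc n) \<omega> \<in> space X" if "\<omega> \<in> space ?L" for \<omega>
    using measurable_space[OF state_measurable] that by (simp add: space_law[OF \<pi>])
  show "AE \<omega> in ?L. state n \<omega> \<in> \<Delta> \<longrightarrow> state (Suc n) \<omega> \<in> \<Delta>"
  proof (rule AE_I')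
    have "?E \<in> sets ?L" using S Dc_sets by measurable
    then show "?E \<in> null_sets ?L" using 0 by (simp add: null_sets_def)
    show "{\<omega> \<in> space ?L. \<not> (state n \<omega> \<in> \<Delta> \<longrightarrow> state (Suc n) \<omega> \<in> \<Delta>)} \<subseteq> ?E"
      using hs sX by (auto simp: hist_def)
  qed
qed

text \<open>Since \<open>\<Delta>\<close> is almost surely never left, survival up to time \<open>t\<close> can be read off from the state at time
  \<open>t\<close>.\<close>

lemma AE_hitting: "AE \<omega> in law \<eta> \<pi>. \<forall>t. enat t < hitting_time \<omega> \<longleftrightarrow> state t \<omega> \<notin> \<Delta>"
  using AE_absorbed
proof eventually_elim
  case (elim \<omega>)
  have up: "state n \<omega> \<in> \<Delta> \<Longrightarrow> state (n + k) \<omega> \<in> \<Delta>" for n k by (induction k) (use elim in auto)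
  show ?case
    unfolding hitting_time_gt
  proof (intro allI, rule iffI)
    fix t assume t: "state t \<omega> \<notin> \<Delta>"
    show "\<forall>n\<le>t. state n \<omega> \<notin> \<Delta>"
    proof (intro allI impI notI)
      fix n assume "n \<le> t" "state n \<omega> \<in> \<Delta>"
      then show False using up[of n "t - n"] t by simp
    qed
  qed auto
qed

lemma hitting_set: "{\<omega> \<in> space (law \<eta> \<pi>). enat t < hitting_time \<omega>} \<in> sets (law \<eta> \<pi>)"
proof -
  note [measurable_cong] = sets_law[OF \<pi>]
  have "Measurable.pred (law \<eta> \<pi>) (\<lambda>\<omega>. state n \<omega> \<in> \<Delta>)" for n using Delta_measurable by measurable
  note [measurable] = this
  show ?thesis unfolding hitting_time_gt by measurable
qed

lemma prob_hitting: "emeasure (law \<eta> \<pi>) {\<omega> \<in> space (law \<eta> \<pi>). enat t < hitting_time \<omega>} = emeasure (state_law \<pi> t) (space X - \<Delta>)"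
proof -
  note [measurable_cong] = sets_law[OF \<pi>]
  have "emeasure (state_law \<pi> t) (space X - \<Delta>) = emeasure (law \<eta> \<pi>) (state t -` (space X - \<Delta>) \<inter> space (law \<eta> \<pi>))"
    unfolding state_law_def by (rule emeasure_distr) measurable
  also have "\<dots> = emeasure (law \<eta> \<pi>) {\<omega> \<in> space (law \<eta> \<pi>). enat t < hitting_time \<omega>}"
  proof (rule emeasure_eq_AE[OF _ _ hitting_set])
    show "AE \<omega> in law \<eta> \<pi>. (\<omega> \<in> state t -` (space X - \<Delta>) \<inter> space (law \<eta> \<pi>)) = (\<omega> \<in> {\<omega> \<in> space (law \<eta> \<pi>). enat t < hitting_time \<omega>})"
      using AE_hitting AE_space
    proof eventually_elim
      case (elim \<omega>)
      have "state t \<omega> \<in> space X" using measurable_space[OF state_measurable] elim(2) by (simp add: space_law[OF \<pi>])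
      then show ?case using elim by auto
    qed
    show "state t -` (space X - \<Delta>) \<inter> space (law \<eta> \<pi>) \<in> sets (law \<eta> \<pi>)" by measurable
  qed
  finally show ?thesis by simp
qed

lemma summable_survival: "(\<Sum>t. emeasure (state_law \<pi> t) (space X - \<Delta>)) < \<infinity>"
proof -
  let ?L = "law \<eta> \<pi>"
  have "(\<Sum>t. emeasure (state_law \<pi> t) (space X - \<Delta>)) = (\<Sum>t. \<integral>\<^sup>+\<omega>. indicator {\<omega> \<in> space ?L. enat t < hitting_time \<omega>} \<omega> \<partial>?L)"
    using hitting_set by (simp add: prob_hitting)
  also have "\<dots> = (\<integral>\<^sup>+\<omega>. (\<Sum>t. indicator {\<omega> \<in> space ?L. enat t < hitting_time \<omega>} \<omega>) \<partial>?L)"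
    using hitting_set by (intro nn_integral_suminf[symmetric]) simp
  also have "\<dots> = (\<integral>\<^sup>+\<omega>. ennreal_of_enat (hitting_time \<omega>) \<partial>?L)"
    unfolding ennreal_of_enat_eq_suminf
    by (intro nn_integral_cong suminf_cong) (auto simp: indicator_def)
  also have "\<dots> < \<infinity>" using absorbing \<pi> by (auto simp: absorbing_def)
  finally show ?thesis .
qed

end

definition alive :: "('x \<times> 'a) set" where
  "alive = (space X - \<Delta>) \<times> A"

lemma alive_sets [measurable]: "alive \<in> sets Z"
  unfolding alive_def using pair_measureI[OF Dc_sets sets.top[of "actM A"]] by (simp add: space_act)

definition alive_law :: "(nat \<Rightarrow> (nat \<Rightarrow> 'x \<times> 'a) \<times> 'x \<Rightarrow> 'a measure) \<Rightarrow> nat \<Rightarrow> ('x \<times> 'a) measure" where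
  "alive_law \<pi> t = density (pair_law \<pi> t) (indicator alive)"

text \<open>The expected number of visits to a set from time \<open>n\<close> on and before absorption.  As a mixture over the
  times it inherits its integration rule from the monadic bind; for \<open>n = 0\<close> it is the occupation measure.\<close>

definition occ_from :: "nat \<Rightarrow> (nat \<Rightarrow> (nat \<Rightarrow> 'x \<times> 'a) \<times> 'x \<Rightarrow> 'a measure) \<Rightarrow> ('x \<times> 'a) measure" where
  "occ_from n \<pi> = count_space UNIV \<bind> (\<lambda>t. alive_law \<pi> (n + t))"

lemma sets_alive_law [measurable_cong]: "sets (alive_law \<pi> t) = sets Z"
  by (simp add: alive_law_def sets_pair_law)

context
  fixes \<pi> assumes \<pi>: "\<pi> \<in> policies"
begin

lemma nn_integral_alive_law:
  "f \<in> borel_measurable Z \<Longrightarrow> (\<integral>\<^sup>+z. f z \<partial>alive_law \<pi> t) = (\<integral>\<^sup>+z. indicator alive z * f z \<partial>pair_law \<pi> t)"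
  unfolding alive_law_def by (rule nn_integral_density) (auto simp: sets_pair_law cong: measurable_cong_sets)

lemma alive_law_kernel: "(\<lambda>t. alive_law \<pi> (n + t)) \<in> count_space UNIV \<rightarrow>\<^sub>M subprob_algebra Z"
proof -
  have "subprob_space (alive_law \<pi> t)" for t
  proof (rule subprob_spaceI)
    have "emeasure (alive_law \<pi> t) (space (alive_law \<pi> t)) = (\<integral>\<^sup>+z. 1 \<partial>alive_law \<pi> t)" by simp
    also have "\<dots> = (\<integral>\<^sup>+z. indicator alive z * 1 \<partial>pair_law \<pi> t)"
      by (rule nn_integral_alive_law) simp
    also have "\<dots> \<le> (\<integral>\<^sup>+z. 1 \<partial>pair_law \<pi> t)"
      by (intro nn_integral_mono) (simp add: indicator_def)
    also have "\<dots> = 1" using prob_space.emeasure_space_1[OF prob_pair_law[OF \<pi>]] by simp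
    finally show "emeasure (alive_law \<pi> t) (space (alive_law \<pi> t)) \<le> 1" .
    show "space (alive_law \<pi> t) \<noteq> {}"
      using prob_space.not_empty[OF prob_pair_law[OF \<pi>]] by (simp add: alive_law_def)
  qed
  then show ?thesis by (simp add: space_subprob_algebra sets_alive_law)
qed

lemma sets_occ_from [measurable_cong]: "sets (occ_from n \<pi>) = sets Z"
  unfolding occ_from_def by (rule sets_bind) (simp_all add: sets_alive_law)

lemma nn_integral_occ_from:
  assumes f: "f \<in> borel_measurable Z"
  shows "(\<integral>\<^sup>+z. f z \<partial>occ_from n \<pi>) = (\<Sum>t. \<integral>\<^sup>+z. indicator alive z * f z \<partial>pair_law \<pi> (n + t))"
  unfolding occ_from_def
  by (simp add: nn_integral_bind[OF f alive_law_kernel] nn_integral_count_space_nat nn_integral_alive_law[OF f])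

lemma emeasure_occ_from:
  assumes S: "S \<in> sets Z"
  shows "emeasure (occ_from n \<pi>) S = (\<Sum>t. emeasure (pair_law \<pi> (n + t)) (alive \<inter> S))"
proof -
  have "emeasure (occ_from n \<pi>) S = (\<integral>\<^sup>+z. indicator S z \<partial>occ_from n \<pi>)" using S by (simp add: sets_occ_from)
  also have "\<dots> = (\<Sum>t. \<integral>\<^sup>+z. indicator alive z * indicator S z \<partial>pair_law \<pi> (n + t))"
    by (rule nn_integral_occ_from) (use S in simp)
  also have "\<dots> = (\<Sum>t. \<integral>\<^sup>+z. indicator (alive \<inter> S) z \<partial>pair_law \<pi> (n + t))"
    by (simp only: indicator_inter_arith)
  also have "\<dots> = (\<Sum>t. emeasure (pair_law \<pi> (n + t)) (alive \<inter> S))"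
    using S alive_sets by (simp add: sets_pair_law)
  finally show ?thesis .
qed

lemma emeasure_occ_from_rect:
  assumes G: "\<Gamma> \<in> sets X"
  shows "emeasure (occ_from n \<pi>) (\<Gamma> \<times> A) = (\<Sum>t. emeasure (state_law \<pi> (n + t)) (\<Gamma> - \<Delta>))"
proof -
  have R: "\<Gamma> \<times> A \<in> sets Z" using pair_measureI[OF G sets.top[of "actM A"]] by (simp add: space_act)
  have "emeasure (pair_law \<pi> t) (alive \<inter> \<Gamma> \<times> A) = emeasure (state_law \<pi> t) (\<Gamma> - \<Delta>)" for t
  proof -
    have "emeasure (state_law \<pi> t) (\<Gamma> - \<Delta>) = emeasure (pair_law \<pi> t) (fst -` (\<Gamma> - \<Delta>) \<inter> space (pair_law \<pi> t))"
      unfolding pair_law_fst[OF \<pi>, symmetric] using G Delta_measurable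
      by (intro emeasure_distr) (auto simp: measurable_cong_sets[OF sets_pair_law refl])
    also have "fst -` (\<Gamma> - \<Delta>) \<inter> space (pair_law \<pi> t) = alive \<inter> \<Gamma> \<times> A"
      using sets.sets_into_space[OF G] by (auto simp: space_pair_law space_pair_measure space_act alive_def)
    finally show ?thesis by simp
  qed
  then show ?thesis by (simp add: emeasure_occ_from[OF R])
qed

lemma occ_from_finite: "occ_from n \<pi> \<in> finite_measures Z"
proof -
  have "emeasure (occ_from n \<pi>) (space (occ_from n \<pi>)) = emeasure (occ_from n \<pi>) (space X \<times> A)"
    using sets_eq_imp_space_eq[OF sets_occ_from] by (simp add: space_pair_measure space_act)
  also have "\<dots> = (\<Sum>t. emeasure (state_law \<pi> (t + n)) (space X - \<Delta>))"
    by (simp add: emeasure_occ_from_rect add.commute)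
  also have "\<dots> \<le> (\<Sum>t. emeasure (state_law \<pi> t) (space X - \<Delta>))"
    unfolding suminf_offset[OF summableI, of "\<lambda>t. emeasure (state_law \<pi> t) (space X - \<Delta>)" n]
    by (simp add: add_increasing2)
  also have "\<dots> < \<infinity>" by (rule summable_survival[OF \<pi>])
  finally show ?thesis
    by (auto simp: finite_measures_def sets_occ_from intro!: finite_measureI)
qed

lemma occupation_eq: "occupation_measure \<eta> \<pi> = occ_from 0 \<pi>"
proof -
  let ?L = "law \<eta> \<pi>"
  note [measurable_cong] = sets_law[OF \<pi>]
  have "(\<integral>\<^sup>+\<omega>. (\<Sum>t. indicator {\<omega>. hitting_time \<omega> > enat t} \<omega> * indicator S (state t \<omega>, action t \<omega>)) \<partial>?L)
      = emeasure (occ_from 0 \<pi>) S" if S: "S \<in> sets Z" for S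
  proof -
    have coordZ: "\<omega> t \<in> space Z" if "\<omega> \<in> space ?L" for \<omega> t
      using measurable_space[OF coord_measurable] that by (simp add: space_law[OF \<pi>])
    have "(\<integral>\<^sup>+\<omega>. (\<Sum>t. indicator {\<omega>. hitting_time \<omega> > enat t} \<omega> * indicator S (state t \<omega>, action t \<omega>)) \<partial>?L)
      = (\<integral>\<^sup>+\<omega>. (\<Sum>t. indicator (alive \<inter> S) (\<omega> t)) \<partial>?L)"
    proof (rule nn_integral_cong_AE)
      show "AE \<omega> in ?L. (\<Sum>t. indicator {\<omega>. hitting_time \<omega> > enat t} \<omega> * indicator S (state t \<omega>, action t \<omega>))
          = (\<Sum>t. indicator (alive \<inter> S) (\<omega> t) :: ennreal)"
        using AE_hitting[OF \<pi>] AE_space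
      proof eventually_elim
        case (elim \<omega>)
        have "\<omega> t \<in> space X \<times> A" for t using coordZ[OF elim(2), of t] by (simp add: space_pair_measure space_act)
        then show ?case using elim(1)
          by (intro suminf_cong) (auto simp: indicator_def alive_def state_def action_def mem_Times_iff)
      qed
    qed
    also have "\<dots> = (\<Sum>t. \<integral>\<^sup>+\<omega>. indicator (alive \<inter> S) (\<omega> t) \<partial>?L)"
      using S by (intro nn_integral_suminf) (auto intro!: measurable_compose[OF coord_m[OF \<pi>]])
    also have "\<dots> = (\<Sum>t. \<integral>\<^sup>+z. indicator (alive \<inter> S) z \<partial>pair_law \<pi> t)"
      unfolding pair_law_def using S by (intro suminf_cong nn_integral_distr[symmetric] coord_m[OF \<pi>]) auto
    also have "\<dots> = emeasure (occ_from 0 \<pi>) S"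
      using S by (simp add: emeasure_occ_from sets_pair_law)
    finally show ?thesis .
  qed
  then have "occupation_measure \<eta> \<pi> = measure_of (space Z) (sets Z) (emeasure (occ_from 0 \<pi>))"
    unfolding occupation_measure_def by (intro measure_of_eq sets.space_closed) (simp add: sets.sigma_sets_eq)
  also have "\<dots> = occ_from 0 \<pi>"
    using measure_of_of_measure[of "occ_from 0 \<pi>"] sets_occ_from sets_eq_imp_space_eq[OF sets_occ_from] by simp
  finally show ?thesis .
qed

lemma occ_from_carrier: "AE z in occ_from n \<pi>. fst z \<notin> \<Delta> \<and> snd z \<in> As (fst z)"
proof -
  let ?K = "(SIGMA x:space X. As x) \<inter> alive"
  have K: "?K \<in> sets Z" using K_measurable alive_sets by auto
  then have C: "space Z - ?K \<in> sets Z" by auto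
  have "emeasure (pair_law \<pi> t) (alive \<inter> (space Z - ?K)) = 0" for t
  proof -
    have ae: "AE z in pair_law \<pi> t. z \<notin> alive \<inter> (space Z - ?K)"
      using pair_law_K[OF \<pi>, of t] AE_space
      by eventually_elim (auto simp: alive_def)
    have "alive \<inter> (space Z - ?K) \<in> sets (pair_law \<pi> t)" using C alive_sets by (simp add: sets_pair_law)
    from AE_iff_null_sets[OF this, THEN iffD2, OF ae] show ?thesis by (rule null_setsD1)
  qed
  then have "emeasure (occ_from n \<pi>) (space Z - ?K) = 0" by (simp add: emeasure_occ_from[OF C])
  then have "AE z in occ_from n \<pi>. z \<notin> space Z - ?K"
    using C by (intro AE_not_in) (simp add: null_sets_def sets_occ_from)
  moreover have "AE z in occ_from n \<pi>. z \<in> space Z"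
    using AE_space[of "occ_from n \<pi>"] sets_eq_imp_space_eq[OF sets_occ_from] by simp
  ultimately show ?thesis by eventually_elim (auto simp: alive_def)
qed

text \<open>The balance equation: a state that is alive at some time after \<open>n\<close> has been entered from a state and
  an action that were alive one step before.  The source term is the state law at time \<open>n\<close>.\<close>

lemma occ_from_char:
  assumes G: "\<Gamma> \<in> sets X"
  shows "emeasure (occ_from n \<pi>) (\<Gamma> \<times> A) = emeasure (state_law \<pi> n) (\<Gamma> - \<Delta>) + (\<integral>\<^sup>+z. emeasure (Q z) (\<Gamma> - \<Delta>) \<partial>occ_from n \<pi>)"
proof -
  have GD: "\<Gamma> - \<Delta> \<in> sets X" using G Delta_measurable by auto
  let ?f = "\<lambda>t. emeasure (state_law \<pi> (n + t)) (\<Gamma> - \<Delta>)"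
  have step: "?f (Suc t) = (\<integral>\<^sup>+z. indicator alive z * emeasure (Q z) (\<Gamma> - \<Delta>) \<partial>pair_law \<pi> (n + t))" for t
  proof -
    have "?f (Suc t) = (\<integral>\<^sup>+x. indicator (\<Gamma> - \<Delta>) x \<partial>state_law \<pi> (Suc (n + t)))" using GD by (simp add: sets_state_law)
    also have "\<dots> = (\<integral>\<^sup>+z. \<integral>\<^sup>+y. indicator (\<Gamma> - \<Delta>) y \<partial>Q z \<partial>pair_law \<pi> (n + t))"
      using GD by (intro nn_integral_state_Suc[OF \<pi>]) simp
    also have "\<dots> = (\<integral>\<^sup>+z. indicator alive z * emeasure (Q z) (\<Gamma> - \<Delta>) \<partial>pair_law \<pi> (n + t))"
    proof (rule nn_integral_cong)
      fix z assume "z \<in> space (pair_law \<pi> (n + t))"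
      then have z: "z \<in> space Z" by (simp add: space_pair_law)
      have s: "sets (Q z) = sets X" using Q_space[OF z] by blast
      have "(\<integral>\<^sup>+y. indicator (\<Gamma> - \<Delta>) y \<partial>Q z) = emeasure (Q z) (\<Gamma> - \<Delta>)" using GD s by simp
      moreover have "emeasure (Q z) (\<Gamma> - \<Delta>) = 0" if "z \<notin> alive"
      proof -
        have z': "fst z \<in> \<Delta>" "snd z \<in> A" using that z by (auto simp: alive_def space_pair_measure space_act mem_Times_iff)
        have "emeasure (Q z) (\<Gamma> - \<Delta>) \<le> emeasure (Q (fst z, snd z)) (space X - \<Delta>)"
          using sets.sets_into_space[OF G] Dc_sets s by (simp, intro emeasure_mono) auto
        then show ?thesis using Q_leave[OF z'] by simp
      qed
      ultimately show "(\<integral>\<^sup>+y. indicator (\<Gamma> - \<Delta>) y \<partial>Q z) = indicator alive z * emeasure (Q z) (\<Gamma> - \<Delta>)"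
        by (auto simp: indicator_def)
    qed
    finally show ?thesis .
  qed
  have "emeasure (occ_from n \<pi>) (\<Gamma> \<times> A) = (\<Sum>t. ?f t)" by (rule emeasure_occ_from_rect[OF G])
  also have "\<dots> = ?f 0 + (\<Sum>t. ?f (Suc t))"
    using suminf_offset[OF summableI, of ?f 1] by (simp add: add.commute)
  also have "(\<Sum>t. ?f (Suc t)) = (\<integral>\<^sup>+z. emeasure (Q z) (\<Gamma> - \<Delta>) \<partial>occ_from n \<pi>)"
    unfolding step nn_integral_occ_from[OF Q_emeasure_measurable[OF GD]] ..
  finally show ?thesis by simp
qed

lemma occ_from_le: 
  assumes S: "S \<in> sets Z"
  shows "emeasure (occ_from n \<pi>) S \<le> emeasure (occ_from 0 \<pi>) S"
  unfolding emeasure_occ_from[OF S]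
  using suminf_offset[OF summableI, of "\<lambda>t. emeasure (pair_law \<pi> t) (alive \<inter> S)" n]
  by (simp add: add.commute[of n])

end

lemma occ_markov:
  assumes \<sigma>: "\<sigma> \<in> markov_kernels"
  shows "occ_from 0 (stationary \<sigma>) = kprod X (actM A) (distr (occ_from 0 (stationary \<sigma>)) X fst) \<sigma>"
proof -
  let ?\<pi> = "stationary \<sigma>" and ?\<nu> = "distr (occ_from 0 (stationary \<sigma>)) X fst"
  have \<pi>: "?\<pi> \<in> policies" unfolding stationary_eq by (rule markov_policy_in) (rule \<sigma>)
  note [measurable_cong] = sets_occ_from[OF \<pi>]
  note k = markov_kernelD(1)[OF \<sigma>]
  show ?thesis
  proof (rule measure_eqI_rect)
    show "sets (occ_from 0 ?\<pi>) = sets Z" by (rule sets_occ_from[OF \<pi>])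
    show "sets (kprod X (actM A) ?\<nu> \<sigma>) = sets Z" by (rule sets_kprod[OF _ X_ne k]) simp
    show "finite_measure (occ_from 0 ?\<pi>)" using occ_from_finite[OF \<pi>] by (simp add: finite_measures_def)
    fix \<Gamma> B assume G [measurable]: "\<Gamma> \<in> sets X" and B [measurable]: "B \<in> sets (actM A)"
    have em [measurable]: "(\<lambda>x. emeasure (\<sigma> x) B) \<in> borel_measurable X"
      by (rule measurable_compose[OF measurable_prob_algebraD[OF k] measurable_emeasure_subprob_algebra[OF B]])
    have GD: "\<Gamma> - \<Delta> \<in> sets X" using G Delta_measurable by auto
    have R: "\<Gamma> \<times> B \<in> sets Z" by simp
    have "emeasure (occ_from 0 ?\<pi>) (\<Gamma> \<times> B) = (\<Sum>t. emeasure (pair_law ?\<pi> t) ((\<Gamma> - \<Delta>) \<times> B))"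
      unfolding emeasure_occ_from[OF \<pi> R] using sets.sets_into_space[OF G] sets.sets_into_space[OF B]
      by (intro suminf_cong arg_cong2[where f=emeasure]) (auto simp: alive_def space_act)
    also have "\<dots> = (\<Sum>t. \<integral>\<^sup>+x. emeasure (\<sigma> x) B * indicator (\<Gamma> - \<Delta>) x \<partial>state_law ?\<pi> t)"
      unfolding stationary_eq by (simp add: pair_law_markov \<sigma> emeasure_kprod[OF sets_state_law X_ne k GD B])
    also have "\<dots> = (\<Sum>t. \<integral>\<^sup>+z. indicator alive z * (emeasure (\<sigma> (fst z)) B * indicator \<Gamma> (fst z)) \<partial>pair_law ?\<pi> t)"
    proof (rule suminf_cong)
      fix t
      have "(\<integral>\<^sup>+x. emeasure (\<sigma> x) B * indicator (\<Gamma> - \<Delta>) x \<partial>state_law ?\<pi> t)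
        = (\<integral>\<^sup>+z. emeasure (\<sigma> (fst z)) B * indicator (\<Gamma> - \<Delta>) (fst z) \<partial>pair_law ?\<pi> t)"
        by (intro nn_integral_state_law[OF \<pi>] borel_measurable_times_ennreal em borel_measurable_indicator GD)
      also have "\<dots> = (\<integral>\<^sup>+z. indicator alive z * (emeasure (\<sigma> (fst z)) B * indicator \<Gamma> (fst z)) \<partial>pair_law ?\<pi> t)"
        by (intro nn_integral_cong) (auto simp: space_pair_law space_pair_measure space_act alive_def indicator_def)
      finally show "(\<integral>\<^sup>+x. emeasure (\<sigma> x) B * indicator (\<Gamma> - \<Delta>) x \<partial>state_law ?\<pi> t)
        = (\<integral>\<^sup>+z. indicator alive z * (emeasure (\<sigma> (fst z)) B * indicator \<Gamma> (fst z)) \<partial>pair_law ?\<pi> t)" .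
    qed
    also have "\<dots> = (\<integral>\<^sup>+z. emeasure (\<sigma> (fst z)) B * indicator \<Gamma> (fst z) \<partial>occ_from 0 ?\<pi>)"
      by (subst nn_integral_occ_from[OF \<pi>]) simp_all
    also have "\<dots> = (\<integral>\<^sup>+x\<in>\<Gamma>. emeasure (\<sigma> x) B \<partial>?\<nu>)"
      by (rule nn_integral_distr[symmetric]) (simp_all add: measurable_cong_sets[OF sets_occ_from[OF \<pi>] refl])
    also have "\<dots> = emeasure (kprod X (actM A) ?\<nu> \<sigma>) (\<Gamma> \<times> B)"
      by (rule emeasure_kprod[OF _ X_ne k G B, symmetric]) simp
    finally show "emeasure (occ_from 0 ?\<pi>) (\<Gamma> \<times> B) = emeasure (kprod X (actM A) ?\<nu> \<sigma>) (\<Gamma> \<times> B)" .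
  qed
qed

end

section \<open>Measurable selectors and solutions of the balance equation\<close>

locale compact_model = absorbing_model X A As Q \<Delta> \<eta>
  for X :: "'x measure" and A :: "'a::polish_space set" and As Q \<Delta> and \<eta> :: "'x measure" +
  assumes cond_S: condition_S
begin

lemma A_compact: "compact A"
  and As_hit_openin: "openin (top_of_set A) G \<Longrightarrow> {x\<in>space X. As x \<inter> G \<noteq> {}} \<in> sets X"
  and As_compact: "x \<in> space X \<Longrightarrow> compact (As x)"
  and Q_continuous: "x \<in> space X \<Longrightarrow> \<Gamma> \<in> sets X \<Longrightarrow> continuous_on (As x) (\<lambda>a. measure (Q (x, a)) \<Gamma>)"
  using cond_S unfolding condition_S_def by blast+

lemma As_sub: "x \<in> space X \<Longrightarrow> As x \<subseteq> A"
  using sets.sets_into_space[OF As_measurable] by (simp add: space_act)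

lemma A_ne: "A \<noteq> {}"
proof -
  obtain x where x: "x \<in> space X" using X_ne by blast
  then show ?thesis using As_sub[OF x] As_nonempty[OF x] by blast
qed

lemma As_hit: "open G \<Longrightarrow> {x\<in>space X. As x \<inter> G \<noteq> {}} \<in> sets X"
proof -
  assume "open G"
  then have "{x\<in>space X. As x \<inter> (A \<inter> G) \<noteq> {}} \<in> sets X" by (intro As_hit_openin) (auto simp: openin_open)
  also have "{x\<in>space X. As x \<inter> (A \<inter> G) \<noteq> {}} = {x\<in>space X. As x \<inter> G \<noteq> {}}" using As_sub by blast
  finally show ?thesis .
qed

text \<open>The Kuratowski--Ryll-Nardzewski construction: choose successively the first ball of radius \<open>1 / 2 ^ n\<close>
  around a point of a dense sequence that still meets \<open>As x\<close> inside \<open>G\<close> and the earlier balls.  Each choice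
  is measurable because \<open>As\<close> is weakly measurable, and the centers converge.\<close>

lemma open_selector:
  assumes G: "open G"
  obtains g where "g \<in> X \<rightarrow>\<^sub>M actM A" "\<And>x. x \<in> space X \<Longrightarrow> g x \<in> As x"
    "\<And>x. x \<in> space X \<Longrightarrow> As x \<inter> G \<noteq> {} \<Longrightarrow> g x \<in> closure G"
proof -
  obtain f0 where f0 [measurable]: "f0 \<in> X \<rightarrow>\<^sub>M actM A" and f0_in: "\<And>x. x \<in> space X \<Longrightarrow> f0 x \<in> As x"
    using selector by blast
  obtain D :: "'a set" where D: "countable D" "\<And>V. open V \<Longrightarrow> V \<noteq> {} \<Longrightarrow> \<exists>d\<in>D. d \<in> V"
    using countable_dense_exists by blast
  have "D \<noteq> {}" using D(2)[of UNIV] by auto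
  then have rD: "range (from_nat_into D) = D" using D(1) by (rule range_from_nat_into)
  define d where "d = from_nat_into D"
  have dense: "\<exists>k. d k \<in> V" if "open V" "V \<noteq> {}" for V
    using D(2)[OF that] rD unfolding d_def by (metis rangeE)
  \<comment> \<open>The points that satisfy the constraints chosen so far; \<open>ks\<close> lists the indices of the centers.\<close>
  define V where "V ks = G \<inter> (\<Inter>j<length ks. ball (d (ks ! j)) (1 / 2 ^ j))" for ks
  have V_open: "open (V ks)" for ks unfolding V_def using G by (intro open_Int open_INT) auto
  have V_snoc: "V (ks @ [k]) = V ks \<inter> ball (d k) (1 / 2 ^ length ks)" for ks k
  proof -
    have "{..<length (ks @ [k])} = insert (length ks) {..<length ks}" by auto
    moreover have "(\<Inter>j<length ks. ball (d ((ks @ [k]) ! j)) (1 / 2 ^ j)) = (\<Inter>j<length ks. ball (d (ks ! j)) (1 / 2 ^ j))"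
      by (intro INF_cong) (auto simp: nth_append)
    ultimately show ?thesis unfolding V_def by (auto simp: nth_append)
  qed
  define nxt where "nxt ks x = (LEAST k. As x \<inter> V (ks @ [k]) \<noteq> {})" for ks x
  have nxt_m: "nxt ks \<in> X \<rightarrow>\<^sub>M count_space UNIV" for ks
  proof -
    have "Measurable.pred X (\<lambda>x. As x \<inter> V (ks @ [k]) \<noteq> {})" for k
      using As_hit[OF V_open] by (simp add: pred_def)
    note [measurable] = this
    show ?thesis unfolding nxt_def[abs_def] by measurable
  qed
  have nxt_hit: "As x \<inter> V (ks @ [nxt ks x]) \<noteq> {}" if hit: "As x \<inter> V ks \<noteq> {}" for ks x
  proof -
    obtain a where a: "a \<in> As x" "a \<in> V ks" using hit by blast
    have "a \<in> ball a (1 / 2 ^ length ks)" by simp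
    then have "ball a (1 / 2 ^ length ks) \<noteq> {}" by blast
    then obtain k where "d k \<in> ball a (1 / 2 ^ length ks)" using dense[OF open_ball] by blast
    then have "As x \<inter> V (ks @ [k]) \<noteq> {}" using a by (auto simp: V_snoc dist_commute)
    then show ?thesis unfolding nxt_def by (rule LeastI)
  qed
  define idx where "idx n x = rec_nat [] (\<lambda>_ ks. ks @ [nxt ks x]) n" for n x
  have idx_0: "idx 0 x = []" and idx_Suc: "idx (Suc n) x = idx n x @ [nxt (idx n x) x]" for n x
    by (simp_all add: idx_def)
  have len: "length (idx n x) = n" for n x by (induction n) (simp_all add: idx_0 idx_Suc)
  have idx_m: "idx n \<in> X \<rightarrow>\<^sub>M count_space UNIV" for n
  proof (induction n)
    case (Suc n)
    have "(\<lambda>x. ks @ [nxt ks x]) \<in> X \<rightarrow>\<^sub>M count_space UNIV" for ks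
      by (rule measurable_compose[OF nxt_m]) simp
    then show ?case unfolding idx_Suc by (rule measurable_compose_countable[OF _ Suc])
  qed (simp add: idx_0)
  define y where "y n x = d (nxt (idx n x) x)" for n x
  have y_m: "y n \<in> borel_measurable X" for n
  proof -
    have "(\<lambda>x. nxt (idx n x) x) \<in> X \<rightarrow>\<^sub>M count_space UNIV"
      by (rule measurable_compose_countable[OF nxt_m idx_m])
    from measurable_compose[OF this, of d borel] show ?thesis by (simp add: y_def[abs_def])
  qed
  define W where "W = {x\<in>space X. As x \<inter> G \<noteq> {}}"
  have W: "W \<in> sets X" unfolding W_def by (rule As_hit[OF G])
  have hit: "As x \<inter> V (idx n x) \<noteq> {}" if "x \<in> W" for n x
  proof (induction n)
    case 0
    then show ?case using that by (simp add: idx_0 V_def W_def)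
  next
    case (Suc n)
    then show ?case unfolding idx_Suc by (rule nxt_hit)
  qed
  have near: "\<exists>p\<in>As x \<inter> G. \<forall>j<n. dist (y j x) p < 1 / 2 ^ j" if x: "x \<in> W" for n x
  proof -
    obtain p where p: "p \<in> As x" "p \<in> V (idx n x)" using hit[OF x, of n] by blast
    have "p \<in> V (idx m x)" if "m \<le> n" for m
      using that p(2)
    proof (induction n)
      case (Suc n)
      then show ?case by (cases "m = Suc n") (auto simp: idx_Suc V_snoc)
    qed simp
    then have "dist (y j x) p < 1 / 2 ^ j" if "j < n" for j
      using that Suc_leI[OF that] by (force simp: idx_Suc V_snoc len y_def)
    then show ?thesis using p by (auto simp: V_def)
  qed
  have lim: "\<exists>l. (\<lambda>n. y n x) \<longlonglongrightarrow> l \<and> l \<in> As x \<and> l \<in> closure G" if x: "x \<in> W" for x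
  proof -
    have xX: "x \<in> space X" using x by (simp add: W_def)
    have "\<exists>p. \<forall>n. p n \<in> As x \<inter> G \<and> (\<forall>j<n. dist (y j x) (p n) < 1 / 2 ^ j)"
      by (rule choice) (use near[OF x] in blast)
    then obtain p where p: "\<And>n. p n \<in> As x \<inter> G" "\<And>n j. j < n \<Longrightarrow> dist (y j x) (p n) < 1 / 2 ^ j" by blast
    have half: "(\<lambda>n. 1 / 2 ^ n :: real) \<longlonglongrightarrow> 0"
      using LIMSEQ_power_zero[of "1/2::real"] by (simp add: power_one_over)
    have "Cauchy (\<lambda>n. y n x)"
    proof (rule metric_CauchyI)
      fix e :: real assume "0 < e"
      then have "\<forall>\<^sub>F n in sequentially. 1 / 2 ^ n < e / 2" using order_tendstoD(2)[OF half, of "e / 2"] by simp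
      then obtain N where N: "\<And>n. n \<ge> N \<Longrightarrow> 1 / 2 ^ n < e / 2" by (auto simp: eventually_sequentially)
      have "dist (y m x) (y n x) < e" if "m \<ge> N" "n \<ge> N" for m n
      proof -
        let ?k = "Suc (max m n)"
        have "m < ?k" "n < ?k" by auto
        then have "dist (y m x) (p ?k) < e / 2" "dist (y n x) (p ?k) < e / 2"
          using less_trans[OF p(2) N[OF that(1)]] less_trans[OF p(2) N[OF that(2)]] by blast+
        then show ?thesis using dist_triangle2[of "y m x" "y n x" "p ?k"] by linarith
      qed
      then show "\<exists>M. \<forall>m\<ge>M. \<forall>n\<ge>M. dist (y m x) (y n x) < e" by blast
    qed
    then have "convergent (\<lambda>n. y n x)" by (rule Cauchy_convergent)
    then obtain l where l: "(\<lambda>n. y n x) \<longlonglongrightarrow> l" by (auto simp: convergent_def)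
    have py: "(\<lambda>n. dist (y n x) (p (Suc n))) \<longlonglongrightarrow> 0"
      by (rule tendsto_sandwich[OF _ _ tendsto_const half]) (use p(2) in \<open>auto intro!: always_eventually less_imp_le\<close>)
    have "(\<lambda>n. dist (y n x) (p (Suc n)) + dist (y n x) l) \<longlonglongrightarrow> 0"
      using tendsto_add[OF py l[unfolded tendsto_dist_iff[of _ l]]] by simp
    then have "(\<lambda>n. dist (p (Suc n)) l) \<longlonglongrightarrow> 0"
      by (rule tendsto_sandwich[OF _ _ tendsto_const, rotated 2]) (auto intro!: always_eventually dist_triangle3)
    then have pl: "(\<lambda>n. p (Suc n)) \<longlonglongrightarrow> l" by (simp add: tendsto_dist_iff[of _ l])
    have "l \<in> As x"
      by (rule closed_sequentially[OF compact_imp_closed[OF As_compact[OF xX]] _ pl]) (use p(1) in blast)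
    moreover have "l \<in> closure G"
      by (rule closed_sequentially[OF closed_closure _ pl]) (use p(1) closure_subset in blast)
    ultimately show ?thesis using l by blast
  qed
  define g where "g x = (if x \<in> W then lim (\<lambda>n. y n x) else f0 x)" for x
  have gl: "(\<lambda>n. y n x) \<longlonglongrightarrow> g x" "g x \<in> As x" "g x \<in> closure G" if x: "x \<in> W" for x
    using lim[OF x] x by (auto simp: g_def limI)
  have f0b: "f0 \<in> borel_measurable X"
    using f0 by (simp add: measurable_restrict_space2_iff)
  show ?thesis
  proof (rule that[of g])
    show g_in: "g x \<in> As x" if "x \<in> space X" for x using gl(2) f0_in that by (cases "x \<in> W") (auto simp: g_def)
    show "g \<in> X \<rightarrow>\<^sub>M actM A"
    proof (rule measurable_restrict_space2)
      show "g \<in> space X \<rightarrow> A" using g_in As_sub by blast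
      show "g \<in> borel_measurable X"
      proof (rule borel_measurable_LIMSEQ_metric)
        fix n
        show "(\<lambda>x. if x \<in> W then y n x else f0 x) \<in> borel_measurable X"
          using y_m[of n] f0b W by (intro measurable_If_set) auto
      next
        fix x
        show "(\<lambda>n. if x \<in> W then y n x else f0 x) \<longlonglongrightarrow> g x"
          using gl(1) by (cases "x \<in> W") (auto simp: g_def)
      qed
    qed
    show "g x \<in> closure G" if "x \<in> space X" "As x \<inter> G \<noteq> {}" for x using that gl(3) by (simp add: W_def)
  qed
qed

text \<open>One selector for each set of a countable base gives a family that is dense in \<open>As x\<close> for every \<open>x\<close>.\<close>

lemma castaing:
  obtains f :: "nat \<Rightarrow> 'x \<Rightarrow> 'a" where "\<And>k. f k \<in> X \<rightarrow>\<^sub>M actM A" "\<And>k x. x \<in> space X \<Longrightarrow> f k x \<in> As x"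
    "\<And>x a e. x \<in> space X \<Longrightarrow> a \<in> As x \<Longrightarrow> e > 0 \<Longrightarrow> \<exists>k. dist (f k x) a < e"
proof -
  obtain B :: "'a set set" where B: "countable B" "topological_basis B" using ex_countable_basis by blast
  have "B \<noteq> {}" using topological_basisE[OF B(2), of UNIV undefined] by auto
  then have r: "range (from_nat_into B) = B" using B(1) by (rule range_from_nat_into)
  have op: "open (from_nat_into B n)" for n using topological_basis_open[OF B(2)] r by blast
  have "\<exists>g. g \<in> X \<rightarrow>\<^sub>M actM A \<and> (\<forall>x\<in>space X. g x \<in> As x) \<and>
      (\<forall>x\<in>space X. As x \<inter> from_nat_into B n \<noteq> {} \<longrightarrow> g x \<in> closure (from_nat_into B n))" for n
    using open_selector[OF op[of n]] by metis
  then obtain f where f: "\<And>n. f n \<in> X \<rightarrow>\<^sub>M actM A" "\<And>n x. x \<in> space X \<Longrightarrow> f n x \<in> As x"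
    "\<And>n x. x \<in> space X \<Longrightarrow> As x \<inter> from_nat_into B n \<noteq> {} \<Longrightarrow> f n x \<in> closure (from_nat_into B n)"
    by metis
  show ?thesis
  proof (rule that[OF f(1,2)])
    fix x a and e :: real assume x: "x \<in> space X" and a: "a \<in> As x" and e: "e > 0"
    obtain G where G: "G \<in> B" "a \<in> G" "G \<subseteq> ball a (e/2)"
      using topological_basisE[OF B(2), of "ball a (e/2)" a] e by auto
    obtain n where n: "G = from_nat_into B n" using G(1) r by (metis rangeE)
    have "f n x \<in> closure G" using f(3)[OF x, of n] a G(2) n by blast
    also have "closure G \<subseteq> cball a (e/2)" by (rule closure_minimal) (use G(3) ball_subset_cball in auto)
    finally have "dist (f n x) a < e" using e by (simp add: dist_commute)
    then show "\<exists>k. dist (f k x) a < e" ..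
  qed
qed

definition sel_seq :: "nat \<Rightarrow> 'x \<Rightarrow> 'a" where
  "sel_seq = (SOME f. (\<forall>k. f k \<in> X \<rightarrow>\<^sub>M actM A) \<and> (\<forall>k. \<forall>x\<in>space X. f k x \<in> As x) \<and>
    (\<forall>x\<in>space X. \<forall>a\<in>As x. \<forall>e>0. \<exists>k. dist (f k x) a < e))"

lemma sel_seq: "sel_seq k \<in> X \<rightarrow>\<^sub>M actM A" "x \<in> space X \<Longrightarrow> sel_seq k x \<in> As x"
  "x \<in> space X \<Longrightarrow> a \<in> As x \<Longrightarrow> e > 0 \<Longrightarrow> \<exists>k. dist (sel_seq k x) a < e"
proof -
  have "(\<forall>k. sel_seq k \<in> X \<rightarrow>\<^sub>M actM A) \<and> (\<forall>k. \<forall>x\<in>space X. sel_seq k x \<in> As x) \<and>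
    (\<forall>x\<in>space X. \<forall>a\<in>As x. \<forall>e>0. \<exists>k. dist (sel_seq k x) a < e)"
    (is "?P sel_seq")
  proof -
    obtain f :: "nat \<Rightarrow> 'x \<Rightarrow> 'a" where "\<And>k. f k \<in> X \<rightarrow>\<^sub>M actM A" "\<And>k x. x \<in> space X \<Longrightarrow> f k x \<in> As x"
      "\<And>x a e. x \<in> space X \<Longrightarrow> a \<in> As x \<Longrightarrow> e > 0 \<Longrightarrow> \<exists>k. dist (f k x) a < e" by (rule castaing) blast
    then have "?P f" by blast
    then show ?thesis unfolding sel_seq_def by (rule someI[of ?P])
  qed
  then show "sel_seq k \<in> X \<rightarrow>\<^sub>M actM A" "x \<in> space X \<Longrightarrow> sel_seq k x \<in> As x"
    "x \<in> space X \<Longrightarrow> a \<in> As x \<Longrightarrow> e > 0 \<Longrightarrow> \<exists>k. dist (sel_seq k x) a < e" by blast+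
qed

lemma sel_seq_le:
  assumes x: "x \<in> space X" and g: "continuous_on (As x) g" and a: "a \<in> As x"
    and le: "\<And>k. g (sel_seq k x) \<le> (c::real)"
  shows "g a \<le> c"
proof (rule field_le_epsilon)
  fix e :: real assume "0 < e"
  then obtain d where d: "d > 0" "\<And>b. b \<in> As x \<Longrightarrow> dist b a < d \<Longrightarrow> dist (g b) (g a) < e"
    using g a unfolding continuous_on_iff by metis
  obtain k where "dist (sel_seq k x) a < d" using sel_seq(3)[OF x a d(1)] by blast
  then have "dist (g (sel_seq k x)) (g a) < e" using d(2) sel_seq(2)[OF x] by blast
  then show "g a \<le> c + e" using le[of k] by (simp add: dist_real_def)
qed

text \<open>The geometric distribution gives positive weight to every selector of the dense sequence.\<close>

definition ref_kernel :: "'x \<Rightarrow> 'a measure" where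
  "ref_kernel x = distr (measure_pmf (geometric_pmf (1/2))) (actM A) (\<lambda>k. sel_seq k x)"

lemma ref_kernel: "ref_kernel \<in> markov_kernels"
  unfolding markov_kernels_def
proof (intro CollectI conjI ballI)
  let ?p = "measure_pmf (geometric_pmf (1/2))"
  have m: "(\<lambda>k. sel_seq k x) \<in> ?p \<rightarrow>\<^sub>M actM A" if "x \<in> space X" for x
    using sel_seq(2)[OF that] As_sub[OF that] by (auto simp: space_act)
  show "ref_kernel \<in> X \<rightarrow>\<^sub>M prob_algebra (actM A)"
  proof (rule measurable_prob_algebraI)
    show "prob_space (ref_kernel x)" if "x \<in> space X" for x
      unfolding ref_kernel_def by (rule measure_pmf.prob_space_distr[OF m[OF that]])
    show "ref_kernel \<in> X \<rightarrow>\<^sub>M subprob_algebra (actM A)"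
      unfolding ref_kernel_def[abs_def]
    proof (rule measurable_distr2[where M="count_space UNIV"])
      have "(\<lambda>z. sel_seq (snd z) (fst z)) \<in> X \<Otimes>\<^sub>M count_space UNIV \<rightarrow>\<^sub>M actM A"
        by (rule measurable_compose_countable[where f="\<lambda>k z. sel_seq k (fst z)"])
          (auto intro: measurable_compose[OF measurable_fst sel_seq(1)])
      then show "(\<lambda>(x, k). sel_seq k x) \<in> X \<Otimes>\<^sub>M count_space UNIV \<rightarrow>\<^sub>M actM A"
        by (simp add: case_prod_beta')
      show "(\<lambda>x. ?p) \<in> X \<rightarrow>\<^sub>M subprob_algebra (count_space UNIV)"
        by (simp add: measure_pmf_in_subprob_algebra)
    qed
  qed
  fix x assume x: "x \<in> space X"
  have "emeasure (ref_kernel x) (As x) = emeasure ?p ((\<lambda>k. sel_seq k x) -` As x \<inter> space ?p)"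
    unfolding ref_kernel_def by (rule emeasure_distr[OF m[OF x] As_measurable[OF x]])
  also have "(\<lambda>k. sel_seq k x) -` As x \<inter> space ?p = space ?p" using sel_seq(2)[OF x] by auto
  finally show "emeasure (ref_kernel x) (As x) = 1" by (simp add: measure_pmf.emeasure_space_1)
qed

lemma ref_kernel_null:
  assumes x: "x \<in> space X" and h: "h \<in> borel_measurable (actM A)" and 0: "(\<integral>\<^sup>+a. h a \<partial>ref_kernel x) = 0"
  shows "h (sel_seq k x) = 0"
proof -
  let ?p = "measure_pmf (geometric_pmf (1/2))"
  have m: "(\<lambda>k. sel_seq k x) \<in> ?p \<rightarrow>\<^sub>M actM A"
    using sel_seq(2)[OF x] As_sub[OF x] by (auto simp: space_act)
  have "(\<integral>\<^sup>+k. h (sel_seq k x) \<partial>?p) = 0"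
    using 0 h unfolding ref_kernel_def by (subst (asm) nn_integral_distr[OF m]) auto
  then have "AE k in ?p. h (sel_seq k x) = 0" by (subst (asm) nn_integral_0_iff_AE) auto
  then show ?thesis by (simp add: AE_measure_pmf_iff set_pmf_geometric)
qed

abbreviation ref_law :: "nat \<Rightarrow> 'x measure" where
  "ref_law \<equiv> state_law (stationary ref_kernel)"

definition ref_null :: "'x set \<Rightarrow> bool" where
  "ref_null N \<longleftrightarrow> N \<in> sets X \<and> (\<forall>t. emeasure (ref_law t) N = 0)"

lemma stationary_in: "\<sigma> \<in> markov_kernels \<Longrightarrow> stationary \<sigma> \<in> policies"
  unfolding stationary_eq by (rule markov_policy_in)

text \<open>Setwise continuity of the transition law in the action makes the reference policy reach,
  with positive probability, every set that some policy reaches.\<close>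

lemma state_law_ac:
  assumes \<pi>: "\<pi> \<in> policies"
  shows "N \<in> sets X \<Longrightarrow> emeasure (ref_law t) N = 0 \<Longrightarrow> emeasure (state_law \<pi> t) N = 0"
proof (induction t arbitrary: N)
  case 0
  then show ?case by (simp add: state_law_0[OF \<pi>] state_law_0[OF stationary_in[OF ref_kernel]])
next
  case (Suc t)
  note N = Suc.prems(1)
  let ?e = "evolve ref_kernel (indicator N)"
  have e_m: "?e \<in> borel_measurable X" using N by (intro evolve_measurable[OF ref_kernel]) simp
  have "(\<integral>\<^sup>+x. ?e x \<partial>ref_law t) = (\<integral>\<^sup>+x. indicator N x \<partial>ref_law (Suc t))"
    unfolding stationary_eq using N by (intro nn_integral_markov_Suc[symmetric] ref_kernel) simp
  also have "\<dots> = 0" using Suc.prems by (simp add: sets_state_law)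
  finally have i0: "(\<integral>\<^sup>+x. ?e x \<partial>ref_law t) = 0" .
  define N' where "N' = {x\<in>space X. ?e x \<noteq> 0}"
  have N': "N' \<in> sets X" unfolding N'_def using e_m by measurable
  have "AE x in ref_law t. ?e x = 0"
    using i0 e_m by (subst (asm) nn_integral_0_iff_AE) (simp_all add: measurable_cong_sets[OF sets_state_law refl])
  then have "AE x in ref_law t. x \<notin> N'" by eventually_elim (simp add: N'_def)
  then have "emeasure (ref_law t) N' = 0"
    using AE_iff_null_sets[of N' "ref_law t"] N' by (simp add: sets_state_law null_sets_def)
  from Suc.IH[OF N' this] have "emeasure (state_law \<pi> t) N' = 0" .
  then have "AE x in state_law \<pi> t. x \<notin> N'"
    using N' by (intro AE_not_in) (simp add: null_sets_def sets_state_law)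
  then have "AE x in distr (pair_law \<pi> t) X fst. x \<notin> N'" unfolding pair_law_fst[OF \<pi>] .
  then have ae: "AE z in pair_law \<pi> t. fst z \<notin> N'"
    using N' by (subst (asm) AE_distr_iff) (simp_all add: measurable_cong_sets[OF sets_pair_law refl])
  have Q0: "emeasure (Q (x, a)) N = 0" if x: "x \<in> space X" "x \<notin> N'" and a: "a \<in> As x" for x a
  proof -
    have e0: "(\<integral>\<^sup>+a. \<integral>\<^sup>+y. indicator N y \<partial>Q (x, a) \<partial>ref_kernel x) = 0"
      using x by (simp add: N'_def evolve_def)
    have hm: "(\<lambda>a. \<integral>\<^sup>+y. indicator N y \<partial>Q (x, a)) \<in> borel_measurable (actM A)"
      by (rule measurable_compose[OF measurable_Pair1'[OF x(1)] nn_integral_Q_measurable]) (use N in simp)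
    have z: "(x, b) \<in> space Z" if "b \<in> As x" for b using x As_sub that by (auto simp: space_pair_measure space_act)
    interpret q: prob_space "Q (x, a)" using Q_space[OF z[OF a]] by blast
    have "measure (Q (x, sel_seq k x)) N \<le> 0" for k
      using ref_kernel_null[OF x(1) hm e0, of k] Q_space[OF z[OF sel_seq(2)[OF x(1)]]] N by (simp add: measure_def)
    then have "measure (Q (x, a)) N \<le> 0"
      by (intro sel_seq_le[OF x(1) Q_continuous[OF x(1) N] a])
    then show ?thesis by (simp add: q.emeasure_eq_measure measure_le_0_iff)
  qed
  have "emeasure (state_law \<pi> (Suc t)) N = (\<integral>\<^sup>+x. indicator N x \<partial>state_law \<pi> (Suc t))" using N by (simp add: sets_state_law)
  also have "\<dots> = (\<integral>\<^sup>+z. \<integral>\<^sup>+y. indicator N y \<partial>Q z \<partial>pair_law \<pi> t)"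
    using N by (intro nn_integral_state_Suc[OF \<pi>]) simp
  also have "\<dots> = (\<integral>\<^sup>+z. 0 \<partial>pair_law \<pi> t)"
  proof (rule nn_integral_cong_AE)
    show "AE z in pair_law \<pi> t. (\<integral>\<^sup>+y. indicator N y \<partial>Q z) = 0"
      using ae pair_law_K[OF \<pi>, of t] AE_space
    proof eventually_elim
      case (elim z)
      then have z: "z \<in> space Z" by (simp add: space_pair_law)
      then have "emeasure (Q (fst z, snd z)) N = 0" using elim by (intro Q0) (auto simp: space_pair_measure)
      then show ?case using Q_space[OF z] N by simp
    qed
  qed
  finally show ?case by simp
qed

definition ref_ac :: "('x \<times> 'a) measure \<Rightarrow> bool" where
  "ref_ac \<mu> \<longleftrightarrow> (\<forall>N. ref_null N \<longrightarrow> emeasure \<mu> (N \<times> A) = 0)"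

lemma occ_from_ac:
  assumes \<pi>: "\<pi> \<in> policies"
  shows "ref_ac (occ_from n \<pi>)"
  unfolding ref_ac_def
proof (intro allI impI)
  fix N assume "ref_null N"
  then have N: "N \<in> sets X" "\<And>t. emeasure (state_law \<pi> t) N = 0"
    using state_law_ac[OF \<pi>] by (auto simp: ref_null_def)
  have "emeasure (state_law \<pi> t) (N - \<Delta>) = 0" for t
    using emeasure_mono[of "N - \<Delta>" N "state_law \<pi> t"] N by (simp add: sets_state_law)
  then show "emeasure (occ_from n \<pi>) (N \<times> A) = 0" by (simp add: emeasure_occ_from_rect[OF \<pi> N(1)])
qed

text \<open>Switching from the reference policy to a stationary one at a fixed time gives a policy with
  finite expected absorption time, so the stationary policy dies out from almost every state.\<close>

lemma evolve_vanishes: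
  assumes \<sigma>: "\<sigma> \<in> markov_kernels"
  shows "\<exists>N. ref_null N \<and> (\<forall>x\<in>space X - N. (\<lambda>k. (evolve \<sigma> ^^ k) (indicator (space X - \<Delta>)) x) \<longlonglongrightarrow> 0)"
proof -
  let ?g = "\<lambda>k. (evolve \<sigma> ^^ k) (indicator (space X - \<Delta>))"
  have gm: "?g k \<in> borel_measurable X" for k by (rule evolve_iter_measurable[OF \<sigma>]) simp
  define N where "N = {x\<in>space X. (\<Sum>k. ?g k x) = \<infinity>}"
  have N: "N \<in> sets X" unfolding N_def using gm by measurable
  have "emeasure (ref_law t) N = 0" for t
  proof -
    \<comment> \<open>Follow the reference policy before time \<open>t\<close> and \<open>\<sigma>\<close> from then on.\<close>
    define s where "s k = (if k < t then ref_kernel else \<sigma>)" for k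
    have s: "s k \<in> markov_kernels" for k by (simp add: s_def \<sigma> ref_kernel)
    have agree: "state_law (markov_policy s) t = ref_law t"
      unfolding stationary_eq by (rule state_law_agree[OF s]) (simp_all add: ref_kernel s_def)
    have "(\<integral>\<^sup>+x. (\<Sum>k. ?g k x) \<partial>ref_law t) = (\<Sum>k. \<integral>\<^sup>+x. ?g k x \<partial>ref_law t)"
      using gm by (intro nn_integral_suminf) (simp add: measurable_cong_sets[OF sets_state_law refl])
    also have "\<dots> = (\<Sum>k. \<integral>\<^sup>+x. indicator (space X - \<Delta>) x \<partial>state_law (markov_policy s) (t + k))"
    proof (rule suminf_cong)
      fix k
      have "\<And>k. k \<ge> t \<Longrightarrow> s k = \<sigma>" by (simp add: s_def)
      from nn_integral_markov_add[where s=s and n=t, OF s this, where f="indicator (space X - \<Delta>)" and k=k]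
      show "(\<integral>\<^sup>+x. ?g k x \<partial>ref_law t) = (\<integral>\<^sup>+x. indicator (space X - \<Delta>) x \<partial>state_law (markov_policy s) (t + k))"
        unfolding agree by simp
    qed
    also have "\<dots> = (\<Sum>k. emeasure (state_law (markov_policy s) (k + t)) (space X - \<Delta>))"
      using Dc_sets by (simp add: sets_state_law add.commute)
    also have "\<dots> \<le> (\<Sum>k. emeasure (state_law (markov_policy s) k) (space X - \<Delta>))"
      unfolding suminf_offset[OF summableI, of "\<lambda>k. emeasure (state_law (markov_policy s) k) (space X - \<Delta>)" t]
      by (simp add: add_increasing2)
    also have "\<dots> < \<infinity>" by (rule summable_survival[OF markov_policy_in[OF s]])
    finally have "(\<integral>\<^sup>+x. (\<Sum>k. ?g k x) \<partial>ref_law t) \<noteq> \<infinity>" by simp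
    then have "AE x in ref_law t. (\<Sum>k. ?g k x) \<noteq> \<infinity>"
      using gm by (intro nn_integral_noteq_infinite) (simp_all add: measurable_cong_sets[OF sets_state_law refl])
    then have "AE x in ref_law t. x \<notin> N" by eventually_elim (simp add: N_def)
    then show ?thesis
      using AE_iff_null_sets[of N "ref_law t"] N by (simp add: sets_state_law null_sets_def)
  qed
  moreover have "(\<lambda>k. ?g k x) \<longlonglongrightarrow> 0" if x: "x \<in> space X - N" for x
  proof -
    have fin: "(\<Sum>k. ?g k x) \<noteq> \<top>" using x by (simp add: N_def)
    have g1: "?g k x < \<top>" for k
    proof -
      have "?g k x \<le> 1" using x by (intro evolve_le_1[OF \<sigma>]) (auto simp: indicator_def)
      then show ?thesis using ennreal_one_less_top by (rule le_less_trans)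
    qed
    have "summable (\<lambda>k. enn2real (?g k x))"
      by (rule summable_suminf_not_top) (use fin g1 in simp_all)
    then have "(\<lambda>k. enn2real (?g k x)) \<longlonglongrightarrow> 0" by (rule summable_LIMSEQ_zero)
    then have "(\<lambda>k. ennreal (enn2real (?g k x))) \<longlonglongrightarrow> ennreal 0" by (rule tendsto_ennrealI)
    then show ?thesis using g1 by simp
  qed
  ultimately show ?thesis using N by (auto simp: ref_null_def)
qed

lemma evolve_integral_vanishes:
  assumes \<sigma>: "\<sigma> \<in> markov_kernels" and fin: "finite_measure \<nu>" and s: "sets \<nu> = sets X"
    and ac: "\<And>N. ref_null N \<Longrightarrow> emeasure \<nu> N = 0"
  shows "(\<lambda>k. \<integral>\<^sup>+x. (evolve \<sigma> ^^ k) (indicator (space X - \<Delta>)) x \<partial>\<nu>) \<longlonglongrightarrow> 0"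
proof -
  let ?g = "\<lambda>k. (evolve \<sigma> ^^ k) (indicator (space X - \<Delta>))"
  interpret finite_measure \<nu> by (rule fin)
  have gm: "?g k \<in> borel_measurable \<nu>" for k
    using evolve_iter_measurable[OF \<sigma>, of "indicator (space X - \<Delta>)" k] by (simp add: measurable_cong_sets[OF s refl])
  obtain N where N: "ref_null N" "\<And>x. x \<in> space X - N \<Longrightarrow> (\<lambda>k. ?g k x) \<longlonglongrightarrow> 0"
    using evolve_vanishes[OF \<sigma>] by blast
  have "(\<lambda>k. \<integral>\<^sup>+x. ?g k x \<partial>\<nu>) \<longlonglongrightarrow> (\<integral>\<^sup>+x. 0 \<partial>\<nu>)"
  proof (rule nn_integral_dominated_convergence[where w="\<lambda>_. 1"])
    show "AE x in \<nu>. ?g k x \<le> 1" for k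
      by (rule AE_I2) (use sets_eq_imp_space_eq[OF s] in \<open>auto intro!: evolve_le_1[OF \<sigma>] simp: indicator_def\<close>)
    have "AE x in \<nu>. x \<notin> N"
      using ac[OF N(1)] N(1) s by (intro AE_not_in) (simp add: null_sets_def ref_null_def)
    then show "AE x in \<nu>. (\<lambda>k. ?g k x) \<longlonglongrightarrow> 0"
      using AE_space by eventually_elim (use N(2) sets_eq_imp_space_eq[OF s] in auto)
    show "(\<integral>\<^sup>+x. 1 \<partial>\<nu>) < \<infinity>" using emeasure_finite by (simp add: less_top[symmetric])
  qed (use gm in auto)
  then show ?thesis by simp
qed

text \<open>To be iterated the balance equation is needed for the functions \<open>(evolve \<sigma> ^^ k) f\<close>, not only for
  indicators.\<close>

lemma balance_functions:
  assumes s: "sets \<mu> = sets Z" and sc: "sets c = sets X"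
    and bal: "\<And>\<Gamma>. \<Gamma> \<in> sets X \<Longrightarrow> emeasure \<mu> (\<Gamma> \<times> A) = emeasure c (\<Gamma> - \<Delta>) + (\<integral>\<^sup>+z. emeasure (Q z) (\<Gamma> - \<Delta>) \<partial>\<mu>)"
    and f: "f \<in> borel_measurable X"
  shows "(\<integral>\<^sup>+z. f (fst z) \<partial>\<mu>) = (\<integral>\<^sup>+x. indicator (space X - \<Delta>) x * f x \<partial>c) + (\<integral>\<^sup>+z. \<integral>\<^sup>+y. indicator (space X - \<Delta>) y * f y \<partial>Q z \<partial>\<mu>)"
  using f
proof (induction rule: borel_measurable_induct)
  have zX: "fst z \<in> space X" "sets (Q z) = sets X" "space (Q z) = space X" if "z \<in> space \<mu>" for z
  proof -
    have z: "z \<in> space Z" using that sets_eq_imp_space_eq[OF s] by simp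
    then show "fst z \<in> space X" by (auto simp: space_pair_measure)
    show "sets (Q z) = sets X" using Q_space[OF z] by blast
    then show "space (Q z) = space X" by (rule sets_eq_imp_space_eq)
  qed
  have spc: "space c = space X" by (rule sets_eq_imp_space_eq[OF sc])
  have Qm: "(\<lambda>z. \<integral>\<^sup>+y. indicator (space X - \<Delta>) y * u y \<partial>Q z) \<in> borel_measurable \<mu>" if "u \<in> borel_measurable X" for u
    unfolding measurable_cong_sets[OF s refl] by (rule nn_integral_Q_measurable) (use that in measurable)
  have fm: "(\<lambda>z. u (fst z)) \<in> borel_measurable \<mu>" if "u \<in> borel_measurable X" for u
    unfolding measurable_cong_sets[OF s refl] using that by measurable
  have cm: "(\<lambda>x. indicator (space X - \<Delta>) x * u x) \<in> borel_measurable c" if "u \<in> borel_measurable X" for u :: "'x \<Rightarrow> ennreal"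
    unfolding measurable_cong_sets[OF sc refl]
    by (intro borel_measurable_times_ennreal borel_measurable_indicator Dc_sets that)
  have qm: "(\<lambda>x. indicator (space X - \<Delta>) x * u x) \<in> borel_measurable (Q z)" if "u \<in> borel_measurable X" "z \<in> space \<mu>" for u :: "'x \<Rightarrow> ennreal" and z
    unfolding measurable_cong_sets[OF zX(2)[OF that(2)] refl]
    by (intro borel_measurable_times_ennreal borel_measurable_indicator Dc_sets that)
  {
    case (cong f g)
    have "(\<integral>\<^sup>+z. f (fst z) \<partial>\<mu>) = (\<integral>\<^sup>+z. g (fst z) \<partial>\<mu>)" using cong zX by (intro nn_integral_cong) auto
    moreover have "(\<integral>\<^sup>+x. indicator (space X - \<Delta>) x * f x \<partial>c) = (\<integral>\<^sup>+x. indicator (space X - \<Delta>) x * g x \<partial>c)"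
      using cong spc by (intro nn_integral_cong) auto
    moreover have "(\<integral>\<^sup>+z. \<integral>\<^sup>+y. indicator (space X - \<Delta>) y * f y \<partial>Q z \<partial>\<mu>) = (\<integral>\<^sup>+z. \<integral>\<^sup>+y. indicator (space X - \<Delta>) y * g y \<partial>Q z \<partial>\<mu>)"
      using cong zX by (intro nn_integral_cong) auto
    ultimately show ?case using cong by simp
  next
    case (set \<Gamma>)
    have GD: "\<Gamma> - \<Delta> \<in> sets X" using set Delta_measurable by auto
    have i: "indicator (space X - \<Delta>) x * indicator \<Gamma> x = (indicator (\<Gamma> - \<Delta>) x :: ennreal)" if "x \<in> space X" for x
      using that by (auto simp: indicator_def)
    have R: "\<Gamma> \<times> A \<in> sets \<mu>" using pair_measureI[OF set sets.top[of "actM A"]] by (simp add: space_act s)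
    have "(\<integral>\<^sup>+z. indicator \<Gamma> (fst z) \<partial>\<mu>) = (\<integral>\<^sup>+z. indicator (\<Gamma> \<times> A) z \<partial>\<mu>)"
      using sets_eq_imp_space_eq[OF s] by (intro nn_integral_cong) (auto simp: indicator_def space_pair_measure space_act)
    also have "\<dots> = emeasure \<mu> (\<Gamma> \<times> A)" using R by simp
    also note bal[OF set]
    also have "emeasure c (\<Gamma> - \<Delta>) = (\<integral>\<^sup>+x. indicator (space X - \<Delta>) x * indicator \<Gamma> x \<partial>c)"
    proof -
      have "(\<integral>\<^sup>+x. indicator (space X - \<Delta>) x * indicator \<Gamma> x \<partial>c) = (\<integral>\<^sup>+x. indicator (\<Gamma> - \<Delta>) x \<partial>c)"
        by (intro nn_integral_cong) (simp add: spc i)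
      then show ?thesis using GD sc by simp
    qed
    also have "(\<integral>\<^sup>+z. emeasure (Q z) (\<Gamma> - \<Delta>) \<partial>\<mu>) = (\<integral>\<^sup>+z. \<integral>\<^sup>+y. indicator (space X - \<Delta>) y * indicator \<Gamma> y \<partial>Q z \<partial>\<mu>)"
    proof (rule nn_integral_cong)
      fix z assume z: "z \<in> space \<mu>"
      have "(\<integral>\<^sup>+y. indicator (space X - \<Delta>) y * indicator \<Gamma> y \<partial>Q z) = (\<integral>\<^sup>+y. indicator (\<Gamma> - \<Delta>) y \<partial>Q z)"
        by (intro nn_integral_cong) (simp add: zX[OF z] i)
      then show "emeasure (Q z) (\<Gamma> - \<Delta>) = (\<integral>\<^sup>+y. indicator (space X - \<Delta>) y * indicator \<Gamma> y \<partial>Q z)"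
        using GD zX(2)[OF z] by simp
    qed
    finally show ?case .
  next
    case (mult u r)
    note um = mult.hyps(2)
    have 1: "(\<integral>\<^sup>+z. r * u (fst z) \<partial>\<mu>) = r * (\<integral>\<^sup>+z. u (fst z) \<partial>\<mu>)" by (rule nn_integral_cmult[OF fm[OF um]])
    have 2: "(\<integral>\<^sup>+x. indicator (space X - \<Delta>) x * (r * u x) \<partial>c) = r * (\<integral>\<^sup>+x. indicator (space X - \<Delta>) x * u x \<partial>c)"
      unfolding mult.left_commute[of _ r] by (rule nn_integral_cmult[OF cm[OF um]])
    have 3: "(\<integral>\<^sup>+z. \<integral>\<^sup>+y. indicator (space X - \<Delta>) y * (r * u y) \<partial>Q z \<partial>\<mu>) = r * (\<integral>\<^sup>+z. \<integral>\<^sup>+y. indicator (space X - \<Delta>) y * u y \<partial>Q z \<partial>\<mu>)"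
    proof -
      have "(\<integral>\<^sup>+z. \<integral>\<^sup>+y. indicator (space X - \<Delta>) y * (r * u y) \<partial>Q z \<partial>\<mu>) = (\<integral>\<^sup>+z. r * (\<integral>\<^sup>+y. indicator (space X - \<Delta>) y * u y \<partial>Q z) \<partial>\<mu>)"
        unfolding mult.left_commute[of _ r] by (intro nn_integral_cong nn_integral_cmult qm um)
      also have "\<dots> = r * (\<integral>\<^sup>+z. \<integral>\<^sup>+y. indicator (space X - \<Delta>) y * u y \<partial>Q z \<partial>\<mu>)" by (rule nn_integral_cmult[OF Qm[OF um]])
      finally show ?thesis .
    qed
    show ?case unfolding 1 2 3 mult.IH by (simp add: distrib_left)
  next
    case (add u v)
    note um = add.hyps(1) and vm = add.hyps(3)
    have 1: "(\<integral>\<^sup>+z. v (fst z) + u (fst z) \<partial>\<mu>) = (\<integral>\<^sup>+z. v (fst z) \<partial>\<mu>) + (\<integral>\<^sup>+z. u (fst z) \<partial>\<mu>)"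
      by (rule nn_integral_add[OF fm[OF vm] fm[OF um]])
    have 2: "(\<integral>\<^sup>+x. indicator (space X - \<Delta>) x * (v x + u x) \<partial>c) = (\<integral>\<^sup>+x. indicator (space X - \<Delta>) x * v x \<partial>c) + (\<integral>\<^sup>+x. indicator (space X - \<Delta>) x * u x \<partial>c)"
      unfolding distrib_left by (rule nn_integral_add[OF cm[OF vm] cm[OF um]])
    have 3: "(\<integral>\<^sup>+z. \<integral>\<^sup>+y. indicator (space X - \<Delta>) y * (v y + u y) \<partial>Q z \<partial>\<mu>)
        = (\<integral>\<^sup>+z. \<integral>\<^sup>+y. indicator (space X - \<Delta>) y * v y \<partial>Q z \<partial>\<mu>) + (\<integral>\<^sup>+z. \<integral>\<^sup>+y. indicator (space X - \<Delta>) y * u y \<partial>Q z \<partial>\<mu>)"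
    proof -
      have "(\<integral>\<^sup>+z. \<integral>\<^sup>+y. indicator (space X - \<Delta>) y * (v y + u y) \<partial>Q z \<partial>\<mu>)
          = (\<integral>\<^sup>+z. (\<integral>\<^sup>+y. indicator (space X - \<Delta>) y * v y \<partial>Q z) + (\<integral>\<^sup>+y. indicator (space X - \<Delta>) y * u y \<partial>Q z) \<partial>\<mu>)"
        unfolding distrib_left by (intro nn_integral_cong nn_integral_add qm um vm)
      also have "\<dots> = (\<integral>\<^sup>+z. \<integral>\<^sup>+y. indicator (space X - \<Delta>) y * v y \<partial>Q z \<partial>\<mu>) + (\<integral>\<^sup>+z. \<integral>\<^sup>+y. indicator (space X - \<Delta>) y * u y \<partial>Q z \<partial>\<mu>)"
        by (rule nn_integral_add[OF Qm[OF vm] Qm[OF um]])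
      finally show ?thesis .
    qed
    show ?case unfolding 1 2 3 add.IH by (simp add: ac_simps)
  next
    case (seq U)
    note Um = seq.hyps(1)
    have incU: "incseq (\<lambda>i z. U i (h z))" for h :: "'z \<Rightarrow> 'x" using seq.hyps by (auto simp: incseq_def le_fun_def)
    have incI: "incseq (\<lambda>i x. indicator (space X - \<Delta>) x * U i x)"
      using seq.hyps by (auto simp: incseq_def le_fun_def intro!: mult_left_mono)
    have ptI: "indicator (space X - \<Delta>) x * (SUP i. U i) x = (SUP i. indicator (space X - \<Delta>) x * U i x)" for x
      by (simp add: SUP_mult_left_ennreal image_comp)
    have 1: "(\<integral>\<^sup>+z. (SUP i. U i) (fst z) \<partial>\<mu>) = (SUP i. \<integral>\<^sup>+z. U i (fst z) \<partial>\<mu>)"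
      using nn_integral_monotone_convergence_SUP[OF incU[of fst] fm[OF Um]] by (simp add: image_comp)
    have 2: "(\<integral>\<^sup>+x. indicator (space X - \<Delta>) x * (SUP i. U i) x \<partial>c) = (SUP i. \<integral>\<^sup>+x. indicator (space X - \<Delta>) x * U i x \<partial>c)"
      unfolding ptI by (rule nn_integral_monotone_convergence_SUP[OF incI cm[OF Um]])
    have 3: "(\<integral>\<^sup>+z. \<integral>\<^sup>+y. indicator (space X - \<Delta>) y * (SUP i. U i) y \<partial>Q z \<partial>\<mu>) = (SUP i. \<integral>\<^sup>+z. \<integral>\<^sup>+y. indicator (space X - \<Delta>) y * U i y \<partial>Q z \<partial>\<mu>)"
    proof -
      have "(\<integral>\<^sup>+z. \<integral>\<^sup>+y. indicator (space X - \<Delta>) y * (SUP i. U i) y \<partial>Q z \<partial>\<mu>) = (\<integral>\<^sup>+z. (SUP i. \<integral>\<^sup>+y. indicator (space X - \<Delta>) y * U i y \<partial>Q z) \<partial>\<mu>)"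
        unfolding ptI by (intro nn_integral_cong nn_integral_monotone_convergence_SUP incI qm Um)
      also have "\<dots> = (SUP i. \<integral>\<^sup>+z. \<integral>\<^sup>+y. indicator (space X - \<Delta>) y * U i y \<partial>Q z \<partial>\<mu>)"
        by (rule nn_integral_monotone_convergence_SUP[OF _ Qm[OF Um]])
          (use incI in \<open>auto simp: incseq_def le_fun_def intro!: nn_integral_mono\<close>)
      finally show ?thesis .
    qed
    have inc2: "incseq (\<lambda>i. \<integral>\<^sup>+x. indicator (space X - \<Delta>) x * U i x \<partial>c)"
      "incseq (\<lambda>i. \<integral>\<^sup>+z. \<integral>\<^sup>+y. indicator (space X - \<Delta>) y * U i y \<partial>Q z \<partial>\<mu>)"
      using incI by (auto simp: incseq_def le_fun_def intro!: nn_integral_mono)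
    show ?case unfolding 1 2 3 seq.IH by (rule ennreal_SUP_add[OF inc2])
  }
qed

text \<open>Disintegrate \<open>\<mu>\<close> along its marginal and iterate the balance equation: the \<open>n\<close>-th remainder is the
  integral of the probability of surviving \<open>n\<close> more steps, which tends to \<open>0\<close>.  On the null set where
  the disintegration charges unavailable actions it is replaced by a measurable selector.\<close>

lemma balance_solution:
  assumes \<mu>: "\<mu> \<in> finite_measures Z" and K: "AE z in \<mu>. snd z \<in> As (fst z)" and ac: "ref_ac \<mu>"
    and sc: "sets c = sets X"
    and bal: "\<And>\<Gamma>. \<Gamma> \<in> sets X \<Longrightarrow> emeasure \<mu> (\<Gamma> \<times> A) = emeasure c (\<Gamma> - \<Delta>) + (\<integral>\<^sup>+z. emeasure (Q z) (\<Gamma> - \<Delta>) \<partial>\<mu>)"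
  obtains \<sigma> where "\<sigma> \<in> markov_kernels" "\<mu> = kprod X (actM A) (distr \<mu> X fst) \<sigma>"
    "\<And>\<Gamma>. \<Gamma> \<in> sets X \<Longrightarrow> emeasure \<mu> (\<Gamma> \<times> A) = (\<Sum>k. \<integral>\<^sup>+x. (evolve \<sigma> ^^ k) (indicator (\<Gamma> - \<Delta>)) x \<partial>c)"
proof -
  have fin: "finite_measure \<mu>" and s [measurable_cong]: "sets \<mu> = sets Z" using \<mu> by (auto simp: finite_measures_def)
  interpret finite_measure \<mu> by (rule fin)
  let ?\<nu> = "distr \<mu> X fst"
  have fst: "fst \<in> \<mu> \<rightarrow>\<^sub>M X" by (simp add: measurable_cong_sets[OF s refl])
  obtain \<kappa> where \<kappa>: "\<kappa> \<in> X \<rightarrow>\<^sub>M prob_algebra (actM A)" and \<mu>\<kappa>: "\<mu> = kprod X (actM A) ?\<nu> \<kappa>"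
    using disintegration[OF A_compact A_ne X_ne \<mu>] by blast
  obtain f0 where f0: "f0 \<in> X \<rightarrow>\<^sub>M actM A" "\<And>x. x \<in> space X \<Longrightarrow> f0 x \<in> As x" using selector by blast
  \<comment> \<open>A Markov kernel has to respect the constraint in every state, the disintegration does so in almost every one.\<close>
  define G where "G = {x\<in>space X. emeasure (\<kappa> x) (As x) = 1}"
  have em: "(\<lambda>x. emeasure (\<kappa> x) (As x)) \<in> borel_measurable X"
    by (rule emeasure_measurable_subprob_algebra2[OF K_measurable measurable_prob_algebraD[OF \<kappa>]])
  have G: "G \<in> sets X" unfolding G_def using em by measurable
  define \<sigma> where "\<sigma> x = (if x \<in> G then \<kappa> x else return (actM A) (f0 x))" for x
  have \<sigma>m: "\<sigma> \<in> X \<rightarrow>\<^sub>M prob_algebra (actM A)"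
    unfolding \<sigma>_def[abs_def]
    by (rule measurable_If_set) (use \<kappa> G measurable_compose[OF f0(1) measurable_return_prob_space] in auto)
  have \<sigma>: "\<sigma> \<in> markov_kernels"
    unfolding markov_kernels_def
  proof (intro CollectI conjI ballI \<sigma>m)
    fix x assume x: "x \<in> space X"
    show "emeasure (\<sigma> x) (As x) = 1"
      using x f0(2)[OF x] As_measurable[OF x] by (auto simp: \<sigma>_def G_def)
  qed
  have \<kappa>x: "prob_space (\<kappa> x)" "sets (\<kappa> x) = sets (actM A)" if "x \<in> space X" for x
    using measurable_space[OF \<kappa> that] by (auto simp: space_prob_algebra)
  have "AE x in ?\<nu>. x \<in> G"
  proof -
    let ?C = "space Z - (SIGMA x:space X. As x)"
    have C: "?C \<in> sets Z" using K_measurable by auto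
    have Cm: "indicator ?C \<in> borel_measurable Z" using C by simp
    have "AE z in \<mu>. z \<notin> ?C" using K AE_space
      by eventually_elim (use sets_eq_imp_space_eq[OF s] in \<open>auto simp: space_pair_measure\<close>)
    then have "emeasure \<mu> ?C = 0" using AE_iff_null_sets[of ?C \<mu>] C by (simp add: s null_sets_def)
    then have "(\<integral>\<^sup>+z. indicator ?C z \<partial>\<mu>) = 0" using C by (simp add: s)
    then have "(\<integral>\<^sup>+z. indicator ?C z \<partial>kprod X (actM A) ?\<nu> \<kappa>) = 0" using \<mu>\<kappa> by simp
    then have "(\<integral>\<^sup>+x. \<integral>\<^sup>+a. indicator ?C (x, a) \<partial>\<kappa> x \<partial>?\<nu>) = 0"
      by (subst (asm) nn_integral_kprod[OF _ X_ne \<kappa> Cm]) simp_all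
    moreover have "(\<lambda>x. \<integral>\<^sup>+a. indicator ?C (x, a) \<partial>\<kappa> x) \<in> borel_measurable X"
      by (rule nn_integral_measurable_subprob_algebra2[OF _ measurable_prob_algebraD[OF \<kappa>]]) (use Cm in simp)
    ultimately have "AE x in ?\<nu>. (\<integral>\<^sup>+a. indicator ?C (x, a) \<partial>\<kappa> x) = 0"
      by (subst (asm) nn_integral_0_iff_AE) simp_all
    then show ?thesis using AE_space
    proof eventually_elim
      case (elim x)
      then have x: "x \<in> space X" by simp
      interpret k: prob_space "\<kappa> x" by (rule \<kappa>x[OF x])
      have sk: "space (\<kappa> x) = A" using sets_eq_imp_space_eq[OF \<kappa>x(2)[OF x]] by (simp add: space_act)
      have "(\<integral>\<^sup>+a. indicator ?C (x, a) \<partial>\<kappa> x) = (\<integral>\<^sup>+a. indicator (A - As x) a \<partial>\<kappa> x)"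
        using x by (intro nn_integral_cong) (auto simp: indicator_def sk space_pair_measure space_act)
      moreover have AA: "A - As x \<in> sets (\<kappa> x)" "As x \<in> sets (\<kappa> x)"
        using As_measurable[OF x] sets.top[of "actM A"] \<kappa>x(2)[OF x] by (auto simp: space_act)
      ultimately have "emeasure (\<kappa> x) (A - As x) = 0" using elim by simp
      then have "k.prob (space (\<kappa> x) - As x) = 0" by (simp add: measure_def sk)
      then have "k.prob (As x) = 1" using k.prob_compl[OF AA(2)] by simp
      then show ?case using x by (simp add: G_def k.emeasure_eq_measure)
    qed
  qed
  then have ae: "AE x in ?\<nu>. \<sigma> x = \<kappa> x" by eventually_elim (simp add: \<sigma>_def)
  have \<mu>\<sigma>: "\<mu> = kprod X (actM A) ?\<nu> \<sigma>"
  proof (rule measure_eqI_rect[OF s _ fin])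
    show "sets (kprod X (actM A) ?\<nu> \<sigma>) = sets Z" by (rule sets_kprod[OF _ X_ne \<sigma>m]) simp
    fix \<Gamma> B assume GB: "\<Gamma> \<in> sets X" "B \<in> sets (actM A)"
    have "emeasure \<mu> (\<Gamma> \<times> B) = emeasure (kprod X (actM A) ?\<nu> \<kappa>) (\<Gamma> \<times> B)" using \<mu>\<kappa> by simp
    also have "\<dots> = (\<integral>\<^sup>+x\<in>\<Gamma>. emeasure (\<kappa> x) B \<partial>?\<nu>)"
      by (rule emeasure_kprod[OF _ X_ne \<kappa> GB]) simp
    also have "\<dots> = (\<integral>\<^sup>+x\<in>\<Gamma>. emeasure (\<sigma> x) B \<partial>?\<nu>)"
      by (rule nn_integral_cong_AE[OF AE_mp[OF ae AE_I2]]) simp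
    also have "\<dots> = emeasure (kprod X (actM A) ?\<nu> \<sigma>) (\<Gamma> \<times> B)"
      by (rule emeasure_kprod[OF _ X_ne \<sigma>m GB, symmetric]) simp
    finally show "emeasure \<mu> (\<Gamma> \<times> B) = emeasure (kprod X (actM A) ?\<nu> \<sigma>) (\<Gamma> \<times> B)" .
  qed
  have finn: "finite_measure ?\<nu>" by (rule finite_measure_distr[OF fst])
  have marg: "emeasure ?\<nu> \<Gamma> = emeasure \<mu> (\<Gamma> \<times> A)" if "\<Gamma> \<in> sets X" for \<Gamma>
    using sets.sets_into_space[OF that] sets_eq_imp_space_eq[OF s]
    by (subst emeasure_distr[OF fst that]) (auto simp: space_pair_measure space_act intro!: arg_cong2[where f=emeasure])
  have acn: "emeasure ?\<nu> N = 0" if "ref_null N" for N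
    using ac that marg[of N] by (simp add: ref_ac_def ref_null_def)
  have step: "(\<integral>\<^sup>+x. f x \<partial>?\<nu>) = (\<integral>\<^sup>+x. f x \<partial>c) + (\<integral>\<^sup>+x. evolve \<sigma> f x \<partial>?\<nu>)"
    if f: "f \<in> borel_measurable X" and f0: "\<And>x. x \<in> \<Delta> \<Longrightarrow> f x = 0" for f
  proof -
    have i: "indicator (space X - \<Delta>) x * f x = f x" if "x \<in> space X" for x
      using f0 that by (auto simp: indicator_def)
    have "(\<integral>\<^sup>+x. f x \<partial>?\<nu>) = (\<integral>\<^sup>+z. f (fst z) \<partial>\<mu>)"
      by (rule nn_integral_distr[OF fst]) (use f in simp)
    also have "\<dots> = (\<integral>\<^sup>+x. indicator (space X - \<Delta>) x * f x \<partial>c) + (\<integral>\<^sup>+z. \<integral>\<^sup>+y. indicator (space X - \<Delta>) y * f y \<partial>Q z \<partial>\<mu>)"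
      by (rule balance_functions[OF s sc bal f])
    also have "(\<integral>\<^sup>+x. indicator (space X - \<Delta>) x * f x \<partial>c) = (\<integral>\<^sup>+x. f x \<partial>c)"
      using sets_eq_imp_space_eq[OF sc] by (intro nn_integral_cong) (simp add: i)
    also have "(\<integral>\<^sup>+z. \<integral>\<^sup>+y. indicator (space X - \<Delta>) y * f y \<partial>Q z \<partial>\<mu>) = (\<integral>\<^sup>+z. \<integral>\<^sup>+y. f y \<partial>Q z \<partial>\<mu>)"
    proof (intro nn_integral_cong)
      fix z y assume z: "z \<in> space \<mu>" and y: "y \<in> space (Q z)"
      have "z \<in> space Z" using z sets_eq_imp_space_eq[OF s] by simp
      then have "space (Q z) = space X" using Q_space sets_eq_imp_space_eq by blast
      then show "indicator (space X - \<Delta>) y * f y = f y" using y by (simp add: i)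
    qed
    also have "\<dots> = (\<integral>\<^sup>+z. \<integral>\<^sup>+y. f y \<partial>Q z \<partial>kprod X (actM A) ?\<nu> \<sigma>)" using \<mu>\<sigma> by simp
    also have "\<dots> = (\<integral>\<^sup>+x. evolve \<sigma> f x \<partial>?\<nu>)"
      unfolding evolve_def by (rule nn_integral_kprod[OF _ X_ne \<sigma>m nn_integral_Q_measurable[OF f]]) simp
    finally show ?thesis .
  qed
  have iter: "(\<integral>\<^sup>+x. f x \<partial>?\<nu>) = (\<Sum>k<n. \<integral>\<^sup>+x. (evolve \<sigma> ^^ k) f x \<partial>c) + (\<integral>\<^sup>+x. (evolve \<sigma> ^^ n) f x \<partial>?\<nu>)"
    if f: "f \<in> borel_measurable X" and f0: "\<And>x. x \<in> \<Delta> \<Longrightarrow> f x = 0" for f n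
  proof (induction n)
    case (Suc n)
    have "(\<integral>\<^sup>+x. (evolve \<sigma> ^^ n) f x \<partial>?\<nu>) = (\<integral>\<^sup>+x. (evolve \<sigma> ^^ n) f x \<partial>c) + (\<integral>\<^sup>+x. (evolve \<sigma> ^^ Suc n) f x \<partial>?\<nu>)"
      unfolding funpow.simps comp_def
      by (rule step[OF evolve_iter_measurable[OF \<sigma> f] evolve_Delta[OF \<sigma> f f0]])
    then show ?case unfolding Suc by (simp add: add.assoc)
  qed simp
  show ?thesis
  proof (rule that[OF \<sigma> \<mu>\<sigma>])
    fix \<Gamma> assume G: "\<Gamma> \<in> sets X"
    have GD: "\<Gamma> - \<Delta> \<in> sets X" using G Delta_measurable by auto
    let ?f = "indicator (\<Gamma> - \<Delta>) :: 'x \<Rightarrow> ennreal"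
    have fm: "?f \<in> borel_measurable X" using GD by simp
    have f0: "?f x = 0" if "x \<in> \<Delta>" for x using that by simp
    have le: "(\<integral>\<^sup>+x. (evolve \<sigma> ^^ n) ?f x \<partial>?\<nu>) \<le> (\<integral>\<^sup>+x. (evolve \<sigma> ^^ n) (indicator (space X - \<Delta>)) x \<partial>?\<nu>)" for n
      by (intro nn_integral_mono evolve_iter_mono[OF \<sigma>]) (auto simp: indicator_def)
    have t0: "(\<lambda>n. \<integral>\<^sup>+x. (evolve \<sigma> ^^ n) ?f x \<partial>?\<nu>) \<longlonglongrightarrow> 0"
      by (rule tendsto_sandwich[OF _ _ tendsto_const evolve_integral_vanishes[OF \<sigma> finn _ acn]]) (use le in auto)
    have "(\<lambda>n. \<Sum>k<n. \<integral>\<^sup>+x. (evolve \<sigma> ^^ k) ?f x \<partial>c) \<longlonglongrightarrow> (\<Sum>k. \<integral>\<^sup>+x. (evolve \<sigma> ^^ k) ?f x \<partial>c)"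
      by (rule summable_LIMSEQ[OF summableI])
    from tendsto_add[OF this t0]
    have "(\<lambda>n. (\<Sum>k<n. \<integral>\<^sup>+x. (evolve \<sigma> ^^ k) ?f x \<partial>c) + (\<integral>\<^sup>+x. (evolve \<sigma> ^^ n) ?f x \<partial>?\<nu>))
        \<longlonglongrightarrow> (\<Sum>k. \<integral>\<^sup>+x. (evolve \<sigma> ^^ k) ?f x \<partial>c)" by simp
    then have "(\<lambda>n::nat. \<integral>\<^sup>+x. ?f x \<partial>?\<nu>) \<longlonglongrightarrow> (\<Sum>k. \<integral>\<^sup>+x. (evolve \<sigma> ^^ k) ?f x \<partial>c)"
      by (subst (asm) iter[OF fm f0, symmetric])
    then have eq: "(\<integral>\<^sup>+x. ?f x \<partial>?\<nu>) = (\<Sum>k. \<integral>\<^sup>+x. (evolve \<sigma> ^^ k) ?f x \<partial>c)"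
      by (simp add: LIMSEQ_const_iff)
    have "emeasure \<mu> (\<Gamma> \<times> A) = emeasure \<mu> ((\<Gamma> - \<Delta>) \<times> A)"
    proof -
      have "(\<Gamma> - \<Delta>) - \<Delta> = \<Gamma> - \<Delta>" by auto
      then show ?thesis using bal[OF G] bal[OF GD] by simp
    qed
    also have "\<dots> = (\<integral>\<^sup>+x. ?f x \<partial>?\<nu>)" using GD by (simp add: marg)
    finally show "emeasure \<mu> (\<Gamma> \<times> A) = (\<Sum>k. \<integral>\<^sup>+x. (evolve \<sigma> ^^ k) ?f x \<partial>c)" using eq by simp
  qed
qed

text \<open>With source \<open>\<eta>\<close> the series of the iterated balance equation is the sum of the state laws of the
  stationary policy.\<close>

lemma balance_occupation:
  assumes \<mu>: "\<mu> \<in> finite_measures Z" and K: "AE z in \<mu>. snd z \<in> As (fst z)" and ac: "ref_ac \<mu>"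
    and bal: "\<And>\<Gamma>. \<Gamma> \<in> sets X \<Longrightarrow> emeasure \<mu> (\<Gamma> \<times> A) = emeasure \<eta> (\<Gamma> - \<Delta>) + (\<integral>\<^sup>+z. emeasure (Q z) (\<Gamma> - \<Delta>) \<partial>\<mu>)"
  shows "\<exists>\<sigma>\<in>markov_kernels. \<mu> = occ_from 0 (stationary \<sigma>)"
proof -
  obtain \<sigma> where \<sigma>: "\<sigma> \<in> markov_kernels" "\<mu> = kprod X (actM A) (distr \<mu> X fst) \<sigma>"
    and eq: "\<And>\<Gamma>. \<Gamma> \<in> sets X \<Longrightarrow> emeasure \<mu> (\<Gamma> \<times> A) = (\<Sum>k. \<integral>\<^sup>+x. (evolve \<sigma> ^^ k) (indicator (\<Gamma> - \<Delta>)) x \<partial>\<eta>)"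
    using balance_solution[OF \<mu> K ac sets_\<eta> bal] by blast
  note \<pi> = stationary_in[OF \<sigma>(1)]
  let ?o = "occ_from 0 (stationary \<sigma>)"
  have so: "sets ?o = sets Z" by (rule sets_occ_from[OF \<pi>])
  have s: "sets \<mu> = sets Z" using \<mu> by (simp add: finite_measures_def)
  have marg: "emeasure (distr L X fst) \<Gamma> = emeasure L (\<Gamma> \<times> A)" if "sets L = sets Z" "\<Gamma> \<in> sets X" for L \<Gamma>
    using sets.sets_into_space[OF that(2)] sets_eq_imp_space_eq[OF that(1)]
    by (subst emeasure_distr) (use that in \<open>auto simp: space_pair_measure space_act measurable_cong_sets[OF that(1) refl] intro!: arg_cong2[where f=emeasure]\<close>)
  have "distr \<mu> X fst = distr ?o X fst"
  proof (rule measure_eqI)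
    fix \<Gamma> assume "\<Gamma> \<in> sets (distr \<mu> X fst)"
    then have G: "\<Gamma> \<in> sets X" by simp
    have GD: "\<Gamma> - \<Delta> \<in> sets X" using G Delta_measurable by auto
    have "emeasure ?o (\<Gamma> \<times> A) = (\<Sum>t. emeasure (state_law (stationary \<sigma>) (0 + t)) (\<Gamma> - \<Delta>))"
      by (rule emeasure_occ_from_rect[OF \<pi> G])
    also have "\<dots> = (\<Sum>t. \<integral>\<^sup>+x. indicator (\<Gamma> - \<Delta>) x \<partial>state_law (stationary \<sigma>) (0 + t))"
      using GD by (simp add: sets_state_law)
    also have "\<dots> = (\<Sum>t. \<integral>\<^sup>+x. (evolve \<sigma> ^^ t) (indicator (\<Gamma> - \<Delta>)) x \<partial>state_law (stationary \<sigma>) 0)"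
      unfolding stationary_eq using GD \<sigma>(1) by (subst nn_integral_markov_add[where \<sigma>=\<sigma>]) simp_all
    also have "\<dots> = emeasure \<mu> (\<Gamma> \<times> A)" by (simp add: eq[OF G] state_law_0[OF \<pi>])
    finally show "emeasure (distr \<mu> X fst) \<Gamma> = emeasure (distr ?o X fst) \<Gamma>" by (simp add: marg[OF s G] marg[OF so G])
  qed simp
  then have "\<mu> = ?o" using \<sigma>(2) occ_markov[OF \<sigma>(1)] by simp
  then show ?thesis using \<sigma>(1) by blast
qed

text \<open>With no source the series is empty.\<close>

lemma invariant_zero:
  assumes \<mu>: "\<mu> \<in> finite_measures Z" and K: "AE z in \<mu>. snd z \<in> As (fst z)" and ac: "ref_ac \<mu>"
    and bal: "\<And>\<Gamma>. \<Gamma> \<in> sets X \<Longrightarrow> emeasure \<mu> (\<Gamma> \<times> A) = (\<integral>\<^sup>+z. emeasure (Q z) (\<Gamma> - \<Delta>) \<partial>\<mu>)"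
  shows "emeasure \<mu> (space X \<times> A) = 0"
proof -
  obtain \<sigma> where "\<And>\<Gamma>. \<Gamma> \<in> sets X \<Longrightarrow> emeasure \<mu> (\<Gamma> \<times> A) = (\<Sum>k. \<integral>\<^sup>+x. (evolve \<sigma> ^^ k) (indicator (\<Gamma> - \<Delta>)) x \<partial>null_measure X)"
    using balance_solution[OF \<mu> K ac, of "null_measure X"] bal by auto
  from this[OF sets.top] show ?thesis by simp
qed

end

section \<open>Closedness of the set of occupation measures\<close>

lemma ws_continuous_integral:
  assumes f: "bounded_caratheodory X A f"
  shows "continuous_map (ws_topology X A) euclideanreal (\<lambda>\<mu>. \<integral>z. f z \<partial>\<mu>)"
  unfolding continuous_map_def
proof (intro conjI allI impI)
  fix U :: "real set" assume "openin euclideanreal U"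
  then have "openin (ws_topology X A) {\<mu> \<in> finite_measures (X \<Otimes>\<^sub>M actM A). (\<integral>z. f z \<partial>\<mu>) \<in> U}"
    unfolding ws_topology_def by (intro topology_generated_by_Basis) (use f in auto)
  then show "openin (ws_topology X A) {\<mu> \<in> topspace (ws_topology X A). (\<integral>z. f z \<partial>\<mu>) \<in> U}"
    by (simp add: topspace_ws_topology)
qed simp

context compact_model
begin

abbreviation ws :: "('x \<times> 'a) measure topology" where "ws \<equiv> ws_topology X A"

lemma caratheodory_m: "bounded_caratheodory X A f \<Longrightarrow> f \<in> borel_measurable Z"
  using compact_coding_ex[OF A_compact A_ne] compact_coding.caratheodory_measurable by metis

lemma fmD:
  assumes "\<mu> \<in> finite_measures Z"
  shows "finite_measure \<mu>" "sets \<mu> = sets Z" "space \<mu> = space X \<times> A"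
  using assms sets_eq_imp_space_eq[of \<mu> Z] by (auto simp: finite_measures_def space_pair_measure space_act)

lemma rect_sets: "\<Gamma> \<in> sets X \<Longrightarrow> \<Gamma> \<times> A \<in> sets Z"
  using pair_measureI[OF _ sets.top[of "actM A"]] by (simp add: space_act)

lemma ws_continuous_rect:
  assumes G: "\<Gamma> \<in> sets X"
  shows "continuous_map ws euclideanreal (\<lambda>\<mu>. measure \<mu> (\<Gamma> \<times> A))"
proof (rule continuous_map_eq)
  show "continuous_map ws euclideanreal (\<lambda>\<mu>. \<integral>z. indicat_real \<Gamma> (fst z) * 1 \<partial>\<mu>)"
    by (rule ws_continuous_integral[OF indicator_caratheodory[OF G, where B=1]]) auto
  fix \<mu> assume "\<mu> \<in> topspace ws"
  then have \<mu>: "\<mu> \<in> finite_measures Z" by (simp add: topspace_ws_topology)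
  note D = fmD[OF \<mu>]
  have "(\<integral>z. indicat_real \<Gamma> (fst z) * 1 \<partial>\<mu>) = (\<integral>z. indicator (\<Gamma> \<times> A) z \<partial>\<mu>)"
    by (intro Bochner_Integration.integral_cong) (auto simp: D indicator_def)
  then show "(\<integral>z. indicat_real \<Gamma> (fst z) * 1 \<partial>\<mu>) = measure \<mu> (\<Gamma> \<times> A)"
    using rect_sets[OF G] D(2) by simp
qed

definition on_K :: "('x \<times> 'a) measure set" where
  "on_K = {\<mu> \<in> finite_measures Z. AE z in \<mu>. snd z \<in> As (fst z)}"

lemma on_K_sub: "on_K \<subseteq> topspace ws"
  by (auto simp: on_K_def topspace_ws_topology)

definition gap :: "'x \<times> 'a \<Rightarrow> real" where
  "gap z = min 1 (infdist (snd z) (As (fst z)))"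

lemma gap_caratheodory: "bounded_caratheodory X A gap"
  unfolding bounded_caratheodory_def
proof (intro conjI ballI)
  show "bounded (gap ` (space X \<times> A))"
    by (rule boundedI[where B=1]) (auto simp: gap_def infdist_nonneg)
  show "continuous_on A (\<lambda>a. gap (x, a))" for x
    unfolding gap_def by (auto intro!: continuous_intros)
  fix a
  have "(\<lambda>x. infdist a (As x)) \<in> borel_measurable X"
    unfolding borel_measurable_iff_less
  proof
    fix r
    have "{x \<in> space X. infdist a (As x) < r} = {x \<in> space X. As x \<inter> ball a r \<noteq> {}}"
    proof (intro Collect_cong conj_cong refl)
      fix x assume x: "x \<in> space X"
      show "infdist a (As x) < r \<longleftrightarrow> As x \<inter> ball a r \<noteq> {}"
        using As_nonempty[OF x] by (auto simp: infdist_notempty cINF_less_iff)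
    qed
    then show "{x \<in> space X. infdist a (As x) < r} \<in> sets X" using As_hit[OF open_ball] by simp
  qed
  then show "(\<lambda>x. gap (x, a)) \<in> borel_measurable X" unfolding gap_def by simp
qed

text \<open>The truncated distance of the action to \<open>As x\<close> is a Caratheodory function; its integral is zero exactly
  for the measures carried by the graph of \<open>As\<close>.\<close>

lemma closedin_on_K: "closedin ws on_K"
proof -
  have "on_K = {\<mu> \<in> topspace ws. (\<integral>z. gap z \<partial>\<mu>) = 0}"
  proof (rule set_eqI)
    fix \<mu>
    have "(AE z in \<mu>. snd z \<in> As (fst z)) \<longleftrightarrow> (\<integral>z. gap z \<partial>\<mu>) = 0" if \<mu>: "\<mu> \<in> finite_measures Z"
    proof -
      note D = fmD[OF \<mu>]
      interpret finite_measure \<mu> by (rule D)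
      have gm: "gap \<in> borel_measurable \<mu>"
        using caratheodory_m[OF gap_caratheodory] by (simp add: measurable_cong_sets[OF D(2) refl])
      have ig: "integrable \<mu> gap"
        by (rule integrable_const_bound[where B=1, OF _ gm]) (auto simp: gap_def infdist_nonneg)
      have "(\<integral>z. gap z \<partial>\<mu>) = 0 \<longleftrightarrow> (AE z in \<mu>. gap z = 0)"
        by (rule integral_nonneg_eq_0_iff_AE[OF ig]) (auto simp: gap_def infdist_nonneg)
      also have "\<dots> \<longleftrightarrow> (AE z in \<mu>. snd z \<in> As (fst z))"
      proof (rule AE_cong)
        fix z assume "z \<in> space \<mu>"
        then have x: "fst z \<in> space X" by (auto simp: D)
        show "gap z = 0 \<longleftrightarrow> snd z \<in> As (fst z)"
          unfolding gap_def
          using in_closed_iff_infdist_zero[OF compact_imp_closed[OF As_compact[OF x]] As_nonempty[OF x], of "snd z"]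
          by (auto simp: min_def)
      qed
      finally show ?thesis by simp
    qed
    then show "\<mu> \<in> on_K \<longleftrightarrow> \<mu> \<in> {\<mu> \<in> topspace ws. (\<integral>z. gap z \<partial>\<mu>) = 0}"
      by (auto simp: on_K_def topspace_ws_topology)
  qed
  then show ?thesis
    using closedin_Collect_real(2)[OF ws_continuous_integral[OF gap_caratheodory], of 0] by simp
qed

context
  fixes q :: "'x \<times> 'a \<Rightarrow> real" and B :: real
  assumes qm: "q \<in> borel_measurable Z" and qB: "\<And>z. z \<in> space Z \<Longrightarrow> \<bar>q z\<bar> \<le> B"
    and qc: "\<And>x. x \<in> space X \<Longrightarrow> continuous_on (As x) (\<lambda>a. q (x, a))"
begin

text \<open>Lipschitz envelopes in the action of a function that is continuous on \<open>As x\<close> only.  They are defined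
  on the whole of \<open>A\<close> and increase to the function on the graph of \<open>As\<close>.\<close>

definition env :: "nat \<Rightarrow> 'x \<times> 'a \<Rightarrow> real" where
  "env n z = (INF k. q (fst z, sel_seq k (fst z)) + real n * dist (snd z) (sel_seq k (fst z)))"

lemma q_sel: "x \<in> space X \<Longrightarrow> \<bar>q (x, sel_seq k x)\<bar> \<le> B"
  using sel_seq(2)[of x k] As_sub[of x] by (intro qB) (auto simp: space_pair_measure space_act)

lemma env_term_lower: "x \<in> space X \<Longrightarrow> - B \<le> q (x, sel_seq k x) + real n * dist a (sel_seq k x)"
proof -
  assume "x \<in> space X"
  then have "\<bar>q (x, sel_seq k x)\<bar> \<le> B" by (rule q_sel)
  moreover have "0 \<le> real n * dist a (sel_seq k x)" by simp
  ultimately show ?thesis by linarith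
qed

lemma env_bdd: "x \<in> space X \<Longrightarrow> bdd_below (range (\<lambda>k. q (x, sel_seq k x) + real n * dist a (sel_seq k x)))"
  using env_term_lower by (auto intro!: bdd_belowI)

lemma env_lower: "x \<in> space X \<Longrightarrow> - B \<le> env n (x, a)"
  unfolding env_def using env_term_lower by (auto intro!: cINF_greatest)

lemma env_upper: "x \<in> space X \<Longrightarrow> env n (x, a) \<le> q (x, sel_seq k x) + real n * dist a (sel_seq k x)"
  unfolding env_def fst_conv snd_conv by (rule cINF_lower[OF env_bdd]) auto

lemma env_lipschitz: "x \<in> space X \<Longrightarrow> env n (x, a) \<le> env n (x, b) + real n * dist a b"
proof -
  assume x: "x \<in> space X"
  have "env n (x, a) - real n * dist a b \<le> q (x, sel_seq k x) + real n * dist b (sel_seq k x)" for k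
  proof -
    have "real n * dist a (sel_seq k x) \<le> real n * (dist a b + dist b (sel_seq k x))"
      by (intro mult_left_mono dist_triangle) simp
    then show ?thesis using env_upper[OF x, of n a k] by (simp add: distrib_left)
  qed
  then have "env n (x, a) - real n * dist a b \<le> env n (x, b)"
    unfolding env_def[of n "(x, b)"] by (intro cINF_greatest) auto
  then show ?thesis by simp
qed

lemma env_caratheodory: "bounded_caratheodory X A (env n)"
  unfolding bounded_caratheodory_def
proof (intro conjI ballI)
  have "\<bar>env n z\<bar> \<le> B + real n * diameter A" if "z \<in> space X \<times> A" for z
  proof -
    obtain x a where z: "z = (x, a)" "x \<in> space X" "a \<in> A" using \<open>z \<in> space X \<times> A\<close> by auto
    have "dist a (sel_seq 0 x) \<le> diameter A"
      using As_sub[OF z(2)] sel_seq(2)[OF z(2)] z(3)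
      by (intro diameter_bounded_bound compact_imp_bounded[OF A_compact]) auto
    then have "real n * dist a (sel_seq 0 x) \<le> real n * diameter A" by (rule mult_left_mono) simp
    moreover have "0 \<le> real n * dist a (sel_seq 0 x)" by simp
    ultimately show ?thesis
      using env_upper[OF z(2), of n a 0] env_lower[OF z(2), of n a] q_sel[OF z(2), of 0] unfolding z(1) by linarith
  qed
  then show "bounded (env n ` (space X \<times> A))" by (auto intro!: boundedI[where B="B + real n * diameter A"])
  fix a assume a: "a \<in> A"
  show "(\<lambda>x. env n (x, a)) \<in> borel_measurable X"
    unfolding env_def fst_conv snd_conv
  proof (rule borel_measurable_cINF)
    fix k
    have f: "sel_seq k \<in> X \<rightarrow>\<^sub>M actM A" by (rule sel_seq)
    have "(\<lambda>x. (x, sel_seq k x)) \<in> X \<rightarrow>\<^sub>M Z" using f by measurable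
    then have 1: "(\<lambda>x. q (x, sel_seq k x)) \<in> borel_measurable X" by (rule measurable_compose[OF _ qm])
    have "sel_seq k \<in> borel_measurable X" using f by (simp add: measurable_restrict_space2_iff)
    then have 2: "(\<lambda>x. dist a (sel_seq k x)) \<in> borel_measurable X"
      by (rule measurable_compose) (intro borel_measurable_continuous_onI continuous_intros)
    show "(\<lambda>x. q (x, sel_seq k x) + real n * dist a (sel_seq k x)) \<in> borel_measurable X"
      using 1 2 by measurable
  qed (use env_bdd in auto)
next
  fix x assume x: "x \<in> space X"
  show "continuous_on A (\<lambda>a. env n (x, a))"
    unfolding continuous_on_iff
  proof (intro ballI allI impI)
    fix a and e :: real assume e: "0 < e"
    show "\<exists>d>0. \<forall>b\<in>A. dist b a < d \<longrightarrow> dist (env n (x, b)) (env n (x, a)) < e"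
    proof (intro exI[of _ "e / (real n + 1)"] conjI ballI impI)
      show "0 < e / (real n + 1)" using e by simp
      fix b assume "dist b a < e / (real n + 1)"
      then have "(real n + 1) * dist b a < e" by (simp add: pos_less_divide_eq mult.commute)
      then have "real n * dist b a + dist b a < e" by (simp add: distrib_right)
      then have "real n * dist b a < e" using zero_le_dist[of b a] by linarith
      then show "dist (env n (x, b)) (env n (x, a)) < e"
        using env_lipschitz[OF x, of n a b] env_lipschitz[OF x, of n b a] by (simp add: dist_real_def dist_commute abs_less_iff)
    qed
  qed
qed

lemma env_le: 
  assumes x: "x \<in> space X" and a: "a \<in> As x"
  shows "env n (x, a) \<le> q (x, a)"
proof (rule field_le_epsilon)
  fix e :: real assume e: "0 < e"
  obtain d where d: "d > 0" "\<And>b. b \<in> As x \<Longrightarrow> dist b a < d \<Longrightarrow> dist (q (x, b)) (q (x, a)) < e / 2"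
    using qc[OF x] a e unfolding continuous_on_iff by (metis half_gt_zero)
  have d': "min d (e / (2 * (real n + 1))) > 0" using d e by simp
  obtain k where k: "dist (sel_seq k x) a < min d (e / (2 * (real n + 1)))"
    using sel_seq(3)[OF x a d'] by blast
  have "dist (sel_seq k x) a < d" using k by simp
  from d(2)[OF sel_seq(2)[OF x] this] have "\<bar>q (x, sel_seq k x) - q (x, a)\<bar> < e / 2"
    by (simp only: dist_real_def)
  then have q: "q (x, sel_seq k x) < q (x, a) + e / 2" by linarith
  have "2 * (real n + 1) * dist (sel_seq k x) a < e" using k by (simp add: pos_less_divide_eq mult.commute)
  then have "2 * (real n * dist (sel_seq k x) a) + 2 * dist (sel_seq k x) a < e" by (simp add: algebra_simps)
  then have "real n * dist (sel_seq k x) a \<le> e / 2" using zero_le_dist[of "sel_seq k x" a] by linarith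
  then have "real n * dist a (sel_seq k x) \<le> e / 2" by (simp add: dist_commute)
  then show "env n (x, a) \<le> q (x, a) + e" using env_upper[OF x, of n a k] q by linarith
qed

lemma env_tendsto:
  assumes x: "x \<in> space X" and a: "a \<in> As x"
  shows "(\<lambda>n. env n (x, a)) \<longlonglongrightarrow> q (x, a)"
proof (rule LIMSEQ_I)
  fix e :: real assume e: "0 < e"
  obtain d where d: "d > 0" "\<And>b. b \<in> As x \<Longrightarrow> dist b a < d \<Longrightarrow> dist (q (x, b)) (q (x, a)) < e / 2"
    using qc[OF x] a e unfolding continuous_on_iff by (metis half_gt_zero)
  obtain N where N: "real N * d > 2 * B" using reals_Archimedean3[OF d(1)] by blast
  have aB: "q (x, a) \<le> B" using qB[of "(x, a)"] x a As_sub[OF x] by (auto simp: space_pair_measure space_act)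
  have "norm (env n (x, a) - q (x, a)) < e" if n: "n \<ge> N" for n
  proof -
    have "q (x, a) - e / 2 \<le> q (x, sel_seq k x) + real n * dist a (sel_seq k x)" for k
    proof (cases "dist (sel_seq k x) a < d")
      case True
      from d(2)[OF sel_seq(2)[OF x] this] have "\<bar>q (x, sel_seq k x) - q (x, a)\<bar> < e / 2"
        by (simp only: dist_real_def)
      then have "q (x, a) - e / 2 \<le> q (x, sel_seq k x)" by linarith
      moreover have "0 \<le> real n * dist a (sel_seq k x)" by simp
      ultimately show ?thesis by linarith
    next
      case False
      then have "real N * d \<le> real n * dist a (sel_seq k x)"
        using n d by (intro mult_mono) (auto simp: dist_commute)
      then show ?thesis using N q_sel[OF x, of k] aB e by linarith
    qed
    then have "q (x, a) - e / 2 \<le> env n (x, a)"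
      unfolding env_def fst_conv snd_conv by (intro cINF_greatest) auto
    then show ?thesis using env_le[OF x a, of n] e by simp
  qed
  then show "\<exists>no. \<forall>n\<ge>no. norm (env n (x, a) - q (x, a)) < e" by blast
qed

text \<open>On measures carried by the graph of \<open>As\<close> the integral of \<open>q\<close> is the supremum of the integrals of its
  envelopes, which are continuous for the ws-topology.\<close>

lemma lsc_integral: "openin (subtopology ws on_K) {\<mu> \<in> on_K. r < (\<integral>z. q z \<partial>\<mu>)}"
proof -
  have "{\<mu> \<in> on_K. r < (\<integral>z. q z \<partial>\<mu>)} = (\<Union>n. {\<mu> \<in> on_K. r < (\<integral>z. env n z \<partial>\<mu>)})"
  proof (intro set_eqI)
    fix \<mu>
    have "r < (\<integral>z. q z \<partial>\<mu>) \<longleftrightarrow> (\<exists>n. r < (\<integral>z. env n z \<partial>\<mu>))" if \<mu>: "\<mu> \<in> on_K"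
    proof -
      have \<mu>f: "\<mu> \<in> finite_measures Z" and K: "AE z in \<mu>. snd z \<in> As (fst z)" using \<mu> by (auto simp: on_K_def)
      note D = fmD[OF \<mu>f]
      interpret finite_measure \<mu> by (rule D)
      have spZ: "space \<mu> = space Z" using sets_eq_imp_space_eq[OF D(2)] .
      have em: "env n \<in> borel_measurable \<mu>" for n
        using caratheodory_m[OF env_caratheodory] by (simp add: measurable_cong_sets[OF D(2) refl])
      have qm': "q \<in> borel_measurable \<mu>" using qm by (simp add: measurable_cong_sets[OF D(2) refl])
      have le: "AE z in \<mu>. env n z \<le> q z" for n
        using K AE_space
      proof eventually_elim
        case (elim z)
        then show ?case using env_le[of "fst z" "snd z" n] by (auto simp: D)
      qed
      have ab: "AE z in \<mu>. norm (env n z) \<le> B" for n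
        using le[of n] AE_space
      proof eventually_elim
        case (elim z)
        have "- B \<le> env n z" using env_lower[of "fst z" n "snd z"] elim(2) by (auto simp: D)
        moreover have "q z \<le> B" using qB[of z] elim(2) by (auto simp: spZ)
        ultimately show ?case using elim(1) by auto
      qed
      have iq: "integrable \<mu> q"
        by (rule integrable_const_bound[where B=B]) (use qm' qB in \<open>auto intro!: AE_I2 simp: spZ\<close>)
      have ie: "integrable \<mu> (env n)" for n
        by (rule integrable_const_bound[OF ab em])
      have lim: "(\<lambda>n. \<integral>z. env n z \<partial>\<mu>) \<longlonglongrightarrow> (\<integral>z. q z \<partial>\<mu>)"
      proof (rule integral_dominated_convergence[where w="\<lambda>_. B"])
        show "AE z in \<mu>. (\<lambda>n. env n z) \<longlonglongrightarrow> q z"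
          using K AE_space
        proof eventually_elim
          case (elim z)
          then show ?case using env_tendsto[of "fst z" "snd z"] by (auto simp: D)
        qed
      qed (use qm' em ab in auto)
      show ?thesis
      proof
        assume "r < (\<integral>z. q z \<partial>\<mu>)"
        from order_tendstoD(1)[OF lim this] show "\<exists>n. r < (\<integral>z. env n z \<partial>\<mu>)"
          by (auto simp: eventually_sequentially)
      next
        assume "\<exists>n. r < (\<integral>z. env n z \<partial>\<mu>)"
        then obtain n where "r < (\<integral>z. env n z \<partial>\<mu>)" by blast
        also have "\<dots> \<le> (\<integral>z. q z \<partial>\<mu>)" by (rule integral_mono_AE[OF ie iq le])
        finally show "r < (\<integral>z. q z \<partial>\<mu>)" .
      qed
    qed
    then show "\<mu> \<in> {\<mu> \<in> on_K. r < (\<integral>z. q z \<partial>\<mu>)} \<longleftrightarrow> \<mu> \<in> (\<Union>n. {\<mu> \<in> on_K. r < (\<integral>z. env n z \<partial>\<mu>)})" by blast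
  qed
  also have "openin (subtopology ws on_K) \<dots>"
  proof (rule openin_Union, safe)
    fix n
    have "{\<mu> \<in> on_K. r < (\<integral>z. env n z \<partial>\<mu>)} = on_K \<inter> {\<mu> \<in> topspace ws. (\<integral>z. env n z \<partial>\<mu>) \<in> {r<..}}"
      using on_K_sub by auto
    also have "openin (subtopology ws on_K) \<dots>"
      by (intro openin_subtopology_Int2 openin_continuous_map_preimage[OF ws_continuous_integral[OF env_caratheodory]]) simp
    finally show "openin (subtopology ws on_K) {\<mu> \<in> on_K. r < (\<integral>z. env n z \<partial>\<mu>)}" .
  qed
  finally show ?thesis .
qed

end

text \<open>Both \<open>q\<close> and \<open>- q\<close> have lower semicontinuous integrals.\<close>

lemma continuous_on_K_integral:
  fixes q :: "'x \<times> 'a \<Rightarrow> real"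
  assumes qm: "q \<in> borel_measurable Z" and qB: "\<And>z. z \<in> space Z \<Longrightarrow> \<bar>q z\<bar> \<le> B"
    and qc: "\<And>x. x \<in> space X \<Longrightarrow> continuous_on (As x) (\<lambda>a. q (x, a))"
  shows "continuous_map (subtopology ws on_K) euclideanreal (\<lambda>\<mu>. \<integral>z. q z \<partial>\<mu>)"
  unfolding continuous_map_upper_lower_semicontinuous_lt
proof (intro conjI allI)
  have tp: "topspace (subtopology ws on_K) = on_K" using on_K_sub by auto
  fix r
  show "openin (subtopology ws on_K) {\<mu> \<in> topspace (subtopology ws on_K). r < (\<integral>z. q z \<partial>\<mu>)}"
    unfolding tp by (rule lsc_integral[OF qm qB qc])
  have "openin (subtopology ws on_K) {\<mu> \<in> on_K. - r < (\<integral>z. - q z \<partial>\<mu>)}"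
    by (rule lsc_integral) (use qm qB qc in \<open>auto intro!: continuous_intros\<close>)
  then show "openin (subtopology ws on_K) {\<mu> \<in> topspace (subtopology ws on_K). (\<integral>z. q z \<partial>\<mu>) < r}"
    unfolding tp by simp
qed

text \<open>The source of \<open>\<mu>\<close> on \<open>\<Gamma>\<close>: the amount by which \<open>\<mu>\<close> exceeds what it receives through one transition.\<close>

definition flux :: "'x set \<Rightarrow> ('x \<times> 'a) measure \<Rightarrow> real" where
  "flux \<Gamma> \<mu> = measure \<mu> (\<Gamma> \<times> A) - (\<integral>z. measure (Q z) (\<Gamma> - \<Delta>) \<partial>\<mu>)"

lemma diff_Delta: "\<Gamma> \<in> sets X \<Longrightarrow> \<Gamma> - \<Delta> \<in> sets X"
  using Delta_measurable by auto

lemma Q_measure_le_1: "z \<in> space Z \<Longrightarrow> measure (Q z) \<Gamma> \<le> 1"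
  using prob_space.prob_le_1 Q_space by blast

lemma continuous_flux:
  assumes G: "\<Gamma> \<in> sets X"
  shows "continuous_map (subtopology ws on_K) euclideanreal (flux \<Gamma>)"
  unfolding flux_def[abs_def]
proof (rule continuous_map_diff)
  show "continuous_map (subtopology ws on_K) euclideanreal (\<lambda>\<mu>. measure \<mu> (\<Gamma> \<times> A))"
    by (rule continuous_map_from_subtopology[OF ws_continuous_rect[OF G]])
  show "continuous_map (subtopology ws on_K) euclideanreal (\<lambda>\<mu>. \<integral>z. measure (Q z) (\<Gamma> - \<Delta>) \<partial>\<mu>)"
    by (rule continuous_on_K_integral[where B=1])
      (use Q_measure_measurable[OF diff_Delta[OF G]] Q_continuous[OF _ diff_Delta[OF G]] Q_measure_le_1 in auto)
qed

lemma flux_eq_iff: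
  assumes \<mu>: "\<mu> \<in> finite_measures Z" and G: "\<Gamma> \<in> sets X" and c: "0 \<le> c"
  shows "flux \<Gamma> \<mu> = c \<longleftrightarrow> emeasure \<mu> (\<Gamma> \<times> A) = ennreal c + (\<integral>\<^sup>+z. emeasure (Q z) (\<Gamma> - \<Delta>) \<partial>\<mu>)"
proof -
  note D = fmD[OF \<mu>]
  interpret finite_measure \<mu> by (rule D)
  have spZ: "space \<mu> = space Z" using sets_eq_imp_space_eq[OF D(2)] .
  let ?I = "\<integral>z. measure (Q z) (\<Gamma> - \<Delta>) \<partial>\<mu>"
  have "(\<integral>\<^sup>+z. emeasure (Q z) (\<Gamma> - \<Delta>) \<partial>\<mu>) = (\<integral>\<^sup>+z. ennreal (measure (Q z) (\<Gamma> - \<Delta>)) \<partial>\<mu>)"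
  proof (rule nn_integral_cong)
    fix z assume "z \<in> space \<mu>"
    then interpret q: prob_space "Q z" using Q_space spZ by blast
    show "emeasure (Q z) (\<Gamma> - \<Delta>) = ennreal (measure (Q z) (\<Gamma> - \<Delta>))" by (rule q.emeasure_eq_measure)
  qed
  also have "\<dots> = ennreal ?I"
  proof (rule nn_integral_eq_integral)
    show "integrable \<mu> (\<lambda>z. measure (Q z) (\<Gamma> - \<Delta>))"
      by (rule integrable_const_bound[where B=1])
        (use Q_measure_measurable[OF diff_Delta[OF G]] Q_measure_le_1 in \<open>auto intro!: AE_I2 simp: spZ measurable_cong_sets[OF D(2) refl]\<close>)
  qed simp
  finally have I: "(\<integral>\<^sup>+z. emeasure (Q z) (\<Gamma> - \<Delta>) \<partial>\<mu>) = ennreal ?I" .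
  have "0 \<le> ?I" by simp
  then have "ennreal c + ennreal ?I = ennreal (c + ?I)" using c by simp
  then show ?thesis
    unfolding flux_def I emeasure_eq_measure using c \<open>0 \<le> ?I\<close> by (auto simp: ennreal_inj simp flip: ennreal_plus)
qed

definition flux_between :: "('x set \<Rightarrow> real) \<Rightarrow> ('x set \<Rightarrow> real) \<Rightarrow> ('x \<times> 'a) measure set" where
  "flux_between lo hi = {\<mu> \<in> on_K. ref_ac \<mu> \<and> (\<forall>\<Gamma>\<in>sets X. lo \<Gamma> \<le> flux \<Gamma> \<mu> \<and> flux \<Gamma> \<mu> \<le> hi \<Gamma>)}"

lemma ref_ac_measure: "\<mu> \<in> finite_measures Z \<Longrightarrow> ref_ac \<mu> \<longleftrightarrow> (\<forall>N\<in>Collect ref_null. measure \<mu> (N \<times> A) = 0)"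
  using finite_measure.emeasure_eq_measure[OF fmD(1)] by (simp add: ref_ac_def)

lemma closedin_flux_between: "closedin ws (flux_between lo hi)"
proof -
  let ?T = "subtopology ws on_K"
  have tp: "topspace ?T = on_K" using on_K_sub by auto
  have 1: "closedin ?T {\<mu> \<in> topspace ?T. \<forall>N\<in>Collect ref_null. measure \<mu> (N \<times> A) = 0}"
    by (intro closedin_Collect_all closedin_Collect_real continuous_map_from_subtopology[OF ws_continuous_rect])
      (simp add: ref_null_def)
  have 2: "closedin ?T {\<mu> \<in> topspace ?T. \<forall>\<Gamma>\<in>sets X. lo \<Gamma> \<le> flux \<Gamma> \<mu> \<and> flux \<Gamma> \<mu> \<le> hi \<Gamma>}"
    by (intro closedin_Collect_all closedin_Collect_conj closedin_Collect_real continuous_flux)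
  have "flux_between lo hi = {\<mu> \<in> topspace ?T. (\<forall>N\<in>Collect ref_null. measure \<mu> (N \<times> A) = 0) \<and>
      (\<forall>\<Gamma>\<in>sets X. lo \<Gamma> \<le> flux \<Gamma> \<mu> \<and> flux \<Gamma> \<mu> \<le> hi \<Gamma>)}"
    unfolding tp flux_between_def using ref_ac_measure by (auto simp: on_K_def)
  then have "closedin ?T (flux_between lo hi)" using closedin_Collect_conj[OF 1 2] by simp
  then show ?thesis by (rule closedin_trans_full[OF _ closedin_on_K])
qed

lemma occ_on_K: "\<pi> \<in> policies \<Longrightarrow> occ_from n \<pi> \<in> on_K"
  using occ_from_finite occ_from_carrier by (auto simp: on_K_def)

lemma occ_flux:
  assumes \<pi>: "\<pi> \<in> policies" and G: "\<Gamma> \<in> sets X"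
  shows "flux \<Gamma> (occ_from n \<pi>) = measure (state_law \<pi> n) (\<Gamma> - \<Delta>)"
proof (subst flux_eq_iff[OF occ_from_finite[OF \<pi>] G])
  interpret prob_space "state_law \<pi> n" by (rule prob_state_law[OF \<pi>])
  show "emeasure (occ_from n \<pi>) (\<Gamma> \<times> A) = ennreal (measure (state_law \<pi> n) (\<Gamma> - \<Delta>)) + (\<integral>\<^sup>+z. emeasure (Q z) (\<Gamma> - \<Delta>) \<partial>occ_from n \<pi>)"
    using occ_from_char[OF \<pi> G] by (simp add: emeasure_eq_measure)
qed simp

lemma flux_solution_stationary:
  assumes "\<mu> \<in> flux_between (\<lambda>\<Gamma>. measure \<eta> (\<Gamma> - \<Delta>)) (\<lambda>\<Gamma>. measure \<eta> (\<Gamma> - \<Delta>))"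
  shows "\<exists>\<sigma>\<in>markov_kernels. \<mu> = occ_from 0 (stationary \<sigma>)"
proof (rule balance_occupation)
  interpret e: prob_space \<eta> by (rule prob_\<eta>)
  show \<mu>: "\<mu> \<in> finite_measures Z" and "AE z in \<mu>. snd z \<in> As (fst z)" "ref_ac \<mu>"
    using assms by (auto simp: flux_between_def on_K_def)
  fix \<Gamma> assume G: "\<Gamma> \<in> sets X"
  then have "flux \<Gamma> \<mu> = measure \<eta> (\<Gamma> - \<Delta>)" using assms by (auto simp: flux_between_def intro: antisym)
  then show "emeasure \<mu> (\<Gamma> \<times> A) = emeasure \<eta> (\<Gamma> - \<Delta>) + (\<integral>\<^sup>+z. emeasure (Q z) (\<Gamma> - \<Delta>) \<partial>\<mu>)"
    by (simp add: flux_eq_iff[OF \<mu> G] e.emeasure_eq_measure)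
qed

lemma occ_solution:
  assumes \<pi>: "\<pi> \<in> policies"
  shows "occ_from 0 \<pi> \<in> flux_between (\<lambda>\<Gamma>. measure \<eta> (\<Gamma> - \<Delta>)) (\<lambda>\<Gamma>. measure \<eta> (\<Gamma> - \<Delta>))"
  using occ_on_K[OF \<pi>] occ_from_ac[OF \<pi>] occ_flux[OF \<pi>] by (simp add: flux_between_def state_law_0[OF \<pi>])

text \<open>Occupation measures are the solutions of the balance equation with source \<open>\<eta>\<close> that the reference policy
  dominates, and stationary policies produce all of them.\<close>

lemma occupation_measures_eq:
  "occupation_measures \<eta> = flux_between (\<lambda>\<Gamma>. measure \<eta> (\<Gamma> - \<Delta>)) (\<lambda>\<Gamma>. measure \<eta> (\<Gamma> - \<Delta>))"
  "occupation_measures \<eta> = (\<lambda>\<sigma>. occ_from 0 (stationary \<sigma>)) ` markov_kernels"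
proof -
  have 1: "occupation_measures \<eta> = occ_from 0 ` policies"
    unfolding occupation_measures_def by (rule image_cong[OF refl occupation_eq])
  show "occupation_measures \<eta> = flux_between (\<lambda>\<Gamma>. measure \<eta> (\<Gamma> - \<Delta>)) (\<lambda>\<Gamma>. measure \<eta> (\<Gamma> - \<Delta>))"
    unfolding 1 using occ_solution flux_solution_stationary stationary_in by blast
  show "occupation_measures \<eta> = (\<lambda>\<sigma>. occ_from 0 (stationary \<sigma>)) ` markov_kernels"
    unfolding 1 using occ_solution flux_solution_stationary stationary_in by blast
qed

lemma closedin_occupation_measures: "closedin ws (occupation_measures \<eta>)"
  unfolding occupation_measures_eq(1) by (rule closedin_flux_between)

lemma relatively_compact_iff:
  "relatively_compact_in ws (occupation_measures \<eta>) \<longleftrightarrow> compactin ws (occupation_measures \<eta>)"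
  unfolding relatively_compact_in_def
  using closure_of_closedin[OF closedin_occupation_measures] closedin_subset[OF closedin_occupation_measures] by simp

definition tail :: "nat \<Rightarrow> ennreal" where
  "tail n = (SUP \<sigma>\<in>markov_kernels. emeasure (occ_from n (stationary \<sigma>)) (space X \<times> A))"

lemma uniformly_absorbing_iff: "uniformly_absorbing \<eta> \<longleftrightarrow> tail \<longlonglongrightarrow> 0"
proof -
  have "(\<Sum>t. emeasure (law \<eta> (stationary \<sigma>)) {\<omega>\<in>space (law \<eta> (stationary \<sigma>)). hitting_time \<omega> > enat (n + t)})
      = emeasure (occ_from n (stationary \<sigma>)) (space X \<times> A)" if "\<sigma> \<in> markov_kernels" for \<sigma> n
    by (simp add: prob_hitting[OF stationary_in[OF that]] emeasure_occ_from_rect[OF stationary_in[OF that] sets.top])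
  then have "(\<lambda>n. SUP \<sigma>\<in>markov_kernels. \<Sum>t. emeasure (law \<eta> (stationary \<sigma>))
      {\<omega>\<in>space (law \<eta> (stationary \<sigma>)). hitting_time \<omega> > enat (n + t)}) = tail"
    unfolding tail_def by (intro ext SUP_cong refl) auto
  then show ?thesis unfolding uniformly_absorbing_def using absorbing by simp
qed

section \<open>Uniform absorption implies compactness\<close>

text \<open>The one-step operator of optimal reachability.  The supremum over a countable dense set of available
  actions keeps it measurable; continuity makes it the supremum over all of them.\<close>

definition reach :: "('x \<Rightarrow> ennreal) \<Rightarrow> 'x \<Rightarrow> ennreal" where
  "reach v x = (SUP k. \<integral>\<^sup>+y. v y \<partial>Q (x, sel_seq k x))"

lemma sel_in_Z: "x \<in> space X \<Longrightarrow> a \<in> As x \<Longrightarrow> (x, a) \<in> space Z"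
  using As_sub by (auto simp: space_pair_measure space_act)

lemma nn_integral_Q_le_1:
  assumes z: "z \<in> space Z" and le: "\<And>y. y \<in> space X \<Longrightarrow> v y \<le> 1"
  shows "(\<integral>\<^sup>+y. v y \<partial>Q z) \<le> 1"
proof -
  interpret q: prob_space "Q z" using Q_space[OF z] by blast
  have "space (Q z) = space X" using Q_space[OF z] sets_eq_imp_space_eq by blast
  then have "(\<integral>\<^sup>+y. v y \<partial>Q z) \<le> (\<integral>\<^sup>+y. 1 \<partial>Q z)" using le by (intro nn_integral_mono) simp
  then show ?thesis using q.emeasure_space_1 by simp
qed

lemma reach_measurable: "v \<in> borel_measurable X \<Longrightarrow> reach v \<in> borel_measurable X"
  unfolding reach_def[abs_def]
proof (rule borel_measurable_SUP)
  fix k assume v: "v \<in> borel_measurable X"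
  have "(\<lambda>x. (x, sel_seq k x)) \<in> X \<rightarrow>\<^sub>M Z" using sel_seq(1)[of k] by measurable
  from measurable_compose[OF this nn_integral_Q_measurable[OF v]]
  show "(\<lambda>x. \<integral>\<^sup>+y. v y \<partial>Q (x, sel_seq k x)) \<in> borel_measurable X" .
qed auto

lemma reach_le_1: "x \<in> space X \<Longrightarrow> (\<And>y. y \<in> space X \<Longrightarrow> v y \<le> 1) \<Longrightarrow> reach v x \<le> 1"
  unfolding reach_def by (intro SUP_least nn_integral_Q_le_1 sel_in_Z sel_seq(2))

text \<open>Setwise continuity of the transition law passes from indicators to uniform limits of step functions.\<close>

lemma continuous_on_Q_integral:
  assumes x: "x \<in> space X" and v: "v \<in> borel_measurable X" and v01: "\<And>y. y \<in> space X \<Longrightarrow> v y \<le> (1::ennreal)"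
  shows "continuous_on (As x) (\<lambda>a. enn2real (\<integral>\<^sup>+y. v y \<partial>Q (x, a)))"
proof -
  let ?T = "top_of_set (As x)"
  have "continuous_map ?T euclideanreal (\<lambda>a. enn2real (\<integral>\<^sup>+y. v y \<partial>Q (x, a)))"
  proof (rule continuous_map_uniform_approx)
    fix e :: real assume e: "e > 0"
    obtain n :: nat where n: "n > 0" "1 / real n \<le> e"
      using nat_approx_posE[OF e] by (metis less_imp_le zero_less_Suc)
    define u where "u y = enn2real (v y)" for y
    have um: "u \<in> borel_measurable X" unfolding u_def using v by simp
    have uv: "0 \<le> u y" "u y \<le> 1" "v y = ennreal (u y)" if "y \<in> space X" for y
    proof -
      have "v y < \<top>" using v01[OF that] ennreal_one_less_top by (rule le_less_trans)
      then show "v y = ennreal (u y)" by (simp add: u_def)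
      show "u y \<le> 1" using enn2real_mono[OF v01[OF that]] by (simp add: u_def)
      show "0 \<le> u y" by (simp add: u_def)
    qed
    define L where "L j = {y \<in> space X. \<lfloor>real n * u y\<rfloor> = j}" for j :: int
    have L: "L j \<in> sets X" for j unfolding L_def using um by measurable
    show "\<exists>g. continuous_map ?T euclideanreal g \<and>
        (\<forall>a\<in>topspace ?T. \<bar>g a - enn2real (\<integral>\<^sup>+y. v y \<partial>Q (x, a))\<bar> \<le> e)"
    proof (intro exI[of _ "\<lambda>a. \<Sum>j\<in>{0..int n}. (of_int j / real n) * measure (Q (x, a)) (L j)"] conjI ballI)
      show "continuous_map ?T euclideanreal (\<lambda>a. \<Sum>j\<in>{0..int n}. (of_int j / real n) * measure (Q (x, a)) (L j))"
        using Q_continuous[OF x L] by (intro continuous_map_sum continuous_map_real_mult_left) auto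
      fix a assume "a \<in> topspace ?T"
      then have z: "(x, a) \<in> space Z" using sel_in_Z[OF x] by simp
      interpret q: prob_space "Q (x, a)" using Q_space[OF z] by blast
      have sQ: "sets (Q (x, a)) = sets X" using Q_space[OF z] by blast
      have spQ: "space (Q (x, a)) = space X" by (rule sets_eq_imp_space_eq[OF sQ])
      have um': "u \<in> borel_measurable (Q (x, a))" using um by (simp add: measurable_cong_sets[OF sQ refl])
      have iu: "integrable (Q (x, a)) u"
        by (rule q.integrable_const_bound[where B=1]) (use um' uv in \<open>auto intro!: AE_I2 simp: spQ\<close>)
      have "(\<integral>\<^sup>+y. v y \<partial>Q (x, a)) = (\<integral>\<^sup>+y. ennreal (u y) \<partial>Q (x, a))"
        by (intro nn_integral_cong) (simp add: spQ uv)
      also have "\<dots> = ennreal (\<integral>y. u y \<partial>Q (x, a))"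
        by (rule nn_integral_eq_integral[OF iu]) (simp add: u_def)
      finally have E: "enn2real (\<integral>\<^sup>+y. v y \<partial>Q (x, a)) = (\<integral>y. u y \<partial>Q (x, a))"
        by (simp add: u_def)
      define s where "s y = of_int \<lfloor>real n * u y\<rfloor> / real n" for y
      have s_sum: "s y = (\<Sum>j\<in>{0..int n}. (of_int j / real n) * indicator (L j) y)" if y: "y \<in> space X" for y
      proof -
        have "0 \<le> real n * u y" "real n * u y \<le> real n" using uv[OF y] by (auto simp: mult_left_le)
        then have "\<lfloor>real n * u y\<rfloor> \<in> {0..int n}" by (auto simp: floor_le_iff)
        moreover have "(\<Sum>j\<in>{0..int n}. (of_int j / real n) * indicator (L j) y) = (\<Sum>j\<in>{0..int n}. if \<lfloor>real n * u y\<rfloor> = j then of_int j / real n else 0)"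
          using y by (intro sum.cong) (auto simp: L_def indicator_def)
        ultimately show ?thesis by (simp add: s_def)
      qed
      have close: "\<bar>s y - u y\<bar> \<le> 1 / real n" for y
      proof -
        have "\<lfloor>real n * u y\<rfloor> \<le> real n * u y" "real n * u y \<le> \<lfloor>real n * u y\<rfloor> + 1" by linarith+
        moreover have "real n * (s y - u y) = \<lfloor>real n * u y\<rfloor> - real n * u y"
          using n by (simp add: s_def right_diff_distrib)
        ultimately have "\<bar>real n * (s y - u y)\<bar> \<le> 1" by linarith
        then show ?thesis using n by (simp add: abs_mult pos_le_divide_eq mult.commute)
      qed
      have ints: "integrable (Q (x, a)) s"
      proof (rule q.integrable_const_bound[where B=2])
        have "\<bar>s y\<bar> \<le> 2" if "y \<in> space X" for y
        proof -
          have "1 / real n \<le> 1" using n by simp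
          then show ?thesis using close[of y] uv[OF that] by linarith
        qed
        then show "AE y in Q (x, a). norm (s y) \<le> 2" by (intro AE_I2) (simp add: spQ)
        show "s \<in> borel_measurable (Q (x, a))" unfolding s_def[abs_def] using um' by measurable
      qed
      have "(\<integral>y. s y \<partial>Q (x, a)) = (\<integral>y. (\<Sum>j\<in>{0..int n}. (of_int j / real n) * indicator (L j) y) \<partial>Q (x, a))"
        by (intro Bochner_Integration.integral_cong) (simp_all add: spQ s_sum)
      also have "\<dots> = (\<Sum>j\<in>{0..int n}. (of_int j / real n) * measure (Q (x, a)) (L j))"
      proof (subst Bochner_Integration.integral_sum)
        show "integrable (Q (x, a)) (\<lambda>y. (of_int j / real n) * indicator (L j) y)" for j
          using L[of j] by (intro integrable_mult_right integrable_real_indicator) (simp_all add: sQ q.emeasure_eq_measure)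
      qed (use L in \<open>simp add: sQ\<close>)
      finally have S: "(\<Sum>j\<in>{0..int n}. (of_int j / real n) * measure (Q (x, a)) (L j)) = (\<integral>y. s y \<partial>Q (x, a))" ..
      have "\<bar>(\<integral>y. s y \<partial>Q (x, a)) - (\<integral>y. u y \<partial>Q (x, a))\<bar> = \<bar>\<integral>y. s y - u y \<partial>Q (x, a)\<bar>" using ints iu by simp
      also have "\<dots> \<le> (\<integral>y. \<bar>s y - u y\<bar> \<partial>Q (x, a))" by (rule integral_abs_bound)
      also have "\<dots> \<le> (\<integral>y. 1 / real n \<partial>Q (x, a))" using ints iu close by (intro integral_mono) auto
      also have "\<dots> \<le> e" using n by (simp add: q.prob_space)
      finally show "\<bar>(\<Sum>j\<in>{0..int n}. (of_int j / real n) * measure (Q (x, a)) (L j)) - enn2real (\<integral>\<^sup>+y. v y \<partial>Q (x, a))\<bar> \<le> e"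
        unfolding S E .
    qed
  qed
  then show ?thesis by simp
qed

lemma reach_upper:
  assumes x: "x \<in> space X" and a: "a \<in> As x" and v: "v \<in> borel_measurable X" "\<And>y. y \<in> space X \<Longrightarrow> v y \<le> 1"
  shows "(\<integral>\<^sup>+y. v y \<partial>Q (x, a)) \<le> reach v x"
proof -
  have fin: "(\<integral>\<^sup>+y. v y \<partial>Q (x, b)) < \<top>" if "b \<in> As x" for b
    using nn_integral_Q_le_1[OF sel_in_Z[OF x that] v(2)] ennreal_one_less_top by (rule le_less_trans)
  have rfin: "reach v x < \<top>" using reach_le_1[OF x v(2)] ennreal_one_less_top by (rule le_less_trans)
  have "enn2real (\<integral>\<^sup>+y. v y \<partial>Q (x, a)) \<le> enn2real (reach v x)"
  proof (rule sel_seq_le[OF x continuous_on_Q_integral[OF x v] a])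
    fix k
    have "(\<integral>\<^sup>+y. v y \<partial>Q (x, sel_seq k x)) \<le> reach v x" unfolding reach_def by (rule SUP_upper) simp
    then show "enn2real (\<integral>\<^sup>+y. v y \<partial>Q (x, sel_seq k x)) \<le> enn2real (reach v x)"
      using rfin by (rule enn2real_mono)
  qed
  then have "ennreal (enn2real (\<integral>\<^sup>+y. v y \<partial>Q (x, a))) \<le> ennreal (enn2real (reach v x))" by (rule ennreal_leI)
  then show ?thesis using fin[OF a] rfin by simp
qed

text \<open>Sequences of functions with values in the unit interval that decrease pointwise to \<open>0\<close>; iterating
  \<open>reach\<close> preserves the property.\<close>

definition fading :: "(nat \<Rightarrow> 'x \<Rightarrow> ennreal) \<Rightarrow> bool" where
  "fading v \<longleftrightarrow> (\<forall>j. v j \<in> borel_measurable X) \<and> (\<forall>j. \<forall>y\<in>space X. v j y \<le> 1) \<and>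
     (\<forall>i j. \<forall>y\<in>space X. i \<le> j \<longrightarrow> v j y \<le> v i y) \<and> (\<forall>y\<in>space X. (\<lambda>j. v j y) \<longlonglongrightarrow> 0)"

lemma fading_integral:
  assumes v: "fading v" and p: "prob_space p" and s: "sets p = sets X"
  shows "(\<lambda>j. \<integral>\<^sup>+y. v j y \<partial>p) \<longlonglongrightarrow> 0"
proof -
  interpret prob_space p by (rule p)
  have "(\<lambda>j. \<integral>\<^sup>+y. v j y \<partial>p) \<longlonglongrightarrow> (\<integral>\<^sup>+y. 0 \<partial>p)"
  proof (rule nn_integral_dominated_convergence[where w="\<lambda>_. 1"])
    show "v j \<in> borel_measurable p" for j
      using v by (simp add: fading_def measurable_cong_sets[OF s refl])
    show "(\<integral>\<^sup>+y. 1 \<partial>p) < \<infinity>" by (simp add: emeasure_space_1)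
  qed (use v sets_eq_imp_space_eq[OF s] in \<open>auto simp: fading_def\<close>)
  then show ?thesis by simp
qed

text \<open>Dini: on the compact set of available actions a decreasing sequence of continuous functions
  with limit zero converges uniformly.\<close>

lemma fading_reach:
  assumes v: "fading v"
  shows "fading (\<lambda>j. reach (v j))"
  unfolding fading_def
proof (intro conjI allI ballI impI)
  have vm: "v j \<in> borel_measurable X" and v1: "\<And>y. y \<in> space X \<Longrightarrow> v j y \<le> 1"
    and vd: "\<And>y. y \<in> space X \<Longrightarrow> i \<le> j \<Longrightarrow> v j y \<le> v i y" for i j
    using v by (auto simp: fading_def)
  show "reach (v j) \<in> borel_measurable X" for j by (rule reach_measurable[OF vm])
  show "reach (v j) y \<le> 1" if "y \<in> space X" for j y by (rule reach_le_1[OF that v1])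
  have spQ: "space (Q (x, a)) = space X" if "x \<in> space X" "a \<in> As x" for x a
    using Q_space[OF sel_in_Z[OF that]] sets_eq_imp_space_eq by blast
  have dec: "(\<integral>\<^sup>+y. v j y \<partial>Q (x, a)) \<le> (\<integral>\<^sup>+y. v i y \<partial>Q (x, a))" if "x \<in> space X" "a \<in> As x" "i \<le> j" for x a i j
    using vd that by (intro nn_integral_mono) (simp add: spQ)
  show decr: "reach (v j) x \<le> reach (v i) x" if "x \<in> space X" "i \<le> j" for i j x
    unfolding reach_def using dec[OF that(1) sel_seq(2)[OF that(1)] that(2)] by (intro SUP_mono) auto
  fix x assume x: "x \<in> space X"
  let ?g = "\<lambda>j a. enn2real (\<integral>\<^sup>+y. v j y \<partial>Q (x, a))"
  have fin: "(\<integral>\<^sup>+y. v j y \<partial>Q (x, b)) < \<top>" if "b \<in> As x" for b j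
    using nn_integral_Q_le_1[OF sel_in_Z[OF x that] v1] ennreal_one_less_top by (rule le_less_trans)
  have ex: "\<exists>j. \<forall>a\<in>As x. ?g j a < e" if e: "e > 0" for e
  proof (rule ccontr)
    assume "\<not> ?thesis"
    then have ne: "{a\<in>As x. e \<le> ?g j a} \<noteq> {}" for j by (auto simp: not_less)
    have "(\<Inter>j. {a\<in>As x. e \<le> ?g j a}) \<noteq> {}"
    proof (rule compact_space_imp_nest[of "top_of_set (As x)"])
      show "compact_space (top_of_set (As x))"
        using As_compact[OF x] by (simp add: compact_space_subtopology)
      show "closedin (top_of_set (As x)) {a\<in>As x. e \<le> ?g j a}" for j
        using closedin_Collect_real(3)[of "top_of_set (As x)" "?g j" e] continuous_on_Q_integral[OF x vm v1] by simp
      show "{a\<in>As x. e \<le> ?g j a} \<noteq> {}" for j by (rule ne)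
      show "decseq (\<lambda>j. {a\<in>As x. e \<le> ?g j a})"
        unfolding decseq_def using enn2real_mono[OF dec[OF x] fin] by (auto intro: order_trans)
    qed
    then obtain a where a: "a \<in> As x" "\<And>j. e \<le> ?g j a" by blast
    have "prob_space (Q (x, a))" "sets (Q (x, a)) = sets X" using Q_space[OF sel_in_Z[OF x a(1)]] by blast+
    from fading_integral[OF v this] have "(\<lambda>j. ?g j a) \<longlonglongrightarrow> enn2real 0"
      by (intro tendsto_enn2real) auto
    then have "\<forall>\<^sub>F j in sequentially. ?g j a < e" using e by (intro order_tendstoD(2)) auto
    then show False using a(2) by (auto simp: eventually_sequentially not_less dest: leD)
  qed
  show "(\<lambda>j. reach (v j) x) \<longlonglongrightarrow> 0"
  proof (rule order_tendstoI)
    fix r :: ennreal assume r: "0 < r"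
    have "\<exists>e>0. ennreal e < r"
    proof (cases r)
      case (real r')
      then show ?thesis using r by (intro exI[of _ "r' / 2"]) (auto simp: ennreal_less_iff)
    next
      case top
      then show ?thesis by (intro exI[of _ 1]) simp
    qed
    then obtain e where e: "0 < e" "ennreal e < r" by blast
    obtain j where j: "\<And>a. a \<in> As x \<Longrightarrow> ?g j a < e" using ex[OF e(1)] by blast
    have "reach (v i) x < r" if "i \<ge> j" for i
    proof -
      have "reach (v i) x \<le> reach (v j) x" by (rule decr[OF x that])
      also have "\<dots> \<le> ennreal e"
        unfolding reach_def
      proof (rule SUP_least)
        fix k
        have "(\<integral>\<^sup>+y. v j y \<partial>Q (x, sel_seq k x)) = ennreal (?g j (sel_seq k x))"
          using fin[OF sel_seq(2)[OF x]] by simp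
        also have "\<dots> \<le> ennreal e" using j[OF sel_seq(2)[OF x]] by (intro ennreal_leI less_imp_le)
        finally show "(\<integral>\<^sup>+y. v j y \<partial>Q (x, sel_seq k x)) \<le> ennreal e" .
      qed
      also have "\<dots> < r" by (rule e)
      finally show ?thesis .
    qed
    then show "\<forall>\<^sub>F i in sequentially. reach (v i) x < r" by (auto simp: eventually_sequentially)
  qed simp
qed

lemma fading_reach_iter: "fading v \<Longrightarrow> fading (\<lambda>j. (reach ^^ t) (v j))"
  by (induction t) (auto dest: fading_reach)

text \<open>No policy does better than the greedy choice of the best action at every step.\<close>

lemma state_law_reach:
  assumes \<pi>: "\<pi> \<in> policies" and v: "v \<in> borel_measurable X" "\<And>y. y \<in> space X \<Longrightarrow> v y \<le> 1"
  shows "(\<integral>\<^sup>+x. v x \<partial>state_law \<pi> t) \<le> (\<integral>\<^sup>+x. (reach ^^ t) v x \<partial>\<eta>)"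
  using v
proof (induction t arbitrary: v)
  case 0
  then show ?case by (simp add: state_law_0[OF \<pi>])
next
  case (Suc t)
  have "(\<integral>\<^sup>+x. v x \<partial>state_law \<pi> (Suc t)) = (\<integral>\<^sup>+z. \<integral>\<^sup>+y. v y \<partial>Q z \<partial>pair_law \<pi> t)"
    by (rule nn_integral_state_Suc[OF \<pi> Suc.prems(1)])
  also have "\<dots> \<le> (\<integral>\<^sup>+z. reach v (fst z) \<partial>pair_law \<pi> t)"
  proof (rule nn_integral_mono_AE)
    show "AE z in pair_law \<pi> t. (\<integral>\<^sup>+y. v y \<partial>Q z) \<le> reach v (fst z)"
      using pair_law_K[OF \<pi>, of t] AE_space
    proof eventually_elim
      case (elim z)
      then have "fst z \<in> space X" by (auto simp: space_pair_law space_pair_measure)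
      from reach_upper[OF this elim(1) Suc.prems] show ?case by simp
    qed
  qed
  also have "\<dots> = (\<integral>\<^sup>+x. reach v x \<partial>state_law \<pi> t)"
    by (rule nn_integral_state_law[OF \<pi> reach_measurable[OF Suc.prems(1)], symmetric])
  also have "\<dots> \<le> (\<integral>\<^sup>+x. (reach ^^ t) (reach v) x \<partial>\<eta>)"
    by (rule Suc.IH[OF reach_measurable[OF Suc.prems(1)] reach_le_1[OF _ Suc.prems(2)]])
  also have "(reach ^^ t) (reach v) = (reach ^^ Suc t) v" by (simp add: funpow_swap1)
  finally show ?case .
qed

lemma markov_kernels_ne: "markov_kernels \<noteq> {}"
  using ref_kernel by blast

text \<open>Uniform absorption cuts the occupation measures off at a common time; before it, the
  state laws are uniformly small on sets that shrink to the empty set.\<close>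

lemma uniformly_absorbing_compact:
  assumes ua: "tail \<longlonglongrightarrow> 0"
  shows "compactin ws (occupation_measures \<eta>)"
proof -
  define b where "b \<Gamma> = (SUP \<sigma>\<in>markov_kernels. emeasure (occ_from 0 (stationary \<sigma>)) (\<Gamma> \<times> A))" for \<Gamma>
  have bound: "b \<Gamma> \<le> (\<Sum>t<n. \<integral>\<^sup>+x. (reach ^^ t) (indicator \<Gamma>) x \<partial>\<eta>) + tail n" if G: "\<Gamma> \<in> sets X" for \<Gamma> n
    unfolding b_def
  proof (rule SUP_least)
    fix \<sigma> assume \<sigma>: "\<sigma> \<in> markov_kernels"
    note \<pi> = stationary_in[OF \<sigma>]
    let ?f = "\<lambda>t. emeasure (state_law (stationary \<sigma>) t) (\<Gamma> - \<Delta>)"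
    have le: "?f t \<le> (\<integral>\<^sup>+x. (reach ^^ t) (indicator \<Gamma>) x \<partial>\<eta>)" for t
    proof -
      have "?f t \<le> emeasure (state_law (stationary \<sigma>) t) \<Gamma>" using G by (intro emeasure_mono) (auto simp: sets_state_law)
      also have "\<dots> = (\<integral>\<^sup>+x. indicator \<Gamma> x \<partial>state_law (stationary \<sigma>) t)" using G by (simp add: sets_state_law)
      also have "\<dots> \<le> (\<integral>\<^sup>+x. (reach ^^ t) (indicator \<Gamma>) x \<partial>\<eta>)"
        using G by (intro state_law_reach[OF \<pi>]) (auto simp: indicator_def)
      finally show ?thesis .
    qed
    have "emeasure (occ_from 0 (stationary \<sigma>)) (\<Gamma> \<times> A) = (\<Sum>t. ?f t)"
      by (simp add: emeasure_occ_from_rect[OF \<pi> G])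
    also have "\<dots> = (\<Sum>t. ?f (t + n)) + (\<Sum>t<n. ?f t)" by (rule suminf_offset[OF summableI])
    also have "(\<Sum>t. ?f (t + n)) = emeasure (occ_from n (stationary \<sigma>)) (\<Gamma> \<times> A)"
      by (simp add: emeasure_occ_from_rect[OF \<pi> G] add.commute)
    also have "\<dots> \<le> emeasure (occ_from n (stationary \<sigma>)) (space X \<times> A)"
      using sets.sets_into_space[OF G] rect_sets[OF sets.top] by (intro emeasure_mono) (auto simp: sets_occ_from[OF \<pi>])
    also have "\<dots> \<le> tail n" unfolding tail_def by (rule SUP_upper[OF \<sigma>])
    finally have "emeasure (occ_from 0 (stationary \<sigma>)) (\<Gamma> \<times> A) \<le> tail n + (\<Sum>t<n. ?f t)" by (simp add: add_mono)
    also have "\<dots> \<le> tail n + (\<Sum>t<n. \<integral>\<^sup>+x. (reach ^^ t) (indicator \<Gamma>) x \<partial>\<eta>)" by (intro add_left_mono sum_mono le)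
    finally show "emeasure (occ_from 0 (stationary \<sigma>)) (\<Gamma> \<times> A) \<le> (\<Sum>t<n. \<integral>\<^sup>+x. (reach ^^ t) (indicator \<Gamma>) x \<partial>\<eta>) + tail n"
      by (simp add: add.commute)
  qed
  interpret e: prob_space \<eta> by (rule prob_\<eta>)
  have fin: "b \<Gamma> < \<top>" if G: "\<Gamma> \<in> sets X" for \<Gamma>
  proof -
    have "\<forall>\<^sub>F n in sequentially. tail n < 1" using order_tendstoD(2)[OF ua, of 1] by simp
    then obtain n where n: "tail n < 1" by (auto simp: eventually_sequentially)
    have r1: "(\<integral>\<^sup>+x. (reach ^^ t) (indicator \<Gamma>) x \<partial>\<eta>) \<le> 1" for t
    proof -
      have "(reach ^^ t) (indicator \<Gamma>) x \<le> 1" if "x \<in> space X" for x using that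
      proof (induction t arbitrary: x)
        case (Suc t)
        then show ?case by (simp add: reach_le_1)
      qed (simp add: indicator_def)
      then have "(\<integral>\<^sup>+x. (reach ^^ t) (indicator \<Gamma>) x \<partial>\<eta>) \<le> (\<integral>\<^sup>+x. 1 \<partial>\<eta>)"
        using sets_eq_imp_space_eq[OF sets_\<eta>] by (intro nn_integral_mono) simp
      then show ?thesis by (simp add: e.emeasure_space_1)
    qed
    have "b \<Gamma> \<le> (\<Sum>t<n. \<integral>\<^sup>+x. (reach ^^ t) (indicator \<Gamma>) x \<partial>\<eta>) + tail n" by (rule bound[OF G])
    also have "\<dots> \<le> (\<Sum>t<n. 1) + 1" using n r1 by (intro add_mono sum_mono) auto
    also have "\<dots> < \<top>" by (simp add: less_top[symmetric] ennreal_add_eq_top)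
    finally show ?thesis .
  qed
  have "vanishing X (\<lambda>\<Gamma>. enn2real (b \<Gamma>))"
    unfolding vanishing_def
  proof (intro allI impI)
    fix \<Gamma> :: "nat \<Rightarrow> 'x set" assume G: "range \<Gamma> \<subseteq> sets X \<and> decseq \<Gamma> \<and> (\<Inter>n. \<Gamma> n) = {}"
    have Gs: "\<Gamma> j \<in> sets X" for j using G by auto
    have fad: "fading (\<lambda>j. indicator (\<Gamma> j))"
      unfolding fading_def
    proof (intro conjI allI ballI impI)
      fix y
      obtain k where k: "y \<notin> \<Gamma> k" using G by blast
      have "y \<notin> \<Gamma> j" if "j \<ge> k" for j using k G that by (auto simp: decseq_def)
      then have "\<forall>\<^sub>F j in sequentially. indicator (\<Gamma> j) y = (0::ennreal)"
        by (auto simp: eventually_sequentially intro!: exI[of _ k])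
      then show "(\<lambda>j. indicator (\<Gamma> j) y :: ennreal) \<longlonglongrightarrow> 0" by (rule tendsto_eventually)
      show "indicator (\<Gamma> j) y \<le> (indicator (\<Gamma> i) y :: ennreal)" if "i \<le> j" for i j
        using G that by (auto simp: decseq_def indicator_def)
    qed (use borel_measurable_indicator[OF Gs] in \<open>auto split: split_indicator\<close>)
    have small: "(\<lambda>j. \<Sum>t<n. \<integral>\<^sup>+x. (reach ^^ t) (indicator (\<Gamma> j)) x \<partial>\<eta>) \<longlonglongrightarrow> 0" for n
    proof -
      have "(\<lambda>j. \<Sum>t<n. \<integral>\<^sup>+x. (reach ^^ t) (indicator (\<Gamma> j)) x \<partial>\<eta>) \<longlonglongrightarrow> (\<Sum>t<n. 0)"
        by (intro tendsto_sum fading_integral[OF fading_reach_iter[OF fad] prob_\<eta> sets_\<eta>])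
      then show ?thesis by simp
    qed
    have "(\<lambda>j. b (\<Gamma> j)) \<longlonglongrightarrow> 0"
    proof (rule order_tendstoI)
      fix r :: ennreal assume r: "0 < r"
      have r2: "0 < r / 2" using r by (simp add: ennreal_zero_less_divide)
      obtain n where n: "tail n < r / 2" using order_tendstoD(2)[OF ua r2] by (auto simp: eventually_sequentially)
      show "\<forall>\<^sub>F j in sequentially. b (\<Gamma> j) < r"
        using order_tendstoD(2)[OF small[of n] r2]
      proof eventually_elim
        case (elim j)
        have "b (\<Gamma> j) \<le> (\<Sum>t<n. \<integral>\<^sup>+x. (reach ^^ t) (indicator (\<Gamma> j)) x \<partial>\<eta>) + tail n" by (rule bound[OF Gs])
        also have "\<dots> < r / 2 + r / 2" using elim n by (rule add_strict_mono)
        also have "\<dots> = r * 2 / 2" by (simp add: mult_2[symmetric] ennreal_times_divide mult.commute)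
        also have "\<dots> = r" by (rule ennreal_mult_divide_eq) simp_all
        finally show ?case .
      qed
    qed simp
    then have "(\<lambda>j. enn2real (b (\<Gamma> j))) \<longlonglongrightarrow> enn2real 0" by (intro tendsto_enn2real) auto
    then show "(\<lambda>j. enn2real (b (\<Gamma> j))) \<longlonglongrightarrow> 0" by simp
  qed
  then obtain K where K: "compactin ws K"
    "\<And>\<mu>. \<mu> \<in> finite_measures Z \<Longrightarrow> (\<And>\<Gamma>. \<Gamma> \<in> sets X \<Longrightarrow> measure \<mu> (\<Gamma> \<times> A) \<le> enn2real (b \<Gamma>)) \<Longrightarrow> \<mu> \<in> K"
    using ws_compact_superset[OF A_compact A_ne] by blast
  have "occupation_measures \<eta> \<subseteq> K"
  proof
    fix \<mu> assume "\<mu> \<in> occupation_measures \<eta>"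
    then obtain \<sigma> where \<sigma>: "\<sigma> \<in> markov_kernels" "\<mu> = occ_from 0 (stationary \<sigma>)" unfolding occupation_measures_eq(2) by blast
    show "\<mu> \<in> K"
    proof (rule K(2))
      show "\<mu> \<in> finite_measures Z" using occ_from_finite[OF stationary_in[OF \<sigma>(1)]] \<sigma>(2) by simp
      fix \<Gamma> assume G: "\<Gamma> \<in> sets X"
      have "emeasure \<mu> (\<Gamma> \<times> A) \<le> b \<Gamma>" unfolding b_def \<sigma>(2) by (rule SUP_upper[OF \<sigma>(1)])
      then show "measure \<mu> (\<Gamma> \<times> A) \<le> enn2real (b \<Gamma>)" unfolding measure_def using fin[OF G] by (rule enn2real_mono)
    qed
  qed
  then show ?thesis by (rule closed_compactin[OF K(1) _ closedin_occupation_measures])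
qed

section \<open>Compactness implies uniform absorption\<close>

text \<open>Conversely, compactness makes the total masses of a set uniformly small along sequences of
  sets that shrink to the empty set (Dini), so the tails stay in a compact set.  If they do not vanish, a
  limit of tails is a non-zero measure without source, which is impossible.\<close>

lemma compact_uniformly_absorbing:
  assumes comp: "compactin ws (occupation_measures \<eta>)"
  shows "tail \<longlonglongrightarrow> 0"
proof -
  let ?O = "occupation_measures \<eta>"
  have O_ne: "?O \<noteq> {}" unfolding occupation_measures_eq(2) using markov_kernels_ne by simp
  have O_fm: "\<mu> \<in> finite_measures Z" if "\<mu> \<in> ?O" for \<mu>
    using that occ_from_finite[OF stationary_in] unfolding occupation_measures_eq(2) by blast
  have bdd: "bdd_above ((\<lambda>\<mu>. measure \<mu> (\<Gamma> \<times> A)) ` ?O)" if G: "\<Gamma> \<in> sets X" for \<Gamma>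
  proof -
    have "compactin euclideanreal ((\<lambda>\<mu>. measure \<mu> (\<Gamma> \<times> A)) ` ?O)"
      by (rule image_compactin[OF comp ws_continuous_rect[OF G]])
    then show ?thesis by (simp add: compact_imp_bounded bounded_imp_bdd_above)
  qed
  define \<beta> where "\<beta> \<Gamma> = (SUP \<mu>\<in>?O. measure \<mu> (\<Gamma> \<times> A))" for \<Gamma>
  have le_\<beta>: "measure \<mu> (\<Gamma> \<times> A) \<le> \<beta> \<Gamma>" if "\<mu> \<in> ?O" "\<Gamma> \<in> sets X" for \<mu> \<Gamma>
    unfolding \<beta>_def by (rule cSUP_upper[OF that(1) bdd[OF that(2)]])
  have "vanishing X \<beta>"
    unfolding vanishing_def
  proof (intro allI impI)
    fix \<Gamma> :: "nat \<Rightarrow> 'x set" assume G: "range \<Gamma> \<subseteq> sets X \<and> decseq \<Gamma> \<and> (\<Inter>n. \<Gamma> n) = {}"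
    have Gs: "\<Gamma> j \<in> sets X" for j using G by auto
    have mono: "measure \<mu> (\<Gamma> j \<times> A) \<le> measure \<mu> (\<Gamma> i \<times> A)" if "\<mu> \<in> ?O" "i \<le> j" for \<mu> i j
    proof -
      have "\<Gamma> j \<subseteq> \<Gamma> i" using G that(2) unfolding decseq_def by blast
      then show ?thesis
        using rect_sets[OF Gs] fmD[OF O_fm[OF that(1)]] by (intro finite_measure.finite_measure_mono) auto
    qed
    show "(\<lambda>n. \<beta> (\<Gamma> n)) \<longlonglongrightarrow> 0"
    proof (rule LIMSEQ_I)
      fix r :: real assume r: "0 < r"
      have "\<exists>n. \<forall>\<mu>\<in>?O. measure \<mu> (\<Gamma> n \<times> A) < r / 2"
      proof (rule ccontr)
        assume "\<not> ?thesis"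
        then have ne: "{\<mu> \<in> ?O. r / 2 \<le> measure \<mu> (\<Gamma> n \<times> A)} \<noteq> {}" for n by (auto simp: not_less)
        let ?T = "subtopology ws ?O"
        have tp: "topspace ?T = ?O" using compactin_subset_topspace[OF comp] by auto
        have "(\<Inter>n. {\<mu> \<in> ?O. r / 2 \<le> measure \<mu> (\<Gamma> n \<times> A)}) \<noteq> {}"
        proof (rule compact_space_imp_nest[of ?T])
          show "compact_space ?T" using comp by (simp add: compact_space_subtopology)
          show "closedin ?T {\<mu> \<in> ?O. r / 2 \<le> measure \<mu> (\<Gamma> n \<times> A)}" for n
            using closedin_Collect_real(3)[OF continuous_map_from_subtopology[OF ws_continuous_rect[OF Gs]], of ?O "r / 2"]
            unfolding tp .
          show "decseq (\<lambda>n. {\<mu> \<in> ?O. r / 2 \<le> measure \<mu> (\<Gamma> n \<times> A)})"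
            unfolding decseq_def using mono by (auto intro: order_trans)
        qed (rule ne)
        then obtain \<mu> where \<mu>: "\<mu> \<in> ?O" "\<And>n. r / 2 \<le> measure \<mu> (\<Gamma> n \<times> A)" by blast
        note D = fmD[OF O_fm[OF \<mu>(1)]]
        have "(\<lambda>n. measure \<mu> (\<Gamma> n \<times> A)) \<longlonglongrightarrow> measure \<mu> (\<Inter>n. \<Gamma> n \<times> A)"
        proof (rule finite_measure.finite_Lim_measure_decseq[OF D(1)])
          show "decseq (\<lambda>n. \<Gamma> n \<times> A)" using G unfolding decseq_def by (blast intro: Sigma_mono)
        qed (use rect_sets[OF Gs] D in auto)
        moreover have "(\<Inter>n. \<Gamma> n \<times> A) = {}" using G by auto
        ultimately have "(\<lambda>n. measure \<mu> (\<Gamma> n \<times> A)) \<longlonglongrightarrow> 0" by simp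
        then have "\<forall>\<^sub>F n in sequentially. measure \<mu> (\<Gamma> n \<times> A) < r / 2" using r by (intro order_tendstoD(2)) auto
        then show False using \<mu>(2) by (auto simp: eventually_sequentially dest: leD)
      qed
      then obtain N where N: "\<And>\<mu>. \<mu> \<in> ?O \<Longrightarrow> measure \<mu> (\<Gamma> N \<times> A) < r / 2" by blast
      have "norm (\<beta> (\<Gamma> n) - 0) < r" if n: "n \<ge> N" for n
      proof -
        have "\<beta> (\<Gamma> n) \<le> r / 2"
          unfolding \<beta>_def
        proof (rule cSUP_least[OF O_ne])
          fix \<mu> assume \<mu>: "\<mu> \<in> ?O"
          show "measure \<mu> (\<Gamma> n \<times> A) \<le> r / 2" using mono[OF \<mu> n] N[OF \<mu>] by linarith
        qed
        moreover obtain \<mu> where "\<mu> \<in> ?O" using O_ne by blast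
        then have "0 \<le> \<beta> (\<Gamma> n)" using le_\<beta>[OF _ Gs] measure_nonneg order_trans by blast
        ultimately show ?thesis using r by simp
      qed
      then show "\<exists>no. \<forall>n\<ge>no. norm (\<beta> (\<Gamma> n) - 0) < r" by blast
    qed
  qed
  then obtain K where K: "compactin ws K"
    "\<And>\<mu>. \<mu> \<in> finite_measures Z \<Longrightarrow> (\<And>\<Gamma>. \<Gamma> \<in> sets X \<Longrightarrow> measure \<mu> (\<Gamma> \<times> A) \<le> \<beta> \<Gamma>) \<Longrightarrow> \<mu> \<in> K"
    using ws_compact_superset[OF A_compact A_ne] by blast
  have occ_mono: "emeasure (occ_from (Suc n) \<pi>) S \<le> emeasure (occ_from n \<pi>) S" if \<pi>: "\<pi> \<in> policies" and S: "S \<in> sets Z" for n \<pi> S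
    unfolding emeasure_occ_from[OF \<pi> S]
    using suminf_offset[OF summableI, of "\<lambda>t. emeasure (pair_law \<pi> (n + t)) (alive \<inter> S)" 1] by simp
  have tail_dec: "decseq tail"
    unfolding decseq_Suc_iff tail_def
    using occ_mono[OF stationary_in rect_sets[OF sets.top]] by (auto intro!: SUP_mono)
  have B_nonneg: "0 \<le> \<beta> (space X)"
    using O_ne le_\<beta>[OF _ sets.top] measure_nonneg order_trans by blast
  define B where "B = \<beta> (space X)"
  have step: "\<exists>n. tail n \<le> ennreal e" if e: "e > 0" for e
  proof (rule ccontr)
    assume "\<not> ?thesis"
    then have "\<forall>n. \<exists>\<sigma>\<in>markov_kernels. ennreal e < emeasure (occ_from n (stationary \<sigma>)) (space X \<times> A)"
      by (auto simp: not_le tail_def less_SUP_iff)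
    then obtain s where s: "\<And>n. s n \<in> markov_kernels"
      "\<And>n. ennreal e < emeasure (occ_from n (stationary (s n))) (space X \<times> A)" by metis
    define \<zeta> where "\<zeta> n = occ_from n (stationary (s n))" for n
    note \<pi> = stationary_in[OF s(1)]
    have \<zeta>_fm: "\<zeta> n \<in> finite_measures Z" for n unfolding \<zeta>_def by (rule occ_from_finite[OF \<pi>])
    have \<zeta>K: "\<zeta> n \<in> K" for n
    proof (rule K(2)[OF \<zeta>_fm])
      fix \<Gamma> assume G: "\<Gamma> \<in> sets X"
      have O: "occ_from 0 (stationary (s n)) \<in> ?O" unfolding occupation_measures_eq(2) using s(1) by blast
      have "emeasure (\<zeta> n) (\<Gamma> \<times> A) \<le> emeasure (occ_from 0 (stationary (s n))) (\<Gamma> \<times> A)"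
        unfolding \<zeta>_def by (rule occ_from_le[OF \<pi> rect_sets[OF G]])
      then have "measure (\<zeta> n) (\<Gamma> \<times> A) \<le> measure (occ_from 0 (stationary (s n))) (\<Gamma> \<times> A)"
        unfolding measure_def
        using finite_measure.emeasure_finite[OF fmD(1)[OF O_fm[OF O]]] by (intro enn2real_mono) (auto simp: less_top)
      also have "\<dots> \<le> \<beta> \<Gamma>" by (rule le_\<beta>[OF O G])
      finally show "measure (\<zeta> n) (\<Gamma> \<times> A) \<le> \<beta> \<Gamma>" .
    qed
    have flux_small: "measure (state_law (stationary (s n)) n) (\<Gamma> - \<Delta>) \<le> B / (real n + 1)" if G: "\<Gamma> \<in> sets X" for n \<Gamma>
    proof -
      let ?\<pi> = "stationary (s n)"
      let ?m = "\<lambda>t. measure (state_law ?\<pi> t) (space X - \<Delta>)"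
      have P: "finite_measure (state_law ?\<pi> t)" for t using prob_state_law[OF \<pi>] by (simp add: prob_space.finite_measure)
      have em: "emeasure (state_law ?\<pi> t) C = ennreal (measure (state_law ?\<pi> t) C)" for t C
        by (rule finite_measure.emeasure_eq_measure[OF P])
      have dec: "emeasure (state_law ?\<pi> (Suc t)) (space X - \<Delta>) \<le> emeasure (state_law ?\<pi> t) (space X - \<Delta>)" for t
      proof -
        have "enat t < h" if "enat (Suc t) < h" for h using that by (metis Suc_ile_eq order_less_imp_le)
        then show ?thesis
          unfolding prob_hitting[OF \<pi>, symmetric] by (intro emeasure_mono hitting_set[OF \<pi>]) auto
      qed
      have "decseq ?m" unfolding decseq_Suc_iff using dec by (simp add: em)
      then have md: "?m n \<le> ?m t" if "t \<le> n" for t using that by (simp add: decseq_def)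
      have O: "occ_from 0 ?\<pi> \<in> ?O" unfolding occupation_measures_eq(2) using s(1) by blast
      have "ennreal (\<Sum>t<Suc n. ?m t) = (\<Sum>t<Suc n. emeasure (state_law ?\<pi> t) (space X - \<Delta>))"
        by (simp add: em sum_ennreal del: sum.lessThan_Suc)
      also have "\<dots> \<le> (\<Sum>t. emeasure (state_law ?\<pi> t) (space X - \<Delta>))" by (rule sum_le_suminf[OF summableI]) auto
      also have "\<dots> = emeasure (occ_from 0 ?\<pi>) (space X \<times> A)" by (simp add: emeasure_occ_from_rect[OF \<pi> sets.top])
      also have "\<dots> = ennreal (measure (occ_from 0 ?\<pi>) (space X \<times> A))"
        by (rule finite_measure.emeasure_eq_measure[OF fmD(1)[OF O_fm[OF O]]])
      also have "\<dots> \<le> ennreal B" unfolding B_def by (intro ennreal_leI le_\<beta>[OF O] sets.top)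
      finally have "(\<Sum>t<Suc n. ?m t) \<le> B" using B_nonneg by (simp add: B_def del: sum.lessThan_Suc)
      moreover have "(\<Sum>t<Suc n. ?m n) \<le> (\<Sum>t<Suc n. ?m t)" by (intro sum_mono md) simp
      ultimately have "(real n + 1) * ?m n \<le> B" by (simp add: distrib_right add.commute)
      then have "?m n \<le> B / (real n + 1)" by (simp add: pos_le_divide_eq mult.commute)
      moreover have "measure (state_law ?\<pi> n) (\<Gamma> - \<Delta>) \<le> ?m n"
        using sets.sets_into_space[OF G] Dc_sets by (intro finite_measure.finite_measure_mono[OF P]) (auto simp: sets_state_law)
      ultimately show ?thesis by linarith
    qed
    \<comment> \<open>Tails from time \<open>n\<close> on have source at most \<open>B / (n + 1)\<close>, because the survival probabilities decrease and
      sum up to at most \<open>B\<close>.  A common point of these closed sets has no source at all.\<close>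
    define F where "F n = K \<inter> (flux_between (\<lambda>_. 0) (\<lambda>_. B / (real n + 1)) \<inter> {\<mu> \<in> topspace ws. e \<le> measure \<mu> (space X \<times> A)})" for n
    have \<zeta>F: "\<zeta> n \<in> F n" for n
      unfolding F_def
    proof (intro IntI \<zeta>K CollectI conjI)
      show "\<zeta> n \<in> flux_between (\<lambda>_. 0) (\<lambda>_. B / (real n + 1))"
        unfolding flux_between_def \<zeta>_def using occ_on_K[OF \<pi>] occ_from_ac[OF \<pi>] occ_flux[OF \<pi>] flux_small by simp
      show "\<zeta> n \<in> topspace ws" using \<zeta>_fm by (simp add: topspace_ws_topology)
      show "e \<le> measure (\<zeta> n) (space X \<times> A)"
        using s(2)[of n] e unfolding \<zeta>_def[symmetric] finite_measure.emeasure_eq_measure[OF fmD(1)[OF \<zeta>_fm]]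
        by (simp add: ennreal_less_iff)
    qed
    have "(\<Inter>n. F n) \<noteq> {}"
    proof (rule compact_space_imp_nest[of "subtopology ws K"])
      show "compact_space (subtopology ws K)" using K(1) by (simp add: compact_space_subtopology)
      show "closedin (subtopology ws K) (F n)" for n
        unfolding F_def
        by (intro closedin_subtopology_Int_closed closedin_Int closedin_flux_between closedin_Collect_real ws_continuous_rect sets.top)
      show "F n \<noteq> {}" for n using \<zeta>F by blast
      show "decseq F"
        unfolding decseq_def
      proof (intro allI impI)
        fix m n :: nat assume "m \<le> n"
        then have "B / (real n + 1) \<le> B / (real m + 1)" using B_nonneg by (intro divide_left_mono) (auto simp: B_def)
        then show "F n \<subseteq> F m" unfolding F_def flux_between_def by (fastforce intro: order_trans)
      qed
    qed
    then obtain \<theta> where \<theta>: "\<And>n. \<theta> \<in> F n" by blast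
    have \<theta>f: "\<theta> \<in> finite_measures Z" "AE z in \<theta>. snd z \<in> As (fst z)" "ref_ac \<theta>" "e \<le> measure \<theta> (space X \<times> A)"
      using \<theta>[of 0] by (auto simp: F_def flux_between_def on_K_def)
    have "emeasure \<theta> (space X \<times> A) = 0"
    proof (rule invariant_zero[OF \<theta>f(1-3)])
      fix \<Gamma> assume G: "\<Gamma> \<in> sets X"
      have f: "0 \<le> flux \<Gamma> \<theta>" "flux \<Gamma> \<theta> \<le> B / (real n + 1)" for n
        using \<theta>[of n] G by (auto simp: F_def flux_between_def)
      have "(\<lambda>n. B / (real n + 1)) \<longlonglongrightarrow> 0"
        using LIMSEQ_Suc[OF lim_const_over_n[of B]] by (simp add: add.commute)
      then have "flux \<Gamma> \<theta> \<le> 0" by (rule LIMSEQ_le_const) (use f(2) in blast)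
      then have "flux \<Gamma> \<theta> = 0" using f(1) by simp
      then show "emeasure \<theta> (\<Gamma> \<times> A) = (\<integral>\<^sup>+z. emeasure (Q z) (\<Gamma> - \<Delta>) \<partial>\<theta>)"
        by (simp add: flux_eq_iff[OF \<theta>f(1) G])
    qed
    then show False using \<theta>f(4) e by (simp add: measure_def)
  qed
  show ?thesis
  proof (rule order_tendstoI)
    fix r :: ennreal assume r: "0 < r"
    have "\<exists>e>0. ennreal e < r"
    proof (cases r)
      case (real r')
      then show ?thesis using r by (intro exI[of _ "r' / 2"]) (auto simp: ennreal_less_iff)
    next
      case top
      then show ?thesis by (intro exI[of _ 1]) simp
    qed
    then obtain e where e: "0 < e" "ennreal e < r" by blast
    obtain n where n: "tail n \<le> ennreal e" using step[OF e(1)] by blast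
    have "tail m < r" if "m \<ge> n" for m
    proof -
      have "tail m \<le> tail n" using tail_dec that by (simp add: decseq_def)
      then show ?thesis using n e(2) by (meson le_less_trans order_trans)
    qed
    then show "\<forall>\<^sub>F m in sequentially. tail m < r" by (auto simp: eventually_sequentially)
  qed simp
qed

end

theorem theorem4p13:
  fixes X :: "'x measure"
    and A :: "'a::polish_space set"
    and As :: "'x \<Rightarrow> 'a set"
    and Q :: "'x \<times> 'a \<Rightarrow> 'x measure"
    and \<Delta> :: "'x set"
    and \<eta> :: "'x measure"
  assumes "control_model X A As Q \<Delta>"
    and "prob_space \<eta>" and "sets \<eta> = sets X"
    and "control_model.absorbing X A As Q \<Delta> \<eta>"
    and "control_model.condition_S X A As Q"
  shows "(control_model.uniformly_absorbing X A As Q \<Delta> \<eta> \<longleftrightarrow>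
            relatively_compact_in (ws_topology X A)
              (control_model.occupation_measures X A As Q \<Delta> \<eta>)) \<and>
         (relatively_compact_in (ws_topology X A)
              (control_model.occupation_measures X A As Q \<Delta> \<eta>) \<longleftrightarrow>
            compactin (ws_topology X A)
              (control_model.occupation_measures X A As Q \<Delta> \<eta>))"
proof -
  interpret compact_model X A As Q \<Delta> \<eta>
    using assms by (intro compact_model.intro absorbing_model.intro initial_model.intro
        compact_model_axioms.intro absorbing_model_axioms.intro initial_model_axioms.intro)
  show ?thesis
    using relatively_compact_iff uniformly_absorbing_iff uniformly_absorbing_compact compact_uniformly_absorbing
    by blast
qed

end
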